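(* Let $\Lambda$ be a nontrivial subgroup of $(\mathbb{R}_{>0},\cdot)$ and let $\Gamma$ be a $\mathbb{Z}\cdot\Lambda$-submodule of $\mathbb{Z}\cdot\Lambda$ with $\Gamma\neq 0$. For every $\ell\in\Gamma$ with $\ell>0$, the derived subgroup $D(V(\Gamma,\Lambda,\ell))$ is simple. Moreover, the following are equivalent: (1) the group $\Gamma\ltimes\Lambda$ is finitely generated; (2) the topological groupoid $\Gamma\ltimes\Lambda\ltimes[0_+,\ell_-]$ is compactly generated for all $\ell\in\Gamma$ with $\ell>0$; (3) $D(V(\Gamma,\Lambda,\ell))$ is finitely generated for all $\ell\in\Gamma$ with $\ell>0$; (4) $D(V(\Gamma,\Lambda,\ell))$ is 2-generated (generated by two elements) for all $\ell\in\Gamma$ with $\ell>0$.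
   Context: $\mathbb{Z}\cdot\Lambda$ is the subring (additive subgroup) of $\mathbb{R}$ generated by $\Lambda$; a $\mathbb{Z}\cdot\Lambda$-submodule is an additive subgroup $\Gamma$ with $\Lambda\cdot\Gamma=\Gamma$. $V(\Gamma,\Lambda,\ell)$ (for $0<\ell\in\Gamma$) is the group, under composition, of right-continuous bijections $f:[0,\ell]\to[0,\ell]$ for which there are points $0=x_0<x_1<\dots<x_n=\ell$ in $\Gamma$ such that on each $[x_i,x_{i+1})$ the map $f$ is affine with slope in $\Lambda$. $D(G)$ denotes the derived (commutator) subgroup of a group $G$. $\Gamma\ltimes\Lambda$ is the set $\Gamma\times\Lambda$ with product $(a,\mu)(b,\lambda)=(\lambda^{-1}a+b,\mu\lambda)$. $\mathbb{R}_\Gamma=(\mathbb{R}\setminus\Gamma)\sqcup\{a_+,a_-: a\in\Gamma\}$, with $q:\mathbb{R}_\Gamma\to\mathbb{R}$, $q(t)=t$, $q(a_\pm)=a$, is totally ordered by: $q(x)<q(y)\Rightarrow x<y$, and $a_-<a_+$ for $a\in\Gamma$; it carries the order topology. $[0_+,\ell_-]=\{x\in\mathbb{R}_\Gamma: 0_+\le x\le \ell_-\}$. $\Gamma\ltimes\Lambda$ acts on $\mathbb{R}_\Gamma$ by $(c,\mu)(t)=\mu(t+c)$ for $t\in\mathbb{R}\setminus\Gamma$ and $(c,\mu)(a_\pm)=(\mu(a+c))_\pm$ for $a\in\Gamma$. $\Gamma\ltimes\Lambda\ltimes[0_+,\ell_-]$ is the groupoid of pairs $(g,x)$ with $g\in\Gamma\ltimes\Lambda$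 and $x,gx\in[0_+,\ell_-]$, source $x$, range $gx$, product $(g,hx)(h,x)=(gh,x)$, with the topology inherited from (discrete group) $\times\,\mathbb{R}_\Gamma$. A topological groupoid $\mathcal{G}$ is compactly generated if there is a compact $K\subset\mathcal{G}$ with $\mathcal{G}=\bigcup_{n\in\mathbb{N}}(K\cup K^{-1})^n$. *)

theory Defs
  imports
    "HOL-Algebra.Bij"
    "HOL-Algebra.Generated_Groups"
    "HOL-Analysis.Analysis"
begin

text \<open>The library locale \<^verbatim>\<open>simple_group\<close> demands \<^verbatim>\<open>order G > 1\<close>, and the order of an infinite
  group is 0 there, so it only covers finite groups. The notion below has no finiteness restriction.\<close>

definition is_simple :: "('a, 'b) monoid_scheme \<Rightarrow> bool" where
  "is_simple G \<longleftrightarrow> group G \<and> carrier G \<noteq> {\<one>\<^bsub>G\<^esub>} \<and>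
     (\<forall>N. N \<lhd> G \<longrightarrow> N = {\<one>\<^bsub>G\<^esub>} \<or> N = carrier G)"

definition finitely_generated :: "('a, 'b) monoid_scheme \<Rightarrow> bool" where
  "finitely_generated G \<longleftrightarrow> (\<exists>S. finite S \<and> S \<subseteq> carrier G \<and> generate G S = carrier G)"

definition two_generated :: "('a, 'b) monoid_scheme \<Rightarrow> bool" where
  "two_generated G \<longleftrightarrow> (\<exists>a \<in> carrier G. \<exists>b \<in> carrier G. generate G {a, b} = carrier G)"

definition derived_group :: "('a, 'b) monoid_scheme \<Rightarrow> ('a, 'b) monoid_scheme" where
  "derived_group G = G\<lparr>carrier := derived G (carrier G)\<rparr>"

definition real_add_group :: "real monoid" where
  "real_add_group = \<lparr>carrier = UNIV, monoid.mult = (+), one = 0\<rparr>"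

definition pos_real_mult_group :: "real monoid" where
  "pos_real_mult_group = \<lparr>carrier = {0<..}, monoid.mult = (*), one = 1\<rparr>"

text \<open>The additive subgroup generated by \<open>\<Lambda>\<close>; it is a subring of the reals because \<open>\<Lambda>\<close> is closed
  under multiplication.\<close>

definition Z_span :: "real set \<Rightarrow> real set" where
  "Z_span \<Lambda> = generate real_add_group \<Lambda>"

definition Z_submodule :: "real set \<Rightarrow> real set \<Rightarrow> bool" where
  "Z_submodule \<Lambda> \<Gamma> \<longleftrightarrow> subgroup \<Gamma> real_add_group \<and> {\<mu> * \<gamma> | \<mu> \<gamma>. \<mu> \<in> \<Lambda> \<and> \<gamma> \<in> \<Gamma>} = \<Gamma>"

text \<open>Continuity at \<open>t\<close> within \<open>{t..l}\<close> is right-continuity of a function on \<open>{0..l}\<close>. Elements of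
  \<^verbatim>\<open>Bij {0..l}\<close> are the bijections of \<open>{0..l}\<close>, made extensional so that equality of group elements
  is equality of functions on \<open>{0..l}\<close>.\<close>

definition V_carrier :: "real set \<Rightarrow> real set \<Rightarrow> real \<Rightarrow> (real \<Rightarrow> real) set" where
  "V_carrier \<Gamma> \<Lambda> l = {f \<in> Bij {0..l}.
     (\<forall>t \<in> {0..l}. continuous (at t within {t..l}) f) \<and>
     (\<exists>(n::nat) (x :: nat \<Rightarrow> real).
        x 0 = 0 \<and> x n = l \<and> (\<forall>i \<le> n. x i \<in> \<Gamma>) \<and> (\<forall>i < n. x i < x (Suc i)) \<and>
        (\<forall>i < n. \<exists>\<mu> \<in> \<Lambda>. \<exists>c. \<forall>t \<in> {x i..<x (Suc i)}. f t = \<mu> * t + c))}"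

definition V_group :: "real set \<Rightarrow> real set \<Rightarrow> real \<Rightarrow> (real \<Rightarrow> real) monoid" where
  "V_group \<Gamma> \<Lambda> l = (BijGroup {0..l})\<lparr>carrier := V_carrier \<Gamma> \<Lambda> l\<rparr>"

definition semidirect :: "real set \<Rightarrow> real set \<Rightarrow> (real \<times> real) monoid" where
  "semidirect \<Gamma> \<Lambda> =
     \<lparr>carrier = \<Gamma> \<times> \<Lambda>,
      monoid.mult = (\<lambda>(a, \<mu>) (b, \<nu>). (inverse \<nu> * a + b, \<mu> * \<nu>)),
      one = (0, 1)\<rparr>"

datatype split_real = Reg real | Minus real | Plus real

primrec proj :: "split_real \<Rightarrow> real" where
  "proj (Reg t) = t"
| "proj (Minus a) = a"
| "proj (Plus a) = a"

definition split_line :: "real set \<Rightarrow> split_real set" where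
  "split_line \<Gamma> = Reg ` (- \<Gamma>) \<union> Minus ` \<Gamma> \<union> Plus ` \<Gamma>"

text \<open>On the whole type this is only a strict partial order; it is total on \<^verbatim>\<open>split_line \<Gamma>\<close>.\<close>

definition split_less :: "split_real \<Rightarrow> split_real \<Rightarrow> bool" where
  "split_less x y \<longleftrightarrow> proj x < proj y \<or> (\<exists>a. x = Minus a \<and> y = Plus a)"

definition split_le :: "split_real \<Rightarrow> split_real \<Rightarrow> bool" where
  "split_le x y \<longleftrightarrow> split_less x y \<or> x = y"

text \<open>The order topology of \<^verbatim>\<open>split_line \<Gamma>\<close>, generated by its open rays.\<close>

definition split_topology :: "real set \<Rightarrow> split_real topology" where
  "split_topology \<Gamma> = topology_generated_by
     (insert (split_line \<Gamma>)
       ({{y \<in> split_line \<Gamma>. split_less x y} | x. x \<in> split_line \<Gamma>} \<union>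
        {{y \<in> split_line \<Gamma>. split_less y x} | x. x \<in> split_line \<Gamma>}))"

definition split_interval :: "real set \<Rightarrow> real \<Rightarrow> split_real set" where
  "split_interval \<Gamma> l = {x \<in> split_line \<Gamma>. split_le (Plus 0) x \<and> split_le x (Minus l)}"

fun act :: "real \<times> real \<Rightarrow> split_real \<Rightarrow> split_real" where
  "act (c, \<mu>) (Reg t) = Reg (\<mu> * (t + c))"
| "act (c, \<mu>) (Minus a) = Minus (\<mu> * (a + c))"
| "act (c, \<mu>) (Plus a) = Plus (\<mu> * (a + c))"

text \<open>The product \<^verbatim>\<open>gcomp G g h\<close> is meaningful only when \<^verbatim>\<open>gsource G g = grange G h\<close>.\<close>

record ('g, 'u) top_groupoid =
  arrows :: "'g set"
  gsource :: "'g \<Rightarrow> 'u"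
  grange :: "'g \<Rightarrow> 'u"
  gcomp :: "'g \<Rightarrow> 'g \<Rightarrow> 'g"
  ginverse :: "'g \<Rightarrow> 'g"
  gtopology :: "'g topology"

definition gset_mult :: "('g, 'u) top_groupoid \<Rightarrow> 'g set \<Rightarrow> 'g set \<Rightarrow> 'g set" where
  "gset_mult G A B = {gcomp G g h | g h. g \<in> A \<and> h \<in> B \<and> gsource G g = grange G h}"

text \<open>The exponent is shifted: \<^verbatim>\<open>gset_power G A n\<close> is the set of products of \<open>n + 1\<close> elements of \<open>A\<close>.\<close>

primrec gset_power :: "('g, 'u) top_groupoid \<Rightarrow> 'g set \<Rightarrow> nat \<Rightarrow> 'g set" where
  "gset_power G A 0 = A"
| "gset_power G A (Suc n) = gset_mult G A (gset_power G A n)"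

definition compactly_generated :: "('g, 'u) top_groupoid \<Rightarrow> bool" where
  "compactly_generated G \<longleftrightarrow>
     (\<exists>K. K \<subseteq> arrows G \<and> compactin (gtopology G) K \<and>
          arrows G = (\<Union>n. gset_power G (K \<union> ginverse G ` K) n))"

definition transf_arrows :: "real set \<Rightarrow> real set \<Rightarrow> real \<Rightarrow> ((real \<times> real) \<times> split_real) set" where
  "transf_arrows \<Gamma> \<Lambda> l = {(g, x). g \<in> carrier (semidirect \<Gamma> \<Lambda>) \<and>
     x \<in> split_interval \<Gamma> l \<and> act g x \<in> split_interval \<Gamma> l}"

definition transf_groupoid ::
    "real set \<Rightarrow> real set \<Rightarrow> real \<Rightarrow> ((real \<times> real) \<times> split_real, split_real) top_groupoid" where
  "transf_groupoid \<Gamma> \<Lambda> l =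
     \<lparr>arrows = transf_arrows \<Gamma> \<Lambda> l,
      gsource = (\<lambda>(g, x). x),
      grange = (\<lambda>(g, x). act g x),
      gcomp = (\<lambda>(g, y) (h, x). (g \<otimes>\<^bsub>semidirect \<Gamma> \<Lambda>\<^esub> h, x)),
      ginverse = (\<lambda>(g, x). (inv\<^bsub>semidirect \<Gamma> \<Lambda>\<^esub> g, act g x)),
      gtopology = subtopology
        (prod_topology (discrete_topology (carrier (semidirect \<Gamma> \<Lambda>))) (split_topology \<Gamma>))
        (transf_arrows \<Gamma> \<Lambda> l)\<rparr>"

end

theory Submission
  imports Defs
begin

text \<open>Removing the fixed point \<open>l\<close> identifies \<open>V(\<Gamma>, \<Lambda>, l)\<close> with a group of piecewise affine bijections of
  \<open>[0, l)\<close>. Call an element a three-cycle if it permutes cyclically the disjoint images of an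
  interval \<open>[u, v)\<close> under three affine maps of \<open>\<Gamma> \<ltimes> \<Lambda>\<close> and is the identity elsewhere. Small intervals can be
  moved anywhere by contractions, so short three-cycles behave as in an infinite alternating group: they
  generate the commutator subgroup and are commutators of three-cycles. A nontrivial normal subgroup
  contains all commutators of three-cycles supported in an interval that one of its elements moves off
  itself; this gives simplicity.

  If \<open>\<Gamma> \<ltimes> \<Lambda>\<close> is finitely generated, then finitely many contractions \<open>t \<mapsto> \<nu> t\<close> and small translations
  \<open>t \<mapsto> t + c\<close> of \<open>[0, l)\<close> yield all affine bijections between subintervals by restriction, gluing,
  composition and inversion. For arrows of the groupoid this is compact generation, the intervals of the
  split line being compact. For three-cycles, the operations are realized by commutators of three-cycles
  through five disjoint copies of an interval, which gives finite generation. Two generators then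
  suffice: \<open>a\<close> is a contraction near \<open>0\<close>, with a wandering interval, and \<open>b\<close> acts on the copies
  of this interval at the positions \<open>2\<^sup>k\<close> by elements \<open>x\<^sub>k\<close>. Sums of two powers of \<open>2\<close> being essentially
  unique, commutators of conjugates of \<open>b\<close> by powers of \<open>a\<close> isolate single commutators \<open>[x\<^sub>i, x\<^sub>j]\<close>.

  Conversely, finitely many elements of the group involve finitely many elements of \<open>\<Gamma> \<ltimes> \<Lambda>\<close>. Every
  affine map is part of a three-cycle, hence on infinitely many points equal to an element of the
  subgroup that these generate, and two affine maps agreeing at two points are equal. A compact
  subset of the groupoid also involves only finitely many elements of \<open>\<Gamma> \<ltimes> \<Lambda>\<close>.\<close>

subsection \<open>Three-cycles of disjoint copies of a set\<close>

text \<open>Two obstacles shape the proof. Partial affine maps can be composed only while all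
  intermediate images stay in the interval, so the scalings and translations in use must be small;
  this is the origin of the factors 2, 3 and 4 in the size conditions. And restricting a three-cycle
  to a smaller interval is not a group operation. It is replaced by the identity [(a b c), (a d e)]
  = (a b d) for cycles with different bases \<open>B\<close> and \<open>B'\<close>, whose commutator
  has base \<open>B \<inter> B'\<close>. It involves five sets, whence the five copies. A subgroup
  can thereby cut three-cycles down to a set only if it contains suitable three-cycles over that
  set; which sets these are must be settled before arbitrary maps are generated.

  For two generators, the copies at the positions \<open>2 ^ k\<close> only give back the
  three-cycles inside one copy of the interval. Therefore \<open>b\<close> is a product of two
  commuting elements of orders dividing 3 and 2: the first carries the \<open>x k\<close>, which are
  three-cycles, and the second exchanges an outside region with part of that copy. Powers of
  \<open>b\<close> separate the two factors.\<close>

abbreviation iv :: "('a \<Rightarrow> 'b) \<Rightarrow> 'b \<Rightarrow> 'a" where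
  "iv \<equiv> inv_into UNIV"

text \<open>With one base \<open>B\<close> for all three sets, conjugation becomes composition with
  the three maps (\<open>cyc_conj\<close>), cutting becomes shrinking \<open>B\<close>
  (\<open>cyc_union\<close>), and the maps may be replaced by any others that agree with them on
  \<open>B\<close>.\<close>

definition cyc :: "'a set \<Rightarrow> ('a \<Rightarrow> 'b) \<Rightarrow> ('a \<Rightarrow> 'b) \<Rightarrow> ('a \<Rightarrow> 'b) \<Rightarrow> 'b \<Rightarrow> 'b" where
  "cyc B a b c x =
    (if x \<in> a ` B then b (inv_into B a x)
     else if x \<in> b ` B then c (inv_into B b x)
     else if x \<in> c ` B then a (inv_into B c x) else x)"

definition tri :: "'a set \<Rightarrow> ('a \<Rightarrow> 'b) \<Rightarrow> ('a \<Rightarrow> 'b) \<Rightarrow> ('a \<Rightarrow> 'b) \<Rightarrow> bool" where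
  "tri B a b c \<longleftrightarrow> inj_on a B \<and> inj_on b B \<and> inj_on c B \<and>
     a ` B \<inter> b ` B = {} \<and> a ` B \<inter> c ` B = {} \<and> b ` B \<inter> c ` B = {}"

lemma tri_rot: "tri B a b c \<Longrightarrow> tri B b c a"
  and tri_swap: "tri B a b c \<Longrightarrow> tri B a c b"
  and tri_subset: "tri B a b c \<Longrightarrow> B' \<subseteq> B \<Longrightarrow> tri B' a b c"
  unfolding tri_def by (blast intro: inj_on_subset)+

lemma tri_cong:
  assumes "\<And>t. t \<in> B \<Longrightarrow> a t = a' t" "\<And>t. t \<in> B \<Longrightarrow> b t = b' t" "\<And>t. t \<in> B \<Longrightarrow> c t = c' t"
  shows "tri B a b c \<longleftrightarrow> tri B a' b' c'"
proof -
  have "a ` B = a' ` B" "b ` B = b' ` B" "c ` B = c' ` B"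
    using assms by (auto intro!: image_cong)
  moreover have "inj_on a B = inj_on a' B" "inj_on b B = inj_on b' B" "inj_on c B = inj_on c' B"
    using assms by (auto intro!: inj_on_cong)
  ultimately show ?thesis by (simp add: tri_def)
qed

lemma tri_comp: "inj g \<Longrightarrow> tri B a b c \<Longrightarrow> tri B (g \<circ> a) (g \<circ> b) (g \<circ> c)"
  unfolding tri_def image_comp[symmetric]
  by (simp add: comp_inj_on inj_on_subset flip: image_Int)

lemma cyc_app:
  assumes "tri B a b c" "t \<in> B"
  shows "cyc B a b c (a t) = b t" "cyc B a b c (b t) = c t" "cyc B a b c (c t) = a t"
proof -
  have d: "a ` B \<inter> b ` B = {}" "a ` B \<inter> c ` B = {}" "b ` B \<inter> c ` B = {}"
    and i: "inj_on a B" "inj_on b B" "inj_on c B"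
    using assms(1) by (simp_all add: tri_def)
  show "cyc B a b c (a t) = b t"
    using assms(2) i by (simp add: cyc_def)
  have "b t \<notin> a ` B" "c t \<notin> a ` B" "c t \<notin> b ` B"
    using d assms(2) by blast+
  then show "cyc B a b c (b t) = c t" "cyc B a b c (c t) = a t"
    using assms(2) i by (simp_all add: cyc_def)
qed

lemma cyc_out: "x \<notin> a ` B \<union> b ` B \<union> c ` B \<Longrightarrow> cyc B a b c x = x"
  by (simp add: cyc_def)

lemma cyc_empty [simp]: "cyc {} a b c = id"
  by (auto simp: cyc_def)

lemma cyc_eqI:
  assumes "tri B a b c"
    and "\<And>t. t \<in> B \<Longrightarrow> f (a t) = b t" "\<And>t. t \<in> B \<Longrightarrow> f (b t) = c t" "\<And>t. t \<in> B \<Longrightarrow> f (c t) = a t"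
    and "\<And>x. x \<notin> a ` B \<union> b ` B \<union> c ` B \<Longrightarrow> f x = x"
  shows "f = cyc B a b c"
proof
  fix x
  show "f x = cyc B a b c x"
  proof (cases "x \<in> a ` B \<union> b ` B \<union> c ` B")
    case False then show ?thesis using assms(5) cyc_out by metis
  next
    case True then show ?thesis using assms cyc_app[OF assms(1)] by auto
  qed
qed

lemma cyc_cong:
  assumes "tri B a b c"
    and "\<And>t. t \<in> B \<Longrightarrow> a t = a' t" "\<And>t. t \<in> B \<Longrightarrow> b t = b' t" "\<And>t. t \<in> B \<Longrightarrow> c t = c' t"
  shows "cyc B a b c = cyc B a' b' c'"
proof (rule cyc_eqI)
  show "tri B a' b' c'" using assms tri_cong[of B a a' b b' c c'] by simp
  have im: "a ` B = a' ` B" "b ` B = b' ` B" "c ` B = c' ` B"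
    using assms by (auto intro!: image_cong)
  show "cyc B a b c x = x" if "x \<notin> a' ` B \<union> b' ` B \<union> c' ` B" for x
    using that im by (intro cyc_out) simp
qed (use assms cyc_app[OF assms(1)] in \<open>metis+\<close>)

lemma cyc_rot: "tri B a b c \<Longrightarrow> cyc B a b c = cyc B b c a"
  by (rule cyc_eqI[OF tri_rot]) (auto simp: cyc_app intro: cyc_out)

lemma cyc_inverse:
  assumes "tri B a b c"
  shows "cyc B a b c \<circ> cyc B a c b = id"
proof
  fix x
  show "(cyc B a b c \<circ> cyc B a c b) x = id x"
  proof (cases "x \<in> a ` B \<union> b ` B \<union> c ` B")
    case False
    then show ?thesis by (simp add: cyc_out)
  next
    case True
    then show ?thesis
      using cyc_app[OF assms] cyc_app[OF tri_swap[OF assms]] by auto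
  qed
qed

lemma bij_cyc: "tri B a b c \<Longrightarrow> bij (cyc B a b c)"
  using cyc_inverse[of B a b c] cyc_inverse[OF tri_swap, of B a b c] by (metis o_bij)

lemma inv_cyc: "tri B a b c \<Longrightarrow> iv (cyc B a b c) = cyc B a c b"
  using cyc_inverse[of B a b c] cyc_inverse[OF tri_swap, of B a b c] by (metis inv_unique_comp)

lemma cyc_square: "tri B a b c \<Longrightarrow> cyc B a b c \<circ> cyc B a b c = cyc B a c b"
proof (rule cyc_eqI[OF tri_swap])
  fix x assume "x \<notin> a ` B \<union> c ` B \<union> b ` B"
  then have "cyc B a b c x = x" by (intro cyc_out) auto
  then show "(cyc B a b c \<circ> cyc B a b c) x = x" by simp
qed (auto simp: cyc_app)

lemma cyc_conj:
  assumes "bij g" "tri B a b c"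
  shows "g \<circ> cyc B a b c \<circ> iv g = cyc B (g \<circ> a) (g \<circ> b) (g \<circ> c)"
proof (rule cyc_eqI)
  note ii = bij_is_inj[OF assms(1)]
  show "tri B (g \<circ> a) (g \<circ> b) (g \<circ> c)" by (rule tri_comp[OF ii assms(2)])
  fix t
  show "(g \<circ> cyc B a b c \<circ> iv g) ((g \<circ> a) t) = (g \<circ> b) t" if "t \<in> B"
    using that by (simp add: ii cyc_app[OF assms(2)])
  show "(g \<circ> cyc B a b c \<circ> iv g) ((g \<circ> b) t) = (g \<circ> c) t" if "t \<in> B"
    using that by (simp add: ii cyc_app[OF assms(2)])
  show "(g \<circ> cyc B a b c \<circ> iv g) ((g \<circ> c) t) = (g \<circ> a) t" if "t \<in> B"
    using that by (simp add: ii cyc_app[OF assms(2)])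
next
  fix x assume x: "x \<notin> (g \<circ> a) ` B \<union> (g \<circ> b) ` B \<union> (g \<circ> c) ` B"
  obtain y where y: "x = g y" using assms(1) by (metis bij_pointE)
  have "iv g x = y" using y assms(1) by (simp add: bij_is_inj)
  moreover have "y \<notin> a ` B \<union> b ` B \<union> c ` B" using x y by auto
  ultimately show "(g \<circ> cyc B a b c \<circ> iv g) x = x"
    using y by (simp add: cyc_out)
qed

text \<open>The three maps send the two parts of the base to disjoint sets, so each factor fixes
  what the other one moves.\<close>

lemma cyc_union:
  assumes t: "tri (B \<union> B') a b c" and d: "B \<inter> B' = {}"
  shows "cyc (B \<union> B') a b c = cyc B a b c \<circ> cyc B' a b c"
proof (rule cyc_eqI[OF t, symmetric])
  have t1: "tri B a b c" and t2: "tri B' a b c" using t tri_subset by blast+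
  have inj: "\<forall>x\<in>{a,b,c}. inj_on x (B \<union> B')"
    and disj: "\<forall>x\<in>{a,b,c}. \<forall>y\<in>{a,b,c}. x = y \<or> x ` (B \<union> B') \<inter> y ` (B \<union> B') = {}"
    using t unfolding tri_def by (simp_all add: Int_commute)
  have sep: "x t \<noteq> y t'" if "x \<in> {a,b,c}" "y \<in> {a,b,c}" "t \<in> B" "t' \<in> B'" for x y t t'
  proof
    assume eq: "x t = y t'"
    have "t \<noteq> t'" using that d by blast
    moreover have "t = t'" if "x = y"
      using that eq \<open>x \<in> _\<close> \<open>t \<in> B\<close> \<open>t' \<in> B'\<close> inj by (metis UnI1 UnI2 inj_onD)
    moreover have "x t \<in> x ` (B \<union> B') \<inter> y ` (B \<union> B')"
      using that(3,4) eq by (metis IntI UnI1 UnI2 imageI)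
    ultimately show False using disj that(1,2) by (metis empty_iff)
  qed
  have key: "cyc B a b c (x t) = x t" if "t \<in> B'" "x \<in> {a,b,c}" for x t
    using sep[of _ x _ t] that by (intro cyc_out) (force simp: image_iff)
  have key': "cyc B' a b c (x t) = x t" if "t \<in> B" "x \<in> {a,b,c}" for x t
    using sep[of x _ t] that by (intro cyc_out) (force simp: image_iff)
  fix t assume "t \<in> B \<union> B'"
  then show "(cyc B a b c \<circ> cyc B' a b c) (a t) = b t"
    "(cyc B a b c \<circ> cyc B' a b c) (b t) = c t"
    "(cyc B a b c \<circ> cyc B' a b c) (c t) = a t"
    using cyc_app[OF t1] cyc_app[OF t2] key key' by auto
next
  fix x assume "x \<notin> a ` (B \<union> B') \<union> b ` (B \<union> B') \<union> c ` (B \<union> B')"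
  then have "cyc B' a b c x = x" "cyc B a b c x = x" by (auto intro!: cyc_out)
  then show "(cyc B a b c \<circ> cyc B' a b c) x = x" by simp
qed

lemma tri_reindex: "inj_on g K \<Longrightarrow> tri (g ` K) a b c \<longleftrightarrow> tri K (a \<circ> g) (b \<circ> g) (c \<circ> g)"
  unfolding tri_def by (metis comp_inj_on_iff image_comp)

lemma cyc_reindex:
  assumes "inj_on g K" "tri (g ` K) a b c"
  shows "cyc (g ` K) a b c = cyc K (a \<circ> g) (b \<circ> g) (c \<circ> g)"
proof (rule cyc_eqI)
  show "tri K (a \<circ> g) (b \<circ> g) (c \<circ> g)" using assms tri_reindex by blast
qed (auto simp: cyc_app[OF assms(2)] image_comp intro!: cyc_out)

text \<open>Each of the ten pairs of the five maps occurs in one of the four triples, so the five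
  images are pairwise disjoint.\<close>

definition dis5 :: "'a set \<Rightarrow> ('a \<Rightarrow> 'b) \<Rightarrow> ('a \<Rightarrow> 'b) \<Rightarrow> ('a \<Rightarrow> 'b) \<Rightarrow> ('a \<Rightarrow> 'b) \<Rightarrow> ('a \<Rightarrow> 'b) \<Rightarrow> bool" where
  "dis5 B a b c d e \<longleftrightarrow> tri B a b c \<and> tri B a d e \<and> tri B b d e \<and> tri B c d e"

lemma dis5_tri:
  assumes "dis5 B a b c d e"
  shows "tri B a b c" "tri B a b d" "tri B a b e" "tri B a c d" "tri B a c e" "tri B a d e"
    "tri B b c d" "tri B b c e" "tri B b d e" "tri B c d e"
  using assms unfolding dis5_def tri_def by simp_all

text \<open>Over a point of both bases this is the identity [(a b c), (a d e)] = (a b d) for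
  permutations. Over a point of only one base, the other factor fixes all three images, so the
  commutator is trivial there. Injectivity of \<open>a\<close> on the union keeps the images of
  points outside one base away from the image of that base.\<close>

lemma cyc_commutator:
  assumes "tri B a b c" "tri B' a d e" "inj_on a (B \<union> B')"
    "(a ` B \<union> b ` B \<union> c ` B) \<inter> (d ` B' \<union> e ` B') = {}"
    "(b ` B \<union> c ` B) \<inter> a ` B' = {}"
  shows "cyc B a b c \<circ> cyc B' a d e \<circ> iv (cyc B a b c) \<circ> iv (cyc B' a d e) = cyc (B \<inter> B') a b d"
proof (rule cyc_eqI)
  let ?x = "cyc B a b c" and ?y = "cyc B' a d e"
  let ?xi = "cyc B a c b" and ?yi = "cyc B' a e d"
  note i [simp] = inv_cyc[OF assms(1)] inv_cyc[OF assms(2)]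
  note t1 = assms(1) and t2 = assms(2)
  note x = cyc_app[OF t1] cyc_app[OF tri_swap[OF t1]] and y = cyc_app[OF t2] cyc_app[OF tri_swap[OF t2]]
  have xo: "?x z = z" "?xi z = z" if "z \<notin> a ` B \<union> b ` B \<union> c ` B" for z
    using that by (auto intro!: cyc_out)
  have yo: "?y z = z" "?yi z = z" if "z \<notin> a ` B' \<union> d ` B' \<union> e ` B'" for z
    using that by (auto intro!: cyc_out)
  show "tri (B \<inter> B') a b d"
  proof -
    have "inj_on a (B \<inter> B')" "inj_on b (B \<inter> B')" "inj_on d (B \<inter> B')"
      using t1 t2 unfolding tri_def
      by (meson Int_lower1 Int_lower2 inj_on_subset)+
    moreover have "a ` (B \<inter> B') \<inter> b ` (B \<inter> B') = {}" using t1 unfolding tri_def by fast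
    moreover have "a ` (B \<inter> B') \<inter> d ` (B \<inter> B') = {}" using t2 unfolding tri_def by fast
    moreover have "b ` (B \<inter> B') \<inter> d ` (B \<inter> B') = {}" using assms(4) by fast
    ultimately show ?thesis unfolding tri_def by blast
  qed
  have D: "y \<notin> d ` B'" "y \<notin> e ` B'" if "y \<in> a ` B \<or> y \<in> b ` B \<or> y \<in> c ` B" for y
    using assms(4) that by blast+
  have D': "y \<notin> a ` B'" if "y \<in> b ` B \<or> y \<in> c ` B" for y
    using assms(5) that by blast
  have yb: "?y (b t) = b t" "?yi (b t) = b t" "?y (c t) = c t" "?yi (c t) = c t" if "t \<in> B" for t
    using imageI[OF that, of b] imageI[OF that, of c] D[of "b t"] D[of "c t"] D'[of "b t"] D'[of "c t"]
    by (simp_all add: yo)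
  have xd: "?x (d t) = d t" "?xi (d t) = d t" "?x (e t) = e t" "?xi (e t) = e t" if "t \<in> B'" for t
    using imageI[OF that, of d] imageI[OF that, of e] D(1)[of "d t"] D(2)[of "e t"]
    by (blast intro: xo)+
  have xa: "?x (a t) = a t" "?xi (a t) = a t" if "t \<in> B'" "t \<notin> B" for t
  proof -
    have "a t \<notin> a ` B" using that assms(3) by (simp add: inj_on_image_mem_iff)
    moreover have "a t \<notin> b ` B" "a t \<notin> c ` B" using D'[of "a t"] imageI[OF that(1), of a] by blast+
    ultimately show "?x (a t) = a t" "?xi (a t) = a t" by (simp_all add: xo)
  qed
  have ya: "?y (a t) = a t" "?yi (a t) = a t" if "t \<in> B" "t \<notin> B'" for t
  proof -
    have "a t \<notin> a ` B'" using that assms(3) by (simp add: inj_on_image_mem_iff)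
    moreover have "a t \<notin> d ` B'" "a t \<notin> e ` B'" using D[of "a t"] imageI[OF that(1), of a] by blast+
    ultimately show "?y (a t) = a t" "?yi (a t) = a t" by (simp_all add: yo)
  qed
  show "(?x \<circ> ?y \<circ> iv ?x \<circ> iv ?y) z = z" if z: "z \<notin> a ` (B \<inter> B') \<union> b ` (B \<inter> B') \<union> d ` (B \<inter> B')" for z
  proof (cases "z \<in> a ` B \<union> b ` B \<union> c ` B \<union> a ` B' \<union> d ` B' \<union> e ` B'")
    case False then show ?thesis by (simp add: xo yo)
  next
    case True
    have aB: "(?x \<circ> ?y \<circ> iv ?x \<circ> iv ?y) (a t) = a t" if "t \<in> B" "t \<notin> B'" for t
      using that ya[of t] yb[of t] x by simp
    have bB: "(?x \<circ> ?y \<circ> iv ?x \<circ> iv ?y) (b t) = b t" if "t \<in> B" "t \<notin> B'" for t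
      using that ya[of t] yb[of t] x by simp
    have cB: "(?x \<circ> ?y \<circ> iv ?x \<circ> iv ?y) (c t) = c t" if "t \<in> B" for t
      using that ya[of t] yb[of t] x by simp
    have aB': "(?x \<circ> ?y \<circ> iv ?x \<circ> iv ?y) (a t) = a t" if "t \<in> B'" "t \<notin> B" for t
      using that xa[of t] xd[of t] y by simp
    have dB': "(?x \<circ> ?y \<circ> iv ?x \<circ> iv ?y) (d t) = d t" if "t \<in> B'" "t \<notin> B" for t
      using that xa[of t] xd[of t] y by simp
    have eB': "(?x \<circ> ?y \<circ> iv ?x \<circ> iv ?y) (e t) = e t" if "t \<in> B'" for t
      using that xa[of t] xd[of t] y by simp
    define w where "w = ?x \<circ> ?y \<circ> iv ?x \<circ> iv ?y"
    note F = aB bB cB aB' dB' eB'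
    note F = F[folded w_def]
    have g1: "w z = z" if "z = f t" "t \<in> B" "f = a \<or> f = b \<or> f = c" for f t
      using that F(1-3)[of t] z by (cases "t \<in> B'") auto
    have g2: "w z = z" if "z = f t" "t \<in> B'" "f = a \<or> f = d \<or> f = e" for f t
      using that F(4-6)[of t] z by (cases "t \<in> B") auto
    have "w z = z"
      using True by (elim UnE imageE) (rule g1 g2, assumption, assumption, simp)+
    then show ?thesis by (simp only: w_def)
  qed
  fix t assume t: "t \<in> B \<inter> B'"
  then show "(?x \<circ> ?y \<circ> iv ?x \<circ> iv ?y) (a t) = b t" "(?x \<circ> ?y \<circ> iv ?x \<circ> iv ?y) (b t) = d t"
    "(?x \<circ> ?y \<circ> iv ?x \<circ> iv ?y) (d t) = a t"
    by (simp_all add: x y yb xd)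
qed

subsection \<open>Affine maps with slope in \<open>\<Lambda>\<close> and translation part in \<open>\<Gamma>\<close>\<close>

text \<open>Nontriviality of \<Lambda> and \<Gamma> enters as a slope below 1 and a positive
  element; together they make \<Gamma> dense (\<open>dense_mem\<close>).\<close>

locale gamma_lambda =
  fixes \<Gamma> \<Lambda> :: "real set"
  assumes zero_mem: "0 \<in> \<Gamma>"
    and add_mem: "x \<in> \<Gamma> \<Longrightarrow> y \<in> \<Gamma> \<Longrightarrow> x + y \<in> \<Gamma>"
    and uminus_mem: "x \<in> \<Gamma> \<Longrightarrow> - x \<in> \<Gamma>"
    and one_slope: "1 \<in> \<Lambda>"
    and mult_slope: "\<mu> \<in> \<Lambda> \<Longrightarrow> \<nu> \<in> \<Lambda> \<Longrightarrow> \<mu> * \<nu> \<in> \<Lambda>"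
    and inverse_slope: "\<mu> \<in> \<Lambda> \<Longrightarrow> inverse \<mu> \<in> \<Lambda>"
    and slope_pos: "\<mu> \<in> \<Lambda> \<Longrightarrow> 0 < \<mu>"
    and scale_mem: "\<mu> \<in> \<Lambda> \<Longrightarrow> x \<in> \<Gamma> \<Longrightarrow> \<mu> * x \<in> \<Gamma>"
    and ex_contraction: "\<exists>\<mu>\<in>\<Lambda>. \<mu> < 1"
    and ex_pos: "\<exists>x\<in>\<Gamma>. 0 < x"
begin

lemma diff_mem: "x \<in> \<Gamma> \<Longrightarrow> y \<in> \<Gamma> \<Longrightarrow> x - y \<in> \<Gamma>"
  using add_mem[OF _ uminus_mem] by fastforce

lemma power_slope: "\<mu> \<in> \<Lambda> \<Longrightarrow> \<mu> ^ n \<in> \<Lambda>"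
  by (induction n) (auto simp: one_slope mult_slope)

lemma divide_slope: "\<mu> \<in> \<Lambda> \<Longrightarrow> \<nu> \<in> \<Lambda> \<Longrightarrow> \<mu> / \<nu> \<in> \<Lambda>"
  by (simp add: divide_inverse mult_slope inverse_slope)

lemma divide_mem: "\<mu> \<in> \<Lambda> \<Longrightarrow> x \<in> \<Gamma> \<Longrightarrow> x / \<mu> \<in> \<Gamma>"
  using scale_mem[OF inverse_slope] by (simp add: divide_inverse mult.commute)

lemma nat_mult_mem: "x \<in> \<Gamma> \<Longrightarrow> real n * x \<in> \<Gamma>"
  by (induction n) (auto simp: zero_mem algebra_simps add_mem)

lemma int_mult_mem: "x \<in> \<Gamma> \<Longrightarrow> real_of_int k * x \<in> \<Gamma>"
  by (cases k) (auto simp: nat_mult_mem uminus_mem simp del: of_nat_Suc)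

lemmas mem_intros = zero_mem add_mem uminus_mem diff_mem scale_mem divide_mem nat_mult_mem
  one_slope mult_slope inverse_slope divide_slope power_slope

lemma small_slope:
  assumes "0 < \<epsilon>"
  obtains \<mu> where "\<mu> \<in> \<Lambda>" "0 < \<mu>" "\<mu> < \<epsilon>" "\<mu> < 1"
proof -
  obtain \<nu> where \<nu>: "\<nu> \<in> \<Lambda>" "\<nu> < 1" using ex_contraction by blast
  obtain n where n: "\<nu> ^ n < \<epsilon>"
    using real_arch_pow_inv[OF assms \<nu>(2)] by blast
  have "\<nu> ^ Suc n \<le> \<nu> ^ n" "\<nu> ^ Suc n < 1"
    using \<nu> slope_pos[OF \<nu>(1)] by (simp_all add: power_Suc_le_self power_Suc_less_one del: power_Suc)
  then show thesis
    using that[of "\<nu> ^ Suc n"] n \<nu> slope_pos power_slope by (meson le_less_trans)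
qed

lemma small_mem:
  assumes "0 < \<epsilon>"
  obtains x where "x \<in> \<Gamma>" "0 < x" "x < \<epsilon>"
proof -
  obtain x0 where x0: "x0 \<in> \<Gamma>" "0 < x0" using ex_pos by blast
  obtain \<mu> where "\<mu> \<in> \<Lambda>" "0 < \<mu>" "\<mu> < \<epsilon> / x0"
    using small_slope[of "\<epsilon> / x0"] assms x0 by auto
  then show thesis
    using that[of "\<mu> * x0"] x0 scale_mem by (simp add: pos_less_divide_eq)
qed

lemma dense_mem:
  assumes "x < y"
  obtains z where "z \<in> \<Gamma>" "x < z" "z < y"
proof -
  obtain d where d: "d \<in> \<Gamma>" "0 < d" "d < y - x" using small_mem[of "y - x"] assms by auto
  define k where "k = \<lfloor>x / d\<rfloor> + 1"
  have "x / d < real_of_int k" "real_of_int k \<le> x / d + 1"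
    unfolding k_def by linarith+
  then have "x < k * d" "k * d \<le> x + d"
    using d by (simp_all add: field_simps)
  then show thesis using that[of "k * d"] d int_mult_mem by simp
qed

text \<open>The predicate \<open>loc t P\<close> says that \<open>P\<close> holds for all sufficiently small \<open>\<Gamma>\<close>-intervals near \<open>t\<close>.
  A point \<open>t\<close> of \<open>\<Gamma>\<close> may only be an endpoint of them, because the maps considered may be
  discontinuous there.\<close>

definition loc :: "real \<Rightarrow> (real \<Rightarrow> real \<Rightarrow> bool) \<Rightarrow> bool" where
  "loc t P \<longleftrightarrow> (\<exists>\<delta>>0. \<forall>u\<in>\<Gamma>. \<forall>v\<in>\<Gamma>. t - \<delta> < u \<longrightarrow> u < v \<longrightarrow> v < t + \<delta> \<longrightarrow>
      (t \<in> \<Gamma> \<longrightarrow> \<not> (u < t \<and> t < v)) \<longrightarrow> P u v)"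

lemma loc_mono:
  assumes "loc t P" "\<And>u v. u \<in> \<Gamma> \<Longrightarrow> v \<in> \<Gamma> \<Longrightarrow> u < v \<Longrightarrow> P u v \<Longrightarrow> P' u v"
  shows "loc t P'"
  using assms unfolding loc_def by metis

lemma loc_conj:
  assumes "loc t P" "loc t P'"
  shows "loc t (\<lambda>u v. P u v \<and> P' u v)"
proof -
  from assms obtain d d' where "0 < d" "0 < d'"
    and "\<forall>u\<in>\<Gamma>. \<forall>v\<in>\<Gamma>. t - d < u \<longrightarrow> u < v \<longrightarrow> v < t + d \<longrightarrow> (t \<in> \<Gamma> \<longrightarrow> \<not> (u < t \<and> t < v)) \<longrightarrow> P u v"
    and "\<forall>u\<in>\<Gamma>. \<forall>v\<in>\<Gamma>. t - d' < u \<longrightarrow> u < v \<longrightarrow> v < t + d' \<longrightarrow> (t \<in> \<Gamma> \<longrightarrow> \<not> (u < t \<and> t < v)) \<longrightarrow> P' u v"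
    unfolding loc_def by blast
  then show ?thesis unfolding loc_def by (intro exI[of _ "min d d'"]) auto
qed

lemma loc_near: "0 < \<epsilon> \<Longrightarrow> loc t (\<lambda>u v. t - \<epsilon> < u \<and> u < v \<and> v < t + \<epsilon>)"
  unfolding loc_def by blast

lemma loc_avoid:
  assumes "finite Q" "Q \<subseteq> \<Gamma>"
  shows "loc t (\<lambda>u v. {u<..<v} \<inter> Q = {})"
proof -
  obtain d where d: "d > 0" "\<forall>x\<in>Q. x \<noteq> t \<longrightarrow> d \<le> dist t x"
    using finite_set_avoid[OF assms(1)] by blast
  show ?thesis unfolding loc_def
  proof (intro exI[of _ d] conjI d(1) ballI impI)
    fix u v assume uv: "u \<in> \<Gamma>" "v \<in> \<Gamma>" "t - d < u" "u < v" "v < t + d" "t \<in> \<Gamma> \<longrightarrow> \<not> (u < t \<and> t < v)"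
    show "{u<..<v} \<inter> Q = {}"
    proof (rule ccontr)
      assume "{u<..<v} \<inter> Q \<noteq> {}"
      then obtain x where x: "x \<in> Q" "u < x" "x < v" by auto
      then have "x \<noteq> t" using uv assms by blast
      then have "d \<le> \<bar>t - x\<bar>" using d x by (auto simp: dist_real_def)
      then show False using uv x by linarith
    qed
  qed
qed

text \<open>A Heine-Borel argument: what adds up along common endpoints and holds for short
  intervals holds for long ones. The difficulty is that the bisection rule \<open>Bolzano\<close>
  cuts at arbitrary reals, whereas \<open>add\<close> may cut only at points of \<Gamma>.\<close>

lemma loc_imp_all:
  assumes pq: "p \<in> \<Gamma>" "q \<in> \<Gamma>" "p < q"
    and add: "\<And>u v w. u \<in> \<Gamma> \<Longrightarrow> v \<in> \<Gamma> \<Longrightarrow> w \<in> \<Gamma> \<Longrightarrow> p \<le> u \<Longrightarrow> u < v \<Longrightarrow> v < w \<Longrightarrow> w \<le> q \<Longrightarrow>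
      P u v \<Longrightarrow> P v w \<Longrightarrow> P u w"
    and loc: "\<And>t. p \<le> t \<Longrightarrow> t \<le> q \<Longrightarrow> loc t (\<lambda>u v. p \<le> u \<longrightarrow> v \<le> q \<longrightarrow> P u v)"
  shows "P p q"
proof -
  define R where "R a b \<longleftrightarrow> (\<forall>u\<in>\<Gamma>. \<forall>v\<in>\<Gamma>. p \<le> u \<longrightarrow> v \<le> q \<longrightarrow> a \<le> u \<longrightarrow> u < v \<longrightarrow> v \<le> b \<longrightarrow> P u v)" for a b
  have near: "\<exists>\<delta>>0. \<forall>u\<in>\<Gamma>. \<forall>v\<in>\<Gamma>. p \<le> u \<longrightarrow> v \<le> q \<longrightarrow> t - \<delta> < u \<longrightarrow> u < v \<longrightarrow> v < t + \<delta> \<longrightarrow> P u v"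
    if pt: "p \<le> t" "t \<le> q" for t
  proof -
    obtain \<delta> where \<delta>: "\<delta> > 0" "\<And>u v. u \<in> \<Gamma> \<Longrightarrow> v \<in> \<Gamma> \<Longrightarrow> t - \<delta> < u \<Longrightarrow> u < v \<Longrightarrow> v < t + \<delta> \<Longrightarrow>
        (t \<in> \<Gamma> \<longrightarrow> \<not> (u < t \<and> t < v)) \<Longrightarrow> p \<le> u \<Longrightarrow> v \<le> q \<Longrightarrow> P u v"
      using loc[OF pt] unfolding loc_def by metis
    have "P u v" if "u \<in> \<Gamma>" "v \<in> \<Gamma>" "p \<le> u" "v \<le> q" "t - \<delta> < u" "u < v" "v < t + \<delta>" for u v
    \<comment> \<open>An interval around a point \<open>t\<close> of \<Gamma> is not covered by
      \<open>loc\<close>, but it may be cut at \<open>t\<close>.\<close>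
    proof (cases "t \<in> \<Gamma> \<and> u < t \<and> t < v")
      case True
      then show ?thesis
        using add[of u t v] \<delta>(2)[of u t] \<delta>(2)[of t v] that by auto
    next
      case False then show ?thesis using \<delta>(2) that by blast
    qed
    then show ?thesis using \<delta>(1) by blast
  qed
  have "R p q"
  proof (rule Bolzano)
    show "p \<le> q" using pq by simp
    fix a b c assume R: "R a b" "R b c" and ab: "a \<le> b" "b \<le> c"
    show "R a c"
      unfolding R_def
    proof (intro ballI impI)
      fix u v assume uv: "u \<in> \<Gamma>" "v \<in> \<Gamma>" "p \<le> u" "v \<le> q" "a \<le> u" "u < v" "v \<le> c"
      consider "v \<le> b" | "b \<le> u" | "u < b" "b < v" by linarith
      then show "P u v"
      proof cases
        case 1 then show ?thesis using R uv unfolding R_def by auto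
      next
        case 2 then show ?thesis using R uv unfolding R_def by auto
      next
        \<comment> \<open>\<open>b\<close> may lie outside \<Gamma>: a short interval from
          \<open>r\<close> to \<open>s\<close> around it, with endpoints in \<Gamma>, bridges the
          cut.\<close>
        case 3
        then have "p \<le> b" "b \<le> q" using uv by auto
        then obtain \<delta> where \<delta>: "\<delta> > 0" "\<And>u v. u \<in> \<Gamma> \<Longrightarrow> v \<in> \<Gamma> \<Longrightarrow> p \<le> u \<Longrightarrow> v \<le> q \<Longrightarrow>
            b - \<delta> < u \<Longrightarrow> u < v \<Longrightarrow> v < b + \<delta> \<Longrightarrow> P u v"
          using near by metis
        obtain r where r: "r \<in> \<Gamma>" "max u (b - \<delta>) < r" "r < b"
          using dense_mem[of "max u (b - \<delta>)" b] 3 \<delta>(1) by auto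
        obtain s where s: "s \<in> \<Gamma>" "b < s" "s < min v (b + \<delta>)"
          using dense_mem[of b "min v (b + \<delta>)"] 3 \<delta>(1) by auto
        have "P u r" using R(1) uv r 3 unfolding R_def by auto
        moreover have "P r s" using \<delta>(2)[of r s] r s uv by auto
        moreover have "P s v" using R(2) uv s 3 unfolding R_def by auto
        ultimately show ?thesis using add[of u r s] add[of u s v] uv r s by auto
      qed
    qed
  next
    fix t assume "p \<le> t" "t \<le> q"
    then obtain \<delta> where \<delta>: "\<delta> > 0" "\<forall>u\<in>\<Gamma>. \<forall>v\<in>\<Gamma>. p \<le> u \<longrightarrow> v \<le> q \<longrightarrow> t - \<delta> < u \<longrightarrow> u < v \<longrightarrow> v < t + \<delta> \<longrightarrow> P u v"
      using near by blast
    show "\<exists>d>0. \<forall>a b. a \<le> t \<and> t \<le> b \<and> b - a < d \<longrightarrow> R a b"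
      using \<delta> unfolding R_def by (intro exI[of _ \<delta>]) auto
  qed
  then show ?thesis using pq unfolding R_def by auto
qed

section \<open>Affine maps and free room for their images\<close>

definition aff :: "(real \<Rightarrow> real) set" where
  "aff = {(\<lambda>t. \<mu> * t + c) | \<mu> c. \<mu> \<in> \<Lambda> \<and> c \<in> \<Gamma>}"

lemma affI: "\<mu> \<in> \<Lambda> \<Longrightarrow> c \<in> \<Gamma> \<Longrightarrow> (\<lambda>t. \<mu> * t + c) \<in> aff"
  unfolding aff_def by blast

lemma affE:
  assumes "e \<in> aff"
  obtains \<mu> c where "\<mu> \<in> \<Lambda>" "c \<in> \<Gamma>" "\<And>t. e t = \<mu> * t + c" "0 < \<mu>"
  using assms slope_pos unfolding aff_def by force

lemma aff_id: "id \<in> aff"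
  using affI[OF one_slope zero_mem] by (simp add: id_def)

lemma aff_trans: "c \<in> \<Gamma> \<Longrightarrow> (\<lambda>t. t + c) \<in> aff"
  using affI[OF one_slope] by simp

lemma aff_scale: "\<mu> \<in> \<Lambda> \<Longrightarrow> (\<lambda>t. \<mu> * t) \<in> aff"
  using affI[OF _ zero_mem] by simp

lemma aff_comp:
  assumes "e \<in> aff" "f \<in> aff"
  shows "e \<circ> f \<in> aff"
proof -
  obtain \<mu> c where e: "\<mu> \<in> \<Lambda>" "c \<in> \<Gamma>" "\<And>t. e t = \<mu> * t + c" using affE[OF assms(1)] by metis
  obtain \<nu> d where f: "\<nu> \<in> \<Lambda>" "d \<in> \<Gamma>" "\<And>t. f t = \<nu> * t + d" using affE[OF assms(2)] by metis
  have "e \<circ> f = (\<lambda>t. (\<mu> * \<nu>) * t + (\<mu> * d + c))" by (auto simp: e f algebra_simps)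
  then show ?thesis using e f by (simp only:) (intro affI mem_intros)
qed

lemma aff_less_iff [simp]: "e \<in> aff \<Longrightarrow> e x < e y \<longleftrightarrow> x < y"
  and aff_le_iff [simp]: "e \<in> aff \<Longrightarrow> e x \<le> e y \<longleftrightarrow> x \<le> y"
  and aff_eq_iff [simp]: "e \<in> aff \<Longrightarrow> e x = e y \<longleftrightarrow> x = y"
  by (auto elim!: affE)

lemma aff_inj: "e \<in> aff \<Longrightarrow> inj_on e S"
  by (auto simp: inj_on_def)

lemma aff_bij:
  assumes "e \<in> aff"
  shows "bij e"
proof -
  obtain \<mu> c where e: "\<mu> \<in> \<Lambda>" "c \<in> \<Gamma>" "\<And>t. e t = \<mu> * t + c" "0 < \<mu>" using affE[OF assms] by metis
  have "e ((y - c) / \<mu>) = y" for y using e by simp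
  then have "surj e" by (rule surjI)
  then show ?thesis using aff_inj[OF assms, of UNIV] by (simp add: bij_def)
qed

lemma aff_iv:
  assumes "e \<in> aff"
  shows "iv e \<in> aff"
proof -
  obtain \<mu> c where e: "\<mu> \<in> \<Lambda>" "c \<in> \<Gamma>" "\<And>t. e t = \<mu> * t + c" "0 < \<mu>" using affE[OF assms] by metis
  have "iv e = (\<lambda>t. inverse \<mu> * t + (- (c / \<mu>)))"
  proof
    fix t
    have "e (inverse \<mu> * t + (- (c / \<mu>))) = t" using e by (simp add: field_simps)
    then show "iv e t = inverse \<mu> * t + (- (c / \<mu>))"
      using aff_inj[OF assms] by (metis inv_f_f)
  qed
  then show ?thesis using e by (simp only:) (intro affI mem_intros)
qed

lemma aff_iv_simps [simp]: "e \<in> aff \<Longrightarrow> e (iv e x) = x" "e \<in> aff \<Longrightarrow> iv e (e x) = x"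
  using aff_bij by (auto simp: bij_is_surj surj_f_inv_f aff_inj)

lemma aff_mem: "e \<in> aff \<Longrightarrow> t \<in> \<Gamma> \<Longrightarrow> e t \<in> \<Gamma>"
  by (auto elim!: affE intro!: mem_intros)

lemma aff_mem_iff [simp]: "e \<in> aff \<Longrightarrow> e t \<in> \<Gamma> \<longleftrightarrow> t \<in> \<Gamma>"
  using aff_mem[of e t] aff_mem[OF aff_iv[of e], of "e t"] by auto

lemma aff_image:
  assumes "e \<in> aff"
  shows "e ` {u..<v} = {e u..<e v}"
proof
  show "{e u..<e v} \<subseteq> e ` {u..<v}"
  proof
    fix y assume "y \<in> {e u..<e v}"
    then have "iv e y \<in> {u..<v}" using assms aff_le_iff[OF assms, of u "iv e y"]
        aff_less_iff[OF assms, of "iv e y" v] by simp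
    then show "y \<in> e ` {u..<v}" using assms image_eqI[of y e "iv e y"] by simp
  qed
qed (use assms in auto)

lemma aff_subset_iff: "e \<in> aff \<Longrightarrow> u < v \<Longrightarrow> e ` {u..<v} \<subseteq> {a..<b} \<longleftrightarrow> a \<le> e u \<and> e v \<le> b"
  by (simp add: aff_image)

lemma aff_eqI:
  assumes "e \<in> aff" "f \<in> aff" "e x = f x" "e y = f y" "x \<noteq> y"
  shows "e = f"
proof -
  obtain \<mu> c where e: "\<And>t. e t = \<mu> * t + c" using affE[OF assms(1)] by metis
  obtain \<nu> d where f: "\<And>t. f t = \<nu> * t + d" using affE[OF assms(2)] by metis
  have "\<mu> * (x - y) = \<nu> * (x - y)" using assms e f by (simp add: algebra_simps)
  then have "\<mu> = \<nu>" using assms by simp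
  then show ?thesis using e f assms by auto
qed

text \<open>Near \<open>t\<close> the images under the finitely many maps of \<open>E\<close> stay
  close to the values \<open>e t\<close>. A point \<open>z\<close> of \<Gamma> different from these
  values is chosen in the target, and \<open>r\<close> contracts towards \<open>z\<close>.\<close>

lemma loc_room:
  assumes "finite E" "E \<subseteq> aff" "c < d"
  shows "loc t (\<lambda>u v. \<exists>r\<in>aff. r ` {u..<v} \<subseteq> {c..<d} \<and> (\<forall>e\<in>E. r ` {u..<v} \<inter> e ` {u..<v} = {}))"
proof -
  have "infinite (\<Gamma> \<inter> {c<..<d})"
  proof
    let ?G = "\<Gamma> \<inter> {c<..<d}"
    assume fin: "finite ?G"
    obtain z0 where "z0 \<in> ?G" using dense_mem[OF assms(3)] by auto
    then have "Max ?G \<in> ?G" using fin by (intro Max_in) auto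
    then obtain z where "z \<in> \<Gamma>" "Max ?G < z" "z < d" "c < Max ?G"
      using dense_mem[of "Max ?G" d] by auto
    then show False using Max_ge[OF fin, of z] by auto
  qed
  then have "\<Gamma> \<inter> {c<..<d} - (\<lambda>e. e t) ` E \<noteq> {}"
    using assms(1) by (metis finite_imageI finite_subset Diff_eq_empty_iff)
  then obtain z where "z \<in> \<Gamma> \<inter> {c<..<d}" "z \<notin> (\<lambda>e. e t) ` E" by blast
  then have z: "z \<in> \<Gamma>" "c < z" "z < d" "\<And>e. e \<in> E \<Longrightarrow> e t \<noteq> z" by auto
  obtain \<eta>0 where \<eta>0: "\<eta>0 > 0" "\<forall>x\<in>(\<lambda>e. e t) ` E. x \<noteq> z \<longrightarrow> \<eta>0 \<le> dist z x"
    using finite_set_avoid[of "(\<lambda>e. e t) ` E" z] assms(1) by blast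
  define \<eta> where "\<eta> = min \<eta>0 (min (z - c) (d - z))"
  have \<eta>: "0 < \<eta>" "\<eta> \<le> z - c" "\<eta> \<le> d - z" "\<And>e. e \<in> E \<Longrightarrow> \<eta> \<le> \<bar>z - e t\<bar>"
    using z \<eta>0 unfolding \<eta>_def by (auto simp: dist_real_def min_def not_le)
  obtain \<mu> where \<mu>: "\<mu> \<in> \<Lambda>" "0 < \<mu>" "\<mu> < \<eta> / 4" using small_slope[of "\<eta> / 4"] \<eta> by auto
  \<comment> \<open>\<open>r\<close> is centred at \<open>w\<close> instead of \<open>t\<close>,
    since \<open>t\<close> need not lie in \<Gamma>. Points within 1 of \<open>t\<close> are within
    2 of \<open>w\<close>, so a slope below \<open>\<eta> / 4\<close> keeps their images within
    \<open>\<eta> / 2\<close> of \<open>z\<close>.\<close>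
  obtain w where w: "w \<in> \<Gamma>" "t < w" "w < t + 1" using dense_mem[of t "t + 1"] by auto
  define r where "r = (\<lambda>s. \<mu> * s + (z - \<mu> * w))"
  have r: "r \<in> aff" unfolding r_def using \<mu> z w by (intro affI mem_intros)
  have "\<exists>M>0. \<forall>e\<in>E. \<forall>s. \<bar>e s - e t\<bar> \<le> M * \<bar>s - t\<bar>"
    using assms(1,2)
  proof (induction E)
    case empty then show ?case by (auto intro: exI[of _ 1])
  next
    case (insert e E)
    then obtain M where M: "M > 0" "\<And>e s. e \<in> E \<Longrightarrow> \<bar>e s - e t\<bar> \<le> M * \<bar>s - t\<bar>" by auto
    obtain \<nu> c where e: "\<And>t. e t = \<nu> * t + c" "0 < \<nu>" using affE insert by (metis insert_subset)
    have 1: "\<bar>e s - e t\<bar> \<le> max M \<nu> * \<bar>s - t\<bar>" for s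
    proof -
      have "\<bar>e s - e t\<bar> = \<nu> * \<bar>s - t\<bar>" using e by (simp add: abs_mult flip: right_diff_distrib)
      then show ?thesis by (simp add: mult_right_mono)
    qed
    have 2: "\<bar>e' s - e' t\<bar> \<le> max M \<nu> * \<bar>s - t\<bar>" if "e' \<in> E" for s e'
      using M(2)[OF that, of s] mult_right_mono[of M "max M \<nu>" "\<bar>s - t\<bar>"] by simp
    show ?case using 1 2 M(1) by (intro exI[of _ "max M \<nu>"]) auto
  qed
  then obtain M where M: "M > 0" "\<And>e s. e \<in> E \<Longrightarrow> \<bar>e s - e t\<bar> \<le> M * \<bar>s - t\<bar>" by blast
  define \<delta> where "\<delta> = min 1 (\<eta> / (2 * M))"
  have \<delta>: "0 < \<delta>" "\<delta> \<le> 1" "M * \<delta> \<le> \<eta> / 2"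
    using M \<eta> unfolding \<delta>_def by (auto simp: min_def field_simps)
  show ?thesis
  proof (rule loc_mono[OF loc_near[OF \<delta>(1), of t]])
    fix u v assume uv: "t - \<delta> < u \<and> u < v \<and> v < t + \<delta>"
    have rs: "\<bar>r s - z\<bar> < \<eta> / 2" if "s \<in> {u..<v}" for s
    proof -
      have "\<bar>s - w\<bar> \<le> 2" using that uv w \<delta> by auto
      then have "\<mu> * \<bar>s - w\<bar> \<le> \<mu> * 2" using \<mu> by (intro mult_left_mono) auto
      moreover have "\<bar>r s - z\<bar> = \<mu> * \<bar>s - w\<bar>"
        using \<mu> unfolding r_def by (simp add: abs_mult flip: right_diff_distrib)
      ultimately show ?thesis using \<mu> by linarith
    qed
    have es: "\<bar>e s - e t\<bar> \<le> \<eta> / 2" if "s \<in> {u..<v}" "e \<in> E" for s e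
    proof -
      have "M * \<bar>s - t\<bar> \<le> M * \<delta>" using that uv M by (intro mult_left_mono) auto
      then show ?thesis using M(2)[OF that(2), of s] \<delta> by linarith
    qed
    have "r ` {u..<v} \<subseteq> {c..<d}"
    proof
      fix y assume "y \<in> r ` {u..<v}"
      then have "\<bar>y - z\<bar> < \<eta> / 2" using rs by auto
      then have "c \<le> y" "y < d" using \<eta>(1-3) by linarith+
      then show "y \<in> {c..<d}" by simp
    qed
    moreover have "r ` {u..<v} \<inter> e ` {u..<v} = {}" if "e \<in> E" for e
    proof (rule ccontr)
      assume "r ` {u..<v} \<inter> e ` {u..<v} \<noteq> {}"
      then obtain y where "y \<in> r ` {u..<v}" "y \<in> e ` {u..<v}" by blast
      then obtain s s' where s: "s \<in> {u..<v}" "s' \<in> {u..<v}" "r s = e s'"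
        by (elim imageE) (rule that, assumption, assumption, simp)
      show False using rs[OF s(1)] es[OF s(2) that] \<eta>(4)[OF that] s(3) by linarith
    qed
    ultimately show "\<exists>r\<in>aff. r ` {u..<v} \<subseteq> {c..<d} \<and> (\<forall>e\<in>E. r ` {u..<v} \<inter> e ` {u..<v} = {})"
      using r by blast
  qed
qed

end

subsection \<open>Piecewise affine bijections of a half-open interval\<close>

lemma cyc_fix:
  assumes "f ` B \<inter> a ` B = {}" "f ` B \<inter> b ` B = {}" "f ` B \<inter> c ` B = {}" "t \<in> B"
  shows "cyc B a b c (f t) = f t"
proof -
  have "f t \<in> f ` B" using assms(4) by (rule imageI)
  then have "f t \<notin> a ` B" "f t \<notin> b ` B" "f t \<notin> c ` B" using assms(1-3) by blast+
  then show ?thesis by (simp add: cyc_def)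
qed

locale stein = gamma_lambda +
  fixes l :: real
  assumes l_mem: "l \<in> \<Gamma>" and l_pos: "0 < l"
begin

text \<open>Maps of the whole line that fix everything outside \<open>[0, l)\<close> compose without
  domain restrictions. Half-open pieces encode right-continuity. An unordered cover by pieces is
  easy to transport to the inverse; \<open>pw_cuts\<close> gives the form with cut points, which
  suits composition.\<close>

definition pw :: "(real \<Rightarrow> real) set" where
  "pw = {f. bij f \<and> (\<forall>t. t \<notin> {0..<l} \<longrightarrow> f t = t) \<and>
    (\<exists>P. finite P \<and> P \<subseteq> \<Gamma> \<times> \<Gamma> \<and> {0..<l} \<subseteq> (\<Union>p\<in>P. {fst p..<snd p}) \<and>
      (\<forall>p\<in>P. \<exists>e\<in>aff. \<forall>t\<in>{fst p..<snd p}. f t = e t))}"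

lemma pwI:
  assumes "bij f" "\<And>t. t \<notin> {0..<l} \<Longrightarrow> f t = t" "finite P" "P \<subseteq> \<Gamma> \<times> \<Gamma>"
    "{0..<l} \<subseteq> (\<Union>p\<in>P. {fst p..<snd p})" "\<And>p. p \<in> P \<Longrightarrow> \<exists>e\<in>aff. \<forall>t\<in>{fst p..<snd p}. f t = e t"
  shows "f \<in> pw"
  unfolding pw_def mem_Collect_eq
  by (intro conjI allI impI exI[of _ P] ballI assms; assumption)

lemma pw_cover:
  assumes "f \<in> pw"
  obtains P where "finite P" "P \<subseteq> \<Gamma> \<times> \<Gamma>" "{0..<l} \<subseteq> (\<Union>p\<in>P. {fst p..<snd p})"
    "\<forall>p\<in>P. \<exists>e\<in>aff. \<forall>t\<in>{fst p..<snd p}. f t = e t"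
  using assms unfolding pw_def mem_Collect_eq by (elim conjE exE) (rule that)

lemma pw_bij: "f \<in> pw \<Longrightarrow> bij f"
  and pw_out: "f \<in> pw \<Longrightarrow> t \<notin> {0..<l} \<Longrightarrow> f t = t"
  unfolding pw_def mem_Collect_eq by simp_all

lemma pw_inj: "f \<in> pw \<Longrightarrow> f x = f y \<longleftrightarrow> x = y"
  using pw_bij by (metis bij_pointE)

lemma pw_iv [simp]: "f \<in> pw \<Longrightarrow> f (iv f x) = x" "f \<in> pw \<Longrightarrow> iv f (f x) = x"
  using pw_bij by (auto simp: bij_is_surj surj_f_inv_f bij_is_inj)

lemma pw_mem_iff: "f \<in> pw \<Longrightarrow> f t \<in> {0..<l} \<longleftrightarrow> t \<in> {0..<l}"
  using pw_out[of f t] pw_out[of f "f t"] pw_inj[of f "f t" t] by metis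

lemma pw_image:
  assumes f: "f \<in> pw"
  shows "f ` {0..<l} = {0..<l}"
proof
  show "f ` {0..<l} \<subseteq> {0..<l}" using pw_mem_iff[OF f] by blast
  show "{0..<l} \<subseteq> f ` {0..<l}"
  proof
    fix y assume "y \<in> {0..<l}"
    then have "iv f y \<in> {0..<l}" using pw_mem_iff[OF f, of "iv f y"] f by simp
    then show "y \<in> f ` {0..<l}" using f image_eqI[of y f "iv f y"] by simp
  qed
qed

text \<open>The right endpoints of the pieces, with 0 and \<open>l\<close>, suffice: an interval
  that avoids them stays inside any piece containing its left endpoint.\<close>

lemma pw_cuts:
  assumes "f \<in> pw"
  obtains Q where "finite Q" "Q \<subseteq> \<Gamma>"
    "\<And>u v. u < v \<Longrightarrow> {u<..<v} \<inter> Q = {} \<Longrightarrow> \<exists>e\<in>aff. \<forall>t\<in>{u..<v}. f t = e t"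
proof -
  obtain P where P: "finite P" "P \<subseteq> \<Gamma> \<times> \<Gamma>" "{0..<l} \<subseteq> (\<Union>p\<in>P. {fst p..<snd p})"
    "\<forall>p\<in>P. \<exists>e\<in>aff. \<forall>t\<in>{fst p..<snd p}. f t = e t"
    by (rule pw_cover[OF assms])
  define Q where "Q = insert 0 (insert l (snd ` P))"
  show thesis
  proof (rule that)
    show "finite Q" "Q \<subseteq> \<Gamma>" using P zero_mem l_mem unfolding Q_def by auto
    fix u v :: real assume uv: "u < v" "{u<..<v} \<inter> Q = {}"
    show "\<exists>e\<in>aff. \<forall>t\<in>{u..<v}. f t = e t"
    proof (cases "u \<in> {0..<l}")
      case True
      then obtain a b where ab: "(a, b) \<in> P" "a \<le> u" "u < b" using P(3) by force
      then have "b \<in> Q" unfolding Q_def by force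
      then have "v \<le> b" using uv ab by (meson disjoint_iff greaterThanLessThan_iff not_le)
      then have "{u..<v} \<subseteq> {a..<b}" using ab by auto
      then show ?thesis using bspec[OF P(4) ab(1)] by (auto simp: subset_iff)
    next
      case False
      have "\<not> (u < 0 \<and> 0 < v)" using uv unfolding Q_def by auto
      then have "\<forall>t\<in>{u..<v}. f t = id t"
        using False uv(1) by (auto intro!: pw_out[OF assms])
      then show ?thesis using aff_id by (rule bexI)
    qed
  qed
qed

text \<open>Consecutive cut points form the pieces; 0 and \<open>l\<close> are added so that the
  pieces exhaust the interval.\<close>

lemma pw_cutsI:
  assumes "bij f" "\<And>t. t \<notin> {0..<l} \<Longrightarrow> f t = t" "finite Q" "Q \<subseteq> \<Gamma>"
    "\<And>u v. u < v \<Longrightarrow> 0 \<le> u \<Longrightarrow> v \<le> l \<Longrightarrow> {u<..<v} \<inter> Q = {} \<Longrightarrow> \<exists>e\<in>aff. \<forall>t\<in>{u..<v}. f t = e t"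
  shows "f \<in> pw"
proof -
  define R where "R = insert 0 (insert l (Q \<inter> {0..l}))"
  have R: "finite R" "R \<subseteq> \<Gamma>" using assms(3,4) zero_mem l_mem unfolding R_def by auto
  define P where "P = {(a, b) \<in> R \<times> R. a < b \<and> {a<..<b} \<inter> R = {}}"
  show ?thesis
  proof (rule pwI[OF assms(1,2)])
  show "finite P" unfolding P_def using R by (auto intro: finite_subset[of _ "R \<times> R"])
  show "P \<subseteq> \<Gamma> \<times> \<Gamma>" unfolding P_def using R by auto
  show "{0..<l} \<subseteq> (\<Union>p\<in>P. {fst p..<snd p})"
  proof
    fix t assume t: "t \<in> {0..<l}"
    define a where "a = Max {q \<in> R. q \<le> t}"
    define b where "b = Min {q \<in> R. t < q}"
    have "0 \<in> {q \<in> R. q \<le> t}" "l \<in> {q \<in> R. t < q}" using t unfolding R_def by auto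
    then have ab: "a \<in> {q \<in> R. q \<le> t}" "b \<in> {q \<in> R. t < q}"
      unfolding a_def b_def using R by (intro Max_in Min_in; fastforce)+
    have "q \<le> a" if "q \<in> R" "q \<le> t" for q unfolding a_def using that R by (intro Max_ge) auto
    moreover have "b \<le> q" if "q \<in> R" "t < q" for q unfolding b_def using that R by (intro Min_le) auto
    ultimately have "{a<..<b} \<inter> R = {}" by force
    then have "(a, b) \<in> P" using ab unfolding P_def by auto
    then show "t \<in> (\<Union>p\<in>P. {fst p..<snd p})" using ab by force
  qed
  fix p assume "p \<in> P"
  then obtain a b where that: "(a, b) \<in> P" and [simp]: "p = (a, b)" by (cases p) simp
  have "\<exists>e\<in>aff. \<forall>t\<in>{a..<b}. f t = e t"
  proof (rule assms(5))
    have ab: "a \<in> R" "b \<in> R" "a < b" "{a<..<b} \<inter> R = {}" using that unfolding P_def by auto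
    show "a < b" by fact
    show "0 \<le> a" "b \<le> l" using ab l_pos unfolding R_def by auto
    then show "{a<..<b} \<inter> Q = {}" using ab(4) unfolding R_def by force
  qed
  then show "\<exists>e\<in>aff. \<forall>t\<in>{fst p..<snd p}. f t = e t" by simp
  qed
qed

lemma pw_id: "id \<in> pw"
  by (rule pw_cutsI[of _ "{}"]) (auto intro!: bexI[OF _ aff_id])

lemma pw_comp:
  assumes "f \<in> pw" "g \<in> pw"
  shows "f \<circ> g \<in> pw"
proof -
  obtain Q where Q: "finite Q" "Q \<subseteq> \<Gamma>"
    "\<And>u v. u < v \<Longrightarrow> {u<..<v} \<inter> Q = {} \<Longrightarrow> \<exists>e\<in>aff. \<forall>t\<in>{u..<v}. f t = e t"
    using pw_cuts[OF assms(1)] by metis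
  obtain R where R: "finite R" "R \<subseteq> \<Gamma>"
    "\<And>u v. u < v \<Longrightarrow> {u<..<v} \<inter> R = {} \<Longrightarrow> \<exists>e\<in>aff. \<forall>t\<in>{u..<v}. g t = e t"
    using pw_cuts[OF assms(2)] by metis
  \<comment> \<open>Cut points pull back to \<Gamma>: to the right of the preimage, \<open>g\<close>
    agrees with an element of \<open>aff\<close>, and these preserve membership in \<Gamma> in both
    directions.\<close>
  have ivg: "iv g q \<in> \<Gamma>" if "q \<in> \<Gamma>" for q
  proof -
    define t where "t = iv g q"
    have gt: "g t = q" using assms(2) unfolding t_def by simp
    obtain d where d: "d > 0" "\<forall>x\<in>R. x \<noteq> t \<longrightarrow> d \<le> dist t x"
      using finite_set_avoid[OF R(1)] by blast
    have "{t<..<t + d} \<inter> R = {}" using d by (force simp: dist_real_def)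
    then obtain e where e: "e \<in> aff" "\<forall>s\<in>{t..<t + d}. g s = e s" using R(3)[of t "t + d"] d by auto
    then have "e t \<in> \<Gamma>" using gt that d(1) by auto
    then show ?thesis using e unfolding t_def by simp
  qed
  show ?thesis
  proof (rule pw_cutsI[of _ "R \<union> iv g ` Q"])
    show "bij (f \<circ> g)" using pw_bij assms by (intro bij_comp) auto
    show "(f \<circ> g) t = t" if "t \<notin> {0..<l}" for t
      using pw_out[OF assms(1) that] pw_out[OF assms(2) that] by simp
    show "finite (R \<union> iv g ` Q)" "R \<union> iv g ` Q \<subseteq> \<Gamma>" using R Q ivg by auto
    fix u v :: real assume uv: "u < v" "{u<..<v} \<inter> (R \<union> iv g ` Q) = {}"
    then obtain e where e: "e \<in> aff" "\<forall>s\<in>{u..<v}. g s = e s" using R(3)[of u v] by blast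
    have "{e u<..<e v} \<inter> Q = {}"
    proof (rule ccontr)
      assume "{e u<..<e v} \<inter> Q \<noteq> {}"
      then obtain q where q: "q \<in> Q" "e u < q" "q < e v" by auto
      define s where "s = iv e q"
      have "e s = q" using e unfolding s_def by simp
      then have s: "u < s" "s < v" using q aff_less_iff[OF e(1)] by metis+
      then have "g s = q" using e \<open>e s = q\<close> by auto
      then have "s = iv g q" using assms(2) by (metis pw_iv(2))
      then show False using s uv q by auto
    qed
    then obtain e' where e': "e' \<in> aff" "\<forall>s\<in>{e u..<e v}. f s = e' s"
      using Q(3)[of "e u" "e v"] uv e by auto
    then have "\<forall>t\<in>{u..<v}. (f \<circ> g) t = (e' \<circ> e) t" using e by auto
    then show "\<exists>e\<in>aff. \<forall>t\<in>{u..<v}. (f \<circ> g) t = e t" using aff_comp[OF e'(1) e(1)] by blast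
  qed
qed

lemma pw_inverse:
  assumes "f \<in> pw"
  shows "iv f \<in> pw"
proof -
  obtain P where P: "finite P" "P \<subseteq> \<Gamma> \<times> \<Gamma>" "{0..<l} \<subseteq> (\<Union>p\<in>P. {fst p..<snd p})"
    "\<forall>p\<in>P. \<exists>e\<in>aff. \<forall>t\<in>{fst p..<snd p}. f t = e t"
    by (rule pw_cover[OF assms])
  then obtain E where E: "\<And>p. p \<in> P \<Longrightarrow> E p \<in> aff" "\<And>p t. p \<in> P \<Longrightarrow> t \<in> {fst p..<snd p} \<Longrightarrow> f t = E p t"
    by metis
  define P' where "P' = (\<lambda>p. (E p (fst p), E p (snd p))) ` P"
  show ?thesis
  proof (rule pwI)
  show "bij (iv f)" by (simp add: assms bij_imp_bij_inv pw_bij)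
  show "iv f t = t" if "t \<notin> {0..<l}" for t using pw_out[OF assms that] assms by (metis pw_iv(2))
  show "finite P'" "P' \<subseteq> \<Gamma> \<times> \<Gamma>" using P(1,2) E(1) aff_mem unfolding P'_def by force+
  show "{0..<l} \<subseteq> (\<Union>p\<in>P'. {fst p..<snd p})"
  proof
    fix y assume y: "y \<in> {0..<l}"
    then have "iv f y \<in> {0..<l}" using pw_mem_iff[OF assms, of "iv f y"] assms by simp
    then obtain p where p: "p \<in> P" "iv f y \<in> {fst p..<snd p}" using P(3) by force
    then have "y = E p (iv f y)" using E(2)[OF p] assms by simp
    then have "y \<in> {E p (fst p)..<E p (snd p)}"
      using p E(1)[OF p(1)] aff_image[OF E(1)[OF p(1)], of "fst p" "snd p"] by (metis imageI)
    then show "y \<in> (\<Union>p\<in>P'. {fst p..<snd p})" using p(1) unfolding P'_def by auto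
  qed
  show "\<exists>e\<in>aff. \<forall>t\<in>{fst p'..<snd p'}. iv f t = e t" if p': "p' \<in> P'" for p'
  proof -
    obtain p where p: "p \<in> P" "fst p' = E p (fst p)" "snd p' = E p (snd p)" using p' unfolding P'_def by auto
    have "iv f t = iv (E p) t" if t: "t \<in> {fst p'..<snd p'}" for t
    proof -
      obtain s where s: "s \<in> {fst p..<snd p}" "t = E p s"
        using t p(2,3) aff_image[OF E(1)[OF p(1)], of "fst p" "snd p"] by (metis imageE)
      then show ?thesis using E(2)[OF p(1) s(1)] E(1)[OF p(1)] assms by (metis pw_iv(2) aff_iv_simps(2))
    qed
    then show ?thesis using aff_iv[OF E(1)[OF p(1)]] by (intro bexI[of _ "iv (E p)"]) simp_all
  qed
  qed
qed

section \<open>The group of piecewise affine bijections and its subgroups\<close>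

definition PG :: "(real \<Rightarrow> real) monoid" where
  "PG = \<lparr>carrier = pw, monoid.mult = (\<circ>), one = id\<rparr>"

lemma PG_simps [simp]: "carrier PG = pw" "x \<otimes>\<^bsub>PG\<^esub> y = x \<circ> y" "\<one>\<^bsub>PG\<^esub> = id"
  by (simp_all add: PG_def)

lemma iv_comp: "f \<in> pw \<Longrightarrow> iv f \<circ> f = id" "f \<in> pw \<Longrightarrow> f \<circ> iv f = id"
  by auto

lemma group_PG: "group PG"
proof (rule groupI)
  show "\<exists>y\<in>carrier PG. y \<otimes>\<^bsub>PG\<^esub> x = \<one>\<^bsub>PG\<^esub>" if "x \<in> carrier PG" for x
    using that iv_comp pw_inverse by (intro bexI[of _ "iv x"]) auto
qed (simp_all add: pw_comp pw_id comp_assoc)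

lemma PG_inv [simp]: "f \<in> pw \<Longrightarrow> inv\<^bsub>PG\<^esub> f = iv f"
  using group.inv_equality[OF group_PG, of "iv f" f] pw_inverse iv_comp by simp

lemma sg_pw: "subgroup H PG \<Longrightarrow> f \<in> H \<Longrightarrow> f \<in> pw"
  using subgroup.subset by force

lemma sg_comp: "subgroup H PG \<Longrightarrow> f \<in> H \<Longrightarrow> g \<in> H \<Longrightarrow> f \<circ> g \<in> H"
  using subgroup.m_closed by fastforce

lemma sg_iv: "subgroup H PG \<Longrightarrow> f \<in> H \<Longrightarrow> iv f \<in> H"
  using subgroup.m_inv_closed sg_pw PG_inv by metis

lemma sg_id: "subgroup H PG \<Longrightarrow> id \<in> H"
  using subgroup.one_closed by fastforce

lemma sg_conj: "subgroup H PG \<Longrightarrow> f \<in> H \<Longrightarrow> g \<in> H \<Longrightarrow> f \<circ> g \<circ> iv f \<in> H"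
  by (intro sg_comp sg_iv)

lemma sgI:
  assumes "H \<subseteq> pw" "id \<in> H" "\<And>f g. f \<in> H \<Longrightarrow> g \<in> H \<Longrightarrow> f \<circ> g \<in> H" "\<And>f. f \<in> H \<Longrightarrow> iv f \<in> H"
  shows "subgroup H PG"
  using assms by (intro group.subgroupI[OF group_PG]) auto

lemma pw_loc:
  assumes "f \<in> pw" "e \<in> aff"
  shows "loc t (\<lambda>u v. \<exists>e'\<in>aff. \<forall>s\<in>{u..<v}. f (e s) = e' s)"
proof -
  obtain Q where Q: "finite Q" "Q \<subseteq> \<Gamma>"
    "\<And>u v. u < v \<Longrightarrow> {u<..<v} \<inter> Q = {} \<Longrightarrow> \<exists>e\<in>aff. \<forall>t\<in>{u..<v}. f t = e t"
    using pw_cuts[OF assms(1)] by metis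
  have "finite (iv e ` Q)" "iv e ` Q \<subseteq> \<Gamma>" using Q aff_iv[OF assms(2)] by auto
  then show ?thesis
  proof (rule loc_mono[OF loc_avoid])
    fix u v assume uv: "u < v" "{u<..<v} \<inter> iv e ` Q = {}"
    have "{e u<..<e v} \<inter> Q = {}"
    proof (rule ccontr)
      assume "{e u<..<e v} \<inter> Q \<noteq> {}"
      then obtain q where q: "q \<in> Q" "e u < q" "q < e v" by auto
      then have "u < iv e q" "iv e q < v"
        using assms(2) aff_less_iff[OF assms(2), of u "iv e q"] aff_less_iff[OF assms(2), of "iv e q" v] by auto
      then show False using uv q by auto
    qed
    then obtain e' where e': "e' \<in> aff" "\<forall>t\<in>{e u..<e v}. f t = e' t"
      using Q(3)[of "e u" "e v"] uv assms by auto
    then have "\<forall>s\<in>{u..<v}. f (e s) = (e' \<circ> e) s" using assms by auto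
    then show "\<exists>e'\<in>aff. \<forall>s\<in>{u..<v}. f (e s) = e' s" using aff_comp[OF e'(1) assms(2)] by blast
  qed
qed

section \<open>Three-cycles of intervals with affine maps\<close>

inductive_set cycs :: "real set \<Rightarrow> (real \<Rightarrow> real) set" for U where
  cycsI: "\<lbrakk>u \<in> \<Gamma>; v \<in> \<Gamma>; u < v; a \<in> aff; b \<in> aff; c \<in> aff; tri {u..<v} a b c;
    a ` {u..<v} \<subseteq> U; b ` {u..<v} \<subseteq> U; c ` {u..<v} \<subseteq> U\<rbrakk> \<Longrightarrow> cyc {u..<v} a b c \<in> cycs U"

lemma cycs_mono:
  assumes "U \<subseteq> V"
  shows "cycs U \<subseteq> cycs V"
proof
  fix z assume "z \<in> cycs U"
  then show "z \<in> cycs V"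
    by cases (simp only:, intro cycsI order_trans[OF _ assms])
qed

lemma cycs_pw:
  assumes "U \<subseteq> {0..<l}"
  shows "cycs U \<subseteq> pw"
proof
  fix z assume "z \<in> cycs U"
  then obtain u v a b c where z: "z = cyc {u..<v} a b c" and uv: "u \<in> \<Gamma>" "v \<in> \<Gamma>" "u < v"
    and abc: "a \<in> aff" "b \<in> aff" "c \<in> aff" and t: "tri {u..<v} a b c"
    and im: "a ` {u..<v} \<subseteq> U" "b ` {u..<v} \<subseteq> U" "c ` {u..<v} \<subseteq> U"
    by (rule cycs.cases)
  define Q where "Q = {a u, a v, b u, b v, c u, c v}"
  show "z \<in> pw"
  proof (rule pw_cutsI[of _ Q])
    show "bij z" using z t bij_cyc by blast
    show "z t = t" if "t \<notin> {0..<l}" for t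
      unfolding z using that im assms by (intro cyc_out) blast
    show "finite Q" "Q \<subseteq> \<Gamma>" unfolding Q_def using uv abc by auto
    fix p q :: real assume pq: "p < q" "{p<..<q} \<inter> Q = {}"
    have sub: "{p..<q} \<subseteq> e ` {u..<v}" if "e \<in> {a,b,c}" "p \<in> e ` {u..<v}" for e
    proof -
      have e: "e \<in> aff" using that abc by auto
      have "e v \<in> Q" using that unfolding Q_def by auto
      then have "q \<le> e v" using that pq uv e by (auto simp: aff_image disjoint_iff not_less)
      then show ?thesis using that e by (auto simp: aff_image)
    qed
    have app: "\<forall>s\<in>{p..<q}. z s = (e' \<circ> iv e) s"
      if ee: "(e, e') \<in> {(a,b),(b,c),(c,a)}" and pe: "p \<in> e ` {u..<v}" for e e'
    proof
      fix s assume s: "s \<in> {p..<q}"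
      have e: "e \<in> {a,b,c}" using ee by auto
      have "s \<in> e ` {u..<v}" using subsetD[OF sub[OF e pe] s] .
      then obtain r where r: "r \<in> {u..<v}" "s = e r" by (rule imageE) (rule that)
      have "e \<in> aff" using e abc by auto
      then show "z s = (e' \<circ> iv e) s" using ee r cyc_app[OF t r(1)] unfolding z by auto
    qed
    show "\<exists>e\<in>aff. \<forall>t\<in>{p..<q}. z t = e t"
    proof (cases "p \<in> a ` {u..<v} \<union> b ` {u..<v} \<union> c ` {u..<v}")
      case True
      then obtain e e' where "(e, e') \<in> {(a,b),(b,c),(c,a)}" "p \<in> e ` {u..<v}" by auto
      moreover from this have "e' \<circ> iv e \<in> aff" using abc aff_iv aff_comp by auto
      ultimately show ?thesis using app by blast
    next
      case False
      have out: "s \<notin> e ` {u..<v}" if "e \<in> {a,b,c}" "s \<in> {p..<q}" for e s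
      proof
        assume s: "s \<in> e ` {u..<v}"
        have e: "e \<in> aff" using that abc by auto
        have "p < e u" using False s that e by (auto simp: aff_image)
        moreover have "e u < q" using s that e by (auto simp: aff_image)
        moreover have "e u \<in> Q" using that unfolding Q_def by auto
        ultimately show False using pq by auto
      qed
      have "\<forall>t\<in>{p..<q}. z t = id t" unfolding z
        using out[of a] out[of b] out[of c] by (intro ballI) (simp add: cyc_out)
      then show ?thesis using aff_id by blast
    qed
  qed
qed

text \<open>By \<open>cyc_union\<close>, membership in \<open>H\<close> adds up along adjacent base
  intervals, so \<open>loc_imp_all\<close> allows the base to be cut as finely as needed.\<close>

lemma cyc_cut:
  assumes H: "subgroup H PG" and pq: "p \<in> \<Gamma>" "q \<in> \<Gamma>" "p < q" and t: "tri {p..<q} a b c"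
    and loc: "\<And>t. p \<le> t \<Longrightarrow> t \<le> q \<Longrightarrow> loc t (\<lambda>u v. p \<le> u \<longrightarrow> v \<le> q \<longrightarrow> cyc {u..<v} a b c \<in> H)"
  shows "cyc {p..<q} a b c \<in> H"
proof (rule loc_imp_all[where P = "\<lambda>u v. cyc {u..<v} a b c \<in> H", OF pq])
  fix u v w assume uvw: "p \<le> u" "u < v" "v < w" "w \<le> q"
    and in_H: "cyc {u..<v} a b c \<in> H" "cyc {v..<w} a b c \<in> H"
  have "{u..<w} = {u..<v} \<union> {v..<w}" "{u..<v} \<inter> {v..<w} = {}" using uvw by auto
  moreover have "tri {u..<w} a b c" using t uvw by (elim tri_subset) auto
  ultimately have "cyc {u..<w} a b c = cyc {u..<v} a b c \<circ> cyc {v..<w} a b c"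
    using cyc_union[of "{u..<v}" "{v..<w}" a b c] by simp
  then show "cyc {u..<w} a b c \<in> H" using sg_comp[OF H in_H] by simp
qed (use loc in auto)

text \<open>The conjugate is again a three-cycle by \<open>cyc_conj\<close>, but its maps such as
  \<open>g \<circ> a\<close> are only piecewise affine. The base is cut until they are
  affine.\<close>

lemma conj_cycs:
  assumes H: "subgroup H PG" and g: "g \<in> pw" and z: "z \<in> cycs U" and sub: "cycs (g ` U) \<subseteq> H"
  shows "g \<circ> z \<circ> iv g \<in> H"
proof -
  obtain p q a b c where z: "z = cyc {p..<q} a b c" and pq: "p \<in> \<Gamma>" "q \<in> \<Gamma>" "p < q"
    and abc: "a \<in> aff" "b \<in> aff" "c \<in> aff" and t: "tri {p..<q} a b c"
    and im: "a ` {p..<q} \<subseteq> U" "b ` {p..<q} \<subseteq> U" "c ` {p..<q} \<subseteq> U"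
    using z by (rule cycs.cases)
  have tg: "tri {p..<q} (g \<circ> a) (g \<circ> b) (g \<circ> c)" using tri_comp bij_is_inj pw_bij g t by blast
  have "cyc {p..<q} (g \<circ> a) (g \<circ> b) (g \<circ> c) \<in> H"
  proof (rule cyc_cut[OF H pq tg])
    fix t
    show "loc t (\<lambda>u v. p \<le> u \<longrightarrow> v \<le> q \<longrightarrow> cyc {u..<v} (g \<circ> a) (g \<circ> b) (g \<circ> c) \<in> H)"
    proof (rule loc_mono[OF loc_conj[OF pw_loc[OF g abc(1)] loc_conj[OF pw_loc[OF g abc(2)] pw_loc[OF g abc(3)]]]], intro impI)
      fix u v assume uv: "u \<in> \<Gamma>" "v \<in> \<Gamma>" "u < v" "p \<le> u" "v \<le> q"
        and ex: "(\<exists>e'\<in>aff. \<forall>s\<in>{u..<v}. g (a s) = e' s) \<and> (\<exists>e'\<in>aff. \<forall>s\<in>{u..<v}. g (b s) = e' s) \<and>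
          (\<exists>e'\<in>aff. \<forall>s\<in>{u..<v}. g (c s) = e' s)"
      then obtain a' b' c' where e: "a' \<in> aff" "b' \<in> aff" "c' \<in> aff"
        "\<And>s. s \<in> {u..<v} \<Longrightarrow> (g \<circ> a) s = a' s" "\<And>s. s \<in> {u..<v} \<Longrightarrow> (g \<circ> b) s = b' s"
        "\<And>s. s \<in> {u..<v} \<Longrightarrow> (g \<circ> c) s = c' s" by auto
      have sub': "{u..<v} \<subseteq> {p..<q}" using uv by auto
      have t': "tri {u..<v} (g \<circ> a) (g \<circ> b) (g \<circ> c)" using tri_subset[OF tg sub'] .
      have "cyc {u..<v} (g \<circ> a) (g \<circ> b) (g \<circ> c) = cyc {u..<v} a' b' c'"
        by (rule cyc_cong[OF t' e(4-6)])
      moreover have "cyc {u..<v} a' b' c' \<in> cycs (g ` U)"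
      proof (rule cycsI[OF uv(1-3) e(1-3)])
        show "tri {u..<v} a' b' c'"
        proof -
          have "tri {u..<v} (g \<circ> a) (g \<circ> b) (g \<circ> c) \<longleftrightarrow> tri {u..<v} a' b' c'"
            by (rule tri_cong) (simp_all only: e(4-6))
          then show ?thesis using t' by simp
        qed
        have "a' ` {u..<v} = g ` a ` {u..<v}" "b' ` {u..<v} = g ` b ` {u..<v}" "c' ` {u..<v} = g ` c ` {u..<v}"
          unfolding image_comp by (rule image_cong, simp, simp only: e(4-6))+
        then show "a' ` {u..<v} \<subseteq> g ` U" "b' ` {u..<v} \<subseteq> g ` U" "c' ` {u..<v} \<subseteq> g ` U"
          using image_mono[OF order_trans[OF image_mono[OF sub'] im(1)], of g]
            image_mono[OF order_trans[OF image_mono[OF sub'] im(2)], of g]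
            image_mono[OF order_trans[OF image_mono[OF sub'] im(3)], of g]
          by simp_all
      qed
      ultimately show "cyc {u..<v} (g \<circ> a) (g \<circ> b) (g \<circ> c) \<in> H" using sub by auto
    qed
  qed
  then show ?thesis unfolding z using cyc_conj[OF pw_bij[OF g] t] by simp
qed

text \<open>Conjugation by \<open>iv h\<close> carries a three-cycle in the image of
  \<open>U\<close> back to \<open>U\<close>, hence into \<open>H\<close>; since \<open>h\<close>
  itself lies in \<open>H\<close>, the conjugation can be undone there.\<close>

lemma conj_cycs_mem:
  assumes "subgroup H PG" "h \<in> H" "cycs U \<subseteq> H" "U \<subseteq> {0..<l}"
  shows "cycs (h ` U) \<subseteq> H"
proof
  fix z assume z: "z \<in> cycs (h ` U)"
  have h: "h \<in> pw" using assms sg_pw by blast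
  have "iv h ` h ` U = U" using h by (simp add: image_comp iv_comp)
  then have "iv h \<circ> z \<circ> iv (iv h) \<in> H"
    using conj_cycs[OF assms(1) pw_inverse[OF h] z] assms by simp
  then have "h \<circ> (iv h \<circ> z \<circ> iv (iv h)) \<circ> iv h \<in> H" using assms sg_conj by blast
  moreover have "iv (iv h) = h" using h by (simp add: inv_inv_eq pw_bij)
  moreover have "h \<circ> (iv h \<circ> z \<circ> h) \<circ> iv h = z" using h by (auto simp: fun_eq_iff)
  ultimately show "z \<in> H" by simp
qed

lemma cyc_swap_mem:
  assumes "subgroup H PG" "tri B a b c" "cyc B a b c \<in> H"
  shows "cyc B a c b \<in> H"
  using sg_iv[OF assms(1,3)] inv_cyc[OF assms(2)] by simp

lemma cyc_rot_mem:
  assumes "tri B a b c" "cyc B a b c \<in> H"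
  shows "cyc B b c a \<in> H" "cyc B c a b \<in> H"
  using assms cyc_rot[OF assms(1)] cyc_rot[OF tri_rot[OF assms(1)]] by auto

lemma dis5I:
  assumes "tri B a b c" "tri B a d e" "tri B b d e" "tri B c d e"
  shows "dis5 B a b c d e"
  using assms unfolding dis5_def by blast

lemma cyc_conj_mem:
  assumes H: "subgroup H PG" "x \<in> H" and abc: "tri B a b c" "cyc B a b c \<in> H"
    and eq: "\<And>t. t \<in> B \<Longrightarrow> x (a t) = a' t" "\<And>t. t \<in> B \<Longrightarrow> x (b t) = b' t" "\<And>t. t \<in> B \<Longrightarrow> x (c t) = c' t"
  shows "cyc B a' b' c' \<in> H"
proof -
  have bx: "bij x" using sg_pw[OF H] pw_bij by blast
  have "cyc B (x \<circ> a) (x \<circ> b) (x \<circ> c) = cyc B a' b' c'"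
    by (rule cyc_cong[OF tri_comp[OF bij_is_inj[OF bx] abc(1)]]) (use eq in auto)
  then show ?thesis using sg_conj[OF H abc(2)] cyc_conj[OF bx abc(1)] by simp
qed

text \<open>Conjugating (a d e) by (b d e) gives (a e b), and conjugating that by (c d e) gives (a c
  b). So only three-cycles through two fixed spare sets \<open>d\<close> and \<open>e\<close> have
  to be found.\<close>

lemma cyc_join:
  assumes H: "subgroup H PG" and d5: "dis5 B a b c d e"
    and in_H: "cyc B a d e \<in> H" "cyc B b d e \<in> H" "cyc B c d e \<in> H"
  shows "cyc B a b c \<in> H"
proof -
  note t = dis5_tri[OF d5]
  have dis: "a ` B \<inter> b ` B = {}" "a ` B \<inter> c ` B = {}" "a ` B \<inter> d ` B = {}" "a ` B \<inter> e ` B = {}"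
    "b ` B \<inter> c ` B = {}" "b ` B \<inter> d ` B = {}" "b ` B \<inter> e ` B = {}"
    using t(1) t(6) t(9) unfolding tri_def by simp_all
  have 1: "cyc B a e b \<in> H"
  proof (rule cyc_conj_mem[OF H in_H(2) t(6) in_H(1)])
    fix s assume s: "s \<in> B"
    show "cyc B b d e (a s) = a s" by (rule cyc_fix) (use dis s in simp_all)
  qed (simp_all add: cyc_app[OF t(9)])
  have "cyc B a c b \<in> H"
  proof (rule cyc_conj_mem[OF H in_H(3) tri_swap[OF t(3)] 1])
    fix s assume s: "s \<in> B"
    show "cyc B c d e (a s) = a s" by (rule cyc_fix) (use dis s in simp_all)
    show "cyc B c d e (b s) = b s" by (rule cyc_fix) (use dis s in simp_all)
  qed (simp_all add: cyc_app[OF t(10)])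
  then show ?thesis using cyc_swap_mem[OF H tri_swap[OF t(1)]] by simp
qed

end

subsection \<open>The subgroup generated by three-cycles\<close>

lemma commute_if_disjoint:
  assumes "inj f" "inj g" "\<And>t. t \<notin> S \<Longrightarrow> f t = t" "\<And>t. t \<notin> S' \<Longrightarrow> g t = t" "S \<inter> S' = {}"
  shows "f \<circ> g = g \<circ> f"
proof
  fix t
  have fS: "f t \<in> S" if "t \<in> S" for t
    using that assms(1) assms(3)[of "f t"] by (metis injD)
  have gS: "g t \<in> S'" if "t \<in> S'" for t
    using that assms(2) assms(4)[of "g t"] by (metis injD)
  consider "t \<in> S" "t \<notin> S'" | "t \<in> S'" "t \<notin> S" | "t \<notin> S" "t \<notin> S'" using assms(5) by blast
  then show "(f \<circ> g) t = (g \<circ> f) t"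
  proof cases
    case 1
    then have "f t \<notin> S'" using fS assms(5) by blast
    then show ?thesis using 1 assms(4) by simp
  next
    case 2
    then have "g t \<notin> S" using gS assms(5) by blast
    then show ?thesis using 2 assms(3) by simp
  next
    case 3
    then show ?thesis using assms(3,4) by simp
  qed
qed

context gamma_lambda
begin

text \<open>The earlier copies depend on \<open>u\<close> and \<open>v\<close>, so they cannot be
  added to \<open>E\<close>. Instead the target is halved: they stay in the left half, and the new
  copy is taken from the right half.\<close>

lemma loc_rooms:
  assumes E: "finite E" "E \<subseteq> aff" and "c < d"
  shows "loc t (\<lambda>u v. \<exists>r. (\<forall>i<n::nat. r i \<in> aff \<and> r i ` {u..<v} \<subseteq> {c..<d} \<and>
      (\<forall>e\<in>E. r i ` {u..<v} \<inter> e ` {u..<v} = {})) \<and>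
      (\<forall>i<n. \<forall>j<n. i \<noteq> j \<longrightarrow> r i ` {u..<v} \<inter> r j ` {u..<v} = {}))"
  using \<open>c < d\<close>
proof (induction n arbitrary: c d)
  case 0
  show ?case by (rule loc_mono[OF loc_near[of 1]]) simp_all
next
  case (Suc n)
  define m where "m = (c + d) / 2"
  have m: "c < m" "m < d" using Suc.prems unfolding m_def by simp_all
  show ?case
  proof (rule loc_mono[OF loc_conj[OF Suc.IH[OF m(1)] loc_room[OF E m(2)]]], elim conjE exE bexE)
    fix u v r s
    assume r: "\<forall>i<n. r i \<in> aff \<and> r i ` {u..<v} \<subseteq> {c..<m} \<and> (\<forall>e\<in>E. r i ` {u..<v} \<inter> e ` {u..<v} = {})"
      and rr: "\<forall>i<n. \<forall>j<n. i \<noteq> j \<longrightarrow> r i ` {u..<v} \<inter> r j ` {u..<v} = {}"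
      and s: "s \<in> aff" "s ` {u..<v} \<subseteq> {m..<d}" "\<forall>e\<in>E. s ` {u..<v} \<inter> e ` {u..<v} = {}"
    define r' where "r' = r(n := s)"
    have sub: "{c..<m} \<subseteq> {c..<d}" "{m..<d} \<subseteq> {c..<d}" "{c..<m} \<inter> {m..<d} = {}" using m by auto
    have "r' i \<in> aff \<and> r' i ` {u..<v} \<subseteq> {c..<d} \<and> (\<forall>e\<in>E. r' i ` {u..<v} \<inter> e ` {u..<v} = {})"
      if "i < Suc n" for i
      using that r s sub unfolding r'_def by (cases "i = n") (simp_all add: order_trans[OF _ sub(1)] order_trans[OF _ sub(2)])
    moreover have "r' i ` {u..<v} \<inter> r' j ` {u..<v} = {}" if "i < Suc n" "j < Suc n" "i \<noteq> j" for i j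
    proof -
      have "r i ` {u..<v} \<inter> s ` {u..<v} = {}" if "i < n" for i
        using r s(2) sub(3) that by blast
      then show ?thesis
        using that rr unfolding r'_def by (cases "i = n"; cases "j = n") (simp_all add: Int_commute)
    qed
    ultimately show "\<exists>r. (\<forall>i<Suc n. r i \<in> aff \<and> r i ` {u..<v} \<subseteq> {c..<d} \<and>
        (\<forall>e\<in>E. r i ` {u..<v} \<inter> e ` {u..<v} = {})) \<and>
        (\<forall>i<Suc n. \<forall>j<Suc n. i \<noteq> j \<longrightarrow> r i ` {u..<v} \<inter> r j ` {u..<v} = {})"
      by (intro exI[of _ r']) simp
  qed
qed

lemma loc_ex:
  assumes "loc t P" "t < q"
  obtains u v where "u \<in> \<Gamma>" "v \<in> \<Gamma>" "t < u" "u < v" "v < q" "P u v"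
proof -
  obtain \<delta> where \<delta>: "\<delta> > 0" "\<And>u v. u \<in> \<Gamma> \<Longrightarrow> v \<in> \<Gamma> \<Longrightarrow> t - \<delta> < u \<Longrightarrow> u < v \<Longrightarrow> v < t + \<delta> \<Longrightarrow>
      (t \<in> \<Gamma> \<longrightarrow> \<not> (u < t \<and> t < v)) \<Longrightarrow> P u v"
    using assms(1) unfolding loc_def by metis
  obtain v where v: "v \<in> \<Gamma>" "t < v" "v < min q (t + \<delta>)" using dense_mem[of t "min q (t + \<delta>)"] \<delta> assms by auto
  obtain u where u: "u \<in> \<Gamma>" "t < u" "u < v" using dense_mem[OF v(2)] by auto
  show thesis by (rule that[OF u(1) v(1) u(2,3)]) (use u v \<delta> in auto)
qed

lemma tri_aff: "a \<in> aff \<Longrightarrow> b \<in> aff \<Longrightarrow> c \<in> aff \<Longrightarrow> tri B a b c \<longleftrightarrow>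
    a ` B \<inter> b ` B = {} \<and> a ` B \<inter> c ` B = {} \<and> b ` B \<inter> c ` B = {}"
  unfolding tri_def by (simp add: aff_inj)

end

context stein
begin

abbreviation comm :: "(real \<Rightarrow> real) \<Rightarrow> (real \<Rightarrow> real) \<Rightarrow> real \<Rightarrow> real" where
  "comm f g \<equiv> f \<circ> g \<circ> iv f \<circ> iv g"

text \<open>The analogue of an infinite alternating group. By \<open>derived_PG\<close> it is the
  derived subgroup.\<close>

definition alt :: "(real \<Rightarrow> real) set" where
  "alt = generate PG (cycs {0..<l})"

lemma alt_sg: "subgroup alt PG"
  unfolding alt_def using cycs_pw by (intro group.generate_is_subgroup[OF group_PG]) simp

lemma alt_le: "subgroup H PG \<Longrightarrow> cycs {0..<l} \<subseteq> H \<Longrightarrow> alt \<subseteq> H"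
  unfolding alt_def by (intro group.generate_subgroup_incl[OF group_PG])

lemma cycs_alt: "cycs {0..<l} \<subseteq> alt"
  unfolding alt_def by (auto intro: generate.incl)

lemma cycs_alt': "U \<subseteq> {0..<l} \<Longrightarrow> z \<in> cycs U \<Longrightarrow> z \<in> alt"
  using cycs_alt cycs_mono by blast

lemma iv_simps [simp]: "f \<in> pw \<Longrightarrow> g \<in> pw \<Longrightarrow> iv (f \<circ> g) = iv g \<circ> iv f" "f \<in> pw \<Longrightarrow> iv (iv f) = f"
  by (simp_all add: o_inv_distrib inv_inv_eq pw_bij)

lemma alt_normal:
  assumes g: "g \<in> pw" and f: "f \<in> alt"
  shows "g \<circ> f \<circ> iv g \<in> alt"
proof -
  let ?H = "{f \<in> pw. g \<circ> f \<circ> iv g \<in> alt}"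
  have "subgroup ?H PG"
  proof (rule sgI)
    show "id \<in> ?H" using g sg_id[OF alt_sg] by (simp add: iv_comp pw_id)
    fix f f' assume f: "f \<in> ?H" "f' \<in> ?H"
    have "g \<circ> (f \<circ> f') \<circ> iv g = (g \<circ> f \<circ> iv g) \<circ> (g \<circ> f' \<circ> iv g)" using g by (simp add: fun_eq_iff)
    then show "f \<circ> f' \<in> ?H" using f pw_comp sg_comp[OF alt_sg] by simp
  next
    fix f assume f: "f \<in> ?H"
    then have "g \<circ> iv f \<circ> iv g = iv (g \<circ> f \<circ> iv g)" using g by (simp add: pw_comp pw_inverse comp_assoc)
    then show "iv f \<in> ?H" using f pw_inverse sg_iv[OF alt_sg] by simp
  qed auto
  moreover have "cycs {0..<l} \<subseteq> ?H"
    using conj_cycs[OF alt_sg g] cycs_alt cycs_pw[OF order_refl] pw_image[OF g] by auto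
  ultimately show ?thesis using alt_le f by blast
qed

lemma cycs_le:
  assumes H: "subgroup H PG"
    and loc: "\<And>a b c t. a \<in> aff \<Longrightarrow> b \<in> aff \<Longrightarrow> c \<in> aff \<Longrightarrow>
      loc t (\<lambda>u v. tri {u..<v} a b c \<longrightarrow> a ` {u..<v} \<union> b ` {u..<v} \<union> c ` {u..<v} \<subseteq> U \<longrightarrow> cyc {u..<v} a b c \<in> H)"
  shows "cycs U \<subseteq> H"
proof
  fix z assume "z \<in> cycs U"
  then show "z \<in> H"
  proof cases
    case (cycsI p q a b c)
    have "cyc {p..<q} a b c \<in> H"
    proof (rule cyc_cut[OF H cycsI(2-4) cycsI(8)], rule loc_mono[OF loc[OF cycsI(5-7)]], intro impI)
      fix u v assume uv: "p \<le> u" "v \<le> q"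
        and imp: "tri {u..<v} a b c \<longrightarrow> a ` {u..<v} \<union> b ` {u..<v} \<union> c ` {u..<v} \<subseteq> U \<longrightarrow> cyc {u..<v} a b c \<in> H"
      have sub: "{u..<v} \<subseteq> {p..<q}" using uv by auto
      have "e ` {u..<v} \<subseteq> e ` {p..<q}" for e :: "real \<Rightarrow> real" using sub by (rule image_mono)
      then have "a ` {u..<v} \<union> b ` {u..<v} \<union> c ` {u..<v} \<subseteq> U" using cycsI(9-11) by (meson Un_least order_trans)
      then show "cyc {u..<v} a b c \<in> H" using imp tri_subset[OF cycsI(8) sub] by simp
    qed
    then show ?thesis using cycsI(1) by simp
  qed
qed

text \<open>(a b c) = [(a b d), (a c e)] with two spare copies \<open>d\<close> and \<open>e\<close>
  of the base. For short base intervals there is room for these copies inside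
  \<open>U\<close>.\<close>

lemma small_commutator:
  assumes abc: "a \<in> aff" "b \<in> aff" "c \<in> aff" and cd: "p < q" "{p..<q} \<subseteq> U"
  shows "loc t (\<lambda>u v. tri {u..<v} a b c \<longrightarrow> a ` {u..<v} \<union> b ` {u..<v} \<union> c ` {u..<v} \<subseteq> U \<longrightarrow>
    (\<exists>x\<in>cycs U. \<exists>y\<in>cycs U. cyc {u..<v} a b c = comm x y))"
proof (rule loc_mono[OF loc_rooms[of "{a, b, c}" p q t 2]])
  fix u v assume uv: "u \<in> \<Gamma>" "v \<in> \<Gamma>" "u < v"
    and ex: "\<exists>r. (\<forall>i<2::nat. r i \<in> aff \<and> r i ` {u..<v} \<subseteq> {p..<q} \<and>
      (\<forall>e\<in>{a,b,c}. r i ` {u..<v} \<inter> e ` {u..<v} = {})) \<and>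
      (\<forall>i<2. \<forall>j<2. i \<noteq> j \<longrightarrow> r i ` {u..<v} \<inter> r j ` {u..<v} = {})"
  let ?B = "{u..<v}"
  show "tri ?B a b c \<longrightarrow> a ` ?B \<union> b ` ?B \<union> c ` ?B \<subseteq> U \<longrightarrow>
    (\<exists>x\<in>cycs U. \<exists>y\<in>cycs U. cyc ?B a b c = comm x y)"
  proof (intro impI)
    assume t: "tri ?B a b c" and im: "a ` ?B \<union> b ` ?B \<union> c ` ?B \<subseteq> U"
    obtain r :: "nat \<Rightarrow> real \<Rightarrow> real" where r: "\<And>i. i < 2 \<Longrightarrow> r i \<in> aff" "\<And>i. i < 2 \<Longrightarrow> r i ` ?B \<subseteq> {p..<q}"
      "\<And>i e. i < 2 \<Longrightarrow> e \<in> {a,b,c} \<Longrightarrow> r i ` ?B \<inter> e ` ?B = {}"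
      "\<And>i j. i < 2 \<Longrightarrow> j < 2 \<Longrightarrow> i \<noteq> j \<Longrightarrow> r i ` ?B \<inter> r j ` ?B = {}"
      using ex by metis
    define d e where "d = r 0" and "e = r 1"
    have de: "d \<in> aff" "e \<in> aff" "d ` ?B \<subseteq> U" "e ` ?B \<subseteq> U"
      using r(1,2)[of 0] r(1,2)[of 1] cd(2) unfolding d_def e_def by auto
    have dis: "a ` ?B \<inter> b ` ?B = {}" "a ` ?B \<inter> c ` ?B = {}" "b ` ?B \<inter> c ` ?B = {}"
      "a ` ?B \<inter> d ` ?B = {}" "b ` ?B \<inter> d ` ?B = {}" "c ` ?B \<inter> d ` ?B = {}"
      "a ` ?B \<inter> e ` ?B = {}" "b ` ?B \<inter> e ` ?B = {}" "c ` ?B \<inter> e ` ?B = {}" "d ` ?B \<inter> e ` ?B = {}"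
      using r(3)[of 0 a] r(3)[of 0 b] r(3)[of 0 c] r(3)[of 1 a] r(3)[of 1 b] r(3)[of 1 c] r(4)[of 0 1]
        t unfolding d_def e_def tri_def by (simp_all add: Int_commute)
    have t1: "tri ?B a b d" and t2: "tri ?B a c e"
      using abc de dis by (simp_all add: tri_aff)
    have "comm (cyc ?B a b d) (cyc ?B a c e) = cyc (?B \<inter> ?B) a b c"
    proof (rule cyc_commutator[OF t1 t2 aff_inj[OF abc(1)]])
      show "(a ` ?B \<union> b ` ?B \<union> d ` ?B) \<inter> (c ` ?B \<union> e ` ?B) = {}"
        "(b ` ?B \<union> d ` ?B) \<inter> a ` ?B = {}"
        using dis by (simp_all add: Int_Un_distrib Int_Un_distrib2 Int_commute)
    qed
    moreover have "cyc ?B a b d \<in> cycs U" "cyc ?B a c e \<in> cycs U"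
      using uv abc de im t1 t2 by (auto intro!: cycsI simp del: atLeastLessThan_iff)
    ultimately show "\<exists>x\<in>cycs U. \<exists>y\<in>cycs U. cyc ?B a b c = comm x y" by (metis Int_absorb)
  qed
qed (use abc cd in auto)

lemma moved_interval:
  assumes f: "f \<in> pw" "f \<noteq> id"
  obtains p q e where "p \<in> \<Gamma>" "q \<in> \<Gamma>" "0 < p" "p < q" "q < l" "e \<in> aff" "\<And>t. t \<in> {p..<q} \<Longrightarrow> f t = e t"
    "e ` {p..<q} \<inter> {p..<q} = {}"
proof -
  obtain t where t: "f t \<noteq> t" using f(2) by (auto simp: fun_eq_iff)
  then have tX: "0 \<le> t" "t < l" using pw_out[OF f(1), of t] by auto
  obtain Q where Q: "finite Q" "Q \<subseteq> \<Gamma>"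
    "\<And>u v. u < v \<Longrightarrow> {u<..<v} \<inter> Q = {} \<Longrightarrow> \<exists>e\<in>aff. \<forall>t\<in>{u..<v}. f t = e t"
    using pw_cuts[OF f(1)] by metis
  obtain d where d: "d > 0" "\<forall>x\<in>Q. x \<noteq> t \<longrightarrow> d \<le> dist t x"
    using finite_set_avoid[OF Q(1)] by blast
  have "{t<..<t + d} \<inter> Q = {}" using d by (force simp: dist_real_def)
  then obtain e where e: "e \<in> aff" "\<forall>s\<in>{t..<t + d}. f s = e s" using Q(3)[of t "t + d"] d by auto
  have et: "e t \<noteq> t" using e t d(1) by auto
  \<comment> \<open>\<open>m\<close> bounds \<open>q\<close> so that the image of the interval lies
    entirely on one side of it: if \<open>t < e t\<close>, then \<open>q < e t\<close>; otherwise
    \<open>e q < t\<close>.\<close>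
  define m where "m = (if t < e t then e t else iv e t)"
  have "t < m"
    unfolding m_def using et e(1) aff_less_iff[OF e(1), of t "iv e t"] by auto
  then obtain q where q: "q \<in> \<Gamma>" "t < q" "q < min m (min l (t + d))"
    using dense_mem[of t "min m (min l (t + d))"] tX d by auto
  obtain p where p: "p \<in> \<Gamma>" "t < p" "p < q" using dense_mem[OF q(2)] by auto
  show thesis
  proof (rule that[OF p(1) q(1) _ p(3) _ e(1)])
    show "0 < p" "q < l" using p q tX by auto
    show "f s = e s" if "s \<in> {p..<q}" for s using that p q e by auto
    show "e ` {p..<q} \<inter> {p..<q} = {}"
    proof (cases "t < e t")
      case True
      then have "q < e t" using q unfolding m_def by simp
      moreover have "e t < e p" using p e(1) by simp
      ultimately show ?thesis unfolding aff_image[OF e(1)] by auto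
    next
      case False
      then have "q < iv e t" using q unfolding m_def by simp
      then have "e q < t" using e(1) aff_less_iff[OF e(1), of q "iv e t"] by simp
      then show ?thesis unfolding aff_image[OF e(1)] using p by auto
    qed
  qed
qed

text \<open>If \<open>x\<close> and \<open>y\<close> are supported in a set \<open>Z\<close> that
  \<alpha> moves off itself, then \<open>c = \<alpha> \<circ> iv x \<circ> iv \<alpha>\<close>
  commutes with \<open>y\<close>, so [x, y] = [x c, y], and x c = [x, \<alpha>] lies in
  \<open>N\<close>. By \<open>small_commutator\<close>, \<open>N\<close> then contains all
  three-cycles in \<open>Z\<close>, and conjugation by elements of \<open>alt\<close> moves these to
  any place.\<close>

lemma alt_le_normal:
  assumes N: "subgroup N PG" and norm: "\<And>f g. f \<in> alt \<Longrightarrow> g \<in> N \<Longrightarrow> f \<circ> g \<circ> iv f \<in> N"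
    and \<alpha>: "\<alpha> \<in> N" "\<alpha> \<noteq> id"
  shows "alt \<subseteq> N"
proof -
  have \<alpha>_pw: "\<alpha> \<in> pw" using \<alpha> N sg_pw by blast
  obtain p q e where pq: "p \<in> \<Gamma>" "q \<in> \<Gamma>" "0 < p" "p < q" "q < l" and e: "e \<in> aff" "\<And>t. t \<in> {p..<q} \<Longrightarrow> \<alpha> t = e t"
    "e ` {p..<q} \<inter> {p..<q} = {}"
    using moved_interval[OF \<alpha>_pw \<alpha>(2)] by metis
  define Z where "Z = {p..<q}"
  have ZX: "Z \<subseteq> {0..<l}" unfolding Z_def using pq by auto
  have \<alpha>Z: "\<alpha> ` Z \<inter> Z = {}" using e unfolding Z_def by (metis image_cong)
  have supp: "x t = t" if "x \<in> cycs Z" "t \<notin> Z" for x t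
    using that by cases (auto intro!: cyc_out simp del: atLeastLessThan_iff)
  have comm_N: "comm x y \<in> N" if x: "x \<in> cycs Z" and y: "y \<in> cycs Z" for x y
  proof -
    have xy: "x \<in> alt" "y \<in> alt" using x y cycs_alt'[OF ZX] by auto
    then have xy_pw: "x \<in> pw" "y \<in> pw" using sg_pw[OF alt_sg] by auto
    define c where "c = \<alpha> \<circ> iv x \<circ> iv \<alpha>"
    have c_pw: "c \<in> pw" unfolding c_def using \<alpha>_pw xy_pw by (intro pw_comp pw_inverse)
    have "c \<circ> y = y \<circ> c"
    proof (rule commute_if_disjoint[OF _ _ _ _ \<alpha>Z])
      show "inj c" "inj y" using c_pw xy_pw pw_bij bij_is_inj by blast+
      show "y t = t" if "t \<notin> Z" for t using supp y that by blast
      show "c t = t" if t: "t \<notin> \<alpha> ` Z" for t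
      proof -
        have "iv \<alpha> t \<notin> Z" using t \<alpha>_pw by (metis imageI pw_iv(1))
        then have "x (iv \<alpha> t) = iv \<alpha> t" using supp x by blast
        then have "iv x (iv \<alpha> t) = iv \<alpha> t" using xy_pw by (metis pw_iv(2))
        then show ?thesis unfolding c_def using \<alpha>_pw by simp
      qed
    qed
    then have cy: "c (y t) = y (c t)" for t by (metis comp_apply)
    have "x \<circ> \<alpha> \<circ> iv x \<circ> iv \<alpha> \<in> N" using norm[OF xy(1) \<alpha>(1)] sg_iv[OF N \<alpha>(1)] sg_comp[OF N] by blast
    then have xc: "x \<circ> c \<in> N" unfolding c_def by (simp add: comp_assoc)
    have "(x \<circ> c) \<circ> (y \<circ> iv (x \<circ> c) \<circ> iv y) \<in> N"
      by (intro sg_comp[OF N xc] norm[OF xy(2)] sg_iv[OF N xc])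
    also have "(x \<circ> c) \<circ> (y \<circ> iv (x \<circ> c) \<circ> iv y) = comm x y"
      using xy_pw c_pw by (simp add: fun_eq_iff cy)
    finally show ?thesis .
  qed
  have ZN: "cycs Z \<subseteq> N"
  proof (rule cycs_le[OF N], rule loc_mono[OF small_commutator[where p = p and q = q]])
    fix a b c u v
    assume *: "tri {u..<v} a b c \<longrightarrow> a ` {u..<v} \<union> b ` {u..<v} \<union> c ` {u..<v} \<subseteq> Z \<longrightarrow>
       (\<exists>x\<in>cycs Z. \<exists>y\<in>cycs Z. cyc {u..<v} a b c = comm x y)"
    show "tri {u..<v} a b c \<longrightarrow> a ` {u..<v} \<union> b ` {u..<v} \<union> c ` {u..<v} \<subseteq> Z \<longrightarrow> cyc {u..<v} a b c \<in> N"
    proof (intro impI)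
      assume "tri {u..<v} a b c" "a ` {u..<v} \<union> b ` {u..<v} \<union> c ` {u..<v} \<subseteq> Z"
      then obtain x y where "x \<in> cycs Z" "y \<in> cycs Z" "cyc {u..<v} a b c = comm x y" using * by meson
      then show "cyc {u..<v} a b c \<in> N" using comm_N by simp
    qed
  qed (use pq Z_def in auto)
  have "cycs {0..<l} \<subseteq> N"
  proof (rule cycs_le[OF N])
    fix a b c t assume abc: "a \<in> aff" "b \<in> aff" "c \<in> aff"
    show "loc t (\<lambda>u v. tri {u..<v} a b c \<longrightarrow> a ` {u..<v} \<union> b ` {u..<v} \<union> c ` {u..<v} \<subseteq> {0..<l} \<longrightarrow>
        cyc {u..<v} a b c \<in> N)"
    \<comment> \<open>Four copies in \<open>Z\<close>: the three-cycle (r 0, r 1, r 2) lies in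
      \<open>N\<close>, and its entries are replaced one at a time by \<open>a\<close>,
      \<open>b\<close>, \<open>c\<close>, conjugating by (r i, e, r 3) with \<open>r 3\<close> as
      spare copy.\<close>
    proof (rule loc_mono[OF loc_rooms[of "{a, b, c}" p q t 4]])
      fix u v assume uv: "u \<in> \<Gamma>" "v \<in> \<Gamma>" "u < v"
        and ex: "\<exists>r. (\<forall>i<4::nat. r i \<in> aff \<and> r i ` {u..<v} \<subseteq> {p..<q} \<and>
          (\<forall>e\<in>{a,b,c}. r i ` {u..<v} \<inter> e ` {u..<v} = {})) \<and>
          (\<forall>i<4. \<forall>j<4. i \<noteq> j \<longrightarrow> r i ` {u..<v} \<inter> r j ` {u..<v} = {})"
      let ?B = "{u..<v}"
      show "tri ?B a b c \<longrightarrow> a ` ?B \<union> b ` ?B \<union> c ` ?B \<subseteq> {0..<l} \<longrightarrow> cyc ?B a b c \<in> N"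
      proof (intro impI)
        assume t: "tri ?B a b c" and im: "a ` ?B \<union> b ` ?B \<union> c ` ?B \<subseteq> {0..<l}"
        obtain r :: "nat \<Rightarrow> real \<Rightarrow> real" where r: "\<And>i. i < 4 \<Longrightarrow> r i \<in> aff" "\<And>i. i < 4 \<Longrightarrow> r i ` ?B \<subseteq> Z"
          "\<And>i e. i < 4 \<Longrightarrow> e \<in> {a,b,c} \<Longrightarrow> r i ` ?B \<inter> e ` ?B = {}"
          "\<And>i j. i < 4 \<Longrightarrow> j < 4 \<Longrightarrow> i \<noteq> j \<Longrightarrow> r i ` ?B \<inter> r j ` ?B = {}"
          using ex unfolding Z_def by metis
        have rX: "r i ` ?B \<subseteq> {0..<l}" if "i < 4" for i using r(2)[OF that] ZX by (rule order_trans)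
        have tr: "tri ?B (r i) e (r 3)" if "i < 3" "e \<in> {a,b,c}" for i e
          using that r(1)[of i] r(1)[of 3] r(3)[of i e] r(3)[of 3 e] r(4)[of i 3] abc
          by (subst tri_aff) (auto simp: Int_commute simp del: atLeastLessThan_iff)
        have alt: "cyc ?B (r i) e (r 3) \<in> alt" if "i < 3" "e \<in> {a,b,c}" for i e
        proof (rule subsetD[OF cycs_alt], rule cycsI[OF uv])
          show "e \<in> aff" "e ` ?B \<subseteq> {0..<l}" using that abc im by auto
        qed (use that tr rX r(1) in auto)
        have step: "cyc ?B a' b' c' \<in> N"
          if n: "cyc ?B x y z \<in> N" "tri ?B x y z" and i: "i < 3" "e \<in> {a,b,c}"
            and eq: "\<And>s. s \<in> ?B \<Longrightarrow> cyc ?B (r i) e (r 3) (x s) = a' s"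
            "\<And>s. s \<in> ?B \<Longrightarrow> cyc ?B (r i) e (r 3) (y s) = b' s" "\<And>s. s \<in> ?B \<Longrightarrow> cyc ?B (r i) e (r 3) (z s) = c' s"
          for x y z a' b' c' i e
        proof -
          let ?x = "cyc ?B (r i) e (r 3)"
          have bx: "bij ?x" using bij_cyc tr[OF i] by blast
          have "cyc ?B (?x \<circ> x) (?x \<circ> y) (?x \<circ> z) = cyc ?B a' b' c'"
            by (rule cyc_cong[OF tri_comp[OF bij_is_inj[OF bx] n(2)]]) (use eq in auto)
          then show ?thesis using norm[OF alt[OF i] n(1)] cyc_conj[OF bx n(2)] by simp
        qed
        have t0: "tri ?B (r 0) (r 1) (r 2)" using r(1,4) by (simp add: tri_aff)
        have 0: "cyc ?B (r 0) (r 1) (r 2) \<in> N"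
          by (rule subsetD[OF ZN], rule cycsI[OF uv _ _ _ t0]) (use r in simp_all)
        have t1: "tri ?B a (r 1) (r 2)" using r(1,4) r(3)[of _ a] abc by (simp add: tri_aff Int_commute)
        have t2: "tri ?B a b (r 2)" using r(3)[of 2 a] r(3)[of 2 b] r(1)[of 2] t abc by (simp add: tri_aff Int_commute)
        have to_e: "cyc ?B (r i) e (r 3) (r i s) = e s" if "s \<in> ?B" "i < 3" "e \<in> {a,b,c}" for i e s
          by (rule cyc_app(1)[OF tr[OF that(2,3)] that(1)])
        have fix_r: "cyc ?B (r i) e (r 3) (r j s) = r j s"
          if "s \<in> ?B" "i < 3" "j < 3" "i \<noteq> j" "e \<in> {a,b,c}" for i j e s
          by (rule cyc_fix[OF r(4) r(3)[OF _ that(5)] r(4) that(1)]) (use that in simp_all)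
        have fix_e: "cyc ?B (r i) e (r 3) (f s) = f s"
          if "s \<in> ?B" "i < 3" "e \<in> {a,b,c}" "f \<in> {a,b,c}" "f ` ?B \<inter> e ` ?B = {}" for i e f s
        proof (rule cyc_fix[OF _ that(5) _ that(1)])
          show "f ` ?B \<inter> r i ` ?B = {}" "f ` ?B \<inter> r 3 ` ?B = {}"
            using r(3)[OF _ that(4), of i] r(3)[OF _ that(4), of 3] that(2) by (simp_all add: Int_commute)
        qed
        have dj: "a ` ?B \<inter> b ` ?B = {}" "a ` ?B \<inter> c ` ?B = {}" "b ` ?B \<inter> c ` ?B = {}"
          using t unfolding tri_def by simp_all
        have 1: "cyc ?B a (r 1) (r 2) \<in> N"
          by (rule step[OF 0 t0, of 0 a]) (simp, simp, rule to_e, assumption, simp, simp, (rule fix_r, assumption, simp, simp, simp, simp)+)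
        have 2: "cyc ?B a b (r 2) \<in> N"
          by (rule step[OF 1 t1, of 1 b]) (simp, simp, rule fix_e, assumption, simp, simp, simp, rule dj,
            rule to_e, assumption, simp, simp, rule fix_r, assumption, simp, simp, simp, simp)
        show "cyc ?B a b c \<in> N"
          by (rule step[OF 2 t2, of 2 c]) (simp, simp, rule fix_e, assumption, simp, simp, simp, rule dj,
            rule fix_e, assumption, simp, simp, simp, rule dj, rule to_e, assumption, simp, simp)
      qed
    qed (use abc pq in auto)
  qed
  then show ?thesis by (rule alt_le[OF N])
qed

subsection \<open>Commutators and simplicity\<close>

lemma disjoint_subsets: "A' \<inter> B' = {} \<Longrightarrow> A \<subseteq> A' \<Longrightarrow> B \<subseteq> B' \<Longrightarrow> A \<inter> B = {}"
  by blast

lemma comm_disjoint: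
  assumes pw: "f \<in> pw" "g \<in> pw" "c \<in> pw" "d \<in> pw"
    and "c \<circ> g = g \<circ> c" "c \<circ> d = d \<circ> c" "d \<circ> f = f \<circ> d"
  shows "comm (f \<circ> c) (g \<circ> d) = comm f g"
proof
  fix t
  have cg: "c (g t) = g (c t)" and cd: "c (d t) = d (c t)" and df: "d (f t) = f (d t)" for t
    using assms(5-7) by (metis comp_apply)+
  have fd: "f (d t) = d (f t)" "iv f (d t) = d (iv f t)" for t
    using df pw by (metis pw_iv)+
  have fd': "iv f (iv d t) = iv d (iv f t)" for t
    using fd(2)[of "iv d t"] pw by (metis pw_iv)
  show "comm (f \<circ> c) (g \<circ> d) t = comm f g t"
    using pw by (simp add: cg cd fd')
qed

lemma conj_supp:
  assumes "f \<in> pw" "k \<in> pw" "\<And>t. t \<notin> Y \<Longrightarrow> f t = t" "t \<notin> k ` Y"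
  shows "(k \<circ> f \<circ> iv k) t = t"
proof -
  have "iv k t \<notin> Y" using assms(2,4) by (metis imageI pw_iv(1))
  then show ?thesis using assms by simp
qed

lemma iv_supp:
  assumes "f \<in> pw" "\<And>t. t \<notin> Y \<Longrightarrow> f t = t" "t \<notin> Y"
  shows "iv f t = t"
  using assms by (metis pw_iv(2))

text \<open>Two elements fixing a common interval pointwise: outside of it, both can be completed to
  elements \<open>[f, k]\<close> and \<open>[g, k\<inverse>]\<close> of \<open>alt\<close> without changing their commutator.\<close>

lemma comm_alt_common:
  assumes f: "f \<in> pw" and g: "g \<in> pw" and p: "p \<in> \<Gamma>" and q: "q \<in> \<Gamma>" "0 < p" "p < q" "q < l"
    and fixed: "\<And>t. t \<in> {p..<q} \<Longrightarrow> f t = t" "\<And>t. t \<in> {p..<q} \<Longrightarrow> g t = t"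
  shows "comm f g \<in> alt"
proof -
  define Y where "Y = {0..<p} \<union> {q..<l}"
  \<comment> \<open>The slope makes two disjoint copies, under \<open>r\<close> and
    \<open>s\<close>, of the whole interval fit into \<open>[p, q)\<close>.\<close>
  obtain \<mu> where \<mu>: "\<mu> \<in> \<Lambda>" "0 < \<mu>" "\<mu> < (q - p) / (2 * l)" using small_slope[of "(q - p) / (2 * l)"] q l_pos by auto
  then have \<mu>l: "2 * (\<mu> * l) < q - p" using l_pos by (simp add: field_simps)
  define r s where "r = (\<lambda>t. \<mu> * t + p)" and "s = (\<lambda>t. \<mu> * t + (p + \<mu> * l))"
  have rs: "r \<in> aff" "s \<in> aff" unfolding r_def s_def using \<mu> p l_mem by (auto intro!: affI mem_intros)
  have rX: "r ` {0..<l} = {p..<p + \<mu> * l}" unfolding aff_image[OF rs(1)] by (simp add: r_def add.commute)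
  have sX: "s ` {0..<l} = {p + \<mu> * l..<p + 2 * (\<mu> * l)}" unfolding aff_image[OF rs(2)] by (simp add: s_def algebra_simps)
  have dis: "{0..<p} \<inter> {q..<l} = {}" "{p..<p + \<mu> * l} \<inter> Y = {}" "{p + \<mu> * l..<p + 2 * (\<mu> * l)} \<inter> Y = {}"
    "{p..<p + \<mu> * l} \<inter> {p + \<mu> * l..<p + 2 * (\<mu> * l)} = {}"
    "{p..<p + \<mu> * l} \<subseteq> {0..<l}" "{p + \<mu> * l..<p + 2 * (\<mu> * l)} \<subseteq> {0..<l}" "Y \<subseteq> {0..<l}"
  proof -
    define m where "m = \<mu> * l"
    have m: "0 < m" "2 * m < q - p" using \<mu>l \<mu>(2) l_pos unfolding m_def by auto
    have Y: "t \<in> Y \<longleftrightarrow> 0 \<le> t \<and> t < p \<or> q \<le> t \<and> t < l" for t unfolding Y_def by auto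
    show "{0..<p} \<inter> {q..<l} = {}" "{p..<p + \<mu> * l} \<inter> Y = {}"
      "{p + \<mu> * l..<p + 2 * (\<mu> * l)} \<inter> Y = {}"
      "{p..<p + \<mu> * l} \<inter> {p + \<mu> * l..<p + 2 * (\<mu> * l)} = {}"
      "{p..<p + \<mu> * l} \<subseteq> {0..<l}" "{p + \<mu> * l..<p + 2 * (\<mu> * l)} \<subseteq> {0..<l}" "Y \<subseteq> {0..<l}"
      unfolding m_def[symmetric] disjoint_iff subset_iff Y atLeastLessThan_iff using m q by fastforce+
  qed
  have rY: "r ` Y \<subseteq> {p..<p + \<mu> * l}" and sY: "s ` Y \<subseteq> {p + \<mu> * l..<p + 2 * (\<mu> * l)}"
    using image_mono[OF dis(7), of r] image_mono[OF dis(7), of s] rX sX by simp_all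
  have rYs: "id ` Y \<inter> r ` Y = {}" "id ` Y \<inter> s ` Y = {}" "r ` Y \<inter> s ` Y = {}"
    using disjoint_subsets[OF dis(2) rY order_refl] disjoint_subsets[OF dis(3) sY order_refl]
      disjoint_subsets[OF dis(4) rY sY] by (simp_all add: Int_commute)
  have t: "tri Y id r s" using rYs rs aff_id by (simp add: tri_aff)
  define k where "k = cyc Y id r s"
  have k_in: "cyc B id r s \<in> alt" if "B = {a..<b}" "a \<in> \<Gamma>" "b \<in> \<Gamma>" "a < b" "B \<subseteq> Y" for a b B
  proof (rule subsetD[OF cycs_alt], unfold that(1), rule cycsI[OF that(2-4) aff_id rs])
    show "tri {a..<b} id r s" using tri_subset[OF t] that by simp
    show "id ` {a..<b} \<subseteq> {0..<l}" "r ` {a..<b} \<subseteq> {0..<l}" "s ` {a..<b} \<subseteq> {0..<l}"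
      using order_trans[OF that(5) dis(7)] order_trans[OF image_mono[OF that(5)] order_trans[OF rY dis(5)]]
        order_trans[OF image_mono[OF that(5)] order_trans[OF sY dis(6)]] that(1) by simp_all
  qed
  have "k = cyc {0..<p} id r s \<circ> cyc {q..<l} id r s"
    unfolding k_def Y_def by (rule cyc_union[OF t[unfolded Y_def] dis(1)])
  moreover have "cyc {0..<p} id r s \<in> alt" "cyc {q..<l} id r s \<in> alt"
    using k_in[OF refl, of 0 p] k_in[OF refl, of q l] p q zero_mem l_mem unfolding Y_def by auto
  ultimately have k: "k \<in> alt" using sg_comp[OF alt_sg] by simp
  then have kp: "k \<in> pw" using sg_pw[OF alt_sg] by blast
  have ik: "iv k = cyc Y id s r" unfolding k_def by (rule inv_cyc[OF t])
  have kY: "k ` Y = r ` Y" unfolding k_def by (rule image_cong[OF refl]) (use cyc_app(1)[OF t] in simp)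
  have ikY: "iv k ` Y = s ` Y"
  proof (rule image_cong[OF refl])
    show "iv k y = s y" if "y \<in> Y" for y
      using cyc_app(1)[OF tri_swap[OF t] that] by (simp only: ik id_apply)
  qed
  have fY: "f y = y" "g y = y" if "y \<notin> Y" for y
  proof -
    have "y \<notin> {0..<l} \<or> y \<in> {p..<q}" using that unfolding Y_def by auto
    then show "f y = y" "g y = y" using fixed[of y] pw_out[OF f, of y] pw_out[OF g, of y] by blast+
  qed
  \<comment> \<open>\<open>k\<close> carries \<open>Y\<close> to its copy under \<open>r\<close>,
    and \<open>iv k\<close> carries it to the copy under \<open>s\<close>. So the supports of
    \<open>c\<close> and \<open>d\<close> are disjoint from \<open>Y\<close> and from each other,
    and \<open>comm_disjoint\<close> applies. Moreover \<open>f \<circ> c\<close> and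
    \<open>g \<circ> d\<close> are commutators with \<open>k\<close> and with \<open>iv k\<close>,
    hence in \<open>alt\<close>.\<close>
  define c d where "c = k \<circ> iv f \<circ> iv k" and "d = iv k \<circ> iv g \<circ> iv (iv k)"
  have cd: "c \<in> pw" "d \<in> pw" unfolding c_def d_def by (intro pw_comp pw_inverse f g kp)+
  have cs: "c t = t" if "t \<notin> r ` Y" for t
    unfolding c_def by (rule conj_supp[OF pw_inverse[OF f] kp iv_supp[OF f fY(1)]]) (use that kY in auto)
  have ds: "d t = t" if "t \<notin> s ` Y" for t
    unfolding d_def by (rule conj_supp[OF pw_inverse[OF g] pw_inverse[OF kp] iv_supp[OF g fY(2)]]) (use that ikY in auto)
  have inj: "inj f" "inj g" "inj c" "inj d" using f g cd pw_bij bij_is_inj by blast+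
  have "comm (f \<circ> c) (g \<circ> d) = comm f g"
  proof (rule comm_disjoint[OF f g cd])
    show "c \<circ> g = g \<circ> c" by (rule commute_if_disjoint[where S = "r ` Y" and S' = Y, OF inj(3,2) cs fY(2)]) (use rYs in auto)
    show "c \<circ> d = d \<circ> c" by (rule commute_if_disjoint[where S = "r ` Y" and S' = "s ` Y", OF inj(3,4) cs ds]) (use rYs in auto)
    show "d \<circ> f = f \<circ> d" by (rule commute_if_disjoint[where S = "s ` Y" and S' = Y, OF inj(4,1) ds fY(1)]) (use rYs in auto)
  qed
  moreover have "f \<circ> c \<in> alt"
  proof -
    have "f \<circ> c = (f \<circ> k \<circ> iv f) \<circ> iv k" unfolding c_def by (simp add: comp_assoc)
    then show ?thesis using sg_comp[OF alt_sg alt_normal[OF f k] sg_iv[OF alt_sg k]] by simp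
  qed
  moreover have "g \<circ> d \<in> alt"
  proof -
    have "g \<circ> d = (g \<circ> iv k \<circ> iv g) \<circ> k" unfolding d_def using kp by (simp add: comp_assoc)
    then show ?thesis using sg_comp[OF alt_sg alt_normal[OF g sg_iv[OF alt_sg k]] k] by simp
  qed
  ultimately show ?thesis
    using sg_comp[OF alt_sg] sg_iv[OF alt_sg] by metis
qed

lemma room_interval:
  fixes n :: nat
  assumes "finite E" "E \<subseteq> aff" "p < q" "c < d"
  obtains u v r where "u \<in> \<Gamma>" "v \<in> \<Gamma>" "p < u" "u < v" "v < q"
    "\<forall>i<n. r i \<in> aff \<and> r i ` {u..<v} \<subseteq> {c..<d} \<and> (\<forall>e\<in>E. r i ` {u..<v} \<inter> e ` {u..<v} = {})"
    "\<forall>i<n. \<forall>j<n. i \<noteq> j \<longrightarrow> r i ` {u..<v} \<inter> r j ` {u..<v} = {}"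
  by (rule loc_ex[OF loc_rooms[where n = n, OF assms(1,2,4)] assms(3)], elim exE conjE) (rule that)

text \<open>On an interval that \<open>g\<close> moves off itself, the three-cycle through the
  affine map \<open>e\<close> of \<open>g\<close>, \<open>id\<close> and a spare copy carries the
  image back.\<close>

lemma fix_interval:
  assumes g: "g \<in> pw"
  obtains a p q where "a \<in> alt" "p \<in> \<Gamma>" "q \<in> \<Gamma>" "0 < p" "p < q" "q < l" "\<And>t. t \<in> {p..<q} \<Longrightarrow> a (g t) = t"
proof (cases "g = id")
  case True
  obtain q where q: "q \<in> \<Gamma>" "0 < q" "q < l" using small_mem[OF l_pos] by metis
  obtain p where "p \<in> \<Gamma>" "0 < p" "p < q" using small_mem[OF q(2)] by metis
  then show thesis using that[OF sg_id[OF alt_sg]] q True by simp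
next
  case False
  obtain p q e where pq: "p \<in> \<Gamma>" "q \<in> \<Gamma>" "0 < p" "p < q" "q < l" and e: "e \<in> aff" "\<And>t. t \<in> {p..<q} \<Longrightarrow> g t = e t"
    "e ` {p..<q} \<inter> {p..<q} = {}"
    using moved_interval[OF g False] by metis
  have E: "finite {id, e}" "{id, e} \<subseteq> aff" using e aff_id by auto
  obtain u v r where uv: "u \<in> \<Gamma>" "v \<in> \<Gamma>" "p < u" "u < v" "v < q"
    and r: "\<forall>i<Suc 0. r i \<in> aff \<and> r i ` {u..<v} \<subseteq> {0..<l} \<and> (\<forall>e'\<in>{id, e}. r i ` {u..<v} \<inter> e' ` {u..<v} = {})"
    by (rule room_interval[where n = "Suc 0", OF E pq(4) l_pos])
  have sub: "{u..<v} \<subseteq> {p..<q}" using uv by auto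
  have eid: "e ` {u..<v} \<inter> id ` {u..<v} = {}" by (rule disjoint_subsets[OF e(3) image_mono[OF sub]]) (use sub in simp)
  have t: "tri {u..<v} e id (r 0)"
    using r e(1) aff_id eid by (simp add: tri_aff Int_commute)
  have "e ` {u..<v} = g ` {u..<v}" using e(2) sub by (intro image_cong) auto
  also have "\<dots> \<subseteq> {0..<l}"
  proof -
    have "{u..<v} \<subseteq> {0..<l}" using uv pq by auto
    then show ?thesis using image_mono[of "{u..<v}" "{0..<l}" g] pw_image[OF g] by simp
  qed
  finally have eX: "e ` {u..<v} \<subseteq> {0..<l}" .
  have "cyc {u..<v} e id (r 0) \<in> alt"
  proof (rule subsetD[OF cycs_alt], rule cycsI[OF uv(1,2,4) e(1) aff_id _ t eX])
    show "id ` {u..<v} \<subseteq> {0..<l}" using uv pq by auto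
  qed (use r in simp_all)
  moreover have "cyc {u..<v} e id (r 0) (g s) = s" if "s \<in> {u..<v}" for s
  proof -
    have "g s = e s" using that sub by (intro e(2)) blast
    then show ?thesis using cyc_app(1)[OF t that] by simp
  qed
  ultimately show thesis using uv pq by (intro that[of "cyc {u..<v} e id (r 0)" u v]) auto
qed

text \<open>In the quotient by the normal subgroup \<open>alt\<close>, a commutator depends only on
  the classes of its entries.\<close>

lemma comm_alt_congruent:
  assumes pw: "f \<in> pw" "g \<in> pw" and ab: "a \<in> alt" "b \<in> alt" and fg: "comm f g \<in> alt"
  shows "comm (a \<circ> f) (b \<circ> g) \<in> alt"
proof -
  have ab_pw: "a \<in> pw" "b \<in> pw" using ab sg_pw[OF alt_sg] by auto
  have "comm (a \<circ> f) (b \<circ> g) = a \<circ> (f \<circ> b \<circ> iv f) \<circ> comm f g \<circ> (g \<circ> iv a \<circ> iv g) \<circ> iv b"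
    using pw ab_pw by (simp add: fun_eq_iff)
  then show ?thesis
    using sg_comp[OF alt_sg] sg_iv[OF alt_sg] alt_normal pw ab fg by metis
qed

lemma comm_alt:
  assumes f: "f \<in> pw" and g: "g \<in> pw"
  shows "comm f g \<in> alt"
proof -
  obtain a p q where a: "a \<in> alt" "p \<in> \<Gamma>" "q \<in> \<Gamma>" "0 < p" "p < q" "q < l" "\<And>t. t \<in> {p..<q} \<Longrightarrow> a (f t) = t"
    using fix_interval[OF f] by metis
  obtain b p' q' where b: "b \<in> alt" "p' \<in> \<Gamma>" "q' \<in> \<Gamma>" "0 < p'" "p' < q'" "q' < l" "\<And>t. t \<in> {p'..<q'} \<Longrightarrow> b (g t) = t"
    using fix_interval[OF g] by metis
  have ab_pw: "a \<in> pw" "b \<in> pw" using a(1) b(1) sg_pw[OF alt_sg] by auto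
  define f1 g1 where "f1 = a \<circ> f" and "g1 = b \<circ> g"
  have fg1: "f1 \<in> pw" "g1 \<in> pw" unfolding f1_def g1_def using ab_pw f g pw_comp by auto
  have E: "finite {id}" "{id} \<subseteq> aff" using aff_id by auto
  obtain u v r where uv: "u \<in> \<Gamma>" "v \<in> \<Gamma>" "p' < u" "u < v" "v < q'"
    and r: "\<forall>i<2::nat. r i \<in> aff \<and> r i ` {u..<v} \<subseteq> {p..<q} \<and> (\<forall>e\<in>{id}. r i ` {u..<v} \<inter> e ` {u..<v} = {})"
    and rr: "\<forall>i<2::nat. \<forall>j<2. i \<noteq> j \<longrightarrow> r i ` {u..<v} \<inter> r j ` {u..<v} = {}"
    by (rule room_interval[where n = 2, OF E b(5) a(5)])
  have r0: "r 0 \<in> aff" "r 0 ` {u..<v} \<subseteq> {p..<q}" and r1: "r 1 \<in> aff" "r 1 ` {u..<v} \<subseteq> {p..<q}"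
    using r by auto
  have t: "tri {u..<v} (r 0) id (r 1)"
    using r rr[rule_format, of 0 1] aff_id by (simp add: tri_aff Int_commute)
  define h where "h = cyc {u..<v} (r 0) id (r 1)"
  have pqX: "{p..<q} \<subseteq> {0..<l}" "id ` {u..<v} \<subseteq> {0..<l}" using a(4-6) b(4-6) uv(3-5) by auto
  have h: "h \<in> alt" unfolding h_def
    by (rule subsetD[OF cycs_alt], rule cycsI[OF uv(1,2,4) r0(1) aff_id r1(1) t order_trans[OF r0(2) pqX(1)] pqX(2)
      order_trans[OF r1(2) pqX(1)]])
  then have hp: "h \<in> pw" using sg_pw[OF alt_sg] by blast
  have hr: "h (r 0 s) = s" if "s \<in> {u..<v}" for s
    using cyc_app(1)[OF t that] unfolding h_def by simp
  \<comment> \<open>\<open>f1\<close> and \<open>g1\<close> fix an interval each, but not the same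
    one. Conjugation by \<open>h\<close>, which carries a part of \<open>[p, q)\<close> onto
    \<open>[u, v)\<close> inside \<open>[p', q')\<close>, does not change the class of
    \<open>f1\<close> modulo \<open>alt\<close> and makes it fix \<open>[u, v)\<close> as
    \<open>g1\<close> does.\<close>
  define f2 where "f2 = h \<circ> f1 \<circ> iv h"
  have f2: "f2 \<in> pw" unfolding f2_def using hp fg1 by (intro pw_comp pw_inverse)
  have "comm f2 g1 \<in> alt"
  proof (rule comm_alt_common[OF f2 fg1(2) uv(1,2)])
    fix s assume s: "s \<in> {u..<v}"
    have "iv h s = r 0 s" using hr[OF s] hp by (metis pw_iv(2))
    moreover have "r 0 s \<in> {p..<q}" using imageI[OF s, of "r 0"] r0(2) by blast
    ultimately show "f2 s = s" unfolding f2_def f1_def using a(7)[of "r 0 s"] hr[OF s] by simp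
    show "g1 s = s" unfolding g1_def using b(7)[of s] s uv by simp
  qed (use uv b in auto)
  moreover have "f = (iv a \<circ> (iv h \<circ> (f2 \<circ> h \<circ> iv f2))) \<circ> f2"
    unfolding f2_def f1_def using hp ab_pw f pw_comp pw_inverse by (simp add: fun_eq_iff)
  moreover have "iv a \<circ> (iv h \<circ> (f2 \<circ> h \<circ> iv f2)) \<in> alt"
    by (intro sg_comp[OF alt_sg] sg_iv[OF alt_sg] a(1) h alt_normal f2)
  moreover have "g = iv b \<circ> g1" "iv b \<in> alt"
    unfolding g1_def using ab_pw sg_iv[OF alt_sg b(1)] by (simp_all add: fun_eq_iff)
  ultimately show ?thesis
    using comm_alt_congruent[OF f2 fg1(2)] by metis
qed

lemma cycs_le_of_comms:
  assumes H: "subgroup H PG" and pq: "p < q" "{p..<q} \<subseteq> U"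
    and comms: "\<And>x y. x \<in> cycs U \<Longrightarrow> y \<in> cycs U \<Longrightarrow> comm x y \<in> H"
  shows "cycs U \<subseteq> H"
proof (rule cycs_le[OF H], rule loc_mono[OF small_commutator[where p = p and q = q]])
  fix a b c u v
  assume *: "tri {u..<v} a b c \<longrightarrow> a ` {u..<v} \<union> b ` {u..<v} \<union> c ` {u..<v} \<subseteq> U \<longrightarrow>
     (\<exists>x\<in>cycs U. \<exists>y\<in>cycs U. cyc {u..<v} a b c = comm x y)"
  show "tri {u..<v} a b c \<longrightarrow> a ` {u..<v} \<union> b ` {u..<v} \<union> c ` {u..<v} \<subseteq> U \<longrightarrow> cyc {u..<v} a b c \<in> H"
  proof (intro impI)
    assume "tri {u..<v} a b c" "a ` {u..<v} \<union> b ` {u..<v} \<union> c ` {u..<v} \<subseteq> U"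
    then obtain x y where "x \<in> cycs U" "y \<in> cycs U" "cyc {u..<v} a b c = comm x y" using * by meson
    then show "cyc {u..<v} a b c \<in> H" using comms by simp
  qed
qed (use pq in auto)

lemma derived_PG: "derived PG pw = alt"
proof
  have "comm f g = f \<otimes>\<^bsub>PG\<^esub> g \<otimes>\<^bsub>PG\<^esub> inv\<^bsub>PG\<^esub> f \<otimes>\<^bsub>PG\<^esub> inv\<^bsub>PG\<^esub> g" if "f \<in> pw" "g \<in> pw" for f g
    using that by simp
  then have set: "derived_set PG pw = (\<Union>f\<in>pw. \<Union>g\<in>pw. {comm f g})"
    by auto
  show "derived PG pw \<subseteq> alt"
    unfolding derived_def set
    by (rule group.generate_subgroup_incl[OF group_PG _ alt_sg]) (auto intro: comm_alt)
  have D: "subgroup (derived PG pw) PG"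
    using group.derived_is_subgroup[OF group_PG, of pw] by simp
  have "cycs {0..<l} \<subseteq> derived PG pw"
  proof (rule cycs_le_of_comms[OF D l_pos order_refl])
    fix x y assume "x \<in> cycs {0..<l}" "y \<in> cycs {0..<l}"
    then have "x \<in> pw" "y \<in> pw" using cycs_pw[OF order_refl] by auto
    then have "comm x y \<in> derived_set PG pw" unfolding set by blast
    then show "comm x y \<in> derived PG pw" unfolding derived_def by (rule generate.incl)
  qed
  then show "alt \<subseteq> derived PG pw" by (rule alt_le[OF D])
qed

lemma derived_group_PG: "derived_group PG = PG\<lparr>carrier := alt\<rparr>"
  by (simp add: derived_group_def derived_PG)

lemma alt_nontrivial: "alt \<noteq> {id}"
proof -
  obtain u v r where uv: "u \<in> \<Gamma>" "v \<in> \<Gamma>" "0 < u" "u < v" "v < l"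
    and r: "\<forall>i<3::nat. r i \<in> aff \<and> r i ` {u..<v} \<subseteq> {0..<l} \<and> (\<forall>e\<in>{}. r i ` {u..<v} \<inter> e ` {u..<v} = {})"
    and rr: "\<forall>i<3::nat. \<forall>j<3. i \<noteq> j \<longrightarrow> r i ` {u..<v} \<inter> r j ` {u..<v} = {}"
    by (rule room_interval[where n = 3, OF finite.emptyI empty_subsetI l_pos l_pos])
  have t: "tri {u..<v} (r 0) (r 1) (r 2)" using r rr by (simp add: tri_aff)
  have "cyc {u..<v} (r 0) (r 1) (r 2) \<in> alt"
    by (rule subsetD[OF cycs_alt], rule cycsI[OF uv(1,2,4) _ _ _ t]) (use r in simp_all)
  moreover have "cyc {u..<v} (r 0) (r 1) (r 2) (r 0 u) = r 1 u" using cyc_app(1)[OF t] uv by simp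
  moreover have "r 1 u \<noteq> r 0 u" 
  proof -
    have "r 0 ` {u..<v} \<inter> r 1 ` {u..<v} = {}" using rr[rule_format, of 0 1] by simp
    moreover have "r 0 u \<in> r 0 ` {u..<v}" "r 1 u \<in> r 1 ` {u..<v}" using uv(4) by simp_all
    ultimately show ?thesis by (metis disjoint_iff)
  qed
  ultimately show ?thesis by (metis id_apply singletonD)
qed

lemma simple_PG: "is_simple (derived_group PG)"
proof -
  have G: "group (PG\<lparr>carrier := alt\<rparr>)" by (rule group.subgroup_imp_group[OF group_PG alt_sg])
  have "N = {id} \<or> N = alt" if N: "N \<lhd> PG\<lparr>carrier := alt\<rparr>" for N
  proof (cases "N \<subseteq> {id}")
    case True
    have "id \<in> N" using subgroup.one_closed[OF normal_imp_subgroup[OF N]] by simp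
    then show ?thesis using True by blast
  next
    case False
    then obtain \<alpha> where \<alpha>: "\<alpha> \<in> N" "\<alpha> \<noteq> id" by blast
    have sub: "N \<subseteq> alt" using subgroup.subset[OF normal_imp_subgroup[OF N]] by simp
    have sg: "subgroup N PG"
      using group.incl_subgroup[OF group_PG alt_sg normal_imp_subgroup[OF N]] .
    have "f \<circ> g \<circ> iv f \<in> N" if "f \<in> alt" "g \<in> N" for f g
      using normal.inv_op_closed2[OF N, of f g] that group.m_inv_consistent[OF group_PG alt_sg, of f]
        sg_pw[OF alt_sg, of f] by simp
    then have "alt \<subseteq> N" using alt_le_normal[OF sg _ \<alpha>] by blast
    then show ?thesis using sub by blast
  qed
  then show ?thesis
    unfolding derived_group_PG is_simple_def using G alt_nontrivial by simp
qed

end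

subsection \<open>Generation of germs of affine maps\<close>

text \<open>The monoid generated by \<open>M\<close>. For contractions its elements are at most 1,
  so scaling by them never leaves an interval \<open>[0, L)\<close>.\<close>

inductive_set mon :: "real set \<Rightarrow> real set" for M where
  mon_one: "1 \<in> mon M"
| mon_step: "\<nu> \<in> M \<Longrightarrow> \<mu> \<in> mon M \<Longrightarrow> \<nu> * \<mu> \<in> mon M"

lemma mon_mult: "\<mu> \<in> mon M \<Longrightarrow> \<nu> \<in> mon M \<Longrightarrow> \<mu> * \<nu> \<in> mon M"
  by (induction rule: mon.induct) (auto simp: mult.assoc intro: mon.intros)

context gamma_lambda
begin

definition maps_into :: "real \<Rightarrow> (real \<Rightarrow> real) \<Rightarrow> real \<Rightarrow> real \<Rightarrow> bool" where
  "maps_into L g u v \<longleftrightarrow> g \<in> aff \<and> u \<in> \<Gamma> \<and> v \<in> \<Gamma> \<and> u < v \<and> 0 \<le> u \<and> v \<le> L \<and> 0 \<le> g u \<and> g v \<le> L"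

lemma maps_into_sub:
  assumes "maps_into L g u v" "u \<le> u'" "u' < v'" "v' \<le> v" "u' \<in> \<Gamma>" "v' \<in> \<Gamma>"
  shows "maps_into L g u' v'"
proof -
  have g: "g \<in> aff" using assms unfolding maps_into_def by blast
  have "0 \<le> g u'" using order_trans[of 0 "g u" "g u'"] assms g unfolding maps_into_def by simp
  moreover have "g v' \<le> L" using order_trans[of "g v'" "g v" L] assms g unfolding maps_into_def by simp
  ultimately show ?thesis using assms unfolding maps_into_def by auto
qed

lemma maps_into_iv: "maps_into L g u v \<Longrightarrow> maps_into L (iv g) (g u) (g v)"
  unfolding maps_into_def by (simp add: aff_iv)

lemma iv_iv_aff: "g \<in> aff \<Longrightarrow> iv (iv g) = g"
  by (simp add: inv_inv_eq aff_bij)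

lemma iv_trans: "iv (\<lambda>t::real. t + c) = (\<lambda>t. t + - c)"
  by (rule inv_equality) auto

lemma iv_scale: "\<mu> \<in> \<Lambda> \<Longrightarrow> iv (\<lambda>t. \<mu> * t) = (\<lambda>t. inverse \<mu> * t)"
  by (rule inv_equality) (use slope_pos[of \<mu>] in auto)

end

text \<open>The common core of three arguments: \<open>good g u v\<close> says that the restriction
  of \<open>g\<close> to \<open>[u, v)\<close> has been generated. It is instantiated with
  invariance of a set of endpoints, with three-cycles in a subgroup, and with arrows of the
  groupoid. The size conditions serve \<open>good_trans_mon\<close>: expanding an interval inside
  \<open>[0, 2 * \<gamma>)\<close> by the inverse of \<nu> stays within \<open>[0, L / 2]\<close>,
  and a translation by at most \<open>c\<close> then stays within \<open>[0, L]\<close>.\<close>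

locale germs = gamma_lambda +
  fixes L \<gamma> :: real and M C :: "real set" and good :: "(real \<Rightarrow> real) \<Rightarrow> real \<Rightarrow> real \<Rightarrow> bool"
  assumes L_mem: "L \<in> \<Gamma>" and L_pos: "0 < L"
    and M_slope: "M \<subseteq> \<Lambda>" and M_less: "\<nu> \<in> M \<Longrightarrow> \<nu> < 1"
    and M_gen: "\<mu> \<in> \<Lambda> \<Longrightarrow> \<exists>\<nu>1\<in>mon M. \<exists>\<nu>2\<in>mon M. \<mu> = \<nu>2 / \<nu>1"
    and C_mem: "C \<subseteq> \<Gamma>" and C_pos: "c \<in> C \<Longrightarrow> 0 < c" and C_small: "c \<in> C \<Longrightarrow> 2 * c \<le> L"
    and \<gamma>_C: "\<gamma> \<in> C" and \<gamma>_small: "\<nu> \<in> M \<Longrightarrow> 4 * \<gamma> \<le> \<nu> * L"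
    and C_gen: "\<lbrakk>0 \<in> S; \<And>x y. x \<in> S \<Longrightarrow> y \<in> S \<Longrightarrow> x + y \<in> S; \<And>x. x \<in> S \<Longrightarrow> - x \<in> S;
      \<And>\<mu> x. \<mu> \<in> \<Lambda> \<Longrightarrow> x \<in> S \<Longrightarrow> \<mu> * x \<in> S; C \<subseteq> S\<rbrakk> \<Longrightarrow> \<Gamma> \<subseteq> S"
    and good_id: "maps_into L id u v \<Longrightarrow> good id u v"
    and good_sub: "maps_into L g u v \<Longrightarrow> good g u v \<Longrightarrow> u \<le> u' \<Longrightarrow> u' < v' \<Longrightarrow> v' \<le> v \<Longrightarrow> u' \<in> \<Gamma> \<Longrightarrow> v' \<in> \<Gamma> \<Longrightarrow>
      good g u' v'"
    and good_add: "maps_into L g u w \<Longrightarrow> v \<in> \<Gamma> \<Longrightarrow> u < v \<Longrightarrow> v < w \<Longrightarrow> good g u v \<Longrightarrow> good g v w \<Longrightarrow> good g u w"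
    and good_comp: "maps_into L g u v \<Longrightarrow> good g u v \<Longrightarrow> maps_into L h (g u) (g v) \<Longrightarrow> good h (g u) (g v) \<Longrightarrow>
      good (h \<circ> g) u v"
    and good_iv: "maps_into L g u v \<Longrightarrow> good g u v \<Longrightarrow> good (iv g) (g u) (g v)"
    and good_scale: "\<nu> \<in> M \<Longrightarrow> good (\<lambda>t. \<nu> * t) 0 L"
    and good_trans: "c \<in> C \<Longrightarrow> good (\<lambda>t. t + c) 0 (L - c)"
begin

lemma mon_slope: "\<nu> \<in> mon M \<Longrightarrow> \<nu> \<in> \<Lambda>"
  by (induction rule: mon.induct) (use M_slope in \<open>auto intro: mem_intros\<close>)

lemma mon_pos: "\<nu> \<in> mon M \<Longrightarrow> 0 < \<nu>"
  using mon_slope slope_pos by blast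

lemma mon_le: "\<nu> \<in> mon M \<Longrightarrow> \<nu> \<le> 1"
proof (induction rule: mon.induct)
  case (mon_step \<nu> \<mu>)
  then have "\<nu> * \<mu> \<le> 1 * 1" using M_less[of \<nu>] mon_pos[of \<mu>] by (intro mult_mono) auto
  then show ?case by simp
qed simp

lemma mon_small:
  assumes "0 < \<epsilon>"
  obtains \<nu> where "\<nu> \<in> mon M" "\<nu> < \<epsilon>"
proof -
  obtain \<mu> where \<mu>: "\<mu> \<in> \<Lambda>" "\<mu> < \<epsilon>" using small_slope[OF assms] by metis
  obtain \<nu>1 \<nu>2 where n: "\<nu>1 \<in> mon M" "\<nu>2 \<in> mon M" "\<mu> = \<nu>2 / \<nu>1" using M_gen[OF \<mu>(1)] by blast
  have "\<nu>2 = \<mu> * \<nu>1" using n mon_pos[OF n(1)] by simp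
  also have "\<dots> \<le> \<mu> * 1" using mon_le[OF n(1)] slope_pos[OF \<mu>(1)] by (intro mult_left_mono) auto
  finally show thesis using \<mu> n(2) that by simp
qed

lemma good_iv':
  assumes "maps_into L g u v" "good (iv g) (g u) (g v)"
  shows "good g u v"
proof -
  have g: "g \<in> aff" using assms unfolding maps_into_def by blast
  show ?thesis using good_iv[OF maps_into_iv[OF assms(1)] assms(2)] g by (simp add: iv_iv_aff)
qed

text \<open>Gluing by \<open>good_add\<close> reduces a claim to short intervals, which have room to
  be moved around inside \<open>[0, L)\<close>.\<close>

lemma good_small:
  assumes g: "maps_into L g p q" and "0 < \<epsilon>"
    and small: "\<And>u v. maps_into L g u v \<Longrightarrow> p \<le> u \<Longrightarrow> v \<le> q \<Longrightarrow> v - u < \<epsilon> \<Longrightarrow> good g u v"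
  shows "good g p q"
proof (rule loc_imp_all[where P = "good g"])
  show "p \<in> \<Gamma>" "q \<in> \<Gamma>" "p < q" using g unfolding maps_into_def by auto
  fix u v w assume *: "u \<in> \<Gamma>" "v \<in> \<Gamma>" "w \<in> \<Gamma>" "p \<le> u" "u < v" "v < w" "w \<le> q" "good g u v" "good g v w"
  then have "maps_into L g u w" by (intro maps_into_sub[OF g]) auto
  then show "good g u w" using good_add * by blast
next
  fix t
  show "loc t (\<lambda>u v. p \<le> u \<longrightarrow> v \<le> q \<longrightarrow> good g u v)"
  proof (rule loc_mono[OF loc_near[OF half_gt_zero[OF assms(2)]]], intro impI)
    fix u v assume "u \<in> \<Gamma>" "v \<in> \<Gamma>" "t - \<epsilon> / 2 < u \<and> u < v \<and> v < t + \<epsilon> / 2" "p \<le> u" "v \<le> q"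
    then show "good g u v" by (intro small maps_into_sub[OF g]) auto
  qed
qed

lemma maps_trans: "c \<in> \<Gamma> \<Longrightarrow> maps_into L (\<lambda>t. t + c) u v \<longleftrightarrow>
    u \<in> \<Gamma> \<and> v \<in> \<Gamma> \<and> u < v \<and> 0 \<le> u \<and> v \<le> L \<and> 0 \<le> u + c \<and> v + c \<le> L"
  unfolding maps_into_def by (auto simp: aff_trans)

lemma maps_scale:
  assumes "\<mu> \<in> \<Lambda>"
  shows "maps_into L (\<lambda>t. \<mu> * t) u v \<longleftrightarrow> u \<in> \<Gamma> \<and> v \<in> \<Gamma> \<and> u < v \<and> 0 \<le> u \<and> v \<le> L \<and> \<mu> * v \<le> L"
  using slope_pos[OF assms] unfolding maps_into_def by (auto simp: aff_scale assms)

lemma good_trans_neg: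
  assumes "c \<in> \<Gamma>" "maps_into L (\<lambda>t. t + - c) u v" "good (\<lambda>t. t + c) (u - c) (v - c)"
  shows "good (\<lambda>t. t + - c) u v"
proof -
  have "iv (\<lambda>t. t + - c) = (\<lambda>t. t + c)" using iv_trans[of "- c"] by simp
  then show ?thesis using good_iv'[OF assms(2)] assms(3) by simp
qed

lemma good_trans_mult:
  "c \<in> C \<Longrightarrow> maps_into L (\<lambda>t. t + real k * c) u v \<Longrightarrow> good (\<lambda>t. t + real k * c) u v"
proof (induction k)
  case 0
  then show ?case using good_id[of u v] by (simp add: id_def)
next
  case (Suc k)
  have c: "c \<in> \<Gamma>" "0 < c" "real k * c \<in> \<Gamma>" "real (Suc k) * c \<in> \<Gamma>"
    using Suc.prems(1) C_mem C_pos nat_mult_mem by (auto simp del: of_nat_Suc)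
  have m: "maps_into L (\<lambda>t. t + real k * c) u v" "maps_into L (\<lambda>t. t + c) (u + real k * c) (v + real k * c)"
    "maps_into L (\<lambda>t. t + c) 0 (L - c)"
    using Suc.prems(2) c L_mem C_small[OF Suc.prems(1)] by (auto simp: maps_trans algebra_simps zero_mem add_mem diff_mem)
  have "good (\<lambda>t. t + c) (u + real k * c) (v + real k * c)"
    by (rule good_sub[OF m(3) good_trans[OF Suc.prems(1)]])
      (use Suc.prems(2) c in \<open>auto simp: maps_trans algebra_simps add_mem\<close>)
  then have "good ((\<lambda>t. t + c) \<circ> (\<lambda>t. t + real k * c)) u v"
    using good_comp[OF m(1) Suc.IH[OF Suc.prems(1) m(1)] m(2)] by simp
  then show ?case by (simp add: o_def algebra_simps)
qed

lemma good_scale_mon: "\<nu> \<in> mon M \<Longrightarrow> maps_into L (\<lambda>t. \<nu> * t) u v \<Longrightarrow> good (\<lambda>t. \<nu> * t) u v"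
proof (induction arbitrary: u v rule: mon.induct)
  case mon_one
  then show ?case using good_id[of u v] by (simp add: id_def)
next
  case (mon_step \<nu> \<mu>)
  have n: "\<nu> \<in> \<Lambda>" "0 < \<nu>" "\<nu> < 1" "\<mu> \<in> \<Lambda>" "0 < \<mu>" "\<mu> \<le> 1"
    using mon_step M_slope M_less slope_pos mon_slope mon_le by auto
  have uv: "u \<in> \<Gamma>" "v \<in> \<Gamma>" "u < v" "0 \<le> u" "v \<le> L"
    using mon_step.prems unfolding maps_into_def by auto
  have le: "\<mu> * v \<le> L" "\<nu> * L \<le> L" "\<nu> * (\<mu> * v) \<le> L" "0 \<le> \<mu> * u"
  proof -
    show 1: "\<mu> * v \<le> L" using mult_mono[of \<mu> 1 v L] n uv by simp
    show "\<nu> * L \<le> L" using n L_pos by simp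
    show "\<nu> * (\<mu> * v) \<le> L" using mult_mono[of \<nu> 1 "\<mu> * v" L] 1 n uv by simp
    show "0 \<le> \<mu> * u" using n uv by simp
  qed
  have m: "maps_into L (\<lambda>t. \<mu> * t) u v" "maps_into L (\<lambda>t. \<nu> * t) (\<mu> * u) (\<mu> * v)" "maps_into L (\<lambda>t. \<nu> * t) 0 L"
    using uv n le L_mem L_pos by (auto simp: maps_scale scale_mem zero_mem)
  have "good (\<lambda>t. \<nu> * t) (\<mu> * u) (\<mu> * v)"
    by (rule good_sub[OF m(3) good_scale[OF mon_step.hyps(1)]]) (use m(2) n in \<open>auto simp: maps_scale\<close>)
  then have "good ((\<lambda>t. \<nu> * t) \<circ> (\<lambda>t. \<mu> * t)) u v"
    using good_comp[OF m(1) mon_step.IH[OF m(1)] m(2)] by simp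
  then show ?case by (simp add: o_def mult.assoc)
qed

lemma good_scale_inverse:
  assumes "\<nu> \<in> mon M" "maps_into L (\<lambda>t. inverse \<nu> * t) u v"
  shows "good (\<lambda>t. inverse \<nu> * t) u v"
proof (rule good_iv'[OF assms(2)])
  have n: "\<nu> \<in> \<Lambda>" using mon_slope assms by blast
  have "iv (\<lambda>t. inverse \<nu> * t) = (\<lambda>t. \<nu> * t)" using iv_scale[OF inverse_slope[OF n]] by simp
  then show "good (iv (\<lambda>t. inverse \<nu> * t)) (inverse \<nu> * u) (inverse \<nu> * v)"
    using good_scale_mon[OF assms(1)] maps_into_iv[OF assms(2)] by simp
qed

text \<open>Translations by multiples of \<open>\<gamma>\<close> move any small interval next to \<open>0\<close>, where it can be
  expanded by \<open>\<nu>\<inverse>\<close> without leaving \<open>[0, L)\<close>.\<close>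

lemma good_trans_mon:
  "\<nu> \<in> mon M \<Longrightarrow> c \<in> C \<Longrightarrow> maps_into L (\<lambda>t. t + \<nu> * c) u v \<Longrightarrow> good (\<lambda>t. t + \<nu> * c) u v"
proof (induction arbitrary: u v rule: mon.induct)
  case mon_one
  then show ?case using good_trans_mult[of c 1 u v] by simp
next
  case (mon_step \<nu> \<mu>)
  have n: "\<nu> \<in> \<Lambda>" "0 < \<nu>" "\<nu> < 1" "\<mu> \<in> \<Lambda>" "0 < \<mu>" "\<mu> \<le> 1" "\<nu> \<in> mon M"
    using mon_step M_slope M_less slope_pos mon_slope mon_le mon.mon_step[OF _ mon_one] by force+
  have c: "c \<in> \<Gamma>" "0 < c" "2 * c \<le> L" "\<gamma> \<in> \<Gamma>" "0 < \<gamma>" "4 * \<gamma> \<le> \<nu> * L" "\<mu> * c \<le> c" "0 < \<mu> * c"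
    using mon_step C_mem C_pos C_small \<gamma>_C \<gamma>_small n by auto
  show ?case
  proof (rule good_small[OF mon_step.prems(2) c(5)])
    fix u v assume m: "maps_into L (\<lambda>t. t + \<nu> * \<mu> * c) u v" and small: "v - u < \<gamma>"
    have uv: "u \<in> \<Gamma>" "v \<in> \<Gamma>" "u < v" "0 \<le> u" "v \<le> L" "v + \<nu> * \<mu> * c \<le> L"
      using m unfolding maps_into_def by auto
    \<comment> \<open>Subtracting the largest multiple of \<gamma> below \<open>u\<close> leaves an
      interval inside \<open>[0, 2 * \<gamma>)\<close>. The translation by
      \<open>\<nu> * \<mu> * c\<close> is then composed of five maps: subtract \<open>x\<close>,
      expand by the inverse of \<nu>, translate by \<open>\<mu> * c\<close> (induction hypothesis),
      contract by \<nu>, add \<open>x\<close>.\<close>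
    define k where "k = nat \<lfloor>u / \<gamma>\<rfloor>"
    have "real k = of_int \<lfloor>u / \<gamma>\<rfloor>" unfolding k_def using uv c by simp
    then have "real k \<le> u / \<gamma>" "u / \<gamma> < real k + 1" by linarith+
    then have k: "real k * \<gamma> \<le> u" "u < real k * \<gamma> + \<gamma>" using c by (simp_all add: field_simps)
    define x where "x = real k * \<gamma>"
    have x: "x \<in> \<Gamma>" "0 \<le> x" "x \<le> u" "u < x + \<gamma>" unfolding x_def using k c nat_mult_mem by auto
    define u0 v0 where "u0 = u - x" and "v0 = v - x"
    have uv0: "0 \<le> u0" "u0 < v0" "v0 < 2 * \<gamma>" "u0 \<in> \<Gamma>" "v0 \<in> \<Gamma>"
      unfolding u0_def v0_def using x uv small by (auto intro: diff_mem)
    let ?T = "\<lambda>c t. t + c :: real"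
    have g1: "good (?T (- x)) u v" and m1: "maps_into L (?T (- x)) u v"
    proof -
      show m1: "maps_into L (?T (- x)) u v" using uv x by (subst maps_trans) (auto intro: uminus_mem)
      have "maps_into L (?T x) (u - x) (v - x)" using uv x by (subst maps_trans) (auto intro: diff_mem)
      then have "good (?T x) (u - x) (v - x)" using good_trans_mult[OF \<gamma>_C] unfolding x_def by blast
      then show "good (?T (- x)) u v" by (rule good_trans_neg[OF x(1) m1])
    qed
    have v0\<nu>: "inverse \<nu> * v0 \<le> L / 2"
      using uv0 c n by (simp add: field_simps)
    have v0L: "v0 \<le> L" using uv x unfolding v0_def by simp
    have m2: "maps_into L (\<lambda>t. inverse \<nu> * t) u0 v0"
      using uv0 v0\<nu> v0L n L_pos by (subst maps_scale) (auto intro: inverse_slope)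
    have m3: "maps_into L (?T (\<mu> * c)) (inverse \<nu> * u0) (inverse \<nu> * v0)"
      using uv0 v0\<nu> c n by (subst maps_trans) (auto intro: mem_intros)
    have e4: "\<nu> * (inverse \<nu> * u0 + \<mu> * c) = u0 + \<nu> * \<mu> * c" "\<nu> * (inverse \<nu> * v0 + \<mu> * c) = v0 + \<nu> * \<mu> * c"
      using n by (simp_all add: algebra_simps)
    have m4: "maps_into L (\<lambda>t. \<nu> * t) (inverse \<nu> * u0 + \<mu> * c) (inverse \<nu> * v0 + \<mu> * c)"
    proof (subst maps_scale[OF n(1)], intro conjI)
      show "\<nu> * (inverse \<nu> * v0 + \<mu> * c) \<le> L" unfolding e4 using uv x by (simp add: v0_def)
    qed (use m3 n c uv0 in \<open>auto simp: maps_into_def intro: mem_intros\<close>)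
    have m5: "maps_into L (?T x) (u0 + \<nu> * \<mu> * c) (v0 + \<nu> * \<mu> * c)"
    proof (subst maps_trans[OF x(1)], intro conjI)
      show "v0 + \<nu> * \<mu> * c \<le> L" "v0 + \<nu> * \<mu> * c + x \<le> L" unfolding v0_def using uv x by simp_all
    qed (use uv0 n c x in \<open>auto intro: mem_intros\<close>)
    have g5: "good (?T x) (u0 + \<nu> * \<mu> * c) (v0 + \<nu> * \<mu> * c)"
      using good_trans_mult[OF \<gamma>_C] m5 unfolding x_def by blast
    have g4: "good (\<lambda>t. \<nu> * t) (inverse \<nu> * u0 + \<mu> * c) (inverse \<nu> * v0 + \<mu> * c)"
      by (rule good_scale_mon[OF n(7) m4])
    have g3: "good (?T (\<mu> * c)) (inverse \<nu> * u0) (inverse \<nu> * v0)"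
      by (rule mon_step.IH[OF mon_step.prems(1) m3])
    have g2: "good (\<lambda>t. inverse \<nu> * t) u0 v0" by (rule good_scale_inverse[OF n(7) m2])
    have chain: "maps_into L (h \<circ> g) p q \<and> good (h \<circ> g) p q"
      if "maps_into L g p q" "good g p q" "maps_into L h p' q'" "good h p' q'" "g p = p'" "g q = q'" for g h p q p' q'
      using that good_comp[of g p q h] unfolding maps_into_def by (auto intro: aff_comp)
    have c1: "maps_into L ((\<lambda>t. inverse \<nu> * t) \<circ> ?T (- x)) u v \<and> good ((\<lambda>t. inverse \<nu> * t) \<circ> ?T (- x)) u v"
      by (rule chain[OF m1 g1 m2 g2]) (simp_all add: u0_def v0_def)
    have c2: "maps_into L (?T (\<mu> * c) \<circ> ((\<lambda>t. inverse \<nu> * t) \<circ> ?T (- x))) u v \<and>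
        good (?T (\<mu> * c) \<circ> ((\<lambda>t. inverse \<nu> * t) \<circ> ?T (- x))) u v"
      by (rule chain[OF conjunct1[OF c1] conjunct2[OF c1] m3 g3]) (simp_all add: u0_def v0_def)
    have c3: "maps_into L ((\<lambda>t. \<nu> * t) \<circ> (?T (\<mu> * c) \<circ> ((\<lambda>t. inverse \<nu> * t) \<circ> ?T (- x)))) u v \<and>
        good ((\<lambda>t. \<nu> * t) \<circ> (?T (\<mu> * c) \<circ> ((\<lambda>t. inverse \<nu> * t) \<circ> ?T (- x)))) u v"
      by (rule chain[OF conjunct1[OF c2] conjunct2[OF c2] m4 g4]) (simp_all add: u0_def v0_def)
    have c4: "good (?T x \<circ> ((\<lambda>t. \<nu> * t) \<circ> (?T (\<mu> * c) \<circ> ((\<lambda>t. inverse \<nu> * t) \<circ> ?T (- x))))) u v"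
      using chain[OF conjunct1[OF c3] conjunct2[OF c3] m5 g5] e4 by (simp add: u0_def v0_def)
    have "?T x \<circ> ((\<lambda>t. \<nu> * t) \<circ> (?T (\<mu> * c) \<circ> ((\<lambda>t. inverse \<nu> * t) \<circ> ?T (- x)))) = ?T (\<nu> * \<mu> * c)"
      using n by (auto simp: fun_eq_iff field_simps)
    then show "good (?T (\<nu> * \<mu> * c)) u v" using c4 by simp
  qed
qed

text \<open>The factor \<open>\<nu>'\<close> makes the property stable under further contraction.
  This is what allows elements of \<Gamma> with different factors \<nu> to be added: all factors are
  multiplied together.\<close>

lemma good_trans_all:
  assumes "c \<in> \<Gamma>"
  shows "\<exists>\<nu>\<in>mon M. \<forall>\<nu>'\<in>mon M. \<forall>u v. maps_into L (\<lambda>t. t + \<nu>' * (\<nu> * c)) u v \<longrightarrow> good (\<lambda>t. t + \<nu>' * (\<nu> * c)) u v"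
proof -
  define S where "S = {c \<in> \<Gamma>. \<exists>\<nu>\<in>mon M. \<forall>\<nu>'\<in>mon M. \<forall>u v. maps_into L (\<lambda>t. t + \<nu>' * (\<nu> * c)) u v \<longrightarrow>
      good (\<lambda>t. t + \<nu>' * (\<nu> * c)) u v}"
  have "\<Gamma> \<subseteq> S"
  proof (rule C_gen)
    show "0 \<in> S" unfolding S_def using good_id mon_one zero_mem by (auto simp: id_def)
    show "C \<subseteq> S"
    proof
      fix c assume c: "c \<in> C"
      then show "c \<in> S" unfolding S_def using good_trans_mon[OF _ c] C_mem mon_one[of M]
        by (auto intro!: bexI[of _ 1])
    qed
    show "- x \<in> S" if x: "x \<in> S" for x
    proof -
      obtain \<nu> where n: "\<nu> \<in> mon M" "x \<in> \<Gamma>" "\<And>\<nu>' u v. \<nu>' \<in> mon M \<Longrightarrow> maps_into L (\<lambda>t. t + \<nu>' * (\<nu> * x)) u v \<Longrightarrow>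
        good (\<lambda>t. t + \<nu>' * (\<nu> * x)) u v" using x unfolding S_def by auto
      have "good (\<lambda>t. t + \<nu>' * (\<nu> * - x)) u v"
        if n': "\<nu>' \<in> mon M" and m: "maps_into L (\<lambda>t. t + \<nu>' * (\<nu> * - x)) u v" for \<nu>' u v
      proof -
        define y where "y = \<nu>' * (\<nu> * x)"
        have y: "y \<in> \<Gamma>" unfolding y_def using n n' mon_slope by (intro mem_intros) auto
        have e: "\<nu>' * (\<nu> * - x) = - y" unfolding y_def by simp
        have m': "maps_into L (\<lambda>t. t + - y) u v" using m unfolding e .
        then have "maps_into L (\<lambda>t. t + y) (u - y) (v - y)"
          using y unfolding maps_trans[OF y] maps_trans[OF uminus_mem[OF y]] by (auto intro: diff_mem)
        then have "good (\<lambda>t. t + y) (u - y) (v - y)" using n(3)[OF n'] unfolding y_def by blast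
        then show ?thesis unfolding e by (rule good_trans_neg[OF y m'])
      qed
      then show ?thesis unfolding S_def using n uminus_mem by auto
    qed
    show "\<mu> * x \<in> S" if \<mu>: "\<mu> \<in> \<Lambda>" and x: "x \<in> S" for \<mu> x
    proof -
      obtain \<nu> where n: "\<nu> \<in> mon M" "x \<in> \<Gamma>" "\<And>\<nu>' u v. \<nu>' \<in> mon M \<Longrightarrow> maps_into L (\<lambda>t. t + \<nu>' * (\<nu> * x)) u v \<Longrightarrow>
        good (\<lambda>t. t + \<nu>' * (\<nu> * x)) u v" using x unfolding S_def by auto
      obtain \<nu>1 \<nu>2 where n12: "\<nu>1 \<in> mon M" "\<nu>2 \<in> mon M" "\<mu> = \<nu>2 / \<nu>1" using M_gen[OF \<mu>] by blast
      have e: "\<nu>' * ((\<nu>1 * \<nu>) * (\<mu> * x)) = (\<nu>' * \<nu>2) * (\<nu> * x)" for \<nu>'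
        using mon_pos[OF n12(1)] unfolding n12(3) by simp
      show ?thesis unfolding S_def mem_Collect_eq
      proof (intro conjI bexI[of _ "\<nu>1 * \<nu>"] ballI allI impI)
        show "\<mu> * x \<in> \<Gamma>" using \<mu> n scale_mem by blast
        show "\<nu>1 * \<nu> \<in> mon M" using n n12 mon_mult by blast
        fix \<nu>' u v assume "\<nu>' \<in> mon M" "maps_into L (\<lambda>t. t + \<nu>' * ((\<nu>1 * \<nu>) * (\<mu> * x))) u v"
        then show "good (\<lambda>t. t + \<nu>' * ((\<nu>1 * \<nu>) * (\<mu> * x))) u v"
          unfolding e using n(3) mon_mult n12(2) by blast
      qed
    qed
    show "x + y \<in> S" if x: "x \<in> S" and y: "y \<in> S" for x y
    proof -
      obtain \<nu> where n: "\<nu> \<in> mon M" "x \<in> \<Gamma>" "\<And>\<nu>' u v. \<nu>' \<in> mon M \<Longrightarrow> maps_into L (\<lambda>t. t + \<nu>' * (\<nu> * x)) u v \<Longrightarrow>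
        good (\<lambda>t. t + \<nu>' * (\<nu> * x)) u v" using x unfolding S_def by auto
      obtain \<kappa> where k: "\<kappa> \<in> mon M" "y \<in> \<Gamma>" "\<And>\<nu>' u v. \<nu>' \<in> mon M \<Longrightarrow> maps_into L (\<lambda>t. t + \<nu>' * (\<kappa> * y)) u v \<Longrightarrow>
        good (\<lambda>t. t + \<nu>' * (\<kappa> * y)) u v" using y unfolding S_def by auto
      \<comment> \<open>\<rho> makes both translations shorter than \<open>L / 3\<close>.\<close>
      obtain \<rho> where r: "\<rho> \<in> mon M" "\<rho> < L / (3 * (\<bar>x\<bar> + \<bar>y\<bar> + 1))"
        using mon_small[of "L / (3 * (\<bar>x\<bar> + \<bar>y\<bar> + 1))"] L_pos by auto
      have "\<rho> * (3 * (\<bar>x\<bar> + \<bar>y\<bar> + 1)) < L" using r(2) by (simp add: pos_less_divide_eq)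
      then have r3: "3 * (\<rho> * \<bar>x\<bar>) + 3 * (\<rho> * \<bar>y\<bar>) + 3 * \<rho> < L" by (simp add: algebra_simps)
      have r0: "0 \<le> \<rho> * \<bar>x\<bar>" "0 \<le> \<rho> * \<bar>y\<bar>" "0 < \<rho>" using mon_pos[OF r(1)] by auto
      have r2: "3 * (\<rho> * \<bar>x\<bar>) < L" "3 * (\<rho> * \<bar>y\<bar>) < L" using r3 r0 by linarith+
      let ?\<nu> = "\<nu> * (\<kappa> * \<rho>)"
      show ?thesis unfolding S_def mem_Collect_eq
      proof (intro conjI bexI[of _ ?\<nu>] ballI allI impI)
        show "x + y \<in> \<Gamma>" by (rule add_mem[OF n(2) k(2)])
        show "?\<nu> \<in> mon M" by (intro mon_mult n(1) k(1) r(1))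
        fix \<nu>' p q assume n': "\<nu>' \<in> mon M" and m: "maps_into L (\<lambda>t. t + \<nu>' * (?\<nu> * (x + y))) p q"
        define x' y' where "x' = \<nu>' * (?\<nu> * x)" and "y' = \<nu>' * (?\<nu> * y)"
        have in\<Gamma>: "x' \<in> \<Gamma>" "y' \<in> \<Gamma>" unfolding x'_def y'_def
          by (intro scale_mem mult_slope mon_slope n(1,2) k(1,2) r(1) n')+
        have e: "\<nu>' * (?\<nu> * (x + y)) = x' + y'" unfolding x'_def y'_def by (simp add: algebra_simps)
        have small: "\<bar>x'\<bar> < L / 3" "\<bar>y'\<bar> < L / 3"
        proof -
          have "\<nu>' * \<nu> * \<kappa> \<in> mon M" by (intro mon_mult n(1) n' k(1))
          then have le: "\<nu>' * \<nu> * \<kappa> \<le> 1" "0 \<le> \<nu>' * \<nu> * \<kappa>" using mon_le mon_pos by (force intro: less_imp_le)+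
          have "\<bar>x'\<bar> = (\<nu>' * \<nu> * \<kappa>) * (\<rho> * \<bar>x\<bar>)" "\<bar>y'\<bar> = (\<nu>' * \<nu> * \<kappa>) * (\<rho> * \<bar>y\<bar>)"
            unfolding x'_def y'_def
            using mon_pos[OF n(1)] mon_pos[OF k(1)] mon_pos[OF r(1)] mon_pos[OF n'] by (simp_all add: abs_mult)
          moreover have "(\<nu>' * \<nu> * \<kappa>) * (\<rho> * \<bar>x\<bar>) \<le> \<rho> * \<bar>x\<bar>" "(\<nu>' * \<nu> * \<kappa>) * (\<rho> * \<bar>y\<bar>) \<le> \<rho> * \<bar>y\<bar>"
            using le r0 by (simp_all add: mult_left_le_one_le)
          ultimately show "\<bar>x'\<bar> < L / 3" "\<bar>y'\<bar> < L / 3" using r2 by linarith+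
        qed
        have gx: "good (\<lambda>t. t + x') u v" if "maps_into L (\<lambda>t. t + x') u v" for u v
        proof -
          have "\<nu>' * (\<kappa> * \<rho>) \<in> mon M" by (intro mon_mult n' k(1) r(1))
          moreover have "x' = (\<nu>' * (\<kappa> * \<rho>)) * (\<nu> * x)" unfolding x'_def by (simp add: ac_simps)
          ultimately show ?thesis using n(3) that by metis
        qed
        have gy: "good (\<lambda>t. t + y') u v" if "maps_into L (\<lambda>t. t + y') u v" for u v
        proof -
          have "\<nu>' * (\<nu> * \<rho>) \<in> mon M" by (intro mon_mult n' n(1) r(1))
          moreover have "y' = (\<nu>' * (\<nu> * \<rho>)) * (\<kappa> * y)" unfolding y'_def by (simp add: ac_simps)
          ultimately show ?thesis using k(3) that by metis
        qed
        show "good (\<lambda>t. t + \<nu>' * (?\<nu> * (x + y))) p q"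
          unfolding e
        proof (rule good_small)
          show "maps_into L (\<lambda>t. t + (x' + y')) p q" using m unfolding e .
          show "0 < L / 3" using L_pos by simp
          fix u v assume "maps_into L (\<lambda>t. t + (x' + y')) u v" and uv_small: "v - u < L / 3"
          then have uv: "u \<in> \<Gamma>" "v \<in> \<Gamma>" "u < v" "0 \<le> u" "v \<le> L" "0 \<le> u + (x' + y')" "v + (x' + y') \<le> L"
            using in\<Gamma> by (auto simp: maps_trans add_mem)
          show "good (\<lambda>t. t + (x' + y')) u v"
          \<comment> \<open>The intermediate interval must stay in \<open>[0, L)\<close>. If adding
            \<open>x'\<close> first leaves it on one side, then \<open>y'\<close> points to the
            other side, and the other order works because the interval and both shifts are shorter
            than \<open>L / 3\<close>.\<close>
          proof (cases "0 \<le> u + x' \<and> v + x' \<le> L")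
            case True
            then have m1: "maps_into L (\<lambda>t. t + x') u v" and m2: "maps_into L (\<lambda>t. t + y') (u + x') (v + x')"
              using uv in\<Gamma> by (auto simp: maps_trans add_mem algebra_simps)
            have "good ((\<lambda>t. t + y') \<circ> (\<lambda>t. t + x')) u v" using good_comp[OF m1 gx[OF m1] m2 gy[OF m2]] .
            then show ?thesis by (simp add: o_def algebra_simps)
          next
            case False
            then have "0 \<le> u + y' \<and> v + y' \<le> L"
              using uv uv_small small by (auto simp: abs_if split: if_splits)
            then have m1: "maps_into L (\<lambda>t. t + y') u v" and m2: "maps_into L (\<lambda>t. t + x') (u + y') (v + y')"
              using uv in\<Gamma> by (auto simp: maps_trans add_mem algebra_simps)
            have "good ((\<lambda>t. t + x') \<circ> (\<lambda>t. t + y')) u v" using good_comp[OF m1 gy[OF m1] m2 gx[OF m2]] .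
            then show ?thesis by (simp add: o_def algebra_simps)
          qed
        qed
      qed
    qed
  qed
  then show ?thesis using assms unfolding S_def by blast
qed

text \<open>The identity \<open>b * g t = a * t + d\<close>, with \<open>a\<close> and
  \<open>b\<close> in \<open>mon M\<close>, writes \<open>g\<close> as a contraction, a translation
  and an expansion. The common factor \<nu> of \<open>a\<close>, \<open>b\<close>, \<open>d\<close>
  is chosen so that the translation is good; as \<open>a\<close> and \<open>b\<close> are at most 1,
  no intermediate image leaves \<open>[0, L)\<close>.\<close>

theorem good_all:
  assumes "maps_into L g u v"
  shows "good g u v"
proof -
  have g: "g \<in> aff" and uv: "u \<in> \<Gamma>" "v \<in> \<Gamma>" "u < v" "0 \<le> u" "v \<le> L" "0 \<le> g u" "g v \<le> L"
    using assms unfolding maps_into_def by auto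
  obtain \<mu> c where e: "\<mu> \<in> \<Lambda>" "c \<in> \<Gamma>" "\<And>t. g t = \<mu> * t + c" using affE[OF g] by metis
  obtain \<nu>1 \<nu>2 where n: "\<nu>1 \<in> mon M" "\<nu>2 \<in> mon M" "\<mu> = \<nu>2 / \<nu>1" using M_gen[OF e(1)] by blast
  have "\<nu>1 * c \<in> \<Gamma>" using n mon_slope e scale_mem by blast
  then obtain \<nu> where \<nu>: "\<nu> \<in> mon M" "\<And>u v. maps_into L (\<lambda>t. t + 1 * (\<nu> * (\<nu>1 * c))) u v \<Longrightarrow>
      good (\<lambda>t. t + 1 * (\<nu> * (\<nu>1 * c))) u v"
    using good_trans_all mon_one by meson
  define d where "d = \<nu> * (\<nu>1 * c)"
  define a b where "a = \<nu> * \<nu>2" and "b = \<nu> * \<nu>1"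
  have ab: "a \<in> mon M" "b \<in> mon M" unfolding a_def b_def using n \<nu> mon_mult by auto
  then have ab': "a \<in> \<Lambda>" "b \<in> \<Lambda>" "0 < a" "0 < b" "a \<le> 1" "b \<le> 1" using mon_slope mon_pos mon_le by auto
  have d: "d \<in> \<Gamma>" unfolding d_def using \<nu> n e mon_slope by (auto intro!: mem_intros)
  have ag: "a * t + d = b * g t" for t
    unfolding a_def b_def d_def e(3) n(3) using mon_pos[OF n(1)] by (simp add: field_simps)
  have le: "a * v \<le> L" "b * g v \<le> L" "0 \<le> a * u" "0 \<le> b * g u"
  proof -
    show "a * v \<le> L" using mult_mono[of a 1 v L] ab' uv by simp
    have "g u < g v" using g uv by simp
    then show "b * g v \<le> L" using mult_mono[of b 1 "g v" L] ab' uv by simp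
  qed (use ab' uv in auto)
  have m1: "maps_into L (\<lambda>t. a * t) u v" using uv ab' le by (simp add: maps_scale)
  have m2: "maps_into L (\<lambda>t. t + d) (a * u) (a * v)"
    using uv ab' le d by (subst maps_trans) (auto simp: ag scale_mem)
  have m3: "maps_into L (\<lambda>t. inverse b * t) (b * g u) (b * g v)"
  proof -
    have le3: "inverse b * (b * g v) \<le> L" using ab' uv by (simp flip: mult.assoc)
    show ?thesis
      unfolding maps_scale[OF inverse_slope[OF ab'(2)]]
      by (intro conjI le3) (use uv ab' le g in \<open>auto intro: scale_mem\<close>)
  qed
  have g2: "good (\<lambda>t. t + d) (a * u) (a * v)" using \<nu>(2) m2 unfolding d_def by simp
  have "good ((\<lambda>t. t + d) \<circ> (\<lambda>t. a * t)) u v"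
    using good_comp[OF m1 good_scale_mon[OF ab(1) m1] m2 g2] .
  moreover have "maps_into L ((\<lambda>t. t + d) \<circ> (\<lambda>t. a * t)) u v"
    using m1 m2 unfolding maps_into_def by (auto intro: aff_comp)
  ultimately have "good ((\<lambda>t. inverse b * t) \<circ> ((\<lambda>t. t + d) \<circ> (\<lambda>t. a * t))) u v"
    using good_comp[of "(\<lambda>t. t + d) \<circ> (\<lambda>t. a * t)" u v "\<lambda>t. inverse b * t"] m3 good_scale_inverse[OF ab(2) m3]
    by (simp add: ag)
  moreover have "(\<lambda>t. inverse b * t) \<circ> ((\<lambda>t. t + d) \<circ> (\<lambda>t. a * t)) = g"
    using ab' by (simp add: fun_eq_iff ag)
  ultimately show ?thesis by simp
qed

end

section \<open>Finite generating data for slopes and translations\<close>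

context gamma_lambda
begin

text \<open>The last condition says that \<open>C\<close> generates \<Gamma> as a module over the
  ring spanned by \<Lambda>. It is stated through closed sets, the form in which
  \<open>good_trans_all\<close> applies it.\<close>

definition gen_data :: "real set \<Rightarrow> real set \<Rightarrow> bool" where
  "gen_data M C \<longleftrightarrow> finite M \<and> M \<subseteq> \<Lambda> \<and> (\<forall>\<nu>\<in>M. \<nu> < 1) \<and> (\<forall>\<mu>\<in>\<Lambda>. \<exists>\<nu>1\<in>mon M. \<exists>\<nu>2\<in>mon M. \<mu> = \<nu>2 / \<nu>1) \<and>
    finite C \<and> C \<noteq> {} \<and> C \<subseteq> \<Gamma> \<and> (\<forall>c\<in>C. 0 < c) \<and>
    (\<forall>S. 0 \<in> S \<longrightarrow> (\<forall>x\<in>S. \<forall>y\<in>S. x + y \<in> S) \<longrightarrow> (\<forall>x\<in>S. - x \<in> S) \<longrightarrow>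
      (\<forall>\<mu>\<in>\<Lambda>. \<forall>x\<in>S. \<mu> * x \<in> S) \<longrightarrow> C \<subseteq> S \<longrightarrow> \<Gamma> \<subseteq> S)"

text \<open>Multiplying \<open>C\<close> by a small slope does not change the module that it
  generates, because slopes are invertible in \<Lambda>.\<close>

lemma gen_data_small:
  assumes g: "gen_data M C" and "0 < \<epsilon>"
  obtains C' where "gen_data M C'" "\<forall>c\<in>C'. c < \<epsilon>"
proof -
  have fin: "finite C" "C \<noteq> {}" "C \<subseteq> \<Gamma>" "\<forall>c\<in>C. 0 < c" using g unfolding gen_data_def by blast+
  define m where "m = Max C"
  have m: "0 < m" "c \<le> m" if "c \<in> C" for c using fin Max_in[OF fin(1,2)] Max_ge[OF fin(1) that] unfolding m_def by auto
  have m0: "0 < m" using fin(2) m(1) by blast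
  obtain \<kappa> where k: "\<kappa> \<in> \<Lambda>" "0 < \<kappa>" "\<kappa> < \<epsilon> / m" using small_slope[of "\<epsilon> / m"] assms m0 by auto
  have km: "\<kappa> * m < \<epsilon>" using k m0 by (simp add: field_simps)
  have "\<Gamma> \<subseteq> S" if S: "0 \<in> S" "\<forall>x\<in>S. \<forall>y\<in>S. x + y \<in> S" "\<forall>x\<in>S. - x \<in> S" "\<forall>\<mu>\<in>\<Lambda>. \<forall>x\<in>S. \<mu> * x \<in> S"
    "(\<lambda>c. \<kappa> * c) ` C \<subseteq> S" for S
  proof -
    have "C \<subseteq> S"
    proof
      fix c assume "c \<in> C"
      then have "inverse \<kappa> * (\<kappa> * c) \<in> S" using S(4,5) inverse_slope[OF k(1)] by blast
      then show "c \<in> S" using k by (simp flip: mult.assoc)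
    qed
    then show ?thesis using g S unfolding gen_data_def by blast
  qed
  moreover have "(\<lambda>c. \<kappa> * c) ` C \<subseteq> \<Gamma>" "\<forall>c\<in>(\<lambda>c. \<kappa> * c) ` C. 0 < c"
    using fin k scale_mem[OF k(1)] by auto
  moreover note g[unfolded gen_data_def, THEN conjunct1]
    g[unfolded gen_data_def, THEN conjunct2, THEN conjunct1]
    g[unfolded gen_data_def, THEN conjunct2, THEN conjunct2, THEN conjunct1]
    g[unfolded gen_data_def, THEN conjunct2, THEN conjunct2, THEN conjunct2, THEN conjunct1]
  ultimately have "gen_data M ((\<lambda>c. \<kappa> * c) ` C)"
    using fin(1,2) unfolding gen_data_def by (intro conjI allI impI) (assumption | simp only: image_is_empty finite_imageI not_False_eq_True | blast)+
  moreover have "\<forall>c\<in>(\<lambda>c. \<kappa> * c) ` C. c < \<epsilon>"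
  proof
    fix x assume "x \<in> (\<lambda>c. \<kappa> * c) ` C"
    then obtain c where c: "c \<in> C" "x = \<kappa> * c" by blast
    then have "x \<le> \<kappa> * m" using m(2)[OF c(1)] k by simp
    then show "x < \<epsilon>" using km by simp
  qed
  ultimately show thesis by (rule that)
qed

end

subsection \<open>Three-cycles generated by germs\<close>

context stein
begin

text \<open>After cutting at the points of \<open>Q\<close>, each of the three intervals lies in
  \<open>U\<close> or in \<open>W\<close>. Two spare copies are taken from the overlap, so each
  interval forms with them a three-cycle inside one of the two sets, and \<open>cyc_join\<close>
  combines the three.\<close>

lemma cycs_Un:
  assumes H: "subgroup H PG" and U: "cycs U \<subseteq> H" and W: "cycs W \<subseteq> H"
    and pq: "p < q" "{p..<q} \<subseteq> U" "{p..<q} \<subseteq> W"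
    and Q: "finite Q" "Q \<subseteq> \<Gamma>" "\<And>u v. u < v \<Longrightarrow> {u<..<v} \<inter> Q = {} \<Longrightarrow> {u..<v} \<subseteq> U \<union> W \<Longrightarrow> {u..<v} \<subseteq> U \<or> {u..<v} \<subseteq> W"
  shows "cycs (U \<union> W) \<subseteq> H"
proof (rule cycs_le[OF H])
  fix a b c t assume abc: "a \<in> aff" "b \<in> aff" "c \<in> aff"
  let ?Q = "\<lambda>e. iv e ` Q"
  have av: "loc t (\<lambda>u v. {u<..<v} \<inter> ?Q e = {})" if "e \<in> aff" for e
    using Q(1,2) aff_iv[OF that] by (intro loc_avoid) auto
  have E: "finite {a, b, c}" "{a, b, c} \<subseteq> aff" using abc by auto
  note L = loc_conj[OF loc_rooms[OF E pq(1), where n = 2] loc_conj[OF av[OF abc(1)] loc_conj[OF av[OF abc(2)] av[OF abc(3)]]]]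
  show "loc t (\<lambda>u v. tri {u..<v} a b c \<longrightarrow> a ` {u..<v} \<union> b ` {u..<v} \<union> c ` {u..<v} \<subseteq> U \<union> W \<longrightarrow>
      cyc {u..<v} a b c \<in> H)"
  proof (rule loc_mono[OF L], intro impI, elim conjE exE)
    fix u v :: real and r :: "nat \<Rightarrow> real \<Rightarrow> real"
    let ?B = "{u..<v}"
    assume uv: "u \<in> \<Gamma>" "v \<in> \<Gamma>" "u < v" and t: "tri ?B a b c" and im: "a ` ?B \<union> b ` ?B \<union> c ` ?B \<subseteq> U \<union> W"
      and r: "\<forall>i<2::nat. r i \<in> aff \<and> r i ` ?B \<subseteq> {p..<q} \<and> (\<forall>e\<in>{a, b, c}. r i ` ?B \<inter> e ` ?B = {})"
      and rr: "\<forall>i<2. \<forall>j<2. i \<noteq> j \<longrightarrow> r i ` ?B \<inter> r j ` ?B = {}"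
      and avoid: "{u<..<v} \<inter> ?Q a = {}" "{u<..<v} \<inter> ?Q b = {}" "{u<..<v} \<inter> ?Q c = {}"
    note r_0 = mp[OF spec[OF r, of 0]] and r_1 = mp[OF spec[OF r, of 1]]
    have r0: "r 0 \<in> aff" "r 0 ` ?B \<subseteq> {p..<q}" and r1: "r 1 \<in> aff" "r 1 ` ?B \<subseteq> {p..<q}"
      using conjunct1[OF r_0] conjunct1[OF conjunct2[OF r_0]] conjunct1[OF r_1] conjunct1[OF conjunct2[OF r_1]]
      by simp_all
    have re: "r 0 ` ?B \<inter> e ` ?B = {}" "r 1 ` ?B \<inter> e ` ?B = {}" if "e \<in> {a, b, c}" for e
      using bspec[OF conjunct2[OF conjunct2[OF r_0]] that] bspec[OF conjunct2[OF conjunct2[OF r_1]] that] by simp_all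
    have r01: "r 0 ` ?B \<inter> r 1 ` ?B = {}" using rr[rule_format, of 0 1] by simp
    have one: "cyc ?B e (r 0) (r 1) \<in> H \<and> tri ?B e (r 0) (r 1)"
      if e: "e \<in> aff" "e \<in> {a, b, c}" "{u<..<v} \<inter> ?Q e = {}" "e ` ?B \<subseteq> U \<union> W" for e
    proof -
      have tr: "tri ?B e (r 0) (r 1)"
        unfolding tri_aff[OF e(1) r0(1) r1(1)] using re[OF e(2)] r01 by (simp add: Int_commute)
      have "{e u<..<e v} \<inter> Q = {}"
      proof (rule ccontr)
        assume "{e u<..<e v} \<inter> Q \<noteq> {}"
        then obtain x where x: "x \<in> Q" "e u < x" "x < e v" by auto
        then have "u < iv e x" "iv e x < v"
          using e(1) aff_less_iff[OF e(1), of u "iv e x"] aff_less_iff[OF e(1), of "iv e x" v] by auto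
        then show False using e(3) x(1) by auto
      qed
      then have "e ` ?B \<subseteq> U \<or> e ` ?B \<subseteq> W"
        using Q(3)[of "e u" "e v"] e uv by (simp add: aff_image)
      then have "cyc ?B e (r 0) (r 1) \<in> cycs U \<or> cyc ?B e (r 0) (r 1) \<in> cycs W"
        using cycsI[OF uv e(1) r0(1) r1(1) tr _ order_trans[OF r0(2) pq(2)] order_trans[OF r1(2) pq(2)]]
          cycsI[OF uv e(1) r0(1) r1(1) tr _ order_trans[OF r0(2) pq(3)] order_trans[OF r1(2) pq(3)]] by blast
      then show ?thesis using U W tr by blast
    qed
    have A: "cyc ?B a (r 0) (r 1) \<in> H \<and> tri ?B a (r 0) (r 1)" by (rule one) (use abc avoid im in auto)
    have B: "cyc ?B b (r 0) (r 1) \<in> H \<and> tri ?B b (r 0) (r 1)" by (rule one) (use abc avoid im in auto)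
    have C: "cyc ?B c (r 0) (r 1) \<in> H \<and> tri ?B c (r 0) (r 1)" by (rule one) (use abc avoid im in auto)
    show "cyc ?B a b c \<in> H"
      by (rule cyc_join[OF H dis5I[OF t conjunct2[OF A] conjunct2[OF B] conjunct2[OF C]]
        conjunct1[OF A] conjunct1[OF B] conjunct1[OF C]])
  qed
qed

end

text \<open>Copy 0 is \<open>[0, L)\<close> itself; the other four only provide room. Beside any
  three-cycle two copies remain free (\<open>other_copies\<close>).\<close>

locale charts = stein +
  fixes L :: real and \<theta> :: "nat \<Rightarrow> real \<Rightarrow> real" and H :: "(real \<Rightarrow> real) set"
  assumes L_mem: "L \<in> \<Gamma>" and L_pos: "0 < L" and L_less: "L < l"
    and \<theta>_0: "\<theta> 0 = id" and \<theta>_aff: "i < 5 \<Longrightarrow> \<theta> i \<in> aff" and \<theta>_into: "i < 5 \<Longrightarrow> \<theta> i ` {0..<L} \<subseteq> {0..<l}"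
    and \<theta>_disjoint: "i < 5 \<Longrightarrow> j < 5 \<Longrightarrow> i \<noteq> j \<Longrightarrow> \<theta> i ` {0..<L} \<inter> \<theta> j ` {0..<L} = {}"
    and H: "subgroup H PG"
begin

definition ok :: "real set \<Rightarrow> (real \<Rightarrow> real) \<Rightarrow> bool" where
  "ok K g \<longleftrightarrow> g \<in> aff \<and> g ` K \<subseteq> {0..<L}"

lemma copy_disjoint:
  assumes "a < 5" "b < 5" "a \<noteq> b" "ok K g" "ok K' h"
  shows "(\<theta> a \<circ> g) ` K \<inter> (\<theta> b \<circ> h) ` K' = {}"
  unfolding image_comp[symmetric]
  by (rule disjoint_subsets[OF \<theta>_disjoint[OF assms(1-3)]]) (use assms(4,5) in \<open>auto simp: ok_def intro!: image_mono\<close>)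

lemma copy_aff: "a < 5 \<Longrightarrow> ok K g \<Longrightarrow> \<theta> a \<circ> g \<in> aff"
  unfolding ok_def using \<theta>_aff aff_comp by blast

lemma tri_copies:
  assumes "a < 5" "b < 5" "c < 5" "a \<noteq> b" "a \<noteq> c" "b \<noteq> c" "ok K p" "ok K q" "ok K r"
  shows "tri K (\<theta> a \<circ> p) (\<theta> b \<circ> q) (\<theta> c \<circ> r)"
  unfolding tri_aff[OF copy_aff[OF assms(1,7)] copy_aff[OF assms(2,8)] copy_aff[OF assms(3,9)]]
  using copy_disjoint assms by simp

definition C3 :: "real set \<Rightarrow> nat \<Rightarrow> (real \<Rightarrow> real) \<Rightarrow> nat \<Rightarrow> (real \<Rightarrow> real) \<Rightarrow> nat \<Rightarrow> (real \<Rightarrow> real) \<Rightarrow> bool" where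
  "C3 K a p b q c r \<longleftrightarrow> a < 5 \<and> b < 5 \<and> c < 5 \<and> a \<noteq> b \<and> a \<noteq> c \<and> b \<noteq> c \<and> ok K p \<and> ok K q \<and> ok K r \<and>
    cyc K (\<theta> a \<circ> p) (\<theta> b \<circ> q) (\<theta> c \<circ> r) \<in> H"

lemma C3_tri: "C3 K a p b q c r \<Longrightarrow> tri K (\<theta> a \<circ> p) (\<theta> b \<circ> q) (\<theta> c \<circ> r)"
  unfolding C3_def using tri_copies by blast

lemma C3_rot:
  assumes "C3 K a p b q c r"
  shows "C3 K b q c r a p" "C3 K c r a p b q"
  using cyc_rot_mem[OF C3_tri[OF assms], of H] assms unfolding C3_def by simp_all

lemma C3_swap:
  assumes "C3 K a p b q c r"
  shows "C3 K a p c r b q"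
  using cyc_swap_mem[OF H C3_tri[OF assms]] assms unfolding C3_def by simp

text \<open>Conjugation by the second three-cycle replaces the entry \<open>q\<close> in copy
  \<open>b\<close> by \<open>s\<close> in copy \<open>d\<close>; it fixes the other two entries
  because they lie in other copies.\<close>

lemma C3_move:
  assumes A: "C3 K a p b q c r" and B: "C3 K b q d s e t" and ne: "a \<noteq> d" "a \<noteq> e" "c \<noteq> d" "c \<noteq> e"
  shows "C3 K a p d s c r"
proof -
  have *: "a < 5" "b < 5" "c < 5" "d < 5" "e < 5" "a \<noteq> b" "c \<noteq> b" "ok K p" "ok K q" "ok K r" "ok K s" "ok K t"
    using A B unfolding C3_def by auto
  have "cyc K (\<theta> a \<circ> p) (\<theta> d \<circ> s) (\<theta> c \<circ> r) \<in> H"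
  proof (rule cyc_conj_mem[OF H _ C3_tri[OF A]])
    show "cyc K (\<theta> b \<circ> q) (\<theta> d \<circ> s) (\<theta> e \<circ> t) \<in> H" "cyc K (\<theta> a \<circ> p) (\<theta> b \<circ> q) (\<theta> c \<circ> r) \<in> H"
      using A B unfolding C3_def by auto
    fix x assume x: "x \<in> K"
    show "cyc K (\<theta> b \<circ> q) (\<theta> d \<circ> s) (\<theta> e \<circ> t) ((\<theta> a \<circ> p) x) = (\<theta> a \<circ> p) x"
      by (rule cyc_fix[OF _ _ _ x]; rule copy_disjoint) (use * ne in simp_all)
    show "cyc K (\<theta> b \<circ> q) (\<theta> d \<circ> s) (\<theta> e \<circ> t) ((\<theta> c \<circ> r) x) = (\<theta> c \<circ> r) x"
      by (rule cyc_fix[OF _ _ _ x]; rule copy_disjoint) (use * ne in simp_all)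
    show "cyc K (\<theta> b \<circ> q) (\<theta> d \<circ> s) (\<theta> e \<circ> t) ((\<theta> b \<circ> q) x) = (\<theta> d \<circ> s) x"
      by (rule cyc_app(1)[OF C3_tri[OF B] x])
  qed
  then show ?thesis unfolding C3_def using * A B ne unfolding C3_def by auto
qed

text \<open>How \<open>H\<close> realizes \<open>g\<close> on \<open>K\<close>: the third copy is
  entered through \<open>g\<close>. For \<open>g = id\<close> it says that three-cycles can be
  restricted to \<open>K\<close> within \<open>H\<close> (\<open>good_Int\<close>). All triples of
  copies are demanded so that spare copies are interchangeable.\<close>

definition good :: "real set \<Rightarrow> (real \<Rightarrow> real) \<Rightarrow> bool" where
  "good K g \<longleftrightarrow> ok K g \<and> ok K id \<and>
    (\<forall>a b c. a < 5 \<longrightarrow> b < 5 \<longrightarrow> c < 5 \<longrightarrow> a \<noteq> b \<longrightarrow> a \<noteq> c \<longrightarrow> b \<noteq> c \<longrightarrow> C3 K a id b id c g)"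

lemma good_ok: "good K g \<Longrightarrow> ok K g" "good K g \<Longrightarrow> ok K id"
  unfolding good_def by (elim conjE, assumption)+

lemma ok_subset: "ok K g \<Longrightarrow> K' \<subseteq> K \<Longrightarrow> ok K' g"
  unfolding ok_def using image_mono by blast

lemma goodD: "good K g \<Longrightarrow> a < 5 \<Longrightarrow> b < 5 \<Longrightarrow> c < 5 \<Longrightarrow> a \<noteq> b \<Longrightarrow> a \<noteq> c \<Longrightarrow> b \<noteq> c \<Longrightarrow> C3 K a id b id c g"
  unfolding good_def by blast

lemma other_copies:
  assumes "a < 5" "b < 5" "c < (5::nat)"
  obtains d e where "d < 5" "e < 5" "d \<noteq> e" "d \<notin> {a, b, c}" "e \<notin> {a, b, c}"
proof -
  have "card ({..<5} - {a, b, c}) \<ge> card {..<5::nat} - card {a, b, c}" by (rule diff_card_le_card_Diff) simp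
  moreover have "card {a, b, c} \<le> 3" by (simp add: card_insert_if)
  ultimately have "2 \<le> card ({..<5} - {a, b, c})" by simp
  then obtain D where "D \<subseteq> {..<5} - {a, b, c}" "card D = 2" by (meson obtain_subset_with_card_n)
  then obtain d e where "D = {d, e}" "d \<noteq> e" by (meson card_2_iff)
  then show thesis using \<open>D \<subseteq> _\<close> by (intro that[of d e]) auto
qed

text \<open>With two entries \<open>g\<close> and one entry \<open>id\<close>, reindexing by
  \<open>g\<close> turns this into the condition on \<open>iv g\<close>.\<close>

lemma good_back:
  assumes g: "good K g" and abc: "a < 5" "b < 5" "c < 5" "a \<noteq> b" "a \<noteq> c" "b \<noteq> c"
  shows "C3 K a g b g c id"
proof -
  obtain d e where de: "d < 5" "e < 5" "d \<noteq> e" "d \<notin> {a, b, c}" "e \<notin> {a, b, c}" using other_copies[OF abc(1-3)] .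
  have 1: "C3 K c id d id a g" by (rule goodD[OF g]) (use abc de in auto)
  have 2: "C3 K d id b g e id" by (rule C3_swap, rule goodD[OF g]) (use abc de in auto)
  have "C3 K c id b g a g" by (rule C3_move[OF 1 2]) (use abc de in auto)
  then show ?thesis by (rule C3_rot(2)[OF C3_swap[OF C3_rot(1)]])
qed

lemma C3_reindex:
  assumes "g \<in> aff" "C3 (g ` K) a p b q c r"
  shows "C3 K a (p \<circ> g) b (q \<circ> g) c (r \<circ> g)"
  using cyc_reindex[OF aff_inj[OF assms(1)], of K "\<theta> a \<circ> p" "\<theta> b \<circ> q" "\<theta> c \<circ> r"] C3_tri[OF assms(2)] assms
  unfolding C3_def ok_def by (simp add: aff_comp image_comp comp_assoc)

lemma C3_reindex':
  assumes "g \<in> aff" "C3 K a (p \<circ> g) b (q \<circ> g) c (r \<circ> g)" "p \<in> aff" "q \<in> aff" "r \<in> aff"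
  shows "C3 (g ` K) a p b q c r"
proof -
  have *: "tri (g ` K) (\<theta> a \<circ> p) (\<theta> b \<circ> q) (\<theta> c \<circ> r)"
    unfolding tri_reindex[OF aff_inj[OF assms(1)]] using C3_tri[OF assms(2)] by (simp add: comp_assoc)
  show ?thesis
    using cyc_reindex[OF aff_inj[OF assms(1)] *] assms
    unfolding C3_def ok_def by (simp add: image_comp comp_assoc)
qed

lemma good_aff: "good K g \<Longrightarrow> g \<in> aff"
  using good_ok(1) unfolding ok_def by simp

lemma goodI:
  assumes "ok K g" "ok K id" "\<And>a b c. a < 5 \<Longrightarrow> b < 5 \<Longrightarrow> c < 5 \<Longrightarrow> a \<noteq> b \<Longrightarrow> a \<noteq> c \<Longrightarrow> b \<noteq> c \<Longrightarrow> C3 K a id b id c g"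
  shows "good K g"
  unfolding good_def using assms by blast

text \<open>The three-cycle for \<open>h\<close>, reindexed by \<open>g\<close>, has the entries
  \<open>h \<circ> g\<close>, \<open>g\<close>, \<open>g\<close>. Two conjugations by three-cycles
  for \<open>g\<close> turn the entries \<open>g\<close> into \<open>id\<close>.\<close>

lemma good_comp:
  assumes g: "good K g" and h: "good (g ` K) h"
  shows "good K (h \<circ> g)"
proof (rule goodI)
  have ga: "g \<in> aff" using g good_aff by blast
  show "ok K id" by (rule good_ok(2)[OF g])
  have "h \<in> aff" "h ` g ` K \<subseteq> {0..<L}" using good_ok(1)[OF h] unfolding ok_def by simp_all
  then show "ok K (h \<circ> g)" unfolding ok_def using aff_comp ga by (simp add: image_comp)
  fix a b c :: nat assume abc: "a < 5" "b < 5" "c < 5" "a \<noteq> b" "a \<noteq> c" "b \<noteq> c"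
  obtain d e where de: "d < 5" "e < 5" "d \<noteq> e" "d \<notin> {a, b, c}" "e \<notin> {a, b, c}" using other_copies[OF abc(1-3)] .
  have "C3 (g ` K) d id e id c h" by (rule goodD[OF h]) (use abc de in auto)
  then have 1: "C3 K c (h \<circ> g) d g e g" using C3_rot(2)[OF C3_reindex[OF ga, of K d id e id c h]] by simp
  have 2: "C3 K d g a id b id" by (rule C3_rot(2), rule goodD[OF g]) (use abc de in auto)
  have 3: "C3 K c (h \<circ> g) a id e g" by (rule C3_move[OF 1 2]) (use abc de in auto)
  have 4: "C3 K e g b id d id" by (rule C3_rot(2), rule goodD[OF g]) (use abc de in auto)
  show "C3 K a id b id c (h \<circ> g)" by (rule C3_move[OF C3_rot(1)[OF 3] 4]) (use abc de in auto)
qed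

lemma good_iv:
  assumes g: "good K g"
  shows "good (g ` K) (iv g)"
proof (rule goodI)
  have ga: "g \<in> aff" using g good_aff by blast
  have inv: "iv g \<circ> g = id" using ga by auto
  show "ok (g ` K) id" "ok (g ` K) (iv g)"
    using good_ok[OF g] ga unfolding ok_def by (simp_all add: aff_id aff_iv image_comp inv)
  fix a b c :: nat assume abc: "a < 5" "b < 5" "c < 5" "a \<noteq> b" "a \<noteq> c" "b \<noteq> c"
  show "C3 (g ` K) a id b id c (iv g)"
    by (rule C3_reindex'[OF ga]) (use good_back[OF g abc] inv ga in \<open>simp_all add: aff_id aff_iv\<close>)
qed

lemma good_image_id:
  assumes g: "good K g"
  shows "good (g ` K) id"
proof -
  have ga: "g \<in> aff" using g good_aff by blast
  have "iv g \<circ> g = id" "g \<circ> iv g = id" using ga by auto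
  then show ?thesis using good_comp[OF good_iv[OF g], of g] g by (simp add: image_comp)
qed

text \<open>The three-cycle for \<open>g\<close> over \<open>K\<close> and the one for
  \<open>id\<close> over \<open>K'\<close> share only copy \<open>a\<close>, so their commutator is
  a three-cycle over the intersection. All five copies are used.\<close>

lemma good_Int:
  assumes g: "good K g" and K': "good K' id"
  shows "good (K \<inter> K') g"
proof (rule goodI)
  have ok': "ok K g" "ok K id" "ok K' id" using good_ok[OF g] good_ok[OF K'] by simp_all
  show ok: "ok (K \<inter> K') g" "ok (K \<inter> K') id" using ok'(1,2) by (auto intro: ok_subset)
  fix a b c :: nat assume abc: "a < 5" "b < 5" "c < 5" "a \<noteq> b" "a \<noteq> c" "b \<noteq> c"
  obtain d e where de: "d < 5" "e < 5" "d \<noteq> e" "d \<notin> {a, b, c}" "e \<notin> {a, b, c}" using other_copies[OF abc(1-3)] .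
  have x: "C3 K a id c g d id" by (rule C3_swap, rule goodD[OF g]) (use abc de in auto)
  have y: "C3 K' a id b id e id" by (rule goodD[OF K']) (use abc de in auto)
  have dj: "(\<theta> i \<circ> p) ` K \<inter> (\<theta> j \<circ> q) ` K' = {}" if "i < 5" "j < 5" "i \<noteq> j" "ok K p" "ok K' q" for i j p q
    using copy_disjoint that by blast
  have D: "(\<theta> a \<circ> id) ` K \<inter> (\<theta> b \<circ> id) ` K' = {}" "(\<theta> a \<circ> id) ` K \<inter> (\<theta> e \<circ> id) ` K' = {}"
    "(\<theta> c \<circ> g) ` K \<inter> (\<theta> b \<circ> id) ` K' = {}" "(\<theta> c \<circ> g) ` K \<inter> (\<theta> e \<circ> id) ` K' = {}"
    "(\<theta> d \<circ> id) ` K \<inter> (\<theta> b \<circ> id) ` K' = {}" "(\<theta> d \<circ> id) ` K \<inter> (\<theta> e \<circ> id) ` K' = {}"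
    "(\<theta> c \<circ> g) ` K \<inter> (\<theta> a \<circ> id) ` K' = {}" "(\<theta> d \<circ> id) ` K \<inter> (\<theta> a \<circ> id) ` K' = {}"
    by (rule dj; use abc de ok' in auto)+
  have "comm (cyc K (\<theta> a \<circ> id) (\<theta> c \<circ> g) (\<theta> d \<circ> id)) (cyc K' (\<theta> a \<circ> id) (\<theta> b \<circ> id) (\<theta> e \<circ> id))
      = cyc (K \<inter> K') (\<theta> a \<circ> id) (\<theta> c \<circ> g) (\<theta> b \<circ> id)"
  proof (rule cyc_commutator[OF C3_tri[OF x] C3_tri[OF y]])
    show "inj_on (\<theta> a \<circ> id) (K \<union> K')" using \<theta>_aff[OF abc(1)] aff_inj by simp
    show "((\<theta> a \<circ> id) ` K \<union> (\<theta> c \<circ> g) ` K \<union> (\<theta> d \<circ> id) ` K) \<inter> ((\<theta> b \<circ> id) ` K' \<union> (\<theta> e \<circ> id) ` K') = {}"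
      by (simp only: Int_Un_distrib Int_Un_distrib2 D Un_empty simp_thms)
    show "((\<theta> c \<circ> g) ` K \<union> (\<theta> d \<circ> id) ` K) \<inter> (\<theta> a \<circ> id) ` K' = {}"
      by (simp only: Int_Un_distrib2 D Un_empty simp_thms)
  qed
  moreover have "cyc K (\<theta> a \<circ> id) (\<theta> c \<circ> g) (\<theta> d \<circ> id) \<in> H" "cyc K' (\<theta> a \<circ> id) (\<theta> b \<circ> id) (\<theta> e \<circ> id) \<in> H"
    using x y unfolding C3_def by blast+
  ultimately have "cyc (K \<inter> K') (\<theta> a \<circ> id) (\<theta> c \<circ> g) (\<theta> b \<circ> id) \<in> H"
    using sg_comp[OF H] sg_iv[OF H] by metis
  then have "C3 (K \<inter> K') a id c g b id" using abc ok unfolding C3_def by simp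
  then show "C3 (K \<inter> K') a id b id c g" by (rule C3_swap)
qed

lemma good_Un:
  assumes "good K g" "good K' g" "K \<inter> K' = {}"
  shows "good (K \<union> K') g"
proof (rule goodI)
  show ok: "ok (K \<union> K') g" "ok (K \<union> K') id" 
    using good_ok[OF assms(1)] good_ok[OF assms(2)] unfolding ok_def by (simp_all add: image_Un)
  fix a b c :: nat assume abc: "a < 5" "b < 5" "c < 5" "a \<noteq> b" "a \<noteq> c" "b \<noteq> c"
  have "cyc (K \<union> K') (\<theta> a \<circ> id) (\<theta> b \<circ> id) (\<theta> c \<circ> g) = cyc K (\<theta> a \<circ> id) (\<theta> b \<circ> id) (\<theta> c \<circ> g) \<circ>
      cyc K' (\<theta> a \<circ> id) (\<theta> b \<circ> id) (\<theta> c \<circ> g)"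
    by (rule cyc_union[OF tri_copies[OF abc ok(2,2,1)] assms(3)])
  then show "C3 (K \<union> K') a id b id c g"
    using goodD[OF assms(1) abc] goodD[OF assms(2) abc] ok sg_comp[OF H] unfolding C3_def by simp
qed

lemma good_Diff:
  assumes "good K g" "good K' g" "K' \<subseteq> K"
  shows "good (K - K') g"
proof (rule goodI)
  have okK: "ok K g" "ok K id" using good_ok[OF assms(1)] .
  show ok: "ok (K - K') g" "ok (K - K') id" by (rule ok_subset[OF okK(1)], blast) (rule ok_subset[OF okK(2)], blast)
  have K: "(K - K') \<union> K' = K" using assms(3) by blast
  fix a b c :: nat assume abc: "a < 5" "b < 5" "c < 5" "a \<noteq> b" "a \<noteq> c" "b \<noteq> c"
  let ?c = "\<lambda>K. cyc K (\<theta> a \<circ> id) (\<theta> b \<circ> id) (\<theta> c \<circ> g)"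
  have "?c K = ?c (K - K') \<circ> ?c K'"
    using cyc_union[of "K - K'" K' "\<theta> a \<circ> id" "\<theta> b \<circ> id" "\<theta> c \<circ> g"] tri_copies[OF abc okK(2,2,1)] K by auto
  moreover have in_H: "?c K \<in> H" "?c K' \<in> H"
    using goodD[OF assms(1) abc] goodD[OF assms(2) abc] unfolding C3_def by blast+
  ultimately have "?c (K - K') = ?c K \<circ> iv (?c K')"
    using sg_pw[OF H in_H(2)] by (simp add: comp_assoc iv_comp)
  then show "C3 (K - K') a id b id c g"
    using sg_comp[OF H in_H(1) sg_iv[OF H in_H(2)]] ok abc unfolding C3_def by simp
qed

lemma good_image:
  assumes "good D g" "K \<subseteq> D" "good K id"
  shows "good (g ` K) id"
  using good_image_id[OF good_Int[OF assms(1,3)]] assms(2) by (simp add: Int_absorb1)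

lemma good_empty: "good {} id"
  unfolding good_def C3_def ok_def using aff_id sg_id[OF H] by simp

text \<open>The hypotheses give \<open>good\<close> for each generator on one interval only, but
  \<open>germs\<close> needs closure under restriction, and \<open>good_Int\<close> provides it only
  for sets over which \<open>id\<close> is good. So \<open>germs\<close> is used twice: first to
  show that \<open>id\<close> is good over all \<Gamma>-intervals, then for arbitrary maps.\<close>

lemma cycs_le_of_gens:
  assumes gd: "gen_data M C"
    and small: "\<And>c. c \<in> C \<Longrightarrow> 2 * c \<le> L" "\<And>c \<nu>. c \<in> C \<Longrightarrow> \<nu> \<in> M \<Longrightarrow> 4 * c \<le> \<nu> * L"
    and gM: "\<And>\<nu>. \<nu> \<in> M \<Longrightarrow> good {0..<L} (\<lambda>t. \<nu> * t)"
    and gC: "\<And>c. c \<in> C \<Longrightarrow> good {0..<L - c} (\<lambda>t. t + c)" "\<And>c. c \<in> C \<Longrightarrow> good {0..<c} id"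
    and gL: "good {0..<L} id"
  shows "cycs {0..<L} \<subseteq> H"
proof -
  have M: "M \<subseteq> \<Lambda>" "\<And>\<nu>. \<nu> \<in> M \<Longrightarrow> \<nu> < 1" "\<And>\<mu>. \<mu> \<in> \<Lambda> \<Longrightarrow> \<exists>\<nu>1\<in>mon M. \<exists>\<nu>2\<in>mon M. \<mu> = \<nu>2 / \<nu>1"
    and C: "C \<noteq> {}" "C \<subseteq> \<Gamma>" "\<And>c. c \<in> C \<Longrightarrow> 0 < c"
    and gen: "\<And>S. \<lbrakk>0 \<in> S; \<And>x y. x \<in> S \<Longrightarrow> y \<in> S \<Longrightarrow> x + y \<in> S; \<And>x. x \<in> S \<Longrightarrow> - x \<in> S;
      \<And>\<mu> x. \<mu> \<in> \<Lambda> \<Longrightarrow> x \<in> S \<Longrightarrow> \<mu> * x \<in> S; C \<subseteq> S\<rbrakk> \<Longrightarrow> \<Gamma> \<subseteq> S"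
    using gd unfolding gen_data_def by auto
  obtain \<gamma> where \<gamma>: "\<gamma> \<in> C" using C(1) by blast
  define R where "R = {c. good {0..<c} id}"
  have sc: "(\<lambda>t. \<nu> * t) ` {u..<v} = {\<nu> * u..<\<nu> * v}" if "\<nu> \<in> \<Lambda>" for \<nu> u v
    using aff_image[OF aff_scale[OF that]] .
  have tr: "(\<lambda>t. t + c) ` {u..<v} = {u + c..<v + c}" if "c \<in> \<Gamma>" for c u v
    using aff_image[OF aff_trans[OF that]] .
  \<comment> \<open>The first use: the property of \<open>g\<close> is that it preserves and
    reflects membership in \<open>R\<close>. As a statement about points it restricts to
    subintervals by itself.\<close>
  interpret R: germs \<Gamma> \<Lambda> L \<gamma> M C "\<lambda>g u v. \<forall>c\<in>\<Gamma>. u \<le> c \<longrightarrow> c \<le> v \<longrightarrow> (c \<in> R \<longleftrightarrow> g c \<in> R)"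
  proof unfold_locales
    show "good_trans": "\<forall>x\<in>\<Gamma>. 0 \<le> x \<longrightarrow> x \<le> L - c \<longrightarrow> (x \<in> R) = (x + c \<in> R)" if c: "c \<in> C" for c
    proof (intro ballI impI)
      fix x assume x: "x \<in> \<Gamma>" "0 \<le> x" "x \<le> L - c"
      have cG: "c \<in> \<Gamma>" "0 < c" using c C by auto
      have im: "(\<lambda>t. t + c) ` {0..<x} = {c..<x + c}" using tr[OF cG(1), of 0 x] by simp
      have split: "{0..<x + c} = {0..<c} \<union> {c..<x + c}" "{0..<c} \<inter> {c..<x + c} = {}" "{0..<x + c} - {0..<c} = {c..<x + c}"
        using x cG by auto
      show "(x \<in> R) = (x + c \<in> R)"
      proof
        assume "x \<in> R"
        then have "good {c..<x + c} id"
          using good_image[OF gC(1)[OF c], of "{0..<x}"] x im unfolding R_def by simp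
        then show "x + c \<in> R" unfolding R_def using good_Un[OF gC(2)[OF c], of "{c..<x + c}"] split by simp
      next
        assume "x + c \<in> R"
        then have 1: "good {c..<x + c} id"
          using good_Diff[of "{0..<x + c}" id "{0..<c}"] gC(2)[OF c] split x unfolding R_def by auto
        have iv: "iv (\<lambda>t. t + c) ` {c..<x + c} = {0..<x}"
          unfolding im[symmetric] image_comp using iv_trans[of c] by (simp add: o_def)
        have "{c..<x + c} \<subseteq> (\<lambda>t. t + c) ` {0..<L - c}" using x by (simp add: tr[OF cG(1)])
        then show "x \<in> R" using good_image[OF good_iv[OF gC(1)[OF c]] _ 1] iv unfolding R_def by simp
      qed
    qed
    show "\<forall>x\<in>\<Gamma>. 0 \<le> x \<longrightarrow> x \<le> L \<longrightarrow> (x \<in> R) = (\<nu> * x \<in> R)" if n: "\<nu> \<in> M" for \<nu>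
    proof (intro ballI impI)
      fix x assume x: "x \<in> \<Gamma>" "0 \<le> x" "x \<le> L"
      have nG: "\<nu> \<in> \<Lambda>" "0 < \<nu>" using n M slope_pos by auto
      have im: "(\<lambda>t. \<nu> * t) ` {0..<x} = {0..<\<nu> * x}" using sc[OF nG(1), of 0 x] by simp
      show "(x \<in> R) = (\<nu> * x \<in> R)"
      proof
        assume "x \<in> R"
        then show "\<nu> * x \<in> R" using good_image[OF gM[OF n], of "{0..<x}"] x im unfolding R_def by simp
      next
        assume "\<nu> * x \<in> R"
        then have 1: "good {0..<\<nu> * x} id" unfolding R_def by simp
        have "iv (\<lambda>t. \<nu> * t) \<circ> (\<lambda>t. \<nu> * t) = id" using aff_scale[OF nG(1)] by (auto simp: fun_eq_iff)
        then have iv: "iv (\<lambda>t. \<nu> * t) ` {0..<\<nu> * x} = {0..<x}"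
          unfolding im[symmetric] image_comp by simp
        have "{0..<\<nu> * x} \<subseteq> (\<lambda>t. \<nu> * t) ` {0..<L}" using x nG by (simp add: sc[OF nG(1)] mult_left_mono)
        then show "x \<in> R" using good_image[OF good_iv[OF gM[OF n]] _ 1] iv unfolding R_def by simp
      qed
    qed
  next
    fix g u v assume m: "maps_into L g u v" and e: "\<forall>c\<in>\<Gamma>. u \<le> c \<longrightarrow> c \<le> v \<longrightarrow> (c \<in> R) = (g c \<in> R)"
    have g: "g \<in> aff" using m unfolding maps_into_def by blast
    show "\<forall>c\<in>\<Gamma>. g u \<le> c \<longrightarrow> c \<le> g v \<longrightarrow> (c \<in> R) = (iv g c \<in> R)"
    proof (intro ballI impI)
      fix c assume c: "c \<in> \<Gamma>" "g u \<le> c" "c \<le> g v"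
      have "iv g c \<in> \<Gamma>" "u \<le> iv g c" "iv g c \<le> v"
        using c g aff_le_iff[OF g, of u "iv g c"] aff_le_iff[OF g, of "iv g c" v] by (simp_all add: aff_iv)
      then show "(c \<in> R) = (iv g c \<in> R)" using e g by simp
    qed
  next
    fix g h u v assume m: "maps_into L g u v" and e: "\<forall>c\<in>\<Gamma>. u \<le> c \<longrightarrow> c \<le> v \<longrightarrow> (c \<in> R) = (g c \<in> R)"
      "\<forall>c\<in>\<Gamma>. g u \<le> c \<longrightarrow> c \<le> g v \<longrightarrow> (c \<in> R) = (h c \<in> R)"
    have g: "g \<in> aff" using m unfolding maps_into_def by blast
    show "\<forall>c\<in>\<Gamma>. u \<le> c \<longrightarrow> c \<le> v \<longrightarrow> (c \<in> R) = ((h \<circ> g) c \<in> R)"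
      using e g by simp
  next
    fix g u w v assume "\<forall>c\<in>\<Gamma>. u \<le> c \<longrightarrow> c \<le> v \<longrightarrow> (c \<in> R) = (g c \<in> R)" "\<forall>c\<in>\<Gamma>. v \<le> c \<longrightarrow> c \<le> w \<longrightarrow> (c \<in> R) = (g c \<in> R)"
    then show "\<forall>c\<in>\<Gamma>. u \<le> c \<longrightarrow> c \<le> w \<longrightarrow> (c \<in> R) = (g c \<in> R)" by (meson le_cases)
  next
    fix S assume "0 \<in> S" "\<And>x y. x \<in> S \<Longrightarrow> y \<in> S \<Longrightarrow> x + y \<in> S" "\<And>x. x \<in> S \<Longrightarrow> - x \<in> S"
      "\<And>\<mu> x. \<mu> \<in> \<Lambda> \<Longrightarrow> x \<in> S \<Longrightarrow> \<mu> * x \<in> S" "C \<subseteq> S"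
    then show "\<Gamma> \<subseteq> S" by (rule gen)
  qed (use L_mem L_pos M C small \<gamma> in simp_all)
  have R0: "0 \<in> R" unfolding R_def using good_empty by simp
  \<comment> \<open>0 lies in \<open>R\<close>, and the translation by \<open>c\<close> carries 0 to
    \<open>c\<close>. The case \<open>c = L\<close> is apart because the domain
    \<open>[0, L - c)\<close> would be empty.\<close>
  have R_all: "c \<in> R" if c: "c \<in> \<Gamma>" "0 \<le> c" "c \<le> L" for c
  proof (cases "c = L")
    case True then show ?thesis using gL unfolding R_def by simp
  next
    case False
    then have "maps_into L (\<lambda>t. t + c) 0 (L - c)"
      unfolding maps_into_def using c L_mem by (simp add: aff_trans zero_mem diff_mem)
    then have "\<forall>x\<in>\<Gamma>. 0 \<le> x \<longrightarrow> x \<le> L - c \<longrightarrow> (x \<in> R) = (x + c \<in> R)" by (rule R.good_all)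
    then show ?thesis using R0 zero_mem c by force
  qed
  have good_id: "good {u..<v} id" if "u \<in> \<Gamma>" "v \<in> \<Gamma>" "0 \<le> u" "u < v" "v \<le> L" for u v
  proof -
    have "good ({0..<v} - {0..<u}) id"
      by (rule good_Diff) (use R_all[of u] R_all[of v] that in \<open>auto simp: R_def\<close>)
    moreover have "{0..<v} - {0..<u} = {u..<v}" using that by auto
    ultimately show ?thesis by simp
  qed
  interpret G: germs \<Gamma> \<Lambda> L \<gamma> M C "\<lambda>g u v. good {u..<v} g"
  proof unfold_locales
    fix u v assume "maps_into L id u v"
    then show "good {u..<v} id" unfolding maps_into_def by (intro good_id) auto
  next
    fix g u v u' v' assume "maps_into L g u v" "good {u..<v} g" "u \<le> u'" "u' < v'" "v' \<le> v" "u' \<in> \<Gamma>" "v' \<in> \<Gamma>"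
    moreover from this have "good {u'..<v'} id" unfolding maps_into_def by (intro good_id) auto
    moreover have "{u..<v} \<inter> {u'..<v'} = {u'..<v'}" using calculation by auto
    ultimately show "good {u'..<v'} g" using good_Int by metis
  next
    fix g u w v assume "u < v" "v < w" "good {u..<v} g" "good {v..<w} g"
    moreover have "{u..<v} \<union> {v..<w} = {u..<w}" "{u..<v} \<inter> {v..<w} = {}" using calculation by auto
    ultimately show "good {u..<w} g" using good_Un by metis
  next
    fix g h u v assume m: "maps_into L g u v" "good {u..<v} g" "good {g u..<g v} h"
    have "g \<in> aff" using m unfolding maps_into_def by blast
    then show "good {u..<v} (h \<circ> g)" using good_comp[OF m(2)] m(3) by (simp add: aff_image)
  next
    fix g u v assume m: "maps_into L g u v" "good {u..<v} g"
    have "g \<in> aff" using m unfolding maps_into_def by blast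
    then show "good {g u..<g v} (iv g)" using good_iv[OF m(2)] by (simp add: aff_image)
  next
    fix S assume "0 \<in> S" "\<And>x y. x \<in> S \<Longrightarrow> y \<in> S \<Longrightarrow> x + y \<in> S" "\<And>x. x \<in> S \<Longrightarrow> - x \<in> S"
      "\<And>\<mu> x. \<mu> \<in> \<Lambda> \<Longrightarrow> x \<in> S \<Longrightarrow> \<mu> * x \<in> S" "C \<subseteq> S"
    then show "\<Gamma> \<subseteq> S" by (rule gen)
  qed (use L_mem L_pos M C small \<gamma> gM gC in simp_all)
  show ?thesis
  proof
    fix z assume "z \<in> cycs {0..<L}"
    then show "z \<in> H"
    proof cases
      case (cycsI u v a b c)
      let ?K = "{a u..<a v}"
      \<comment> \<open>With the first interval itself as base, the first map becomes
        \<open>id\<close>; the copies 1 and 2 then serve as the spare sets of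
        \<open>cyc_join\<close>.\<close>
      define p q where "p = b \<circ> iv a" and "q = c \<circ> iv a"
      have pq: "p \<in> aff" "q \<in> aff" unfolding p_def q_def using cycsI aff_comp aff_iv by auto
      have comps: "p \<circ> a = b" "q \<circ> a = c" unfolding p_def q_def using cycsI(5) by (auto simp: fun_eq_iff)
      then have pa: "p (a x) = b x" "q (a x) = c x" for x by (metis comp_apply)+
      have bounds: "0 \<le> a u" "a v \<le> L" "0 \<le> b u" "b v \<le> L" "0 \<le> c u" "c v \<le> L"
        using cycsI by (simp_all add: aff_subset_iff)
      have K: "a ` {u..<v} = ?K" using aff_image[OF cycsI(5)] .
      have mem: "a u \<in> \<Gamma>" "a v \<in> \<Gamma>" "a u < a v" using cycsI by simp_all
      have gp: "good ?K p" and gq: "good ?K q"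
        using G.good_all[of p "a u" "a v"] G.good_all[of q "a u" "a v"] pq mem bounds
        unfolding maps_into_def by (simp_all add: pa)
      have gi: "good ?K id" using good_id mem bounds by simp
      have tri: "tri ?K id p q"
        using cycsI(8) tri_reindex[OF aff_inj[OF cycsI(5)], of "{u..<v}" id p q] K comps by simp
      have "cyc ?K id p q \<in> H"
      proof (rule cyc_join[OF H])
        have 1: "C3 ?K 0 id 1 id 2 id" by (rule goodD[OF gi]) simp_all
        have 2: "C3 ?K 0 p 1 id 2 id" by (rule C3_rot(2), rule goodD[OF gp]) simp_all
        have 3: "C3 ?K 0 q 1 id 2 id" by (rule C3_rot(2), rule goodD[OF gq]) simp_all
        show "dis5 ?K id p q (\<theta> 1) (\<theta> 2)"
          using dis5I[OF tri, of "\<theta> 1" "\<theta> 2"] C3_tri[OF 1] C3_tri[OF 2] C3_tri[OF 3] by (simp add: \<theta>_0)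
        show "cyc ?K id (\<theta> 1) (\<theta> 2) \<in> H" "cyc ?K p (\<theta> 1) (\<theta> 2) \<in> H" "cyc ?K q (\<theta> 1) (\<theta> 2) \<in> H"
          using 1 2 3 unfolding C3_def by (simp_all add: \<theta>_0)
      qed
      moreover have "cyc ?K id p q = cyc {u..<v} a b c"
        using cyc_reindex[OF aff_inj[OF cycsI(5)], of "{u..<v}" id p q] tri comps by (simp add: K)
      ultimately show ?thesis using cycsI(1) by simp
    qed
  qed
qed

end

section \<open>Finite generation of the alternating subgroup\<close>

context stein
begin

text \<open>Conjugation by \<open>h\<close> gives the three-cycles at the right end. The two sets
  overlap in \<open>[p, L)\<close>, so \<open>cycs_Un\<close> joins them.\<close>

lemma alt_le_of_two:
  assumes H: "subgroup H PG" and h: "h \<in> H" and U: "cycs {0..<L} \<subseteq> H" and L: "L \<in> \<Gamma>" "0 < p" "p < L" "L < l"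
    and sub: "{p..<l} \<subseteq> h ` {0..<L}"
  shows "alt \<subseteq> H"
proof -
  have "cycs (h ` {0..<L}) \<subseteq> H" by (rule conj_cycs_mem[OF H h U]) (use L in auto)
  then have W: "cycs {p..<l} \<subseteq> H" using cycs_mono[OF sub] by blast
  have "cycs ({0..<L} \<union> {p..<l}) \<subseteq> H"
  proof (rule cycs_Un[OF H U W, of p L "{L}"])
    fix u v :: real assume *: "u < v" "{u<..<v} \<inter> {L} = {}" "{u..<v} \<subseteq> {0..<L} \<union> {p..<l}"
    have X: "{0..<L} \<union> {p..<l} = {0..<l}" using L by auto
    have "0 \<le> u" "v \<le> l" using *(1,3) unfolding X by auto
    moreover have "v \<le> L \<or> L \<le> u" using *(1,2) by auto
    ultimately show "{u..<v} \<subseteq> {0..<L} \<or> {u..<v} \<subseteq> {p..<l}" using L by auto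
  qed (use L in auto)
  moreover have "{0..<L} \<union> {p..<l} = {0..<l}" using L by auto
  ultimately show ?thesis using alt_le[OF H] by simp
qed

theorem alt_finitely_generated:
  assumes gd0: "gen_data M C0"
  obtains T where "finite T" "T \<subseteq> cycs {0..<l}" "\<forall>H. subgroup H PG \<longrightarrow> T \<subseteq> H \<longrightarrow> alt \<subseteq> H"
proof -
  \<comment> \<open>Four strips of width \<open>m = \<mu> * l\<close> at the right end are reserved
    for the copies 1 to 4; a slope below 1/8 leaves more than half of the interval for
    \<open>[0, L)\<close>.\<close>
  obtain \<mu> where \<mu>: "\<mu> \<in> \<Lambda>" "0 < \<mu>" "\<mu> < 1 / 8" using small_slope[of "1 / 8"] by auto
  define m where "m = \<mu> * l"
  have m: "m \<in> \<Gamma>" "0 < m" "8 * m < l" unfolding m_def using \<mu> l_mem l_pos scale_mem by auto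
  define L where "L = l - 4 * m"
  have m4: "4 * m \<in> \<Gamma>" using nat_mult_mem[OF m(1), of 4] by simp
  have L: "L \<in> \<Gamma>" "0 < L" "L < l" "\<mu> * L \<le> m" unfolding L_def m_def
    using diff_mem[OF l_mem m4] m \<mu> l_pos unfolding m_def by auto
  define \<theta> where "\<theta> i = (if i = 0 then id else (\<lambda>t. \<mu> * t + (L + real (i - 1) * m)))" for i :: nat
  have \<theta>_aff: "\<theta> i \<in> aff" for i
    unfolding \<theta>_def using affI[OF \<mu>(1) add_mem[OF L(1) nat_mult_mem[OF m(1), of "i - 1"]]] aff_id
    by presburger
  have \<theta>_im: "\<theta> i ` {0..<L} \<subseteq> {L + real (i - 1) * m..<L + real i * m}" if "0 < i" for i
  proof -
    have "real i * m = real (i - 1) * m + m" using that by (simp add: of_nat_diff algebra_simps)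
    then show ?thesis
      using that L(4) unfolding aff_image[OF \<theta>_aff] unfolding \<theta>_def by simp
  qed
  have \<theta>_into: "\<theta> i ` {0..<L} \<subseteq> {L..<l}" if "0 < i" "i < 5" for i
  proof -
    have "real i * m \<le> 4 * m" using that m by (intro mult_right_mono) auto
    moreover have "0 \<le> real (i - 1) * m" using m by simp
    ultimately have "{L + real (i - 1) * m..<L + real i * m} \<subseteq> {L..<l}" unfolding L_def by auto
    then show ?thesis using \<theta>_im[OF that(1)] by blast
  qed
  have \<theta>_lt: "\<theta> i ` {0..<L} \<inter> \<theta> j ` {0..<L} = {}" if "i < j" "j < 5" for i j
  proof (cases "i = 0")
    case True
    have "{0..<L} \<inter> {L..<l} = {}" by auto
    then have "{0..<L} \<inter> \<theta> j ` {0..<L} = {}"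
      by (rule disjoint_subsets[OF _ order_refl \<theta>_into]) (use that True in auto)
    moreover have "\<theta> i = id" using True by (simp add: \<theta>_def)
    ultimately show ?thesis by simp
  next
    case False
    have "real i * m \<le> real (j - 1) * m" using that m by (intro mult_right_mono) auto
    then have "{L + real (i - 1) * m..<L + real i * m} \<inter> {L + real (j - 1) * m..<L + real j * m} = {}" by auto
    then show ?thesis by (rule disjoint_subsets) (use \<theta>_im[of i] \<theta>_im[of j] False that in auto)
  qed
  have charts: "charts \<Gamma> \<Lambda> l L \<theta> H" if "subgroup H PG" for H
  proof (intro charts.intro[OF stein_axioms] charts_axioms.intro)
    show "\<theta> i ` {0..<L} \<inter> \<theta> j ` {0..<L} = {}" if "i < 5" "j < 5" "i \<noteq> j" for i j
      using \<theta>_lt[of i j] \<theta>_lt[of j i] that by (cases "i < j") (auto simp: Int_commute)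
    show "\<theta> i ` {0..<L} \<subseteq> {0..<l}" if "i < 5" for i
    proof (cases "i = 0")
      case True then show ?thesis using L by (auto simp: \<theta>_def)
    next
      case False
      have "{L..<l} \<subseteq> {0..<l}" using L by auto
      then show ?thesis using \<theta>_into[of i] False that by auto
    qed
    show "\<theta> 0 = id" by (simp add: \<theta>_def)
  qed (use L \<theta>_aff that in auto)
  \<comment> \<open>The bound that the size conditions of \<open>cycs_le_of_gens\<close> impose on
    the elements of \<open>C\<close>.\<close>
  define \<epsilon> where "\<epsilon> = Min (insert (L / 2) ((\<lambda>\<nu>. \<nu> * L / 4) ` M))"
  have M: "finite M" "M \<subseteq> \<Lambda>" "\<forall>\<nu>\<in>M. \<nu> < 1"
    using gd0[unfolded gen_data_def, THEN conjunct1]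
      gd0[unfolded gen_data_def, THEN conjunct2, THEN conjunct1]
      gd0[unfolded gen_data_def, THEN conjunct2, THEN conjunct2, THEN conjunct1] .
  have \<epsilon>: "0 < \<epsilon>" "\<epsilon> \<le> L / 2" "\<And>\<nu>. \<nu> \<in> M \<Longrightarrow> \<epsilon> \<le> \<nu> * L / 4"
  proof -
    have fin: "finite (insert (L / 2) ((\<lambda>\<nu>. \<nu> * L / 4) ` M))" using M by simp
    show "0 < \<epsilon>" unfolding \<epsilon>_def using M L slope_pos by (subst Min_gr_iff[OF fin]) auto
    show "\<epsilon> \<le> L / 2" unfolding \<epsilon>_def by (rule Min_le[OF fin]) simp
    show "\<epsilon> \<le> \<nu> * L / 4" if "\<nu> \<in> M" for \<nu> unfolding \<epsilon>_def by (rule Min_le[OF fin]) (intro insertI2 image_eqI[OF refl that])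
  qed
  obtain C where gd: "gen_data M C" and Cs: "\<forall>c\<in>C. c < \<epsilon>" using gen_data_small[OF gd0 \<epsilon>(1)] .
  have C: "finite C" "C \<subseteq> \<Gamma>" "\<And>c. c \<in> C \<Longrightarrow> 0 < c"
    using gd unfolding gen_data_def by simp_all
  define F where "F = insert (L, id) ((\<lambda>c. (L - c, \<lambda>t. t + c)) ` C \<union> (\<lambda>c. (c, id)) ` C \<union> (\<lambda>\<nu>. (L, \<lambda>t. \<nu> * t)) ` M)"
  have F: "finite F" unfolding F_def using C M by simp
  have Fd: "d \<in> \<Gamma> \<and> 0 < d \<and> d \<le> L \<and> g \<in> aff \<and> g ` {0..<d} \<subseteq> {0..<L}" if "(d, g) \<in> F" for d g
  proof -
    have "d = L \<and> g = id \<or> (\<exists>c\<in>C. d = L - c \<and> g = (\<lambda>t. t + c)) \<or> (\<exists>c\<in>C. d = c \<and> g = id) \<or>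
        (\<exists>\<nu>\<in>M. d = L \<and> g = (\<lambda>t. \<nu> * t))"
      using that unfolding F_def by (simp only: insert_iff Un_iff image_iff prod.inject disj_assoc)
    then show ?thesis
    proof (elim disjE bexE conjE)
      assume "d = L" "g = id"
      then show ?thesis using L aff_id by simp
    next
      fix c assume "c \<in> C" and dg: "d = L - c" "g = (\<lambda>t. t + c)"
      then have "c \<in> \<Gamma>" "0 < c" "c < L" using C Cs \<epsilon> by force+
      then show ?thesis using dg L aff_trans[of c] aff_image[OF aff_trans[of c]] by (simp add: diff_mem)
    next
      fix c assume "c \<in> C" and dg: "d = c" "g = id"
      then have "c \<in> \<Gamma>" "0 < c" "c < L" using C Cs \<epsilon> by force+
      then show ?thesis using dg aff_id by simp
    next
      fix \<nu> assume "\<nu> \<in> M" and dg: "d = L" "g = (\<lambda>t. \<nu> * t)"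
      then have "\<nu> \<in> \<Lambda>" "0 < \<nu>" "\<nu> < 1" using M slope_pos by auto
      then show ?thesis using dg L aff_scale[of \<nu>] aff_image[OF aff_scale[of \<nu>], of 0 L] by simp
    qed
  qed
  define A where "A = {(a, b, c). a < (5::nat) \<and> b < (5::nat) \<and> c < (5::nat) \<and> a \<noteq> b \<and> a \<noteq> c \<and> b \<noteq> c}"
  have "finite A" by (rule finite_subset[of _ "{..<5} \<times> {..<5} \<times> {..<5}"]) (auto simp: A_def)
  define T where "T = (\<lambda>((d, g), (a, b, c)). cyc {0..<d} (\<theta> a \<circ> id) (\<theta> b \<circ> id) (\<theta> c \<circ> g)) ` (F \<times> A)"
  have T_fin: "finite T" unfolding T_def using F \<open>finite A\<close> by simp
  have T_mem: "cyc {0..<d} (\<theta> a \<circ> id) (\<theta> b \<circ> id) (\<theta> c \<circ> g) \<in> T"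
    if "(d, g) \<in> F" "a < 5" "b < 5" "c < 5" "a \<noteq> b" "a \<noteq> c" "b \<noteq> c" for d g a b c
    unfolding T_def A_def using that by force
  interpret P: charts \<Gamma> \<Lambda> l L \<theta> pw
    by (rule charts) (use group.subgroup_self[OF group_PG] in simp)
  have okF: "P.ok {0..<d} g" "P.ok {0..<d} id" if "(d, g) \<in> F" for d g
    using Fd[OF that] aff_id unfolding P.ok_def by auto
  have T_cycs: "T \<subseteq> cycs {0..<l}"
  proof
    fix z assume "z \<in> T"
    then obtain d g a b c where z: "z = cyc {0..<d} (\<theta> a \<circ> id) (\<theta> b \<circ> id) (\<theta> c \<circ> g)" and dg: "(d, g) \<in> F"
      and abc: "a < 5" "b < 5" "c < 5" "a \<noteq> b" "a \<noteq> c" "b \<noteq> c"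
      unfolding T_def A_def by force
    have into: "(\<theta> i \<circ> p) ` {0..<d} \<subseteq> {0..<l}" if "i < 5" "P.ok {0..<d} p" for i p
    proof -
      have "(\<theta> i \<circ> p) ` {0..<d} \<subseteq> \<theta> i ` {0..<L}"
        using that(2) unfolding P.ok_def image_comp[symmetric] by (intro image_mono) simp
      then show ?thesis using P.\<theta>_into[OF that(1)] by (rule order_trans)
    qed
    note ok = okF[OF dg]
    show "z \<in> cycs {0..<l}" unfolding z
      by (rule cycsI[OF zero_mem _ _ P.copy_aff[OF abc(1) ok(2)] P.copy_aff[OF abc(2) ok(2)] P.copy_aff[OF abc(3) ok(1)]
        P.tri_copies[OF abc ok(2,2,1)] into[OF abc(1) ok(2)] into[OF abc(2) ok(2)] into[OF abc(3) ok(1)]])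
        (use Fd[OF dg] in auto)
  qed
  \<comment> \<open>\<open>h\<close> permutes the strip \<open>[L, l)\<close> and two copies
    \<open>[0, k)\<close> and \<open>[k, 2 * k)\<close> of it, carrying the second copy onto the
    strip. Thus the image of \<open>[0, L)\<close> contains \<open>[2 * k, l)\<close>, and
    \<open>3 * k < L\<close> leaves an overlap of the two sets.\<close>
  obtain \<kappa> where \<kappa>: "\<kappa> \<in> \<Lambda>" "0 < \<kappa>" "\<kappa> < L / (3 * (l - L))" using small_slope[of "L / (3 * (l - L))"] L by auto
  define k where "k = \<kappa> * (l - L)"
  have k: "k \<in> \<Gamma>" "0 < k" "3 * k < L"
    using scale_mem[OF \<kappa>(1) diff_mem[OF l_mem L(1)]] \<kappa> L unfolding k_def by (simp_all add: field_simps)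
  define r s where "r = (\<lambda>t. \<kappa> * t + (- (\<kappa> * L)))" and "s = (\<lambda>t. \<kappa> * t + (k - \<kappa> * L))"
  have rs: "r \<in> aff" "s \<in> aff" unfolding r_def s_def
    by (rule affI[OF \<kappa>(1) uminus_mem[OF scale_mem[OF \<kappa>(1) L(1)]]],
        rule affI[OF \<kappa>(1) diff_mem[OF k(1) scale_mem[OF \<kappa>(1) L(1)]]])
  have r_im: "r ` {L..<l} = {0..<k}" unfolding aff_image[OF rs(1)] unfolding r_def k_def by (simp add: algebra_simps)
  have s_im: "s ` {L..<l} = {k..<2 * k}" unfolding aff_image[OF rs(2)] unfolding s_def k_def by (simp add: algebra_simps)
  have t: "tri {L..<l} id r s" unfolding tri_aff[OF aff_id rs] r_im s_im using k by auto
  define h where "h = cyc {L..<l} id r s"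
  have h_cycs: "h \<in> cycs {0..<l}" unfolding h_def
    by (rule cycsI[OF L(1) l_mem L(3) aff_id rs t]) (use r_im s_im L k in auto)
  show thesis
  proof (rule that[of "insert h T"])
    show "finite (insert h T)" "insert h T \<subseteq> cycs {0..<l}" using T_fin T_cycs h_cycs by auto
    show "\<forall>H. subgroup H PG \<longrightarrow> insert h T \<subseteq> H \<longrightarrow> alt \<subseteq> H"
    proof (intro allI impI)
      fix H assume H: "subgroup H PG" and TH: "insert h T \<subseteq> H"
      interpret Q: charts \<Gamma> \<Lambda> l L \<theta> H by (rule charts[OF H])
      have good: "Q.good {0..<d} g" if dg: "(d, g) \<in> F" for d g
      proof (rule Q.goodI)
        show ok: "Q.ok {0..<d} g" "Q.ok {0..<d} id" using okF[OF dg] unfolding P.ok_def Q.ok_def by auto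
        fix a b c :: nat assume abc: "a < 5" "b < 5" "c < 5" "a \<noteq> b" "a \<noteq> c" "b \<noteq> c"
        show "Q.C3 {0..<d} a id b id c g"
          unfolding Q.C3_def using T_mem[OF dg abc] TH ok abc by blast
      qed
      have "cycs {0..<L} \<subseteq> H"
      proof (rule Q.cycs_le_of_gens[OF gd])
        show "2 * c \<le> L" if "c \<in> C" for c using that Cs \<epsilon> by force
        show "4 * c \<le> \<nu> * L" if "c \<in> C" "\<nu> \<in> M" for c \<nu> using that Cs \<epsilon>(3)[of \<nu>] by force
        show "Q.good {0..<L} (\<lambda>t. \<nu> * t)" if "\<nu> \<in> M" for \<nu> by (rule good) (use that in \<open>simp add: F_def\<close>)
        show "Q.good {0..<L - c} (\<lambda>t. t + c)" if "c \<in> C" for c by (rule good) (use that in \<open>simp add: F_def\<close>)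
        show "Q.good {0..<c} id" if "c \<in> C" for c by (rule good) (use that in \<open>simp add: F_def\<close>)
        show "Q.good {0..<L} id" by (rule good) (simp add: F_def)
      qed
      moreover have "{2 * k..<l} \<subseteq> h ` {0..<L}"
      proof
        fix y assume y: "y \<in> {2 * k..<l}"
        show "y \<in> h ` {0..<L}"
        proof (cases "y < L")
          case True
          then have "y \<notin> id ` {L..<l} \<union> r ` {L..<l} \<union> s ` {L..<l}" unfolding r_im s_im using y k by auto
          then have "h y = y" unfolding h_def by (rule cyc_out)
          then show ?thesis using True y k by (intro image_eqI[of _ _ y]) auto
        next
          case False
          then have yL: "y \<in> {L..<l}" using y by auto
          have "h (s y) = y" using cyc_app(3)[OF t yL] unfolding h_def by simp
          moreover have "s y \<in> {k..<2 * k}" using yL s_im by blast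
          ultimately show ?thesis using k by (intro image_eqI[of _ _ "s y"]) auto
        qed
      qed
      ultimately show "alt \<subseteq> H"
        by (intro alt_le_of_two[OF H _ _ L(1) _ _ L(3), of h "2 * k"]) (use TH k in auto)
    qed
  qed
qed

end

subsection \<open>Independent actions on disjoint copies\<close>

lemma (in group) generate_finite_support:
  assumes "x \<in> generate G S"
  shows "\<exists>F. finite F \<and> F \<subseteq> S \<and> x \<in> generate G F"
  using assms
proof (induction rule: generate.induct)
  case one
  then show ?case by (intro exI[of _ "{}"]) (simp add: generate.one)
next
  case (incl h)
  then show ?case by (intro exI[of _ "{h}"]) (simp add: generate.incl)
next
  case (inv h)
  then show ?case by (intro exI[of _ "{h}"]) (simp add: generate.inv)
next
  case (eng h1 h2)
  then obtain F1 F2 where "finite F1" "F1 \<subseteq> S" "h1 \<in> generate G F1" "finite F2" "F2 \<subseteq> S" "h2 \<in> generate G F2"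
    by auto
  moreover from this have "h1 \<in> generate G (F1 \<union> F2)" "h2 \<in> generate G (F1 \<union> F2)"
    using mono_generate[of F1 "F1 \<union> F2"] mono_generate[of F2 "F1 \<union> F2"] by auto
  ultimately show ?case by (intro exI[of _ "F1 \<union> F2"]) (simp add: generate.eng)
qed

lemma sum_pow2_less:
  assumes "k < j" "l < i" "2 ^ k + 2 ^ j = (2 ^ l + 2 ^ i :: nat)"
  shows "j = i \<and> k = l"
proof -
  have less: "2 ^ k < (2 ^ j :: nat)" "2 ^ l < (2 ^ i :: nat)" using assms by simp_all
  have ji: "j = i"
  proof (rule ccontr)
    assume "j \<noteq> i"
    then consider "Suc j \<le> i" | "Suc i \<le> j" by linarith
    then show False
    proof cases
      case 1
      then have "2 ^ Suc j \<le> (2 ^ i :: nat)" by (intro power_increasing) auto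
      then show False using assms(3) less by simp
    next
      case 2
      then have "2 ^ Suc i \<le> (2 ^ j :: nat)" by (intro power_increasing) auto
      then show False using assms(3) less by simp
    qed
  qed
  then show ?thesis using assms(3) by simp
qed

text \<open>In binary the left side has two digits 1, the right side a single one.\<close>

lemma sum_pow2_neq_double:
  assumes "k < j"
  shows "2 ^ k + 2 ^ j \<noteq> (2 ^ i + 2 ^ i :: nat)"
proof
  assume eq: "2 ^ k + 2 ^ j = (2 ^ i + 2 ^ i :: nat)"
  have less: "2 ^ k < (2 ^ j :: nat)" "0 < (2 ^ k :: nat)" using assms by simp_all
  have "2 ^ j < (2 ^ Suc i :: nat)" unfolding power_Suc using eq less by linarith
  moreover have "2 ^ Suc i < (2 ^ Suc j :: nat)" unfolding power_Suc using eq less by linarith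
  ultimately show False by (simp del: power_Suc)
qed

text \<open>The Sidon property of the powers of 2: the sum determines the unordered pair. The
  condition \<open>i \<noteq> j\<close> excludes the solution in which the sums agree term by term
  in the order written.\<close>

lemma sum_pow2_eq:
  assumes eq: "2 ^ k + 2 ^ j = (2 ^ l + 2 ^ i :: nat)" and ne: "i \<noteq> j"
  shows "k = i \<and> l = j"
proof -
  have eq': "2 ^ j + 2 ^ k = (2 ^ l + 2 ^ i :: nat)" "2 ^ k + 2 ^ j = (2 ^ i + 2 ^ l :: nat)"
    "2 ^ j + 2 ^ k = (2 ^ i + 2 ^ l :: nat)"
    using eq by linarith+
  consider "k < j" "l < i" | "k < j" "i < l" | "j < k" "l < i" | "j < k" "i < l"
    | "k < j" "l = i" | "j < k" "l = i" | "k = j" "l < i" | "k = j" "i < l" | "k = j" "l = i" by linarith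
  then show ?thesis
  proof cases
    case 1 then show ?thesis using sum_pow2_less[OF 1 eq] ne by simp
  next
    case 2 then show ?thesis using sum_pow2_less[OF 2 eq'(2)] by simp
  next
    case 3 then show ?thesis using sum_pow2_less[OF 3 eq'(1)] by simp
  next
    case 4 then show ?thesis using sum_pow2_less[OF 4 eq'(3)] ne by simp
  next
    case 5 then show ?thesis using sum_pow2_neq_double[OF 5(1), of i] eq[unfolded 5(2)] by blast
  next
    case 6 then show ?thesis using sum_pow2_neq_double[OF 6(1), of i] eq'(1)[unfolded 6(2)] by blast
  next
    case 7 then show ?thesis using sum_pow2_neq_double[OF 7(2), of j] eq by simp
  next
    case 8 then show ?thesis using sum_pow2_neq_double[OF 8(2), of j] eq'(2) by simp
  next
    case 9
    have "2 ^ j = (2 ^ i :: nat)" using eq[unfolded 9] by linarith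
    then show ?thesis using ne by simp
  qed
qed

locale copies = stein +
  fixes \<tau> :: "nat \<Rightarrow> real \<Rightarrow> real"
  assumes \<tau>_aff: "\<tau> n \<in> aff" and \<tau>_into: "\<tau> n ` {0..<l} \<subseteq> {0..<l}"
    and \<tau>_disjoint: "m \<noteq> n \<Longrightarrow> \<tau> m ` {0..<l} \<inter> \<tau> n ` {0..<l} = {}"
begin

text \<open>The members of the family act independently on the disjoint copies. With infinitely many
  nontrivial members finitely many pieces need not suffice, so only families of finite support are
  shown to give elements of \<open>alt\<close> (\<open>spread_alt\<close>).\<close>

definition spread :: "(nat \<Rightarrow> real \<Rightarrow> real) \<Rightarrow> real \<Rightarrow> real" where
  "spread \<phi> t = (if \<exists>n. t \<in> \<tau> n ` {0..<l} then let n = (THE n. t \<in> \<tau> n ` {0..<l}) in \<tau> n (\<phi> n (iv (\<tau> n) t)) else t)"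

lemma spread_in:
  assumes "s \<in> {0..<l}"
  shows "spread \<phi> (\<tau> n s) = \<tau> n (\<phi> n s)"
proof -
  have mem: "\<tau> n s \<in> \<tau> n ` {0..<l}" using assms by (rule imageI)
  have "m = n" if "\<tau> n s \<in> \<tau> m ` {0..<l}" for m
    using \<tau>_disjoint[of m n] that mem by blast
  then have "(THE m. \<tau> n s \<in> \<tau> m ` {0..<l}) = n" using mem by (intro the_equality) auto
  moreover have "\<exists>m. \<tau> n s \<in> \<tau> m ` {0..<l}" using mem by blast
  ultimately show ?thesis unfolding spread_def using \<tau>_aff by (simp add: Let_def)
qed

lemma spread_out: "(\<And>n. t \<notin> \<tau> n ` {0..<l}) \<Longrightarrow> spread \<phi> t = t"
  unfolding spread_def by simp

lemma spread_eqI: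
  assumes "\<And>n s. s \<in> {0..<l} \<Longrightarrow> f (\<tau> n s) = \<tau> n (\<phi> n s)" "\<And>t. (\<And>n. t \<notin> \<tau> n ` {0..<l}) \<Longrightarrow> f t = t"
  shows "f = spread \<phi>"
proof
  fix t
  show "f t = spread \<phi> t"
  proof (cases "\<exists>n. t \<in> \<tau> n ` {0..<l}")
    case True
    then obtain n s where "s \<in> {0..<l}" "t = \<tau> n s" by blast
    then show ?thesis using assms(1) spread_in by simp
  next
    case False
    then show ?thesis using assms(2) spread_out by simp
  qed
qed

lemma spread_comp:
  assumes "\<And>n. \<psi> n \<in> pw"
  shows "spread \<phi> \<circ> spread \<psi> = spread (\<lambda>n. \<phi> n \<circ> \<psi> n)"
proof (rule spread_eqI)
  fix n s assume s: "s \<in> {0..<l}"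
  then have "\<psi> n s \<in> {0..<l}" using pw_mem_iff[OF assms] by blast
  then show "(spread \<phi> \<circ> spread \<psi>) (\<tau> n s) = \<tau> n ((\<phi> n \<circ> \<psi> n) s)" using s by (simp add: spread_in)
next
  fix t assume "\<And>n. t \<notin> \<tau> n ` {0..<l}"
  then show "(spread \<phi> \<circ> spread \<psi>) t = t" by (simp add: spread_out)
qed

lemma spread_id: "spread (\<lambda>n. id) = id"
  by (rule spread_eqI[symmetric]) auto

definition single :: "nat \<Rightarrow> (real \<Rightarrow> real) \<Rightarrow> nat \<Rightarrow> real \<Rightarrow> real" where
  "single m x n = (if n = m then x else id)"

lemma single_pw: "x \<in> pw \<Longrightarrow> single m x n \<in> pw"
  by (simp add: single_def pw_id)

lemma spread_single_comp:
  assumes "y \<in> pw"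
  shows "spread (single m x) \<circ> spread (single m y) = spread (single m (x \<circ> y))"
proof -
  have "(\<lambda>n. single m x n \<circ> single m y n) = single m (x \<circ> y)" by (auto simp: single_def fun_eq_iff)
  then show ?thesis using spread_comp[of "single m y" "single m x"] single_pw[OF assms] by simp
qed

lemma spread_single_id: "spread (single m id) = id"
  using spread_id unfolding single_def by simp

lemma spread_single_iv:
  assumes "x \<in> pw"
  shows "iv (spread (single m x)) = spread (single m (iv x))"
  using spread_single_comp[OF pw_inverse[OF assms], of m x] spread_single_comp[OF assms, of m "iv x"]
    iv_comp[OF assms] spread_single_id by (intro inv_unique_comp) simp_all

lemma spread_single_cyc:
  assumes t: "tri B a b c" and im: "a ` B \<subseteq> {0..<l}" "b ` B \<subseteq> {0..<l}" "c ` B \<subseteq> {0..<l}"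
  shows "spread (single m (cyc B a b c)) = cyc B (\<tau> m \<circ> a) (\<tau> m \<circ> b) (\<tau> m \<circ> c)"
proof (rule cyc_eqI)
  show "tri B (\<tau> m \<circ> a) (\<tau> m \<circ> b) (\<tau> m \<circ> c)" by (rule tri_comp[OF aff_inj[OF \<tau>_aff] t])
  fix s assume s: "s \<in> B"
  have "a s \<in> {0..<l}" "b s \<in> {0..<l}" "c s \<in> {0..<l}" using s im by blast+
  then show "spread (single m (cyc B a b c)) ((\<tau> m \<circ> a) s) = (\<tau> m \<circ> b) s"
    "spread (single m (cyc B a b c)) ((\<tau> m \<circ> b) s) = (\<tau> m \<circ> c) s"
    "spread (single m (cyc B a b c)) ((\<tau> m \<circ> c) s) = (\<tau> m \<circ> a) s"
    using cyc_app[OF t s] by (simp_all add: spread_in single_def)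
next
  fix x assume x: "x \<notin> (\<tau> m \<circ> a) ` B \<union> (\<tau> m \<circ> b) ` B \<union> (\<tau> m \<circ> c) ` B"
  show "spread (single m (cyc B a b c)) x = x"
  proof (cases "\<exists>n. x \<in> \<tau> n ` {0..<l}")
    case False then show ?thesis by (simp add: spread_out)
  next
    case True
    then obtain n s where s: "s \<in> {0..<l}" "x = \<tau> n s" by blast
    show ?thesis
    proof (cases "n = m")
      case False then show ?thesis using s by (simp add: spread_in single_def)
    next
      case True
      then have "s \<notin> a ` B \<union> b ` B \<union> c ` B" using x s(2) by auto
      then have "cyc B a b c s = s" by (rule cyc_out)
      then show ?thesis using s True by (simp add: spread_in single_def)
    qed
  qed
qed

lemma spread_single_cycs:
  assumes "z \<in> cycs {0..<l}"
  shows "spread (single m z) \<in> cycs (\<tau> m ` {0..<l})"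
  using assms
proof cases
  case (cycsI u v a b c)
  have im: "(\<tau> m \<circ> e) ` {u..<v} \<subseteq> \<tau> m ` {0..<l}" if "e ` {u..<v} \<subseteq> {0..<l}" for e
    unfolding image_comp[symmetric] by (rule image_mono[OF that])
  show ?thesis
    unfolding cycsI(1) spread_single_cyc[OF cycsI(8-11)]
    by (rule cycs.cycsI[OF cycsI(2-4) aff_comp[OF \<tau>_aff cycsI(5)] aff_comp[OF \<tau>_aff cycsI(6)] aff_comp[OF \<tau>_aff cycsI(7)]
      tri_comp[OF aff_inj[OF \<tau>_aff] cycsI(8)] im[OF cycsI(9)] im[OF cycsI(10)] im[OF cycsI(11)]])
qed

lemma cycs_copy:
  assumes "z \<in> cycs (\<tau> m ` {0..<l})"
  obtains y where "y \<in> cycs {0..<l}" "z = spread (single m y)"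
  using assms
proof cases
  case (cycsI u v a b c)
  have e: "iv (\<tau> m) \<circ> e \<in> aff" "\<tau> m \<circ> (iv (\<tau> m) \<circ> e) = e" if "e \<in> aff" for e
    using aff_comp[OF aff_iv[OF \<tau>_aff] that] \<tau>_aff by (auto simp: fun_eq_iff)
  have im: "(iv (\<tau> m) \<circ> e) ` {u..<v} \<subseteq> {0..<l}" if "e ` {u..<v} \<subseteq> \<tau> m ` {0..<l}" for e
  proof -
    have "iv (\<tau> m) ` \<tau> m ` {0..<l} = {0..<l}" using \<tau>_aff by (simp add: image_comp)
    then show ?thesis using image_mono[OF that, of "iv (\<tau> m)"] by (simp add: image_comp)
  qed
  have t: "tri {u..<v} (iv (\<tau> m) \<circ> a) (iv (\<tau> m) \<circ> b) (iv (\<tau> m) \<circ> c)"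
    by (rule tri_comp[OF aff_inj[OF aff_iv[OF \<tau>_aff]] cycsI(8)])
  have "cyc {u..<v} (iv (\<tau> m) \<circ> a) (iv (\<tau> m) \<circ> b) (iv (\<tau> m) \<circ> c) \<in> cycs {0..<l}"
    by (rule cycs.cycsI[OF cycsI(2-4) e(1)[OF cycsI(5)] e(1)[OF cycsI(6)] e(1)[OF cycsI(7)] t
      im[OF cycsI(9)] im[OF cycsI(10)] im[OF cycsI(11)]])
  moreover have "z = spread (single m (cyc {u..<v} (iv (\<tau> m) \<circ> a) (iv (\<tau> m) \<circ> b) (iv (\<tau> m) \<circ> c)))"
    unfolding spread_single_cyc[OF t im[OF cycsI(9)] im[OF cycsI(10)] im[OF cycsI(11)]] cycsI(1)
    using e(2)[OF cycsI(5)] e(2)[OF cycsI(6)] e(2)[OF cycsI(7)] by simp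
  ultimately show thesis by (rule that)
qed

lemma copy_subgroup:
  assumes H: "subgroup H PG"
  shows "subgroup {x \<in> pw. spread (single m x) \<in> H} PG"
proof (rule sgI)
  show "id \<in> {x \<in> pw. spread (single m x) \<in> H}" using pw_id sg_id[OF H] spread_single_id by simp
  show "f \<circ> g \<in> {x \<in> pw. spread (single m x) \<in> H}"
    if "f \<in> {x \<in> pw. spread (single m x) \<in> H}" "g \<in> {x \<in> pw. spread (single m x) \<in> H}" for f g
    using that pw_comp sg_comp[OF H] spread_single_comp[of g m f] by simp metis
  show "iv f \<in> {x \<in> pw. spread (single m x) \<in> H}" if "f \<in> {x \<in> pw. spread (single m x) \<in> H}" for f
    using that pw_inverse sg_iv[OF H] spread_single_iv[of f m] by simp metis
qed auto

lemma spread_single_alt: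
  assumes "x \<in> alt"
  shows "spread (single m x) \<in> alt"
proof -
  have "cycs {0..<l} \<subseteq> {x \<in> pw. spread (single m x) \<in> alt}"
    using spread_single_cycs cycs_alt'[OF \<tau>_into] cycs_pw[OF order_refl] by blast
  then show ?thesis using alt_le[OF copy_subgroup[OF alt_sg]] assms by blast
qed

lemma spread_alt:
  assumes "\<And>n. \<phi> n \<in> alt" "\<And>n. N \<le> n \<Longrightarrow> \<phi> n = id"
  shows "spread \<phi> \<in> alt"
  using assms
proof (induction N arbitrary: \<phi>)
  case 0
  have "\<phi> = (\<lambda>n. id)" by (rule ext) (use 0(2) in blast)
  then show ?case using sg_id[OF alt_sg] by (simp only: spread_id)
next
  case (Suc N)
  have pw: "\<phi> n \<in> pw" for n using Suc.prems(1) sg_pw[OF alt_sg] by blast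
  let ?\<psi> = "\<phi>(N := id)"
  have "spread ?\<psi> \<in> alt"
  proof (rule Suc.IH)
    show "?\<psi> n \<in> alt" for n using Suc.prems(1) sg_id[OF alt_sg] by simp
    show "?\<psi> n = id" if "N \<le> n" for n using Suc.prems(2)[of n] that by (cases "n = N") auto
  qed
  moreover have "spread (single N (\<phi> N)) \<in> alt" by (rule spread_single_alt[OF Suc.prems(1)])
  moreover have "spread ?\<psi> \<circ> spread (single N (\<phi> N)) = spread \<phi>"
  proof -
    have "(\<lambda>n. ?\<psi> n \<circ> single N (\<phi> N) n) = \<phi>" by (auto simp: fun_eq_iff single_def)
    then show ?thesis using spread_comp[of "single N (\<phi> N)" ?\<psi>] single_pw[OF pw] by simp
  qed
  ultimately show ?case using sg_comp[OF alt_sg] by metis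
qed

definition shift :: "nat \<Rightarrow> (nat \<Rightarrow> real \<Rightarrow> real) \<Rightarrow> nat \<Rightarrow> real \<Rightarrow> real" where
  "shift k \<phi> n = (if n < k then id else \<phi> (n - k))"

lemma spread_shift:
  assumes a: "a \<in> pw" and \<phi>: "\<And>n. \<phi> n \<in> pw" and step: "\<And>n s. s \<in> {0..<l} \<Longrightarrow> a (\<tau> n s) = \<tau> (Suc n) s"
  shows "a \<circ> spread \<phi> \<circ> iv a = spread (shift 1 \<phi>)"
proof -
  \<comment> \<open>The preimage of copy 0 under \<open>a\<close> meets no copy, so the conjugate is
    trivial on copy 0. The same holds for points outside all copies.\<close>
  have nonmem: "iv a t \<notin> \<tau> n ` {0..<l}" if "\<And>n. t \<notin> \<tau> (Suc n) ` {0..<l}" for t n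
  proof
    assume "iv a t \<in> \<tau> n ` {0..<l}"
    then obtain s where s: "s \<in> {0..<l}" "iv a t = \<tau> n s" by blast
    then have "t = \<tau> (Suc n) s" using step[OF s(1)] a by (metis pw_iv(1))
    then show False using that s(1) by blast
  qed
  show ?thesis
  proof (rule spread_eqI)
  fix n s assume s: "s \<in> {0..<l}"
  show "(a \<circ> spread \<phi> \<circ> iv a) (\<tau> n s) = \<tau> n (shift 1 \<phi> n s)"
  proof (cases n)
    case 0
    have "\<tau> 0 s \<notin> \<tau> (Suc n) ` {0..<l}" for n using \<tau>_disjoint[of 0 "Suc n"] s by blast
    then have "spread \<phi> (iv a (\<tau> 0 s)) = iv a (\<tau> 0 s)" using nonmem by (intro spread_out) blast
    then show ?thesis using a 0 by (simp add: shift_def)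
  next
    case (Suc k)
    have "iv a (\<tau> n s) = \<tau> k s" using step[OF s, of k] a Suc by (metis pw_iv(2))
    moreover have "\<phi> k s \<in> {0..<l}" using pw_mem_iff[OF \<phi>] s by blast
    ultimately show ?thesis using s Suc step spread_in[OF s] by (simp add: shift_def)
  qed
next
  fix t assume t: "\<And>n. t \<notin> \<tau> n ` {0..<l}"
  have "spread \<phi> (iv a t) = iv a t" by (rule spread_out, rule nonmem) (rule t)
  then show "(a \<circ> spread \<phi> \<circ> iv a) t = t" using a by simp
  qed
qed

lemma spread_iv:
  assumes "\<And>n. \<phi> n \<in> pw"
  shows "iv (spread \<phi>) = spread (\<lambda>n. iv (\<phi> n))"
proof (rule inv_unique_comp)
  have "spread \<phi> \<circ> spread (\<lambda>n. iv (\<phi> n)) = spread (\<lambda>n. \<phi> n \<circ> iv (\<phi> n))"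
    by (rule spread_comp[OF pw_inverse[OF assms]])
  then show "spread \<phi> \<circ> spread (\<lambda>n. iv (\<phi> n)) = id" by (simp only: iv_comp(2)[OF assms] spread_id)
  have "spread (\<lambda>n. iv (\<phi> n)) \<circ> spread \<phi> = spread (\<lambda>n. iv (\<phi> n) \<circ> \<phi> n)"
    by (rule spread_comp[OF assms])
  then show "spread (\<lambda>n. iv (\<phi> n)) \<circ> spread \<phi> = id" by (simp only: iv_comp(1)[OF assms] spread_id)
qed

lemma spread_comm:
  assumes "\<And>n. \<phi> n \<in> pw" "\<And>n. \<psi> n \<in> pw"
  shows "comm (spread \<phi>) (spread \<psi>) = spread (\<lambda>n. comm (\<phi> n) (\<psi> n))"
proof -
  have "spread \<phi> \<circ> spread \<psi> = spread (\<lambda>n. \<phi> n \<circ> \<psi> n)" by (rule spread_comp[OF assms(2)])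
  moreover have "spread (\<lambda>n. \<phi> n \<circ> \<psi> n) \<circ> spread (\<lambda>n. iv (\<phi> n)) = spread (\<lambda>n. \<phi> n \<circ> \<psi> n \<circ> iv (\<phi> n))"
    by (rule spread_comp[OF pw_inverse[OF assms(1)]])
  moreover have "spread (\<lambda>n. \<phi> n \<circ> \<psi> n \<circ> iv (\<phi> n)) \<circ> spread (\<lambda>n. iv (\<psi> n)) = spread (\<lambda>n. comm (\<phi> n) (\<psi> n))"
    by (rule spread_comp[OF pw_inverse[OF assms(2)]])
  ultimately show ?thesis by (simp only: spread_iv[OF assms(1)] spread_iv[OF assms(2)])
qed

lemma shift_pw: "(\<And>n. \<phi> n \<in> pw) \<Longrightarrow> shift k \<phi> n \<in> pw"
  by (simp add: shift_def pw_id)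

text \<open>A Sidon set of positions: after conjugation by powers of \<open>a\<close>, the two products
  meet only in copy \<open>2 ^ K\<close>, where their commutator is \<open>[x i, x j]\<close>.\<close>

lemma copy_comm_mem:
  assumes H: "subgroup H PG" and a: "a \<in> H" "\<And>n s. s \<in> {0..<l} \<Longrightarrow> a (\<tau> n s) = \<tau> (Suc n) s"
    and \<phi>: "\<And>n. \<phi> n \<in> pw" "\<And>k. k < K \<Longrightarrow> \<phi> (2 ^ k) = x k" "\<And>n. (\<forall>k<K. n \<noteq> 2 ^ k) \<Longrightarrow> \<phi> n = id"
    and mem: "spread \<phi> \<in> H" and ij: "i < K" "j < K" "i \<noteq> j"
  shows "spread (single 0 (comm (x i) (x j))) \<in> H"
proof -
  have ap: "a \<in> pw" using sg_pw[OF H a(1)] .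
  have shift_Suc: "shift 1 (shift k \<phi>) = shift (Suc k) \<phi>" for k
    by (rule ext) (auto simp: shift_def)
  have shift_mem: "spread (shift k \<phi>) \<in> H" for k
  proof (induction k)
    case 0
    have "shift 0 \<phi> = \<phi>" by (rule ext) (simp add: shift_def)
    then show ?case using mem by simp
  next
    case (Suc k)
    show ?case
      using spread_shift[where \<phi> = "shift k \<phi>", OF ap shift_pw[OF \<phi>(1)] a(2)] sg_conj[OF H a(1) Suc] shift_Suc by simp
  qed
  \<comment> \<open>Conjugation by the power \<open>N - 2 ^ i\<close> of \<open>a\<close> moves
    position \<open>2 ^ i\<close> to \<open>N\<close>. If both families were nontrivial at another
    position \<open>n\<close>, then \<open>n + 2 ^ i = N + 2 ^ k\<close> and
    \<open>n + 2 ^ j = N + 2 ^ m\<close>, which \<open>sum_pow2_eq\<close> excludes.\<close>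
  define N where "N = (2 ^ K :: nat)"
  define \<alpha> \<beta> where "\<alpha> = (2 ^ i :: nat)" and "\<beta> = (2 ^ j :: nat)"
  have ab: "\<alpha> \<le> N" "\<beta> \<le> N" unfolding \<alpha>_def \<beta>_def N_def using ij by (simp_all add: power_increasing)
  let ?f = "shift (N - \<alpha>) \<phi>" and ?g = "shift (N - \<beta>) \<phi>"
  have xp: "x i \<in> pw" "x j \<in> pw" using \<phi>(1)[of "2 ^ i"] \<phi>(1)[of "2 ^ j"] \<phi>(2) ij by simp_all
  have comms: "(\<lambda>n. comm (?f n) (?g n)) = single N (comm (x i) (x j))"
  proof
    fix n
    show "comm (?f n) (?g n) = single N (comm (x i) (x j)) n"
    proof (cases "n = N")
      case True
      have nl: "\<not> N < N - \<alpha>" "\<not> N < N - \<beta>" by simp_all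
      have "?f n = \<phi> \<alpha>" "?g n = \<phi> \<beta>"
        unfolding shift_def True using nl diff_diff_cancel[OF ab(1)] diff_diff_cancel[OF ab(2)] by presburger+
      then have "?f n = x i" "?g n = x j" using \<phi>(2) ij unfolding \<alpha>_def \<beta>_def by simp_all
      then show ?thesis using True by (simp add: single_def)
    next
      case False
      have "?f n = id \<or> ?g n = id"
      proof (rule ccontr)
        assume "\<not> ?thesis"
        then have f: "?f n \<noteq> id" and g: "?g n \<noteq> id" by auto
        have ex: "\<exists>k<K. n + c = N + 2 ^ k" if "shift (N - c) \<phi> n \<noteq> id" "c \<le> N" for c
        proof -
          have "\<not> n < N - c" "\<phi> (n - (N - c)) \<noteq> id" using that(1) by (auto simp: shift_def split: if_splits)
          then obtain k' where k': "k' < K" "n - (N - c) = 2 ^ k'" using \<phi>(3) by blast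
          then have "n + c = N + 2 ^ k'" using \<open>\<not> n < N - c\<close> that(2) by linarith
          then show ?thesis using k'(1) by blast
        qed
        obtain k where k: "n + \<alpha> = N + 2 ^ k" using ex[OF f ab(1)] by blast
        obtain m where m: "n + \<beta> = N + 2 ^ m" using ex[OF g ab(2)] by blast
        have "2 ^ k + 2 ^ j = (2 ^ m + 2 ^ i :: nat)" using k m unfolding \<alpha>_def \<beta>_def by linarith
        then have "k = i" using sum_pow2_eq ij(3) by blast
        then show False using k False unfolding \<alpha>_def by simp
      qed
      then have "comm (?f n) (?g n) = id"
        using shift_pw[where \<phi> = \<phi> and k = "N - \<alpha>" and n = n, OF \<phi>(1)] shift_pw[where \<phi> = \<phi> and k = "N - \<beta>" and n = n, OF \<phi>(1)] by (auto simp: iv_comp)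
      then show ?thesis using False by (simp add: single_def)
    qed
  qed
  have "comm (spread ?f) (spread ?g) \<in> H"
    using shift_mem sg_comp[OF H] sg_iv[OF H] by metis
  then have mem_N: "spread (single N (comm (x i) (x j))) \<in> H"
    using spread_comm[of ?f ?g, OF shift_pw[OF \<phi>(1)] shift_pw[OF \<phi>(1)]] comms by simp
  define z where "z = comm (x i) (x j)"
  have z: "z \<in> pw" unfolding z_def using xp by (intro pw_comp pw_inverse)
  \<comment> \<open>Conjugation by \<open>iv a\<close> brings the commutator back from copy
    \<open>N\<close> to copy 0.\<close>
  have "spread (single n z) \<in> H \<Longrightarrow> spread (single 0 z) \<in> H" for n
  proof (induction n)
    case (Suc n)
    have "shift 1 (single n z) = single (Suc n) z" by (rule ext) (auto simp: shift_def single_def)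
    then have eq: "a \<circ> spread (single n z) \<circ> iv a = spread (single (Suc n) z)"
      using spread_shift[where \<phi> = "single n z", OF ap single_pw[OF z] a(2)] by simp
    have "iv a \<circ> spread (single (Suc n) z) \<circ> a = spread (single n z)"
      unfolding eq[symmetric] using ap by (auto simp: fun_eq_iff)
    then show ?case using Suc sg_comp[OF H] sg_iv[OF H] a(1) by metis
  qed
  then show ?thesis using mem_N unfolding z_def by blast
qed

end

subsection \<open>Two generators\<close>

text \<open>(a b c)(b c d) = (a b)(c d). An involution that exchanges two sets is obtained from
  three-cycles at the price of exchanging a second pair.\<close>

lemma cyc_double_transposition:
  assumes dis: "a ` B \<inter> b ` B = {}" "a ` B \<inter> c ` B = {}" "a ` B \<inter> d ` B = {}"
      "b ` B \<inter> c ` B = {}" "b ` B \<inter> d ` B = {}" "c ` B \<inter> d ` B = {}"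
    and inj: "inj_on a B" "inj_on b B" "inj_on c B" "inj_on d B"
    and w: "w = cyc B a b c \<circ> cyc B b c d"
  shows "t \<in> B \<Longrightarrow> w (a t) = b t" "t \<in> B \<Longrightarrow> w (b t) = a t" "t \<in> B \<Longrightarrow> w (c t) = d t" "t \<in> B \<Longrightarrow> w (d t) = c t"
    "y \<notin> a ` B \<union> b ` B \<union> c ` B \<union> d ` B \<Longrightarrow> w y = y" "w \<circ> w = id"
proof -
  have t1: "tri B a b c" and t2: "tri B b c d" using dis inj unfolding tri_def by simp_all
  have f1: "cyc B b c d (a t) = a t" if "t \<in> B" for t by (rule cyc_fix) (use dis that in simp_all)
  have f2: "cyc B a b c (d t) = d t" if "t \<in> B" for t
    by (rule cyc_fix) (use dis that in \<open>simp_all add: Int_commute\<close>)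
  show 1: "w (a t) = b t" "w (b t) = a t" "w (c t) = d t" "w (d t) = c t" if "t \<in> B" for t
    using that cyc_app[OF t1 that] cyc_app[OF t2 that] f1 f2 unfolding w by simp_all
  show 2: "w y = y" if "y \<notin> a ` B \<union> b ` B \<union> c ` B \<union> d ` B" for y
    unfolding w using that by (simp add: cyc_out)
  show "w \<circ> w = id"
  proof
    fix y
    show "(w \<circ> w) y = id y"
      using 1 2[of y] by (cases "y \<in> a ` B \<union> b ` B \<union> c ` B \<union> d ` B") auto
  qed
qed

lemma cyc_cubed: "tri B a b c \<Longrightarrow> cyc B a b c (cyc B a b c (cyc B a b c y)) = y"
  using cyc_square[of B a b c] cyc_inverse[of B a b c] by (metis comp_apply id_apply)

context stein
begin

text \<open>\<open>alt\<close> is generated by the commutators of three-cycles, and each element of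
  the finite set \<open>T\<close> is a product of finitely many of these and their inverses. A list
  is returned because its entries are later assigned to positions.\<close>

lemma finite_comm_generators:
  assumes T: "finite T" "T \<subseteq> alt" "\<forall>H. subgroup H PG \<longrightarrow> T \<subseteq> H \<longrightarrow> alt \<subseteq> H"
  obtains ps where "set ps \<subseteq> cycs {0..<l} \<times> cycs {0..<l}"
    "\<forall>H. subgroup H PG \<longrightarrow> (\<forall>p\<in>set ps. comm (fst p) (snd p) \<in> H) \<longrightarrow> alt \<subseteq> H"
proof -
  let ?f = "\<lambda>p. comm (fst p) (snd p)" and ?C = "cycs {0..<l} \<times> cycs {0..<l}"
  have C_pw: "?f ` ?C \<subseteq> pw"
  proof
    fix z assume "z \<in> ?f ` ?C"
    then obtain p where p: "fst p \<in> cycs {0..<l}" "snd p \<in> cycs {0..<l}" "z = ?f p" by force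
    then have "fst p \<in> pw" "snd p \<in> pw" using cycs_pw[OF order_refl] by auto
    then show "z \<in> pw" unfolding p(3) by (intro pw_comp pw_inverse)
  qed
  have G: "subgroup (generate PG (?f ` ?C)) PG"
    using C_pw by (intro group.generate_is_subgroup[OF group_PG]) simp
  have "cycs {0..<l} \<subseteq> generate PG (?f ` ?C)"
  proof (rule cycs_le_of_comms[OF G l_pos order_refl])
    fix x y assume "x \<in> cycs {0..<l}" "y \<in> cycs {0..<l}"
    then have "?f (x, y) \<in> ?f ` ?C" by (intro imageI) simp
    then show "comm x y \<in> generate PG (?f ` ?C)" by (intro generate.incl) simp
  qed
  then have "alt \<subseteq> generate PG (?f ` ?C)" by (rule alt_le[OF G])
  then have "\<forall>t\<in>T. \<exists>F. finite F \<and> F \<subseteq> ?f ` ?C \<and> t \<in> generate PG F"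
    by (intro ballI group.generate_finite_support[OF group_PG]) (use T(2) in blast)
  then have "\<exists>F. \<forall>t\<in>T. finite (F t) \<and> F t \<subseteq> ?f ` ?C \<and> t \<in> generate PG (F t)" by (rule bchoice)
  then obtain F where F: "\<forall>t\<in>T. finite (F t) \<and> F t \<subseteq> ?f ` ?C \<and> t \<in> generate PG (F t)"
    by (rule exE)
  have "finite (\<Union>t\<in>T. F t)" "(\<Union>t\<in>T. F t) \<subseteq> ?f ` ?C" using T(1) F by auto
  then obtain D where D: "D \<subseteq> ?C" "finite D" "(\<Union>t\<in>T. F t) = ?f ` D" by (meson finite_subset_image)
  obtain ps where ps: "set ps = D" using finite_list[OF D(2)] by blast
  show thesis
  proof (rule that[of ps])
    show "set ps \<subseteq> ?C" using ps D by simp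
    show "\<forall>H. subgroup H PG \<longrightarrow> (\<forall>p\<in>set ps. ?f p \<in> H) \<longrightarrow> alt \<subseteq> H"
    proof (intro allI impI)
      fix H assume H: "subgroup H PG" and mem: "\<forall>p\<in>set ps. ?f p \<in> H"
      have "T \<subseteq> H"
      proof
        fix t assume t: "t \<in> T"
        have "F t \<subseteq> ?f ` D" using D(3) t by blast
        then have "F t \<subseteq> H" using mem ps by auto
        then have "generate PG (F t) \<subseteq> H" by (rule group.generate_subgroup_incl[OF group_PG _ H])
        then show "t \<in> H" using bspec[OF F t] by blast
      qed
      then show "alt \<subseteq> H" using T(3) H by blast
    qed
  qed
qed

text \<open>\<open>[0, d)\<close> and \<open>[0, \<kappa> * d)\<close> overlap, so no single
  three-cycle maps one to the other. The first three-cycle moves \<open>[0, d)\<close> away to the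
  right, the second brings it back contracted.\<close>

lemma contracting_element:
  assumes d: "d \<in> \<Gamma>" "0 < d" "d < l" and \<kappa>: "\<kappa> \<in> \<Lambda>" "\<kappa> < 1"
  obtains a where "a \<in> alt" "\<And>t. t \<in> {0..<d} \<Longrightarrow> a t = \<kappa> * t"
proof -
  obtain \<mu> where \<mu>: "\<mu> \<in> \<Lambda>" "0 < \<mu>" "\<mu> < (l - d) / (3 * d)" using small_slope[of "(l - d) / (3 * d)"] d by auto
  define m where "m = \<mu> * d"
  have m: "m \<in> \<Gamma>" "0 < m" "3 * m < l - d"
    using scale_mem[OF \<mu>(1) d(1)] \<mu> d unfolding m_def by (simp_all add: field_simps)
  define r where "r i = (\<lambda>t. \<mu> * t + (d + real i * m))" for i
  have r: "r i \<in> aff" for i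
    unfolding r_def by (rule affI[OF \<mu>(1) add_mem[OF d(1) nat_mult_mem[OF m(1)]]])
  have r_im: "r i ` {0..<d} = {d + real i * m..<d + real i * m + m}" for i
    unfolding aff_image[OF r] unfolding r_def m_def by (simp add: algebra_simps)
  have s: "(\<lambda>t. \<kappa> * t) \<in> aff" by (rule aff_scale[OF \<kappa>(1)])
  have s_im: "(\<lambda>t. \<kappa> * t) ` {0..<d} = {0..<\<kappa> * d}" unfolding aff_image[OF s] by simp
  have \<kappa>d: "\<kappa> * d < d" "0 < \<kappa>" using \<kappa> d slope_pos by auto
  then have \<kappa>dl: "\<kappa> * d \<le> l" using d by linarith
  have im0: "r 0 ` {0..<d} = {d..<d + m}" "r 1 ` {0..<d} = {d + m..<d + 2 * m}" "r 2 ` {0..<d} = {d + 2 * m..<d + 3 * m}"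
    unfolding r_im by (simp_all add: algebra_simps)
  have t1: "tri {0..<d} id (r 0) (r 1)" unfolding tri_aff[OF aff_id r r] im0 using m by auto
  have t2: "tri {0..<d} (r 0) (\<lambda>t. \<kappa> * t) (r 2)" unfolding tri_aff[OF r s r] im0 s_im using m \<kappa>d by auto
  have "cyc {0..<d} id (r 0) (r 1) \<in> alt"
    by (rule subsetD[OF cycs_alt], rule cycsI[OF zero_mem d(1,2) aff_id r r t1]) (unfold im0, use m d in auto)
  moreover have "cyc {0..<d} (r 0) (\<lambda>t. \<kappa> * t) (r 2) \<in> alt"
    by (rule subsetD[OF cycs_alt], rule cycsI[OF zero_mem d(1,2) r s r t2]) (unfold im0 s_im, use m d \<kappa>d \<kappa>dl in auto)
  ultimately have "cyc {0..<d} (r 0) (\<lambda>t. \<kappa> * t) (r 2) \<circ> cyc {0..<d} id (r 0) (r 1) \<in> alt"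
    using sg_comp[OF alt_sg] by blast
  moreover have "(cyc {0..<d} (r 0) (\<lambda>t. \<kappa> * t) (r 2) \<circ> cyc {0..<d} id (r 0) (r 1)) t = \<kappa> * t" if "t \<in> {0..<d}" for t
    using cyc_app(1)[OF t1 that] cyc_app(1)[OF t2 that] by simp
  ultimately show thesis by (rule that)
qed

theorem alt_two_generated:
  assumes T: "finite T" "T \<subseteq> alt" "\<forall>H. subgroup H PG \<longrightarrow> T \<subseteq> H \<longrightarrow> alt \<subseteq> H"
  obtains a b where "a \<in> alt" "b \<in> alt" "\<forall>H. subgroup H PG \<longrightarrow> a \<in> H \<longrightarrow> b \<in> H \<longrightarrow> alt \<subseteq> H"
proof -
  obtain ps where ps: "set ps \<subseteq> cycs {0..<l} \<times> cycs {0..<l}"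
    "\<forall>H. subgroup H PG \<longrightarrow> (\<forall>p\<in>set ps. comm (fst p) (snd p) \<in> H) \<longrightarrow> alt \<subseteq> H"
    using finite_comm_generators[OF T] .
  obtain \<kappa> where \<kappa>: "\<kappa> \<in> \<Lambda>" "0 < \<kappa>" "\<kappa> < 1" using small_slope[of 1] by auto
  obtain d where d: "d \<in> \<Gamma>" "0 < d" "d < l" using small_mem[OF l_pos] by metis
  obtain a where a: "a \<in> alt" "\<And>t. t \<in> {0..<d} \<Longrightarrow> a t = \<kappa> * t"
    using contracting_element[OF d \<kappa>(1,3)] by metis
  obtain p where p: "p \<in> \<Gamma>" "0 < p" "p < d" using small_mem[OF d(2)] by metis
  have "p < p / \<kappa>" using p \<kappa> by (simp add: field_simps)
  \<comment> \<open>The length \<open>\<rho> * l\<close> of \<open>[p, q)\<close> is bounded so that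
    \<open>q < d\<close> and \<open>\<kappa> * q < p\<close>. The images of \<open>[p, q)\<close>
    under the powers of \<open>a\<close> are then pairwise disjoint, and \<open>a\<close> carries
    each of these copies to the next.\<close>
  then obtain \<rho> where \<rho>: "\<rho> \<in> \<Lambda>" "0 < \<rho>" "\<rho> < min (d - p) (p / \<kappa> - p) / l"
    using small_slope[of "min (d - p) (p / \<kappa> - p) / l"] p l_pos by auto
  define q where "q = p + \<rho> * l"
  have q: "q \<in> \<Gamma>" "p < q" "q < d" "\<kappa> * q < p"
  proof -
    show "q \<in> \<Gamma>" unfolding q_def using p \<rho> l_mem by (auto intro: mem_intros)
    have "\<rho> * l < min (d - p) (p / \<kappa> - p)" using \<rho>(3) l_pos by (simp add: pos_less_divide_eq)
    then have "q < d" "q < p / \<kappa>" unfolding q_def by simp_all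
    then show "q < d" "\<kappa> * q < p" using \<kappa> by (simp_all add: field_simps)
    show "p < q" unfolding q_def using \<rho> l_pos by simp
  qed
  define \<tau> where "\<tau> n = (\<lambda>t. (\<kappa> ^ n * \<rho>) * t + \<kappa> ^ n * p)" for n
  have \<tau>_aff: "\<tau> n \<in> aff" for n
    unfolding \<tau>_def using \<kappa> \<rho> p by (intro affI mem_intros)
  have \<tau>_im: "\<tau> n ` {0..<l} = {\<kappa> ^ n * p..<\<kappa> ^ n * q}" for n
    unfolding aff_image[OF \<tau>_aff] unfolding \<tau>_def q_def by (simp add: algebra_simps)
  have pow: "0 < \<kappa> ^ n" "\<kappa> ^ n \<le> 1" for n using \<kappa> by (simp_all add: power_le_one)
  have pow_q: "\<kappa> ^ n * q < d" for n
    using mult_left_le_one_le[of q "\<kappa> ^ n"] pow[of n] p q by linarith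
  have pow_anti: "\<kappa> ^ n \<le> \<kappa> ^ m" if "m \<le> n" for m n using that \<kappa> by (simp add: power_decreasing)
  have Suc_le: "\<kappa> ^ n * q \<le> \<kappa> ^ m * p" if "m < n" for m n
  proof -
    have "\<kappa> ^ n * q \<le> \<kappa> ^ Suc m * q" using that p q by (intro mult_right_mono pow_anti) auto
    also have "\<dots> = \<kappa> ^ m * (\<kappa> * q)" by simp
    also have "\<dots> \<le> \<kappa> ^ m * p" using q pow[of m] by (intro mult_left_mono) auto
    finally show ?thesis .
  qed
  have \<tau>_lt: "\<tau> m ` {0..<l} \<inter> \<tau> n ` {0..<l} = {}" if "m < n" for m n
    unfolding \<tau>_im using Suc_le[OF that] by auto
  have sub_d: "\<tau> n ` {0..<l} \<subseteq> {0..<d}" for n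
    unfolding \<tau>_im using pow_q[of n] pow[of n] p by auto
  interpret copies \<Gamma> \<Lambda> l \<tau>
  proof (intro copies.intro[OF stein_axioms] copies_axioms.intro)
    show "\<tau> n \<in> aff" for n by (rule \<tau>_aff)
    show "\<tau> n ` {0..<l} \<subseteq> {0..<l}" for n using sub_d[of n] d by auto
    show "\<tau> m ` {0..<l} \<inter> \<tau> n ` {0..<l} = {}" if "m \<noteq> n" for m n
      using \<tau>_lt[of m n] \<tau>_lt[of n m] that by (cases "m < n") (auto simp: Int_commute)
  qed
  have a_step: "a (\<tau> n s) = \<tau> (Suc n) s" if "s \<in> {0..<l}" for n s
  proof -
    have "\<tau> n s \<in> {0..<d}" using sub_d that by blast
    then show ?thesis using a(2) unfolding \<tau>_def by (simp add: algebra_simps)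
  qed
  have a_pw: "a \<in> pw" using sg_pw[OF alt_sg a(1)] .

  define K where "K = 2 * length ps"
  \<comment> \<open>The pairs of \<open>ps\<close> are written out in a row: the entries
    \<open>2 * i\<close> and \<open>2 * i + 1\<close> form the pair number \<open>i\<close>.\<close>
  define x where "x k = (if even k then fst (ps ! (k div 2)) else snd (ps ! (k div 2)))" for k :: nat
  have x_cycs: "x k \<in> cycs {0..<l}" if "k < K" for k
  proof -
    have "k div 2 < length ps" using that unfolding K_def by presburger
    then have "ps ! (k div 2) \<in> cycs {0..<l} \<times> cycs {0..<l}" using subsetD[OF ps(1) nth_mem] by blast
    then show ?thesis unfolding x_def by (auto simp: mem_Times_iff)
  qed
  define \<phi> where "\<phi> n = (if \<exists>k<K. n = 2 ^ k then x (THE k. n = 2 ^ k) else id)" for n :: nat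
  have \<phi>_pow: "\<phi> (2 ^ k) = x k" if "k < K" for k
  proof -
    have "(THE k'. (2::nat) ^ k = 2 ^ k') = k" by (rule the_equality) auto
    then show ?thesis unfolding \<phi>_def using that by auto
  qed
  have \<phi>_other: "\<phi> n = id" if "\<forall>k<K. n \<noteq> 2 ^ k" for n
    using that unfolding \<phi>_def by auto
  have \<phi>_cases: "\<phi> n = id \<or> (\<exists>k<K. n = 2 ^ k \<and> \<phi> n \<in> cycs {0..<l})" for n
    using \<phi>_pow \<phi>_other x_cycs by metis
  have \<phi>_alt: "\<phi> n \<in> alt" for n using \<phi>_cases[of n] sg_id[OF alt_sg] cycs_alt by auto
  have \<phi>_pw: "\<phi> n \<in> pw" for n using sg_pw[OF alt_sg \<phi>_alt] .
  have \<phi>_cubed: "\<phi> n (\<phi> n (\<phi> n t)) = t" for n t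
  proof -
    have "z (z (z t)) = t" if "z \<in> cycs {0..<l}" for z
      using that by cases (simp add: cyc_cubed)
    then show ?thesis using \<phi>_cases[of n] by auto
  qed
  define N where "N = (2 ^ K :: nat)"
  have \<phi>_supp: "1 \<le> n \<and> n < N" if "\<phi> n \<noteq> id" for n
  proof -
    have "\<not> (\<forall>k<K. n \<noteq> 2 ^ k)"
    proof
      assume "\<forall>k<K. n \<noteq> 2 ^ k"
      then have "\<phi> n = id" by (rule \<phi>_other)
      with that show False by (rule notE)
    qed
    then obtain k where "k < K" "n = 2 ^ k" by auto
    then show ?thesis unfolding N_def by simp
  qed
  \<comment> \<open>As \<open>2 ^ k\<close> is at least 1, copy 0, which is \<open>[p, q)\<close>,
    remains free: the support of \<open>B\<close> lies in the copies 1 to \<open>N - 1\<close>,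
    hence in \<open>[s, p)\<close>.\<close>
  define B where "B = spread \<phi>"
  have B_alt: "B \<in> alt"
    unfolding B_def by (rule spread_alt[of \<phi> N, OF \<phi>_alt]) (use \<phi>_supp in force)
  have B_pw: "B \<in> pw" using sg_pw[OF alt_sg B_alt] .
  define s where "s = \<kappa> ^ N * p"
  have s: "s \<in> \<Gamma>" "0 < s" "s < p"
  proof -
    show "s \<in> \<Gamma>" "0 < s" unfolding s_def using \<kappa> p pow by (auto intro: mem_intros)
    have "0 < N" unfolding N_def by simp
    then have "\<kappa> ^ N * q \<le> p" using Suc_le[of 0 N] by simp
    moreover have "\<kappa> ^ N * p < \<kappa> ^ N * q" using q pow[of N] by simp
    ultimately show "s < p" unfolding s_def by simp
  qed
  have B_supp: "B t = t" if "t \<notin> {s..<p}" for t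
  proof (cases "\<exists>n. t \<in> \<tau> n ` {0..<l}")
    case False then show ?thesis unfolding B_def by (intro spread_out) blast
  next
    case True
    then obtain n y where y: "y \<in> {0..<l}" "t = \<tau> n y" by blast
    show ?thesis
    proof (cases "\<phi> n = id")
      case True then show ?thesis unfolding B_def using y by (simp add: spread_in)
    next
      case False
      then have n: "1 \<le> n" "n < N" using \<phi>_supp by auto
      have "t \<in> {\<kappa> ^ n * p..<\<kappa> ^ n * q}" using y \<tau>_im by blast
      moreover have "\<kappa> ^ n * q \<le> p" using Suc_le[of 0 n] n by simp
      moreover have "s \<le> \<kappa> ^ n * p" unfolding s_def using pow_anti[of n N] n p by (intro mult_right_mono) auto
      ultimately show ?thesis using that by auto
    qed
  qed
  have B_cubed: "B (B (B t)) = t" for t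
  proof -
    have "B \<circ> B \<circ> B = spread (\<lambda>n. \<phi> n \<circ> \<phi> n \<circ> \<phi> n)"
      unfolding B_def by (simp only: spread_comp[OF \<phi>_pw])
    also have "(\<lambda>n. \<phi> n \<circ> \<phi> n \<circ> \<phi> n) = (\<lambda>n. id)" using \<phi>_cubed by (auto simp: fun_eq_iff)
    finally show ?thesis by (metis spread_id comp_apply id_apply)
  qed

  \<comment> \<open>\<open>e\<close> will exchange \<open>D\<close>, the complement of
    \<open>[s, q)\<close>, with a copy inside \<open>[p, q)\<close>, away from the support of
    \<open>B\<close>. Three copies of \<open>D\<close> and the remaining interval \<open>R\<close>
    have to fit into \<open>[p, q)\<close>, whence the factor 4.\<close>
  define D where "D = {0..<s} \<union> {q..<l}"
  obtain \<sigma>0 where \<sigma>0: "\<sigma>0 \<in> \<Lambda>" "0 < \<sigma>0" "\<sigma>0 < (q - p) / (4 * l)" using small_slope[of "(q - p) / (4 * l)"] q l_pos by auto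
  define \<sigma> where "\<sigma> = \<sigma>0 * l"
  have \<sigma>: "\<sigma> \<in> \<Gamma>" "0 < \<sigma>" "4 * \<sigma> < q - p"
    using scale_mem[OF \<sigma>0(1) l_mem] \<sigma>0 l_pos unfolding \<sigma>_def by (simp_all add: field_simps)
  define f where "f i = (\<lambda>t. \<sigma>0 * t + (p + real i * \<sigma>))" for i
  have f_aff: "f i \<in> aff" for i
    unfolding f_def by (rule affI[OF \<sigma>0(1) add_mem[OF p(1) nat_mult_mem[OF \<sigma>(1)]]])
  have f_im: "f i ` {0..<l} = {p + real i * \<sigma>..<p + real i * \<sigma> + \<sigma>}" for i
    unfolding aff_image[OF f_aff] unfolding f_def \<sigma>_def by (simp add: algebra_simps)
  have D_sub: "D \<subseteq> {0..<l}" unfolding D_def using s p q d by auto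
  have fD: "f 0 ` D \<subseteq> {p..<p + \<sigma>}" "f 1 ` D \<subseteq> {p + \<sigma>..<p + 2 * \<sigma>}" "f 2 ` D \<subseteq> {p + 2 * \<sigma>..<p + 3 * \<sigma>}"
    using image_mono[OF D_sub, of "f 0"] image_mono[OF D_sub, of "f 1"] image_mono[OF D_sub, of "f 2"]
    unfolding f_im by (simp_all add: algebra_simps)
  have pqX: "{p..<q} \<subseteq> {0..<l}" using p q d by auto
  have fpq: "f 0 ` D \<subseteq> {p..<q}" "f 1 ` D \<subseteq> {p..<q}" "f 2 ` D \<subseteq> {p..<q}"
  proof -
    have 1: "{p..<p + \<sigma>} \<subseteq> {p..<q}" "{p + \<sigma>..<p + 2 * \<sigma>} \<subseteq> {p..<q}" "{p + 2 * \<sigma>..<p + 3 * \<sigma>} \<subseteq> {p..<q}"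
      using \<sigma> by auto
    show "f 0 ` D \<subseteq> {p..<q}" by (rule order_trans[OF fD(1) 1(1)])
    show "f 1 ` D \<subseteq> {p..<q}" by (rule order_trans[OF fD(2) 1(2)])
    show "f 2 ` D \<subseteq> {p..<q}" by (rule order_trans[OF fD(3) 1(3)])
  qed
  have D_mem: "t \<in> D \<longleftrightarrow> 0 \<le> t \<and> t < s \<or> q \<le> t \<and> t < l" for t unfolding D_def by auto
  have Dd: "id ` D \<inter> f 0 ` D = {}" "id ` D \<inter> f 1 ` D = {}" "id ` D \<inter> f 2 ` D = {}"
    "f 0 ` D \<inter> f 1 ` D = {}" "f 0 ` D \<inter> f 2 ` D = {}" "f 1 ` D \<inter> f 2 ` D = {}"
  proof -
    have I: "D \<inter> {p..<q} = {}" unfolding disjoint_iff D_mem using s by auto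
    show "id ` D \<inter> f 0 ` D = {}" "id ` D \<inter> f 1 ` D = {}" "id ` D \<inter> f 2 ` D = {}"
      using disjoint_subsets[OF I order_refl fpq(1)] disjoint_subsets[OF I order_refl fpq(2)]
        disjoint_subsets[OF I order_refl fpq(3)] by simp_all
    show "f 0 ` D \<inter> f 1 ` D = {}" by (rule disjoint_subsets[OF _ fD(1,2)]) auto
    show "f 0 ` D \<inter> f 2 ` D = {}" by (rule disjoint_subsets[OF _ fD(1,3)]) (use \<sigma> in auto)
    show "f 1 ` D \<inter> f 2 ` D = {}" by (rule disjoint_subsets[OF _ fD(2,3)]) auto
  qed
  define e where "e = cyc D id (f 0) (f 1) \<circ> cyc D (f 0) (f 1) (f 2)"
  note e_dt = cyc_double_transposition[OF Dd aff_inj[OF aff_id] aff_inj[OF f_aff] aff_inj[OF f_aff] aff_inj[OF f_aff] e_def]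
  have D_cyc: "cyc D u v w \<in> alt" if uvw: "u \<in> aff" "v \<in> aff" "w \<in> aff" and t: "tri D u v w"
    and im: "u ` D \<subseteq> {0..<l}" "v ` D \<subseteq> {0..<l}" "w ` D \<subseteq> {0..<l}" for u v w
  proof -
    have part: "cyc {x..<y} u v w \<in> alt" if xy: "x \<in> \<Gamma>" "y \<in> \<Gamma>" "x < y" "{x..<y} \<subseteq> D" for x y
      by (rule subsetD[OF cycs_alt], rule cycsI[OF xy(1-3) uvw tri_subset[OF t xy(4)]
        order_trans[OF image_mono[OF xy(4)] im(1)] order_trans[OF image_mono[OF xy(4)] im(2)]
        order_trans[OF image_mono[OF xy(4)] im(3)]])
    have "cyc D u v w = cyc {0..<s} u v w \<circ> cyc {q..<l} u v w"
      unfolding D_def by (rule cyc_union[OF t[unfolded D_def]]) (use s q in auto)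
    moreover have "cyc {0..<s} u v w \<in> alt" by (rule part[OF zero_mem s(1,2)]) (simp add: D_def)
    moreover have "cyc {q..<l} u v w \<in> alt" by (rule part[OF q(1) l_mem]) (use q d in \<open>auto simp: D_def\<close>)
    ultimately show ?thesis using sg_comp[OF alt_sg] by simp
  qed
  have fX: "f 0 ` D \<subseteq> {0..<l}" "f 1 ` D \<subseteq> {0..<l}" "f 2 ` D \<subseteq> {0..<l}"
    by (rule order_trans[OF fpq(1) pqX], rule order_trans[OF fpq(2) pqX], rule order_trans[OF fpq(3) pqX])
  have e_alt: "e \<in> alt" unfolding e_def
  proof (rule sg_comp[OF alt_sg])
    show "cyc D id (f 0) (f 1) \<in> alt"
      by (rule D_cyc[OF aff_id f_aff f_aff]) (use Dd fX D_sub in \<open>simp_all add: tri_aff[OF aff_id f_aff f_aff]\<close>)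
    show "cyc D (f 0) (f 1) (f 2) \<in> alt"
      by (rule D_cyc[OF f_aff f_aff f_aff]) (use Dd fX D_sub in \<open>simp_all add: tri_aff[OF f_aff f_aff f_aff]\<close>)
  qed
  have e_pw: "e \<in> pw" using sg_pw[OF alt_sg e_alt] .
  have ee: "e (e t) = t" for t using e_dt(6) by (metis comp_apply id_apply)
  have e_supp: "e t = t" if t: "t \<notin> D \<union> {p..<p + 3 * \<sigma>}" for t
  proof (rule e_dt(5))
    show "t \<notin> id ` D \<union> f 0 ` D \<union> f 1 ` D \<union> f 2 ` D"
      using t fD \<sigma> by (auto simp: subset_iff simp del: image_subset_iff)
  qed
  have eB: "e \<circ> B = B \<circ> e"
  proof (rule commute_if_disjoint[OF _ _ e_supp B_supp])
    show "inj e" "inj B" using e_pw B_pw pw_bij bij_is_inj by blast+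
    show "(D \<union> {p..<p + 3 * \<sigma>}) \<inter> {s..<p} = {}" unfolding D_def using q by auto
  qed
  then have eB': "e (B t) = B (e t)" for t by (metis comp_apply)
  define b where "b = B \<circ> e"
  show thesis
  proof (rule that[of a b])
    show "a \<in> alt" by (rule a(1))
    show "b \<in> alt" unfolding b_def by (rule sg_comp[OF alt_sg B_alt e_alt])
    show "\<forall>H. subgroup H PG \<longrightarrow> a \<in> H \<longrightarrow> b \<in> H \<longrightarrow> alt \<subseteq> H"
    proof (intro allI impI)
      fix H assume H: "subgroup H PG" and aH: "a \<in> H" and bH: "b \<in> H"
      \<comment> \<open>\<open>B\<close> and \<open>e\<close> commute and have orders dividing 3 and
        2, so \<open>e\<close> is the cube of \<open>b\<close>, and then \<open>B\<close> is
        \<open>b \<circ> e\<close>.\<close>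
      have "b \<circ> b \<circ> b = e" unfolding b_def by (auto simp: fun_eq_iff eB' B_cubed ee)
      then have eH: "e \<in> H" using sg_comp[OF H] bH by metis
      have "b \<circ> e = B" unfolding b_def by (auto simp: fun_eq_iff ee)
      then have BH: "spread \<phi> \<in> H" using sg_comp[OF H bH eH] unfolding B_def by simp
      \<comment> \<open>The elements whose action on copy 0 lies in \<open>H\<close> form a
        subgroup. It contains the commutators from \<open>ps\<close>, hence all of
        \<open>alt\<close>.\<close>
      have "alt \<subseteq> {x \<in> pw. spread (single 0 x) \<in> H}"
      proof (rule mp[OF mp[OF spec[OF ps(2)]]], rule copy_subgroup[OF H], rule ballI)
        fix pr assume "pr \<in> set ps"
        then obtain i where i: "i < length ps" "pr = ps ! i" by (metis in_set_conv_nth)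
        have 1: "spread (single 0 (comm (x (2 * i)) (x (2 * i + 1)))) \<in> H"
          by (rule copy_comm_mem[OF H aH a_step \<phi>_pw \<phi>_pow \<phi>_other BH]) (use i in \<open>auto simp: K_def\<close>)
        have x: "x (2 * i) = fst pr" "x (2 * i + 1) = snd pr" unfolding x_def i(2) by simp_all
        have "x (2 * i) \<in> pw" "x (2 * i + 1) \<in> pw"
          using x_cycs[of "2 * i"] x_cycs[of "2 * i + 1"] cycs_pw[OF order_refl] i unfolding K_def by auto
        then have "comm (x (2 * i)) (x (2 * i + 1)) \<in> pw" by (intro pw_comp pw_inverse)
        then show "comm (fst pr) (snd pr) \<in> {x \<in> pw. spread (single 0 x) \<in> H}" using 1 unfolding x by blast
      qed
      then have U: "cycs {p..<q} \<subseteq> H"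
      proof -
        assume *: "alt \<subseteq> {x \<in> pw. spread (single 0 x) \<in> H}"
        have I: "\<tau> 0 ` {0..<l} = {p..<q}" unfolding \<tau>_im by simp
        show ?thesis
        proof
          fix z assume "z \<in> cycs {p..<q}"
          then obtain y where "y \<in> cycs {0..<l}" "z = spread (single 0 y)" using cycs_copy[of z 0] I by metis
          then show "z \<in> H" using * cycs_alt by auto
        qed
      qed
      \<comment> \<open>The image of \<open>[p, q)\<close> under \<open>e\<close> contains
        \<open>D\<close> and \<open>R\<close>. With \<open>R\<close> as overlap, everything outside
        \<open>[s, p)\<close> is reached.\<close>
      define R where "R = {p + 3 * \<sigma>..<q}"
      have "D \<union> R \<subseteq> e ` {p..<q}"
      proof
        fix t assume "t \<in> D \<union> R"
        then show "t \<in> e ` {p..<q}"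
        proof
          assume t: "t \<in> D"
          have "e (f 0 t) = t" using e_dt(2)[OF t] by simp
          moreover have "f 0 t \<in> {p..<q}" using fD(1) imageI[OF t, of "f 0"] \<sigma> by auto
          ultimately show ?thesis by (metis imageI)
        next
          assume t: "t \<in> R"
          have "t \<notin> D \<union> {p..<p + 3 * \<sigma>}" using t s \<sigma> unfolding R_def D_def by auto
          then have "e t = t" by (rule e_supp)
          moreover have "t \<in> {p..<q}" using t \<sigma> unfolding R_def by auto
          ultimately show ?thesis by (metis imageI)
        qed
      qed
      then have W: "cycs (D \<union> R) \<subseteq> H"
        using conj_cycs_mem[OF H eH U pqX] cycs_mono by blast
      have "cycs ({p..<q} \<union> (D \<union> R)) \<subseteq> H"
      proof (rule cycs_Un[OF H U W, of "p + 3 * \<sigma>" q "{p, q}"])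
        show "p + 3 * \<sigma> < q" "{p + 3 * \<sigma>..<q} \<subseteq> {p..<q}" "{p + 3 * \<sigma>..<q} \<subseteq> D \<union> R"
          using \<sigma> unfolding R_def by auto
        show "{p, q} \<subseteq> \<Gamma>" using p q by simp
        fix u v :: real assume uv: "u < v" "{u<..<v} \<inter> {p, q} = {}" "{u..<v} \<subseteq> {p..<q} \<union> (D \<union> R)"
        show "{u..<v} \<subseteq> {p..<q} \<or> {u..<v} \<subseteq> D \<union> R"
        proof (cases "p \<le> u \<and> v \<le> q")
          case True then show ?thesis by auto
        next
          case False
          then have "v \<le> p \<or> q \<le> u" using uv(1,2) q by auto
          then have "{u..<v} \<inter> {p..<q} = {}" by auto
          then show ?thesis using uv(3) by blast
        qed
      qed simp
      then have U': "cycs ({0..<s} \<union> {p..<l}) \<subseteq> H"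
      proof -
        assume *: "cycs ({p..<q} \<union> (D \<union> R)) \<subseteq> H"
        have "{0..<s} \<union> {p..<l} \<subseteq> {p..<q} \<union> (D \<union> R)" unfolding D_def by auto
        then show ?thesis using * cycs_mono by blast
      qed
      have aN: "(a ^^ n) \<in> H \<and> (\<forall>t\<in>{0..<d}. (a ^^ n) t = \<kappa> ^ n * t)" for n
      proof (induction n)
        case 0 then show ?case using sg_id[OF H] by (simp add: id_def)
      next
        case (Suc n)
        have 1: "a ((a ^^ n) t) = \<kappa> ^ Suc n * t" if t: "t \<in> {0..<d}" for t
        proof -
          have "\<kappa> ^ n * t \<le> t" using pow[of n] t by (simp add: mult_left_le_one_le)
          then have "\<kappa> ^ n * t \<in> {0..<d}" using pow[of n] t by auto
          then show ?thesis using a(2) Suc t by simp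
        qed
        have 2: "a ^^ Suc n \<in> H"
          using sg_comp[OF H aH conjunct1[OF Suc]] by (simp only: funpow.simps)
        show ?case by (intro conjI ballI 2) (simp add: 1)
      qed
      have aN_pw: "a ^^ N \<in> pw" using aN sg_pw[OF H] by blast
      have UX: "{0..<s} \<union> {p..<l} \<subseteq> {0..<l}" using s p q d by auto
      \<comment> \<open>\<open>a ^^ N\<close> maps the missing interval \<open>[s, p)\<close> below
        \<open>s = \<kappa> ^ N * p\<close>, so it carries the complement of \<open>[s, p)\<close>
        onto a set containing \<open>[s, l)\<close>.\<close>
      have "{s..<l} \<subseteq> (a ^^ N) ` ({0..<s} \<union> {p..<l})"
      proof
        fix t assume t: "t \<in> {s..<l}"
        define y where "y = iv (a ^^ N) t"
        have ay: "(a ^^ N) y = t" unfolding y_def using aN_pw by simp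
        then have yX: "y \<in> {0..<l}" using pw_mem_iff[OF aN_pw, of y] t s by auto
        have "y \<notin> {s..<p}"
        proof
          assume y: "y \<in> {s..<p}"
          then have "t = \<kappa> ^ N * y" using aN[of N] ay s p by auto
          also have "\<dots> < \<kappa> ^ N * p" using y pow[of N] by simp
          finally show False using t unfolding s_def by simp
        qed
        then have "y \<in> {0..<s} \<union> {p..<l}" using yX by auto
        then show "t \<in> (a ^^ N) ` ({0..<s} \<union> {p..<l})" using ay by (metis imageI)
      qed
      then have W': "cycs {s..<l} \<subseteq> H"
        using conj_cycs_mem[OF H conjunct1[OF aN[of N]] U' UX] cycs_mono by blast
      have "cycs (({0..<s} \<union> {p..<l}) \<union> {s..<l}) \<subseteq> H"
      proof (rule cycs_Un[OF H U' W', of p l "{s}"])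
        show "p < l" "{p..<l} \<subseteq> {0..<s} \<union> {p..<l}" "{p..<l} \<subseteq> {s..<l}" using p d s by auto
        show "{s} \<subseteq> \<Gamma>" using s by simp
        fix u v :: real assume uv: "u < v" "{u<..<v} \<inter> {s} = {}" "{u..<v} \<subseteq> ({0..<s} \<union> {p..<l}) \<union> {s..<l}"
        have "v \<le> s \<or> s \<le> u" using uv(1,2) by auto
        then have "{u..<v} \<inter> {s..<l} = {} \<or> {u..<v} \<inter> {0..<s} = {}" by auto
        moreover have "{p..<l} \<subseteq> {s..<l}" using s by auto
        ultimately show "{u..<v} \<subseteq> {0..<s} \<union> {p..<l} \<or> {u..<v} \<subseteq> {s..<l}" using uv(3) by blast
      qed simp
      moreover have "({0..<s} \<union> {p..<l}) \<union> {s..<l} = {0..<l}" using s p q d by auto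
      ultimately show "alt \<subseteq> H" using alt_le[OF H] by simp
    qed
  qed
qed

end

subsection \<open>Germs and the semidirect product\<close>

lemma is_simple_iso:
  assumes \<phi>: "\<phi> \<in> iso G H" and G: "is_simple G" and H: "group H"
  shows "is_simple H"
proof -
  have gG: "group G" using G unfolding is_simple_def by blast
  interpret h: group_hom G H \<phi>
    using \<phi> gG H by (simp add: group_hom_def group_hom_axioms_def iso_def)
  have bij: "bij_betw \<phi> (carrier G) (carrier H)" using \<phi> by (simp add: iso_def)
  have "carrier H \<noteq> {\<one>\<^bsub>H\<^esub>}"
  proof
    assume cH: "carrier H = {\<one>\<^bsub>H\<^esub>}"
    have "x = \<one>\<^bsub>G\<^esub>" if x: "x \<in> carrier G" for x
    proof (rule inj_onD[OF bij_betw_imp_inj_on[OF bij] _ x])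
      show "\<one>\<^bsub>G\<^esub> \<in> carrier G" by simp
      have "\<phi> x = \<one>\<^bsub>H\<^esub>" using h.hom_closed[OF x] cH by simp
      then show "\<phi> x = \<phi> \<one>\<^bsub>G\<^esub>" by simp
    qed
    then have "carrier G = {\<one>\<^bsub>G\<^esub>}" using group.is_monoid[OF gG] monoid.one_closed by blast
    then show False using G unfolding is_simple_def by simp
  qed
  moreover have "N = {\<one>\<^bsub>H\<^esub>} \<or> N = carrier H" if N: "N \<lhd> H" for N
  proof -
    define N' where "N' = {x \<in> carrier G. \<phi> x \<in> N}"
    have sN: "subgroup N H" using normal_imp_subgroup[OF N] .
    have "N' \<lhd> G"
      unfolding group.normal_inv_iff[OF gG]
    proof (intro conjI ballI)
      show "subgroup N' G"
        by (rule group.subgroupI[OF gG])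
          (auto simp: N'_def subgroup.one_closed[OF sN] subgroup.m_closed[OF sN] subgroup.m_inv_closed[OF sN]
            intro: exI[of _ "\<one>\<^bsub>G\<^esub>"])
      fix x y assume "x \<in> carrier G" "y \<in> N'"
      then show "x \<otimes>\<^bsub>G\<^esub> y \<otimes>\<^bsub>G\<^esub> inv\<^bsub>G\<^esub> x \<in> N'"
        unfolding N'_def using normal.inv_op_closed2[OF N, of "\<phi> x" "\<phi> y"] by simp
    qed
    then have N': "N' = {\<one>\<^bsub>G\<^esub>} \<or> N' = carrier G" using G unfolding is_simple_def by blast
    have "\<phi> ` N' = N"
      using bij subgroup.subset[OF sN] unfolding N'_def bij_betw_def by (auto simp: image_iff)
    then show ?thesis using N' bij by (auto simp: bij_betw_def)
  qed
  ultimately show ?thesis using H unfolding is_simple_def by blast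
qed

lemma generate_iso:
  assumes "\<phi> \<in> iso G H" "group G" "group H" "S \<subseteq> carrier G" "generate G S = carrier G"
  shows "generate H (\<phi> ` S) = carrier H"
proof -
  interpret h: group_hom G H \<phi>
    using assms(1-3) by (simp add: group_hom_def group_hom_axioms_def iso_def)
  show ?thesis using h.generate_img[OF assms(4)] assms(1,5) by (simp add: iso_def bij_betw_def)
qed

lemma finitely_generated_iso:
  assumes "\<phi> \<in> iso G H" "group G" "group H" "finitely_generated G"
  shows "finitely_generated H"
proof -
  obtain S where S: "finite S" "S \<subseteq> carrier G" "generate G S = carrier G"
    using assms(4) unfolding finitely_generated_def by blast
  have "\<phi> ` S \<subseteq> carrier H" using S(2) assms(1) by (auto simp: iso_def hom_def)
  then show ?thesis
    unfolding finitely_generated_def using S(1) generate_iso[OF assms(1-3) S(2,3)] by blast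
qed

lemma two_generated_iso:
  assumes "\<phi> \<in> iso G H" "group G" "group H" "two_generated G"
  shows "two_generated H"
proof -
  obtain a b where ab: "a \<in> carrier G" "b \<in> carrier G" "generate G {a, b} = carrier G"
    using assms(4) unfolding two_generated_def by blast
  have "\<phi> a \<in> carrier H" "\<phi> b \<in> carrier H" using ab assms(1) by (auto simp: iso_def hom_def)
  then show ?thesis
    unfolding two_generated_def using generate_iso[OF assms(1-3) _ ab(3)] ab by auto
qed

lemma two_generated_imp_finitely_generated: "two_generated G \<Longrightarrow> finitely_generated G"
  unfolding two_generated_def finitely_generated_def by (metis empty_subsetI finite.emptyI finite.insertI insert_subset)

lemma group_derived_group:
  assumes "group G"
  shows "group (derived_group G)"
  unfolding derived_group_def
  by (rule group.subgroup_imp_group[OF assms group.derived_is_subgroup[OF assms]]) simp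

lemma derived_group_iso:
  assumes \<phi>: "\<phi> \<in> iso G H" and G: "group G" and H: "group H"
  shows "\<phi> \<in> iso (derived_group G) (derived_group H)"
proof -
  interpret h: group_hom G H \<phi>
    using assms by (simp add: group_hom_def group_hom_axioms_def iso_def)
  have bij: "bij_betw \<phi> (carrier G) (carrier H)" using \<phi> by (simp add: iso_def)
  have sub: "derived G (carrier G) \<subseteq> carrier G"
    using subgroup.subset[OF group.derived_is_subgroup[OF G]] by blast
  have "derived H (carrier H) = \<phi> ` derived G (carrier G)"
    using h.derived_img[of "carrier G"] bij by (simp add: bij_betw_def)
  then have "bij_betw \<phi> (derived G (carrier G)) (derived H (carrier H))"
    using inj_on_subset[OF bij_betw_imp_inj_on[OF bij] sub] bij by (simp add: bij_betw_def)
  moreover have "\<phi> \<in> hom (derived_group G) (derived_group H)"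
    using \<open>derived H (carrier H) = _\<close> sub by (auto simp: hom_def derived_group_def subset_iff)
  ultimately show ?thesis by (simp add: iso_def derived_group_def)
qed

context stein
begin

lemma carrier_derived_PG [simp]: "carrier (derived_group PG) = alt"
  by (simp add: derived_group_PG)

lemma generate_derived_PG: "S \<subseteq> alt \<Longrightarrow> generate (derived_group PG) S = generate PG S"
  unfolding derived_group_PG by (rule group.generate_consistent[OF group_PG _ alt_sg])

lemma two_generated_derived_PG:
  assumes "gen_data M C"
  shows "two_generated (derived_group PG)"
proof -
  obtain T where T: "finite T" "T \<subseteq> cycs {0..<l}" "\<forall>H. subgroup H PG \<longrightarrow> T \<subseteq> H \<longrightarrow> alt \<subseteq> H"
    using alt_finitely_generated[OF assms] .
  obtain a b where ab: "a \<in> alt" "b \<in> alt" "\<forall>H. subgroup H PG \<longrightarrow> a \<in> H \<longrightarrow> b \<in> H \<longrightarrow> alt \<subseteq> H"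
    using alt_two_generated[OF T(1) order_trans[OF T(2) cycs_alt] T(3)] .
  have ab_pw: "{a, b} \<subseteq> carrier PG" using ab sg_pw[OF alt_sg] by simp
  have "generate PG {a, b} \<subseteq> alt" using ab by (intro group.generate_subgroup_incl[OF group_PG _ alt_sg]) simp
  moreover have "alt \<subseteq> generate PG {a, b}"
    using ab(3) group.generate_is_subgroup[OF group_PG ab_pw] by (meson generate.incl insertI1 insertI2)
  ultimately have "generate (derived_group PG) {a, b} = alt"
    using generate_derived_PG[of "{a, b}"] ab(1,2) by simp
  then show ?thesis unfolding two_generated_def using ab by auto
qed

section \<open>The semidirect product as a group of affine maps\<close>

lemma semidirect_simps [simp]: "carrier (semidirect \<Gamma> \<Lambda>) = \<Gamma> \<times> \<Lambda>"
  "(a, \<mu>) \<otimes>\<^bsub>semidirect \<Gamma> \<Lambda>\<^esub> (b, \<nu>) = (inverse \<nu> * a + b, \<mu> * \<nu>)" "\<one>\<^bsub>semidirect \<Gamma> \<Lambda>\<^esub> = (0, 1)"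
  by (simp_all add: semidirect_def)

lemma group_semidirect: "group (semidirect \<Gamma> \<Lambda>)"
proof (rule groupI)
  fix x y z assume "x \<in> carrier (semidirect \<Gamma> \<Lambda>)" "y \<in> carrier (semidirect \<Gamma> \<Lambda>)" "z \<in> carrier (semidirect \<Gamma> \<Lambda>)"
  then show "x \<otimes>\<^bsub>semidirect \<Gamma> \<Lambda>\<^esub> y \<otimes>\<^bsub>semidirect \<Gamma> \<Lambda>\<^esub> z = x \<otimes>\<^bsub>semidirect \<Gamma> \<Lambda>\<^esub> (y \<otimes>\<^bsub>semidirect \<Gamma> \<Lambda>\<^esub> z)"
    by (cases x; cases y; cases z) (simp add: algebra_simps inverse_mult_distrib)
next
  fix x assume "x \<in> carrier (semidirect \<Gamma> \<Lambda>)"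
  then obtain c \<mu> where x: "x = (c, \<mu>)" "c \<in> \<Gamma>" "\<mu> \<in> \<Lambda>" by auto
  then have "(- (\<mu> * c), inverse \<mu>) \<otimes>\<^bsub>semidirect \<Gamma> \<Lambda>\<^esub> x = \<one>\<^bsub>semidirect \<Gamma> \<Lambda>\<^esub>"
    using slope_pos[of \<mu>] by (simp flip: mult.assoc)
  moreover have "(- (\<mu> * c), inverse \<mu>) \<in> carrier (semidirect \<Gamma> \<Lambda>)" using x by (simp add: uminus_mem scale_mem inverse_slope)
  ultimately show "\<exists>y\<in>carrier (semidirect \<Gamma> \<Lambda>). y \<otimes>\<^bsub>semidirect \<Gamma> \<Lambda>\<^esub> x = \<one>\<^bsub>semidirect \<Gamma> \<Lambda>\<^esub>" by blast
qed (auto simp: mem_intros)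

lemma semidirect_inv:
  assumes "c \<in> \<Gamma>" "\<mu> \<in> \<Lambda>"
  shows "inv\<^bsub>semidirect \<Gamma> \<Lambda>\<^esub> (c, \<mu>) = (- (\<mu> * c), inverse \<mu>)"
proof (rule group.inv_equality[OF group_semidirect])
  show "(- (\<mu> * c), inverse \<mu>) \<otimes>\<^bsub>semidirect \<Gamma> \<Lambda>\<^esub> (c, \<mu>) = \<one>\<^bsub>semidirect \<Gamma> \<Lambda>\<^esub>"
    using slope_pos[OF assms(2)] by (simp flip: mult.assoc)
qed (use assms in \<open>simp_all add: uminus_mem scale_mem inverse_slope\<close>)

text \<open>Inverses give the slopes above 1, and conjugating a translation by a slope rescales it,
  so the short positive translations yield all translations.\<close>

lemma semidirect_subgroup_eq:
  assumes G: "subgroup G (semidirect \<Gamma> \<Lambda>)"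
    and scale: "\<And>\<mu>. \<mu> \<in> \<Lambda> \<Longrightarrow> \<mu> < 1 \<Longrightarrow> (0, \<mu>) \<in> G"
    and trans: "\<And>c. c \<in> \<Gamma> \<Longrightarrow> 0 < c \<Longrightarrow> c < l \<Longrightarrow> (c, 1) \<in> G"
  shows "G = \<Gamma> \<times> \<Lambda>"
proof -
  note mult = subgroup.m_closed[OF G] and inv = subgroup.m_inv_closed[OF G]
  have one: "(0, 1) \<in> G" using subgroup.one_closed[OF G] by simp
  have scale': "(0, \<mu>) \<in> G" if "\<mu> \<in> \<Lambda>" for \<mu>
  proof -
    consider "\<mu> < 1" | "\<mu> = 1" | "1 < \<mu>" by linarith
    then show ?thesis
    proof cases
      case 3
      then have "(0, inverse \<mu>) \<in> G" by (intro scale inverse_slope[OF that]) (simp add: inverse_less_1_iff)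
      then have "inv\<^bsub>semidirect \<Gamma> \<Lambda>\<^esub> (0, inverse \<mu>) \<in> G" by (rule inv)
      then show ?thesis using semidirect_inv[OF zero_mem inverse_slope[OF that]] by simp
    qed (use scale one that in auto)
  qed
  have pos: "(c, 1) \<in> G" if c: "c \<in> \<Gamma>" "0 < c" for c
  proof -
    obtain \<mu> where \<mu>: "\<mu> \<in> \<Lambda>" "0 < \<mu>" "\<mu> < l / c" using small_slope[of "l / c"] c l_pos by auto
    have "\<mu> * c < l" using \<mu> c by (simp add: pos_less_divide_eq)
    then have "(\<mu> * c, 1) \<in> G" using \<mu> c by (intro trans scale_mem) auto
    then have "(0, inverse \<mu>) \<otimes>\<^bsub>semidirect \<Gamma> \<Lambda>\<^esub> (\<mu> * c, 1) \<otimes>\<^bsub>semidirect \<Gamma> \<Lambda>\<^esub> (0, \<mu>) \<in> G"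
      using scale'[OF \<mu>(1)] scale'[OF inverse_slope[OF \<mu>(1)]] mult by blast
    then show ?thesis using \<mu> by (simp flip: mult.assoc)
  qed
  have all: "(c, 1) \<in> G" if c: "c \<in> \<Gamma>" for c
  proof -
    consider "0 < c" | "c = 0" | "c < 0" by linarith
    then show ?thesis
    proof cases
      case 3
      then have "inv\<^bsub>semidirect \<Gamma> \<Lambda>\<^esub> (- c, 1) \<in> G" using pos[of "- c"] c uminus_mem by (intro inv) simp
      then show ?thesis using semidirect_inv[OF uminus_mem[OF c] one_slope] by simp
    qed (use pos one c in auto)
  qed
  have "(c, \<mu>) \<in> G" if "c \<in> \<Gamma>" "\<mu> \<in> \<Lambda>" for c \<mu>
    using mult[OF scale'[OF that(2)] all[OF that(1)]] by simp
  then show ?thesis using subgroup.subset[OF G] by auto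
qed

text \<open>The action on the real line, with the translation applied before the scaling as in
  \<open>act\<close>. By \<open>elt_mult\<close>, \<open>elt_inj\<close> and \<open>aff_elt\<close>
  it identifies the semidirect product with the group \<open>aff\<close>.\<close>

definition elt :: "real \<times> real \<Rightarrow> real \<Rightarrow> real" where
  "elt g t = snd g * (t + fst g)"

lemma elt_aff: "g \<in> \<Gamma> \<times> \<Lambda> \<Longrightarrow> elt g \<in> aff"
proof -
  assume "g \<in> \<Gamma> \<times> \<Lambda>"
  then have "(\<lambda>t. snd g * t + snd g * fst g) \<in> aff" by (intro affI scale_mem) auto
  then show ?thesis by (simp add: elt_def[abs_def] distrib_left)
qed

lemma aff_elt:
  assumes "e \<in> aff"
  obtains g where "g \<in> \<Gamma> \<times> \<Lambda>" "e = elt g"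
proof -
  obtain \<mu> c where e: "\<mu> \<in> \<Lambda>" "c \<in> \<Gamma>" "\<And>t. e t = \<mu> * t + c" "0 < \<mu>" using affE[OF assms] by metis
  then have "e = elt (c / \<mu>, \<mu>)" by (auto simp: fun_eq_iff elt_def field_simps)
  then show thesis using that[of "(c / \<mu>, \<mu>)"] e divide_mem by simp
qed

lemma elt_mult: "g \<in> \<Gamma> \<times> \<Lambda> \<Longrightarrow> h \<in> \<Gamma> \<times> \<Lambda> \<Longrightarrow> elt (g \<otimes>\<^bsub>semidirect \<Gamma> \<Lambda>\<^esub> h) = elt g \<circ> elt h"
  using slope_pos by (cases g; cases h) (auto simp: fun_eq_iff elt_def field_simps)

lemma elt_inj: "g \<in> \<Gamma> \<times> \<Lambda> \<Longrightarrow> h \<in> \<Gamma> \<times> \<Lambda> \<Longrightarrow> elt g = elt h \<Longrightarrow> g = h"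
proof -
  assume g: "g \<in> \<Gamma> \<times> \<Lambda>" and h: "h \<in> \<Gamma> \<times> \<Lambda>" and eq: "elt g = elt h"
  have e: "snd g * fst g = snd h * fst h" "snd g * (1 + fst g) = snd h * (1 + fst h)"
    using fun_cong[OF eq, of 0] fun_cong[OF eq, of 1] by (simp_all add: elt_def)
  then have "snd g = snd h" by (simp add: algebra_simps)
  moreover have "0 < snd g" using g slope_pos by auto
  ultimately show "g = h" using e(1) by (auto simp: prod_eq_iff)
qed

lemma elt_inv:
  assumes g: "g \<in> \<Gamma> \<times> \<Lambda>"
  shows "elt (inv\<^bsub>semidirect \<Gamma> \<Lambda>\<^esub> g) = iv (elt g)"
proof -
  have inv: "inv\<^bsub>semidirect \<Gamma> \<Lambda>\<^esub> g \<in> \<Gamma> \<times> \<Lambda>" using group.inv_closed[OF group_semidirect, of g] g by simp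
  have one: "elt (0, 1) = id" by (auto simp: elt_def)
  have "elt g \<circ> elt (inv\<^bsub>semidirect \<Gamma> \<Lambda>\<^esub> g) = id" "elt (inv\<^bsub>semidirect \<Gamma> \<Lambda>\<^esub> g) \<circ> elt g = id"
    using elt_mult[OF g inv] elt_mult[OF inv g] group.l_inv[OF group_semidirect, of g]
      group.r_inv[OF group_semidirect, of g] g one by simp_all
  then show ?thesis by (intro inv_unique_comp[symmetric])
qed

lemma finitely_generated_semidirect:
  assumes "finitely_generated (derived_group PG)"
  shows "finitely_generated (semidirect \<Gamma> \<Lambda>)"
proof -
  obtain T where T: "finite T" "T \<subseteq> alt" "generate (derived_group PG) T = alt"
    using assms unfolding finitely_generated_def by auto
  then have gen: "generate PG T = alt" using generate_derived_PG by simp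
  have ex: "\<exists>E. finite E \<and> E \<subseteq> \<Gamma> \<times> \<Lambda> \<and> (\<forall>s\<in>{0..<l}. \<exists>g\<in>E. t s = elt g s)" if t: "t \<in> pw" for t
  proof -
    obtain P where P: "finite P" "P \<subseteq> \<Gamma> \<times> \<Gamma>" "{0..<l} \<subseteq> (\<Union>p\<in>P. {fst p..<snd p})"
      "\<forall>p\<in>P. \<exists>e\<in>aff. \<forall>s\<in>{fst p..<snd p}. t s = e s"
      by (rule pw_cover[OF t])
    have "\<forall>p\<in>P. \<exists>g. g \<in> \<Gamma> \<times> \<Lambda> \<and> (\<forall>s\<in>{fst p..<snd p}. t s = elt g s)"
    proof
      fix p assume "p \<in> P"
      then obtain e where e: "e \<in> aff" "\<forall>s\<in>{fst p..<snd p}. t s = e s" using P(4) by blast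
      obtain g where "g \<in> \<Gamma> \<times> \<Lambda>" "e = elt g" using aff_elt[OF e(1)] .
      then show "\<exists>g. g \<in> \<Gamma> \<times> \<Lambda> \<and> (\<forall>s\<in>{fst p..<snd p}. t s = elt g s)" using e(2) by blast
    qed
    then have "\<exists>E. \<forall>p\<in>P. E p \<in> \<Gamma> \<times> \<Lambda> \<and> (\<forall>s\<in>{fst p..<snd p}. t s = elt (E p) s)" by (rule bchoice)
    then obtain E where E: "\<forall>p\<in>P. E p \<in> \<Gamma> \<times> \<Lambda> \<and> (\<forall>s\<in>{fst p..<snd p}. t s = elt (E p) s)" by (rule exE)
    have "\<exists>g\<in>E ` P. t s = elt g s" if s: "s \<in> {0..<l}" for s
    proof -
      obtain p where p: "p \<in> P" "s \<in> {fst p..<snd p}" using subsetD[OF P(3) s] by (rule UN_E)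
      have "E p \<in> E ` P" using p(1) by (rule imageI)
      moreover have "t s = elt (E p) s" using E p by simp
      ultimately show ?thesis by (rule rev_bexI)
    qed
    moreover have "E ` P \<subseteq> \<Gamma> \<times> \<Lambda>" using E by blast
    ultimately show ?thesis using P(1) by blast
  qed
  have "\<forall>t\<in>T. \<exists>E. finite E \<and> E \<subseteq> \<Gamma> \<times> \<Lambda> \<and> (\<forall>s\<in>{0..<l}. \<exists>g\<in>E. t s = elt g s)"
  proof
    fix t assume "t \<in> T"
    then have "t \<in> alt" by (rule subsetD[OF T(2)])
    then show "\<exists>E. finite E \<and> E \<subseteq> \<Gamma> \<times> \<Lambda> \<and> (\<forall>s\<in>{0..<l}. \<exists>g\<in>E. t s = elt g s)"
      by (intro ex sg_pw[OF alt_sg])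
  qed
  then have "\<exists>E. \<forall>t\<in>T. finite (E t) \<and> E t \<subseteq> \<Gamma> \<times> \<Lambda> \<and> (\<forall>s\<in>{0..<l}. \<exists>g\<in>E t. t s = elt g s)" by (rule bchoice)
  then obtain E where E: "\<forall>t\<in>T. finite (E t) \<and> E t \<subseteq> \<Gamma> \<times> \<Lambda> \<and> (\<forall>s\<in>{0..<l}. \<exists>g\<in>E t. t s = elt g s)" by (rule exE)
  define S where "S = (\<Union>t\<in>T. E t)"
  have S: "finite S" "S \<subseteq> \<Gamma> \<times> \<Lambda>" unfolding S_def using E T(1) by auto
  define Gn where "Gn = generate (semidirect \<Gamma> \<Lambda>) S"
  have Gn: "subgroup Gn (semidirect \<Gamma> \<Lambda>)"
    unfolding Gn_def using S by (intro group.generate_is_subgroup[OF group_semidirect]) simp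
  have Gn_sub: "Gn \<subseteq> \<Gamma> \<times> \<Lambda>" using subgroup.subset[OF Gn] unfolding semidirect_simps(1) .
  have S_Gn: "S \<subseteq> Gn" unfolding Gn_def by (rule subsetI, rule generate.incl)
  \<comment> \<open>Only pointwise agreement with finitely many elements of \<open>Gn\<close> is
    asked, not agreement on intervals. This passes to products and inverses without any cutting, and
    by the pigeonhole principle it still gives two points with the same element.\<close>
  define W where "W = {f \<in> pw. \<exists>F. finite F \<and> F \<subseteq> Gn \<and> (\<forall>s\<in>{0..<l}. \<exists>g\<in>F. f s = elt g s)}"
  have WI: "f \<in> W" if "f \<in> pw" "finite F" "F \<subseteq> Gn" "\<forall>s\<in>{0..<l}. \<exists>g\<in>F. f s = elt g s" for f F
    unfolding W_def by (rule CollectI, intro conjI exI[of _ F] that)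
  have W: "subgroup W PG"
  proof (rule sgI)
    show "W \<subseteq> pw" unfolding W_def by blast
    have "(0, 1) \<in> Gn" using subgroup.one_closed[OF Gn] by simp
    then show "id \<in> W" by (intro WI[where F = "{(0, 1)}"] pw_id) (simp_all add: elt_def)
  next
    fix f f' assume "f \<in> W" "f' \<in> W"
    then obtain F F' where F: "f \<in> pw" "finite F" "F \<subseteq> Gn" "\<forall>s\<in>{0..<l}. \<exists>g\<in>F. f s = elt g s"
      and F': "f' \<in> pw" "finite F'" "F' \<subseteq> Gn" "\<forall>s\<in>{0..<l}. \<exists>g\<in>F'. f' s = elt g s" unfolding W_def by auto
    define D where "D = (\<lambda>(g, h). g \<otimes>\<^bsub>semidirect \<Gamma> \<Lambda>\<^esub> h) ` (F \<times> F')"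
    have "finite D" unfolding D_def using F F' by simp
    moreover have "D \<subseteq> Gn"
    proof
      fix d assume "d \<in> D"
      then obtain g h where gh: "g \<in> F" "h \<in> F'" "d = g \<otimes>\<^bsub>semidirect \<Gamma> \<Lambda>\<^esub> h" unfolding D_def by auto
      show "d \<in> Gn" unfolding gh(3) by (rule subgroup.m_closed[OF Gn subsetD[OF F(3) gh(1)] subsetD[OF F'(3) gh(2)]])
    qed
    moreover have "\<exists>g\<in>D. (f \<circ> f') s = elt g s" if s: "s \<in> {0..<l}" for s
    proof -
      obtain h where h: "h \<in> F'" "f' s = elt h s" using F'(4) s by blast
      have "f' s \<in> {0..<l}" using pw_mem_iff[OF F'(1)] s by blast
      then obtain g where g: "g \<in> F" "f (f' s) = elt g (f' s)" using F(4) by blast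
      have "elt (g \<otimes>\<^bsub>semidirect \<Gamma> \<Lambda>\<^esub> h) = elt g \<circ> elt h"
        by (rule elt_mult[OF subsetD[OF Gn_sub subsetD[OF F(3) g(1)]] subsetD[OF Gn_sub subsetD[OF F'(3) h(1)]]])
      then have "(f \<circ> f') s = elt (g \<otimes>\<^bsub>semidirect \<Gamma> \<Lambda>\<^esub> h) s" using g(2) h(2) by simp
      moreover have "g \<otimes>\<^bsub>semidirect \<Gamma> \<Lambda>\<^esub> h \<in> D"
        unfolding D_def by (rule image_eqI[where x = "(g, h)"]) (use g(1) h(1) in simp_all)
      ultimately show ?thesis by (rule bexI)
    qed
    ultimately show "f \<circ> f' \<in> W" by (intro WI[where F = D] pw_comp[OF F(1) F'(1)] ballI)
  next
    fix f assume "f \<in> W"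
    then obtain F where F: "f \<in> pw" "finite F" "F \<subseteq> Gn" "\<forall>s\<in>{0..<l}. \<exists>g\<in>F. f s = elt g s" unfolding W_def by auto
    have "(\<lambda>g. inv\<^bsub>semidirect \<Gamma> \<Lambda>\<^esub> g) ` F \<subseteq> Gn" using F(3) subgroup.m_inv_closed[OF Gn] by blast
    moreover have "\<exists>g\<in>(\<lambda>g. inv\<^bsub>semidirect \<Gamma> \<Lambda>\<^esub> g) ` F. iv f s = elt g s" if s: "s \<in> {0..<l}" for s
    proof -
      have "iv f s \<in> {0..<l}" using pw_mem_iff[OF pw_inverse[OF F(1)]] s by blast
      then obtain g where g: "g \<in> F" "f (iv f s) = elt g (iv f s)" using F(4) by blast
      have gm: "g \<in> \<Gamma> \<times> \<Lambda>" using g(1) F(3) Gn_sub by blast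
      have "s = elt g (iv f s)" using g(2) F(1) by simp
      then have "iv (elt g) s = iv f s" using elt_aff[OF gm] by (metis aff_iv_simps(2))
      then have "iv f s = elt (inv\<^bsub>semidirect \<Gamma> \<Lambda>\<^esub> g) s" using elt_inv[OF gm] by simp
      then show ?thesis using g(1) by blast
    qed
    ultimately show "iv f \<in> W" by (intro WI[OF pw_inverse[OF F(1)] finite_imageI[OF F(2)]] ballI)
  qed
  have "T \<subseteq> W"
  proof
    fix t assume t: "t \<in> T"
    have "E t \<subseteq> Gn" using UN_upper[OF t, of E] S_Gn unfolding S_def by (rule order_trans)
    then show "t \<in> W"
      using bspec[OF E t] by (intro WI[OF sg_pw[OF alt_sg subsetD[OF T(2) t]], where F = "E t"]) simp_all
  qed
  then have altW: "alt \<subseteq> W" using group.generate_subgroup_incl[OF group_PG _ W] unfolding gen[symmetric] by simp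
  have realized: "g \<in> Gn" if g: "g \<in> \<Gamma> \<times> \<Lambda>" and pq: "p < q" "{p..<q} \<subseteq> {0..<l}" "elt g ` {p..<q} \<subseteq> {0..<l}"
    "elt g ` {p..<q} \<inter> {p..<q} = {}" for g p q
  proof -
    let ?e = "elt g"
    have e: "?e \<in> aff" by (rule elt_aff[OF g])
    have E2: "finite {id, ?e}" "{id, ?e} \<subseteq> aff" using e aff_id by auto
    obtain u v r where uv: "u \<in> \<Gamma>" "v \<in> \<Gamma>" "p < u" "u < v" "v < q"
      and r: "\<forall>i<Suc 0. r i \<in> aff \<and> r i ` {u..<v} \<subseteq> {0..<l} \<and> (\<forall>e'\<in>{id, ?e}. r i ` {u..<v} \<inter> e' ` {u..<v} = {})"
      by (rule room_interval[where n = "Suc 0", OF E2 pq(1) l_pos])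
    have sub: "{u..<v} \<subseteq> {p..<q}" using uv by auto
    have "?e ` {u..<v} \<inter> {u..<v} = {}" by (rule disjoint_subsets[OF pq(4) image_mono[OF sub] sub])
    then have t: "tri {u..<v} id ?e (r 0)"
      using r by (simp add: tri_aff aff_id e Int_commute)
    have "cyc {u..<v} id ?e (r 0) \<in> alt"
    proof (rule subsetD[OF cycs_alt], rule cycsI[OF uv(1,2,4) aff_id e _ t])
      show "?e ` {u..<v} \<subseteq> {0..<l}" using image_mono[OF sub] pq(3) by (rule order_trans)
      show "id ` {u..<v} \<subseteq> {0..<l}" using order_trans[OF sub pq(2)] unfolding image_id id_apply .
    qed (use r in simp_all)
    then obtain F where F: "finite F" "F \<subseteq> Gn" "\<forall>s\<in>{0..<l}. \<exists>g\<in>F. cyc {u..<v} id ?e (r 0) s = elt g s"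
      using altW unfolding W_def by auto
    have "\<forall>s\<in>{u..<v}. \<exists>h. h \<in> F \<and> ?e s = elt h s"
    proof
      fix s assume s: "s \<in> {u..<v}"
      then have "s \<in> {0..<l}" using sub pq(2) by blast
      then obtain h where "h \<in> F" "cyc {u..<v} id ?e (r 0) s = elt h s" using F(3) by blast
      moreover have "cyc {u..<v} id ?e (r 0) s = ?e s" using cyc_app(1)[OF t s] by simp
      ultimately show "\<exists>h. h \<in> F \<and> ?e s = elt h s" by (intro exI[of _ h] conjI) simp_all
    qed
    then have "\<exists>h. \<forall>s\<in>{u..<v}. h s \<in> F \<and> ?e s = elt (h s) s" by (rule bchoice)
    then obtain h where h: "\<forall>s\<in>{u..<v}. h s \<in> F \<and> ?e s = elt (h s) s" by (rule exE)
    have "\<not> inj_on h {u..<v}"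
    proof
      assume "inj_on h {u..<v}"
      moreover have "h ` {u..<v} \<subseteq> F" using h by blast
      ultimately have "finite {u..<v}" using F(1) by (meson finite_imageD finite_subset)
      then show False using infinite_Ico[OF uv(4)] by contradiction
    qed
    then obtain s s' where s: "s \<in> {u..<v}" "s' \<in> {u..<v}" "s \<noteq> s'" "h s = h s'" unfolding inj_on_def by blast
    have hs: "h s \<in> Gn" using h s(1) F(2) by blast
    then have hm: "h s \<in> \<Gamma> \<times> \<Lambda>" using Gn_sub by blast
    have "?e s = elt (h s) s" "?e s' = elt (h s) s'" using h s by auto
    then have "?e = elt (h s)" using aff_eqI[OF e elt_aff[OF hm] _ _ s(3)] by blast
    then show ?thesis using elt_inj[OF g hm] hs by simp
  qed
  have "Gn = \<Gamma> \<times> \<Lambda>"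
  proof (rule semidirect_subgroup_eq[OF Gn])
    fix \<mu> assume \<mu>: "\<mu> \<in> \<Lambda>" "\<mu> < 1"
    have \<mu>0: "0 < \<mu>" using slope_pos[OF \<mu>(1)] .
    \<comment> \<open>\<open>[p, l)\<close> starts at or beyond \<open>\<mu> * l\<close>, where its
      image ends, so the two are disjoint as \<open>realized\<close> requires.\<close>
    define p where "p = max (\<mu> * l) (l / 2)"
    have p: "0 < p" "p < l" "\<mu> * l \<le> p" unfolding p_def using \<mu> \<mu>0 l_pos by auto
    have gm: "(0, \<mu>) \<in> \<Gamma> \<times> \<Lambda>" using zero_mem \<mu> by simp
    have im: "elt (0, \<mu>) ` {p..<l} = {\<mu> * p..<\<mu> * l}"
      unfolding aff_image[OF elt_aff[OF gm]] by (simp add: elt_def)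
    have "\<mu> * l < l" "0 \<le> \<mu> * p" using \<mu> \<mu>0 l_pos p by auto
    then show "(0, \<mu>) \<in> Gn"
      by (intro realized[OF gm p(2)]) (unfold im, use p in auto)
  next
    fix c assume c: "c \<in> \<Gamma>" "0 < c" "c < l"
    \<comment> \<open>A length of at most \<open>c\<close> makes the interval disjoint from its
      translate, and at most \<open>l - c\<close> keeps the translate inside
      \<open>[0, l)\<close>.\<close>
    define q where "q = min c (l - c)"
    have q: "0 < q" "q \<le> c" "q + c \<le> l" unfolding q_def using c by auto
    have gm: "(c, 1) \<in> \<Gamma> \<times> \<Lambda>" using c one_slope by simp
    have im: "elt (c, 1) ` {0..<q} = {c..<q + c}"
      unfolding aff_image[OF elt_aff[OF gm]] by (simp add: elt_def)
    show "(c, 1) \<in> Gn"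
      by (intro realized[OF gm q(1)]) (unfold im, use q c in auto)
  qed
  then have "generate (semidirect \<Gamma> \<Lambda>) S = carrier (semidirect \<Gamma> \<Lambda>)" unfolding Gn_def by simp
  then show ?thesis unfolding finitely_generated_def using S by auto
qed

text \<open>\<open>M\<close> collects the slopes other than 1 of the generators, inverted where they
  exceed 1, and \<open>C\<close> the absolute values of their nonzero translation parts. Each
  generation property holds because a suitable product set is a subgroup containing
  \<open>S\<close>.\<close>

lemma gen_data_of_finitely_generated:
  assumes "finitely_generated (semidirect \<Gamma> \<Lambda>)"
  obtains M C where "gen_data M C"
proof -
  obtain S where S: "finite S" "S \<subseteq> \<Gamma> \<times> \<Lambda>" "generate (semidirect \<Gamma> \<Lambda>) S = \<Gamma> \<times> \<Lambda>"
    using assms unfolding finitely_generated_def by auto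
  have sub_gen: "\<Gamma> \<times> \<Lambda> \<subseteq> G" if "subgroup G (semidirect \<Gamma> \<Lambda>)" "S \<subseteq> G" for G
    using group.generate_subgroup_incl[OF group_semidirect that(2,1)] S(3) by simp
  define M where "M = (\<lambda>g. if snd g < 1 then snd g else inverse (snd g)) ` {g \<in> S. snd g \<noteq> 1}"
  define C where "C = (\<lambda>g. \<bar>fst g\<bar>) ` {g \<in> S. fst g \<noteq> 0}"
  have SL: "snd g \<in> \<Lambda>" "fst g \<in> \<Gamma>" "0 < snd g" if "g \<in> S" for g using S(2) that slope_pos by auto
  have M: "finite M" "M \<subseteq> \<Lambda>" "\<forall>\<nu>\<in>M. \<nu> < 1"
  proof -
    show "finite M" unfolding M_def using S(1) by simp
    show "M \<subseteq> \<Lambda>" unfolding M_def using SL inverse_slope by auto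
    show "\<forall>\<nu>\<in>M. \<nu> < 1"
    proof
      fix \<nu> assume "\<nu> \<in> M"
      then obtain g where "g \<in> S" "snd g \<noteq> 1" "\<nu> = (if snd g < 1 then snd g else inverse (snd g))" unfolding M_def by blast
      then show "\<nu> < 1" using SL(3)[of g] by (auto simp: inverse_less_1_iff split: if_splits)
    qed
  qed
  have mon_sub: "\<nu> \<in> \<Lambda>" if "\<nu> \<in> mon M" for \<nu>
    using that by (induction rule: mon.induct) (use M in \<open>auto intro: mem_intros\<close>)
  have Mgen: "\<forall>\<mu>\<in>\<Lambda>. \<exists>\<nu>1\<in>mon M. \<exists>\<nu>2\<in>mon M. \<mu> = \<nu>2 / \<nu>1"
  proof -
    define Q where "Q = {\<mu> \<in> \<Lambda>. \<exists>\<nu>1\<in>mon M. \<exists>\<nu>2\<in>mon M. \<mu> = \<nu>2 / \<nu>1}"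
    have Q_inv: "inverse \<mu> \<in> Q" if "\<mu> \<in> Q" for \<mu>
    proof -
      obtain \<nu>1 \<nu>2 where "\<nu>1 \<in> mon M" "\<nu>2 \<in> mon M" "\<mu> = \<nu>2 / \<nu>1" "\<mu> \<in> \<Lambda>" using \<open>\<mu> \<in> Q\<close> unfolding Q_def by blast
      then show ?thesis unfolding Q_def using inverse_slope[of \<mu>]
        by (intro CollectI conjI bexI[of _ \<nu>1] bexI[of _ \<nu>2]) simp_all
    qed
    have Q_mult: "\<mu> * \<mu>' \<in> Q" if q: "\<mu> \<in> Q" "\<mu>' \<in> Q" for \<mu> \<mu>'
    proof -
      obtain \<nu>1 \<nu>2 where 1: "\<nu>1 \<in> mon M" "\<nu>2 \<in> mon M" "\<mu> = \<nu>2 / \<nu>1" "\<mu> \<in> \<Lambda>" using q(1) unfolding Q_def by blast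
      obtain \<kappa>1 \<kappa>2 where 2: "\<kappa>1 \<in> mon M" "\<kappa>2 \<in> mon M" "\<mu>' = \<kappa>2 / \<kappa>1" "\<mu>' \<in> \<Lambda>" using q(2) unfolding Q_def by blast
      show ?thesis unfolding Q_def
        by (intro CollectI conjI mult_slope[OF 1(4) 2(4)] bexI[of _ "\<nu>1 * \<kappa>1"] bexI[of _ "\<nu>2 * \<kappa>2"] mult_slope mon_mult 1 2)
          (simp add: 1(3) 2(3))
    qed
    have Q_one: "1 \<in> Q" unfolding Q_def using mon_one[of M] one_slope by (auto intro!: bexI[of _ 1])
    have Q_M: "\<nu> \<in> Q" if "\<nu> \<in> M" for \<nu>
      unfolding Q_def using subsetD[OF M(2) that] mon_step[OF that mon_one] mon_one[of M]
      by (intro CollectI conjI bexI[of _ 1] bexI[of _ \<nu>]) simp_all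
    have "subgroup (\<Gamma> \<times> Q) (semidirect \<Gamma> \<Lambda>)"
    proof (rule group.subgroupI[OF group_semidirect])
      show "\<Gamma> \<times> Q \<subseteq> carrier (semidirect \<Gamma> \<Lambda>)" unfolding Q_def by auto
      show "\<Gamma> \<times> Q \<noteq> {}" using zero_mem Q_one by blast
      show "inv\<^bsub>semidirect \<Gamma> \<Lambda>\<^esub> g \<in> \<Gamma> \<times> Q" if g: "g \<in> \<Gamma> \<times> Q" for g
      proof -
        obtain c \<mu> where "g = (c, \<mu>)" "c \<in> \<Gamma>" "\<mu> \<in> Q" using g by (rule SigmaE)
        moreover from this have "\<mu> \<in> \<Lambda>" unfolding Q_def by blast
        ultimately show ?thesis using Q_inv by (simp add: semidirect_inv uminus_mem scale_mem)
      qed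
      show "g \<otimes>\<^bsub>semidirect \<Gamma> \<Lambda>\<^esub> h \<in> \<Gamma> \<times> Q" if gh: "g \<in> \<Gamma> \<times> Q" "h \<in> \<Gamma> \<times> Q" for g h
      proof -
        obtain c \<mu> where "g = (c, \<mu>)" "c \<in> \<Gamma>" "\<mu> \<in> Q" using gh(1) by (rule SigmaE)
        moreover obtain d \<nu> where "h = (d, \<nu>)" "d \<in> \<Gamma>" "\<nu> \<in> Q" using gh(2) by (rule SigmaE)
        moreover from \<open>\<nu> \<in> Q\<close> have "\<nu> \<in> \<Lambda>" unfolding Q_def by blast
        ultimately show ?thesis using Q_mult by (simp add: add_mem scale_mem inverse_slope)
      qed
    qed
    moreover have "S \<subseteq> \<Gamma> \<times> Q"
    proof
      fix g assume g: "g \<in> S"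
      have "snd g \<in> Q"
      proof (cases "snd g = 1")
        case True then show ?thesis using Q_one by simp
      next
        case False
        then have "(if snd g < 1 then snd g else inverse (snd g)) \<in> Q" using g by (intro Q_M) (auto simp: M_def)
        then show ?thesis using Q_inv[of "inverse (snd g)"] by (auto split: if_splits)
      qed
      then show "g \<in> \<Gamma> \<times> Q" using SL(2)[OF g] by (cases g) simp
    qed
    ultimately have "\<Gamma> \<times> \<Lambda> \<subseteq> \<Gamma> \<times> Q" by (rule sub_gen)
    then have "\<Lambda> \<subseteq> Q" using zero_mem by blast
    then show ?thesis unfolding Q_def by blast
  qed
  have Cgen: "\<Gamma> \<subseteq> R" if R: "0 \<in> R" "\<forall>x\<in>R. \<forall>y\<in>R. x + y \<in> R" "\<forall>x\<in>R. - x \<in> R" "\<forall>\<mu>\<in>\<Lambda>. \<forall>x\<in>R. \<mu> * x \<in> R" "C \<subseteq> R" for R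
  proof -
    have "subgroup ((R \<inter> \<Gamma>) \<times> \<Lambda>) (semidirect \<Gamma> \<Lambda>)"
    proof (rule group.subgroupI[OF group_semidirect])
      show "(R \<inter> \<Gamma>) \<times> \<Lambda> \<subseteq> carrier (semidirect \<Gamma> \<Lambda>)" by auto
      show "(R \<inter> \<Gamma>) \<times> \<Lambda> \<noteq> {}" using zero_mem R(1) one_slope by blast
      show "inv\<^bsub>semidirect \<Gamma> \<Lambda>\<^esub> g \<in> (R \<inter> \<Gamma>) \<times> \<Lambda>" if "g \<in> (R \<inter> \<Gamma>) \<times> \<Lambda>" for g
        using that R(3,4) by (cases g) (simp add: semidirect_inv uminus_mem scale_mem inverse_slope)
      show "g \<otimes>\<^bsub>semidirect \<Gamma> \<Lambda>\<^esub> h \<in> (R \<inter> \<Gamma>) \<times> \<Lambda>" if "g \<in> (R \<inter> \<Gamma>) \<times> \<Lambda>" "h \<in> (R \<inter> \<Gamma>) \<times> \<Lambda>" for g h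
        using that R(2,4) by (cases g; cases h) (simp add: add_mem scale_mem inverse_slope mult_slope)
    qed
    moreover have "S \<subseteq> (R \<inter> \<Gamma>) \<times> \<Lambda>"
    proof
      fix g assume g: "g \<in> S"
      have "fst g \<in> R"
      proof (cases "fst g = 0")
        case False
        then have "\<bar>fst g\<bar> \<in> C" unfolding C_def using g by blast
        then have "\<bar>fst g\<bar> \<in> R" using R(5) by blast
        then show ?thesis using R(3) by (cases "0 \<le> fst g") force+
      qed (use R(1) in simp)
      then show "g \<in> (R \<inter> \<Gamma>) \<times> \<Lambda>" using SL(1,2)[OF g] by (cases g) simp
    qed
    ultimately have "\<Gamma> \<times> \<Lambda> \<subseteq> (R \<inter> \<Gamma>) \<times> \<Lambda>" by (rule sub_gen)
    then show ?thesis using one_slope by blast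
  qed
  have "C \<noteq> {}"
  proof
    assume "C = {}"
    then have "\<Gamma> \<subseteq> {0}" by (intro Cgen) auto
    then show False using l_mem l_pos by auto
  qed
  moreover have "finite C" "C \<subseteq> \<Gamma>" "\<forall>c\<in>C. 0 < c"
  proof -
    show "finite C" "\<forall>c\<in>C. 0 < c" unfolding C_def using S(1) by auto
    show "C \<subseteq> \<Gamma>" unfolding C_def using SL(2) uminus_mem by (auto simp: abs_if)
  qed
  ultimately have "gen_data M C"
    unfolding gen_data_def using M Mgen Cgen by (intro conjI allI impI; assumption?) blast+
  then show thesis by (rule that)
qed

end

subsection \<open>Right-continuous bijections of the closed interval\<close>

lemma partition_mono:
  fixes x :: "nat \<Rightarrow> real"
  assumes "\<forall>i<n. x i < x (Suc i)" "i < j" "j \<le> n"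
  shows "x i < x j"
  using assms(2,3)
proof (induction j)
  case (Suc j)
  show ?case
  proof (cases "i = j")
    case True then show ?thesis using Suc.prems assms(1) by simp
  next
    case False
    then have "x i < x j" using Suc by simp
    also have "x j < x (Suc j)" using assms(1) Suc.prems by simp
    finally show ?thesis .
  qed
qed simp

lemma partition_cover:
  fixes x :: "nat \<Rightarrow> real"
  assumes "x 0 \<le> t" "t < x n"
  obtains i where "i < n" "x i \<le> t" "t < x (Suc i)"
proof -
  have "\<exists>i<n. x i \<le> t \<and> t < x (Suc i)"
    using assms(2)
  proof (induction n)
    case 0 then show ?case using assms(1) by simp
  next
    case (Suc n)
    show ?case
    proof (cases "t < x n")
      case True
      then obtain i where "i < n" "x i \<le> t" "t < x (Suc i)" using Suc.IH by blast
      then show ?thesis by (intro exI[of _ i]) simp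
    next
      case False
      then show ?thesis using Suc.prems by (intro exI[of _ n]) simp
    qed
  qed
  then show thesis using that by blast
qed

context stein
begin

lemma pw_right_affine:
  assumes "f \<in> pw"
  obtains d e where "0 < d" "e \<in> aff" "\<forall>s\<in>{t..<t + d}. f s = e s"
proof -
  obtain Q where Q: "finite Q" "Q \<subseteq> \<Gamma>"
    "\<And>u v. u < v \<Longrightarrow> {u<..<v} \<inter> Q = {} \<Longrightarrow> \<exists>e\<in>aff. \<forall>t\<in>{u..<v}. f t = e t"
    using pw_cuts[OF assms] by metis
  obtain d where d: "d > 0" "\<forall>x\<in>Q. x \<noteq> t \<longrightarrow> d \<le> dist t x"
    using finite_set_avoid[OF Q(1)] by blast
  have "{t<..<t + d} \<inter> Q = {}" using d by (force simp: dist_real_def)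
  then obtain e where "e \<in> aff" "\<forall>s\<in>{t..<t + d}. f s = e s" using Q(3)[of t "t + d"] d by auto
  then show thesis using that d(1) by blast
qed

lemma pw_l: "f \<in> pw \<Longrightarrow> f l = l"
  using pw_out by simp

lemma pw_bij_betw: "f \<in> pw \<Longrightarrow> bij_betw f {0..l} {0..l}"
proof -
  assume f: "f \<in> pw"
  have "{0..l} = insert l {0..<l}" using l_pos by auto
  then have "f ` {0..l} = {0..l}" using pw_image[OF f] pw_l[OF f] by simp
  moreover have "inj_on f {0..l}" using pw_inj[OF f] by (simp add: inj_on_def)
  ultimately show ?thesis by (simp add: bij_betw_def)
qed

lemma restrict_in_V_carrier:
  assumes f: "f \<in> pw"
  shows "restrict f {0..l} \<in> V_carrier \<Gamma> \<Lambda> l"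
proof -
  let ?f = "restrict f {0..l}"
  have "bij_betw ?f {0..l} {0..l}" unfolding bij_betw_restrict_eq by (rule pw_bij_betw[OF f])
  then have bij: "?f \<in> Bij {0..l}" by (simp add: Bij_def)
  have cont: "continuous (at t within {t..l}) ?f" if t: "t \<in> {0..l}" for t
  proof (cases "t = l")
    case True
    then show ?thesis by (simp add: continuous_within at_within_def)
  next
    case False
    obtain d e where d: "0 < d" "e \<in> aff" "\<forall>s\<in>{t..<t + d}. f s = e s" using pw_right_affine[OF f] by blast
    obtain \<mu> c where e: "\<And>t. e t = \<mu> * t + c" using affE[OF d(2)] by metis
    have "continuous (at t within {t..l}) (\<lambda>t. \<mu> * t + c)" by (intro continuous_intros)
    then show ?thesis
    proof (rule continuous_transform_within[OF _ d(1)])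
      show "t \<in> {t..l}" using t by simp
      fix s assume "s \<in> {t..l}" "dist s t < d"
      then have "s \<in> {t..<t + d}" "s \<in> {0..l}" using t by (auto simp: dist_real_def)
      then show "\<mu> * s + c = ?f s" using d(3) e by simp
    qed
  qed
  obtain Q where Q: "finite Q" "Q \<subseteq> \<Gamma>"
    "\<And>u v. u < v \<Longrightarrow> {u<..<v} \<inter> Q = {} \<Longrightarrow> \<exists>e\<in>aff. \<forall>t\<in>{u..<v}. f t = e t"
    using pw_cuts[OF f] by metis
  define R where "R = insert 0 (insert l (Q \<inter> {0..l}))"
  have R: "finite R" "R \<subseteq> \<Gamma>" "R \<subseteq> {0..l}" "0 \<in> R" "l \<in> R"
    using Q zero_mem l_mem l_pos unfolding R_def by auto
  define xs where "xs = sorted_list_of_set R"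
  have xs: "sorted_wrt (<) xs" "set xs = R" unfolding xs_def using R(1) by simp_all
  have nth_less: "xs ! i < xs ! j \<longleftrightarrow> i < j" if "i < length xs" "j < length xs" for i j
    using sorted_wrt_nth_less[OF xs(1), of i j] sorted_wrt_nth_less[OF xs(1), of j i] that
    by (cases i j rule: linorder_cases) auto
  define n where "n = length xs - 1"
  have len: "length xs = Suc n" using R(4) xs(2) unfolding n_def by (cases xs) auto
  have mem: "xs ! i \<in> R" if "i \<le> n" for i using that len xs(2) by (metis le_imp_less_Suc nth_mem)
  have 0: "xs ! 0 = 0"
  proof -
    obtain j where "j < length xs" "xs ! j = 0" using R(4) xs(2) by (metis in_set_conv_nth)
    then have "\<not> 0 < xs ! 0" using nth_less[of j 0] len by auto
    then show ?thesis using mem[of 0] R(3) by auto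
  qed
  have n: "xs ! n = l"
  proof -
    obtain j where "j < length xs" "xs ! j = l" using R(5) xs(2) by (metis in_set_conv_nth)
    then have "\<not> xs ! n < l" using nth_less[of n j] len by auto
    then show ?thesis using mem[of n] R(3) by force
  qed
  have piece: "\<exists>\<mu>\<in>\<Lambda>. \<exists>c. \<forall>t\<in>{xs ! i..<xs ! Suc i}. ?f t = \<mu> * t + c" if i: "i < n" for i
  proof -
    have lt: "xs ! i < xs ! Suc i" using nth_less[of i "Suc i"] i len by simp
    have in_X: "{xs ! i..<xs ! Suc i} \<subseteq> {0..l}" using mem[of i] mem[of "Suc i"] i R(3) by force
    have "{xs ! i<..<xs ! Suc i} \<inter> Q = {}"
    proof (rule ccontr)
      assume "{xs ! i<..<xs ! Suc i} \<inter> Q \<noteq> {}"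
      then obtain y where y: "y \<in> Q" "xs ! i < y" "y < xs ! Suc i" by auto
      then have "y \<in> {0..l}" by (intro subsetD[OF in_X]) simp
      then have "y \<in> R" using y(1) unfolding R_def by simp
      then obtain j where "j < length xs" "xs ! j = y" using xs(2) by (metis in_set_conv_nth)
      then have "i < j" "j < Suc i" using nth_less[of i j] nth_less[of j "Suc i"] y i len by auto
      then show False by simp
    qed
    then obtain e where e: "e \<in> aff" "\<forall>t\<in>{xs ! i..<xs ! Suc i}. f t = e t" using Q(3)[OF lt] by blast
    obtain \<mu> c where "\<mu> \<in> \<Lambda>" "\<And>t. e t = \<mu> * t + c" using affE[OF e(1)] by metis
    then show ?thesis using e(2) in_X by (intro bexI[of _ \<mu>] exI[of _ c]) (auto simp: subset_iff)
  qed
  have "\<forall>i<n. xs ! i < xs ! Suc i" using nth_less len by simp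
  moreover have "\<forall>i\<le>n. xs ! i \<in> \<Gamma>" using mem R(2) by blast
  ultimately show ?thesis
    unfolding V_carrier_def mem_Collect_eq
    using bij cont 0 n piece by (intro conjI ballI exI[of _ n] exI[of _ "\<lambda>i. xs ! i"]) auto
qed

text \<open>The definition asks for slopes in \<Lambda> and cut points in \<Gamma>, but neither for
  translation parts in \<Gamma> nor for \<open>l\<close> to be fixed. Both follow from
  bijectivity.\<close>

lemma V_carrier_is_restrict:
  assumes V: "f \<in> V_carrier \<Gamma> \<Lambda> l"
  obtains g where "g \<in> pw" "f = restrict g {0..l}"
proof -
  have bij: "bij_betw f {0..l} {0..l}" "f \<in> extensional {0..l}" using V unfolding V_carrier_def Bij_def by auto
  obtain n x where x: "x 0 = 0" "x n = l" "\<forall>i\<le>n. x i \<in> \<Gamma>" "\<forall>i<n. x i < x (Suc i)"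
    and pieces: "\<forall>i<n. \<exists>\<mu>\<in>\<Lambda>. \<exists>c. \<forall>t\<in>{x i..<x (Suc i)}. f t = \<mu> * t + c"
    using V unfolding V_carrier_def by auto
  have "\<forall>i\<in>{..<n}. \<exists>\<mu>. \<mu> \<in> \<Lambda> \<and> (\<exists>c. \<forall>t\<in>{x i..<x (Suc i)}. f t = \<mu> * t + c)" using pieces by blast
  then have "\<exists>\<mu>. \<forall>i\<in>{..<n}. \<mu> i \<in> \<Lambda> \<and> (\<exists>c. \<forall>t\<in>{x i..<x (Suc i)}. f t = \<mu> i * t + c)" by (rule bchoice)
  then obtain \<mu> where *: "\<forall>i\<in>{..<n}. \<mu> i \<in> \<Lambda> \<and> (\<exists>c. \<forall>t\<in>{x i..<x (Suc i)}. f t = \<mu> i * t + c)" by (rule exE)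
  have \<mu>: "\<And>i. i < n \<Longrightarrow> \<mu> i \<in> \<Lambda>" "\<And>i t. i < n \<Longrightarrow> t \<in> {x i..<x (Suc i)} \<Longrightarrow> f t = f (x i) + \<mu> i * (t - x i)"
  proof -
    show "\<mu> i \<in> \<Lambda>" if "i < n" for i using bspec[OF *, of i] that by simp
    show "f t = f (x i) + \<mu> i * (t - x i)" if it: "i < n" "t \<in> {x i..<x (Suc i)}" for i t
    proof -
      have "\<exists>c. \<forall>t\<in>{x i..<x (Suc i)}. f t = \<mu> i * t + c" using bspec[OF *, of i] it(1) by simp
      then obtain c where c: "\<forall>t\<in>{x i..<x (Suc i)}. f t = \<mu> i * t + c" by (rule exE)
      have "f (x i) = \<mu> i * x i + c" "f t = \<mu> i * t + c" using bspec[OF c, of "x i"] bspec[OF c it(2)] it by auto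
      then show ?thesis by (simp add: algebra_simps)
    qed
  qed
  have mono: "x i < x j" if "i < j" "j \<le> n" for i j using partition_mono[OF x(4) that] .
  have le: "x i \<le> x j" if "i \<le> j" "j \<le> n" for i j using mono[of i j] that by (cases "i = j") auto
  have range: "0 \<le> x i" "x i \<le> l" if "i \<le> n" for i using le[of 0 i] le[of i n] x that by auto
  have fX: "f t \<in> {0..l}" if "t \<in> {0..l}" for t using bij(1) that by (metis bij_betw_apply)
  have finj: "s = t" if "f s = f t" "s \<in> {0..l}" "t \<in> {0..l}" for s t
    using bij_betw_imp_inj_on[OF bij(1)] that by (metis inj_onD)
  \<comment> \<open>To the right of any point below \<open>l\<close> the map still increases, so
    only \<open>l\<close> itself can be sent to the maximum.\<close>
  have fl: "f l = l"
  proof -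
    obtain s where s: "s \<in> {0..l}" "f s = l"
      using bij_betw_imp_surj_on[OF bij(1)] l_pos by (metis atLeastAtMost_iff imageE less_eq_real_def order_refl)
    have "\<not> s < l"
    proof
      assume "s < l"
      then obtain i where i: "i < n" "x i \<le> s" "s < x (Suc i)"
        using partition_cover[of x s n] s(1) x(1,2) by auto
      define s' where "s' = (s + x (Suc i)) / 2"
      have s': "s < s'" "s' < x (Suc i)" using i unfolding s'_def by auto
      have "f s' = f s + \<mu> i * (s' - s)"
        using \<mu>(2)[OF i(1), of s] \<mu>(2)[OF i(1), of s'] i s' by (simp add: algebra_simps)
      moreover have "0 < \<mu> i * (s' - s)" using s' slope_pos[OF \<mu>(1)[OF i(1)]] by simp
      moreover have "f s' \<in> {0..l}" using fX[of s'] s' s(1) range(2)[of "Suc i"] i by auto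
      ultimately show False using s(2) by simp
    qed
    then show ?thesis using s by auto
  qed
  \<comment> \<open>Consider the least value \<open>y\<close> of this kind outside \<Gamma>. The
    piece whose image lies just below \<open>y\<close> must end exactly at \<open>y\<close> by
    injectivity, and it starts at a smaller value, which is in \<Gamma> by minimality. Slope and
    length of the piece then put \<open>y\<close> into \<Gamma>.\<close>
  have f\<Gamma>: "f (x i) \<in> \<Gamma>" if "i < n" for i
  proof (rule ccontr)
    assume notin: "f (x i) \<notin> \<Gamma>"
    define Y where "Y = {f (x i) | i. i < n \<and> f (x i) \<notin> \<Gamma>}"
    have Y: "finite Y" "Y \<noteq> {}" unfolding Y_def using that notin by auto
    define y where "y = Min Y"
    have yY: "y \<in> Y" unfolding y_def using Y by (rule Min_in)
    then obtain k where k: "k < n" "y = f (x k)" "y \<notin> \<Gamma>" unfolding Y_def by blast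
    have xk: "x k \<in> {0..l}" using range[of k] k(1) by simp
    have y: "0 < y" "y \<le> l" using fX[OF xk] k zero_mem by (auto simp: less_eq_real_def)
    \<comment> \<open>\<open>z j\<close> is the limit of piece \<open>j\<close> at its right end,
      and \<open>m\<close> is the largest of these limits below \<open>y\<close>, or 0. A value
      strictly between \<open>m\<close> and \<open>y\<close> is therefore taken on a piece that
      reaches at least up to \<open>y\<close>.\<close>
    define z where "z j = f (x j) + \<mu> j * (x (Suc j) - x j)" for j
    define W where "W = insert 0 ({w \<in> z ` {..<n}. w < y})"
    have W: "finite W" "W \<noteq> {}" unfolding W_def by auto
    define m where "m = Max W"
    have m: "m \<in> W" unfolding m_def using W by (rule Max_in)
    have my: "m < y" "0 \<le> m" using m y Max_ge[OF W(1), of 0] unfolding W_def m_def by auto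
    define w where "w = (m + y) / 2"
    have w: "m < w" "w < y" unfolding w_def using my by auto
    then have "w \<in> {0..l}" using my y by auto
    then obtain s where s: "s \<in> {0..l}" "f s = w" using bij_betw_imp_surj_on[OF bij(1)] by (metis imageE)
    have "s \<noteq> l" using s w y fl by auto
    then obtain j where j: "j < n" "x j \<le> s" "s < x (Suc j)"
      using partition_cover[of x s n] s(1) x(1,2) by auto
    have mj: "0 < \<mu> j" using slope_pos[OF \<mu>(1)[OF j(1)]] .
    have wj: "w = f (x j) + \<mu> j * (s - x j)" using \<mu>(2)[OF j(1), of s] j s by simp
    have xj: "f (x j) < y" using wj w(2) mj j by (smt (verit) mult_nonneg_nonneg)
    have "w < z j" unfolding wj z_def using mj j by simp
    then have zy: "y \<le> z j" using Max_ge[OF W(1), of "z j"] w(1) j(1) unfolding W_def m_def by force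
    have "y = z j"
    proof (rule ccontr)
      assume "y \<noteq> z j"
      then have yz: "y < z j" using zy by simp
      define r where "r = x j + (y - f (x j)) / \<mu> j"
      have r: "x j < r" "r < x (Suc j)"
        using xj yz mj unfolding r_def z_def by (simp_all add: field_simps)
      have "f r = y" using \<mu>(2)[OF j(1), of r] r mj unfolding r_def by simp
      moreover have "r \<in> {0..l}" using r range(1)[of j] range(2)[of "Suc j"] j by auto
      ultimately have "r = x k" using finj xk k(2) by blast
      then have "x j < x k" "x k < x (Suc j)" using r by auto
      then have "\<not> k \<le> j" "\<not> Suc j \<le> k" using le[of k j] le[of "Suc j" k] j k(1) by (auto simp: not_less)
      then show False by simp
    qed
    moreover have "f (x j) \<in> \<Gamma>"
    proof (rule ccontr)
      assume "f (x j) \<notin> \<Gamma>"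
      then have "f (x j) \<in> Y" unfolding Y_def using j(1) by blast
      then have "y \<le> f (x j)" unfolding y_def using Y(1) by (rule Min_le[rotated])
      then show False using xj by simp
    qed
    moreover have "x j \<in> \<Gamma>" "x (Suc j) \<in> \<Gamma>" using x(3) j(1) by auto
    ultimately have "y \<in> \<Gamma>" unfolding z_def using \<mu>(1)[OF j(1)] by (auto intro!: mem_intros)
    then show False using k(3) by simp
  qed
  define g where "g t = (if t \<in> {0..<l} then f t else t)" for t
  have fg: "f = restrict g {0..l}"
  proof
    fix t
    show "f t = restrict g {0..l} t"
      using fl extensional_arb[OF bij(2), of t] by (cases "t \<in> {0..l}"; cases "t = l") (auto simp: g_def)
  qed
  have "g \<in> pw"
  proof (rule pwI[of _ "(\<lambda>i. (x i, x (Suc i))) ` {..<n}"])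
    have "bij_betw f ({0..l} - {l}) ({0..l} - {l})"
      using bij_betw_DiffI[OF bij(1), of "{l}" "{l}"] fl l_pos by (simp add: bij_betw_def)
    moreover have "{0..l} - {l} = {0..<l}" by auto
    ultimately have "bij_betw g {0..<l} {0..<l}" by (subst bij_betw_cong[of _ g f]) (simp_all add: g_def)
    moreover have "bij_betw g (- {0..<l}) (- {0..<l})" by (subst bij_betw_cong[of _ g id]) (auto simp: g_def)
    ultimately have "bij_betw g ({0..<l} \<union> - {0..<l}) ({0..<l} \<union> - {0..<l})" by (rule bij_betw_combine) simp
    then show "bij g" by simp
    show "g t = t" if "t \<notin> {0..<l}" for t using that by (simp only: g_def if_False)
    show "finite ((\<lambda>i. (x i, x (Suc i))) ` {..<n})" by simp
    show "(\<lambda>i. (x i, x (Suc i))) ` {..<n} \<subseteq> \<Gamma> \<times> \<Gamma>" using x(3) by auto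
    show "{0..<l} \<subseteq> (\<Union>p\<in>(\<lambda>i. (x i, x (Suc i))) ` {..<n}. {fst p..<snd p})"
    proof
      fix t assume "t \<in> {0..<l}"
      then obtain i where "i < n" "x i \<le> t" "t < x (Suc i)" using partition_cover[of x t n] x(1,2) by auto
      then show "t \<in> (\<Union>p\<in>(\<lambda>i. (x i, x (Suc i))) ` {..<n}. {fst p..<snd p})" by auto
    qed
    fix p assume "p \<in> (\<lambda>i. (x i, x (Suc i))) ` {..<n}"
    then obtain i where i: "i < n" "p = (x i, x (Suc i))" by auto
    have "(\<lambda>t. \<mu> i * t + (f (x i) - \<mu> i * x i)) \<in> aff"
      using \<mu>(1)[OF i(1)] f\<Gamma>[OF i(1)] x(3) i(1) by (intro affI mem_intros) auto
    moreover have "\<forall>t\<in>{fst p..<snd p}. g t = \<mu> i * t + (f (x i) - \<mu> i * x i)"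
    proof
      fix t assume t: "t \<in> {fst p..<snd p}"
      then have "t \<in> {0..<l}" using i range(1)[of i] range(2)[of "Suc i"] by auto
      then have "g t = f t" by (simp add: g_def)
      then show "g t = \<mu> i * t + (f (x i) - \<mu> i * x i)" using \<mu>(2)[OF i(1), of t] t i(2) by (simp add: algebra_simps)
    qed
    ultimately show "\<exists>e\<in>aff. \<forall>t\<in>{fst p..<snd p}. g t = e t"
      by (intro bexI[of _ "\<lambda>t. \<mu> i * t + (f (x i) - \<mu> i * x i)"])
  qed
  then show thesis using fg by (rule that)
qed

lemma restrict_iso: "(\<lambda>f. restrict f {0..l}) \<in> iso PG (V_group \<Gamma> \<Lambda> l)" and group_V: "group (V_group \<Gamma> \<Lambda> l)"
proof -
  let ?r = "\<lambda>f. restrict f {0..l} :: real \<Rightarrow> real"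
  have im: "?r ` pw = V_carrier \<Gamma> \<Lambda> l"
    using restrict_in_V_carrier V_carrier_is_restrict by (auto simp: image_iff) metis
  have Bij: "?r f \<in> Bij {0..l}" if "f \<in> pw" for f
    using restrict_in_V_carrier[OF that] unfolding V_carrier_def by blast
  have mult: "?r (f \<circ> g) = ?r f \<otimes>\<^bsub>BijGroup {0..l}\<^esub> ?r g" if fg: "f \<in> pw" "g \<in> pw" for f g
  proof -
    have "g t \<in> {0..l}" if "t \<in> {0..l}" for t using pw_bij_betw[OF fg(2)] that by (metis bij_betw_apply)
    then have "?r (f \<circ> g) = compose {0..l} (?r f) (?r g)" by (auto simp: compose_def fun_eq_iff)
    then show ?thesis using Bij[OF fg(1)] Bij[OF fg(2)] by (simp add: BijGroup_def)
  qed
  have inj: "inj_on ?r pw"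
  proof (rule inj_onI)
    fix f g assume fg: "f \<in> pw" "g \<in> pw" "?r f = ?r g"
    show "f = g"
    proof
      fix t
      show "f t = g t"
      proof (cases "t \<in> {0..<l}")
        case True
        then have "t \<in> {0..l}" by simp
        then show ?thesis using fun_cong[OF fg(3), of t] by (metis restrict_apply')
      next
        case False then show ?thesis using pw_out fg by metis
      qed
    qed
  qed
  have hom: "?r \<in> hom PG (BijGroup {0..l})"
    using Bij mult by (auto simp: hom_def BijGroup_def)
  have "group_hom PG (BijGroup {0..l}) ?r"
    using group_PG group_BijGroup hom by (simp add: group_hom_def group_hom_axioms_def)
  then have sub: "subgroup (V_carrier \<Gamma> \<Lambda> l) (BijGroup {0..l})"
    using group_hom.img_is_subgroup[of PG "BijGroup {0..l}" ?r] im by simp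
  show "group (V_group \<Gamma> \<Lambda> l)" unfolding V_group_def
    by (rule group.subgroup_imp_group[OF group_BijGroup sub])
  show "?r \<in> iso PG (V_group \<Gamma> \<Lambda> l)"
    unfolding iso_def hom_def V_group_def using im inj mult by (auto simp: bij_betw_def)
qed

lemma derived_iso: "(\<lambda>f. restrict f {0..l}) \<in> iso (derived_group PG) (derived_group (V_group \<Gamma> \<Lambda> l))"
  by (rule derived_group_iso[OF restrict_iso group_PG group_V])

lemma simple_V: "is_simple (derived_group (V_group \<Gamma> \<Lambda> l))"
  by (rule is_simple_iso[OF derived_iso simple_PG group_derived_group[OF group_V]])

lemma two_generated_V: "gen_data M C \<Longrightarrow> two_generated (derived_group (V_group \<Gamma> \<Lambda> l))"
  by (rule two_generated_iso[OF derived_iso group_derived_group[OF group_PG] group_derived_group[OF group_V]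
    two_generated_derived_PG])

lemma finitely_generated_semidirect_of_V:
  assumes "finitely_generated (derived_group (V_group \<Gamma> \<Lambda> l))"
  shows "finitely_generated (semidirect \<Gamma> \<Lambda>)"
proof -
  have G: "group (derived_group PG)" and V: "group (derived_group (V_group \<Gamma> \<Lambda> l))"
    using group_derived_group group_PG group_V by auto
  have "inv_into (carrier (derived_group PG)) (\<lambda>f. restrict f {0..l}) \<in> iso (derived_group (V_group \<Gamma> \<Lambda> l)) (derived_group PG)"
    by (rule group.iso_set_sym[OF G derived_iso])
  then show ?thesis
    using finitely_generated_iso[OF _ V G assms] finitely_generated_semidirect by blast
qed

subsection \<open>The transformation groupoid\<close>

text \<open>The interval from u_+ to v_-, the counterpart of \<open>{u..<v}\<close>. At a common
  endpoint v in \<Gamma> two such intervals meet without overlap, v_- belonging to the left one and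
  v_+ to the right one.\<close>

definition seg :: "real \<Rightarrow> real \<Rightarrow> split_real set" where
  "seg u v = {x \<in> split_line \<Gamma>. split_le (Plus u) x \<and> split_le x (Minus v)}"

lemma seg_iff [simp]:
  "Reg t \<in> seg u v \<longleftrightarrow> t \<notin> \<Gamma> \<and> u < t \<and> t < v"
  "Plus a \<in> seg u v \<longleftrightarrow> a \<in> \<Gamma> \<and> u \<le> a \<and> a < v"
  "Minus a \<in> seg u v \<longleftrightarrow> a \<in> \<Gamma> \<and> u < a \<and> a \<le> v"
  by (auto simp: seg_def split_line_def split_le_def split_less_def)

lemma seg_mono: "u' \<le> u \<Longrightarrow> v \<le> v' \<Longrightarrow> seg u v \<subseteq> seg u' v'"
proof
  fix x assume "u' \<le> u" "v \<le> v'" "x \<in> seg u v"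
  then show "x \<in> seg u' v'" by (cases x) auto
qed

lemma seg_split: "v \<in> \<Gamma> \<Longrightarrow> seg u w \<subseteq> seg u v \<union> seg v w"
proof
  fix x assume "v \<in> \<Gamma>" "x \<in> seg u w"
  then show "x \<in> seg u v \<union> seg v w"
  proof (cases x)
    case (Reg t)
    then have "t \<noteq> v" using \<open>v \<in> \<Gamma>\<close> \<open>x \<in> seg u w\<close> by auto
    then show ?thesis using Reg \<open>x \<in> seg u w\<close> by auto
  qed auto
qed

lemma seg_max_min: "x \<in> seg u v \<Longrightarrow> x \<in> seg u' v' \<Longrightarrow> x \<in> seg (max u u') (min v v')"
  by (cases x) auto

lemma seg_less: "x \<in> seg u v \<Longrightarrow> u < v"
  by (cases x) auto

lemma seg_split_line: "seg u v \<subseteq> split_line \<Gamma>"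
  unfolding seg_def by blast

lemma act_simps [simp]:
  "act g (Reg t) = Reg (elt g t)" "act g (Plus t) = Plus (elt g t)" "act g (Minus t) = Minus (elt g t)"
  by (cases g; simp add: elt_def)+

lemma act_seg:
  assumes "g \<in> \<Gamma> \<times> \<Lambda>" "x \<in> seg u v"
  shows "act g x \<in> seg (elt g u) (elt g v)"
  using assms(2) elt_aff[OF assms(1)] by (cases x) simp_all

lemma act_mult:
  assumes "g \<in> \<Gamma> \<times> \<Lambda>" "h \<in> \<Gamma> \<times> \<Lambda>"
  shows "act (g \<otimes>\<^bsub>semidirect \<Gamma> \<Lambda>\<^esub> h) x = act g (act h x)"
  by (cases x) (simp_all add: elt_mult[OF assms])

lemma semidirect_closed: "g \<in> \<Gamma> \<times> \<Lambda> \<Longrightarrow> h \<in> \<Gamma> \<times> \<Lambda> \<Longrightarrow> g \<otimes>\<^bsub>semidirect \<Gamma> \<Lambda>\<^esub> h \<in> \<Gamma> \<times> \<Lambda>"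
  using monoid.m_closed[OF group.is_monoid[OF group_semidirect], of g h] unfolding semidirect_simps(1) .

lemma semidirect_inv_closed: "g \<in> \<Gamma> \<times> \<Lambda> \<Longrightarrow> inv\<^bsub>semidirect \<Gamma> \<Lambda>\<^esub> g \<in> \<Gamma> \<times> \<Lambda>"
  using group.inv_closed[OF group_semidirect, of g] unfolding semidirect_simps(1) .

lemma act_inv:
  assumes "g \<in> \<Gamma> \<times> \<Lambda>"
  shows "act (inv\<^bsub>semidirect \<Gamma> \<Lambda>\<^esub> g) (act g x) = x" "act g (act (inv\<^bsub>semidirect \<Gamma> \<Lambda>\<^esub> g) x) = x"
  using elt_aff[OF assms] by (cases x; simp add: elt_inv[OF assms])+

abbreviation "grp \<equiv> transf_groupoid \<Gamma> \<Lambda> l"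

lemma arrows_iff: "(g, x) \<in> arrows grp \<longleftrightarrow> g \<in> \<Gamma> \<times> \<Lambda> \<and> x \<in> seg 0 l \<and> act g x \<in> seg 0 l"
  by (simp add: transf_groupoid_def transf_arrows_def split_interval_def seg_def)

lemma grp_simps [simp]:
  "gsource grp (g, x) = x" "grange grp (g, x) = act g x"
  "gcomp grp (g, y) (h, x) = (g \<otimes>\<^bsub>semidirect \<Gamma> \<Lambda>\<^esub> h, x)"
  "ginverse grp (g, x) = (inv\<^bsub>semidirect \<Gamma> \<Lambda>\<^esub> g, act g x)"
  by (simp_all add: transf_groupoid_def)

lemma arrows_comp:
  assumes "(g, act h x) \<in> arrows grp" "(h, x) \<in> arrows grp"
  shows "(g \<otimes>\<^bsub>semidirect \<Gamma> \<Lambda>\<^esub> h, x) \<in> arrows grp"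
  using assms semidirect_closed[of g h] act_mult[of g h] unfolding arrows_iff by simp

lemma arrows_inverse: "(g, x) \<in> arrows grp \<Longrightarrow> (inv\<^bsub>semidirect \<Gamma> \<Lambda>\<^esub> g, act g x) \<in> arrows grp"
  using semidirect_inv_closed[of g] act_inv[of g] unfolding arrows_iff by simp

lemma gset_mult_iff:
  "(k, x) \<in> gset_mult grp A B \<longleftrightarrow> (\<exists>g h. (g, act h x) \<in> A \<and> (h, x) \<in> B \<and> k = g \<otimes>\<^bsub>semidirect \<Gamma> \<Lambda>\<^esub> h)"
proof
  assume "(k, x) \<in> gset_mult grp A B"
  then obtain g y h z where "(g, y) \<in> A" "(h, z) \<in> B" "y = act h z" "(k, x) = gcomp grp (g, y) (h, z)"
    unfolding gset_mult_def by auto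
  then show "\<exists>g h. (g, act h x) \<in> A \<and> (h, x) \<in> B \<and> k = g \<otimes>\<^bsub>semidirect \<Gamma> \<Lambda>\<^esub> h" by (intro exI[of _ g] exI[of _ h]) simp
next
  assume "\<exists>g h. (g, act h x) \<in> A \<and> (h, x) \<in> B \<and> k = g \<otimes>\<^bsub>semidirect \<Gamma> \<Lambda>\<^esub> h"
  then obtain g h where "(g, act h x) \<in> A" "(h, x) \<in> B" "k = g \<otimes>\<^bsub>semidirect \<Gamma> \<Lambda>\<^esub> h" by (elim exE conjE)
  then show "(k, x) \<in> gset_mult grp A B"
    unfolding gset_mult_def mem_Collect_eq by (intro exI[of _ "(g, act h x)"] exI[of _ "(h, x)"]) simp
qed

lemma gset_power_arrows:
  assumes "A \<subseteq> arrows grp"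
  shows "(k, x) \<in> gset_power grp A n \<Longrightarrow> (k, x) \<in> arrows grp"
proof (induction n arbitrary: k x)
  case 0
  then show ?case using assms by auto
next
  case (Suc n)
  then obtain g h where g: "(g, act h x) \<in> A" and h: "(h, x) \<in> gset_power grp A n" and k: "k = g \<otimes>\<^bsub>semidirect \<Gamma> \<Lambda>\<^esub> h"
    unfolding gset_power.simps gset_mult_iff by (elim exE conjE)
  show ?case unfolding k by (rule arrows_comp[OF subsetD[OF assms g] Suc.IH[OF h]])
qed

text \<open>Exponent \<open>n\<close> stands for \<open>n + 1\<close> factors, so the exponents of a
  product combine to \<open>Suc (m + n)\<close>.\<close>

lemma gset_power_comp:
  assumes A: "A \<subseteq> arrows grp" and q: "(q, x) \<in> gset_power grp A n"
  shows "(p, act q x) \<in> gset_power grp A m \<Longrightarrow> (p \<otimes>\<^bsub>semidirect \<Gamma> \<Lambda>\<^esub> q, x) \<in> gset_power grp A (Suc (m + n))"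
proof (induction m arbitrary: p)
  case 0
  then show ?case using q unfolding add_0 gset_power.simps gset_mult_iff by (intro exI[of _ p] exI[of _ q] conjI refl)
next
  case (Suc m)
  then obtain g h where g: "(g, act h (act q x)) \<in> A" and h: "(h, act q x) \<in> gset_power grp A m"
    and p: "p = g \<otimes>\<^bsub>semidirect \<Gamma> \<Lambda>\<^esub> h"
    unfolding gset_power.simps gset_mult_iff by (elim exE conjE)
  have mem: "g \<in> \<Gamma> \<times> \<Lambda>" "h \<in> \<Gamma> \<times> \<Lambda>" "q \<in> \<Gamma> \<times> \<Lambda>"
    using subsetD[OF A g] gset_power_arrows[OF A h] gset_power_arrows[OF A q] unfolding arrows_iff by blast+
  have pq: "p \<otimes>\<^bsub>semidirect \<Gamma> \<Lambda>\<^esub> q = g \<otimes>\<^bsub>semidirect \<Gamma> \<Lambda>\<^esub> (h \<otimes>\<^bsub>semidirect \<Gamma> \<Lambda>\<^esub> q)"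
    unfolding p by (rule monoid.m_assoc[OF group.is_monoid[OF group_semidirect]]; unfold semidirect_simps(1); rule mem)
  have "(g, act (h \<otimes>\<^bsub>semidirect \<Gamma> \<Lambda>\<^esub> q) x) \<in> A" using g by (simp only: act_mult[OF mem(2,3)])
  then show ?case using Suc.IH[OF h] pq unfolding add_Suc gset_power.simps(2)[of _ _ "Suc _"] gset_mult_iff
    by (intro exI[of _ g] exI[of _ "h \<otimes>\<^bsub>semidirect \<Gamma> \<Lambda>\<^esub> q"] conjI)
qed

lemma gset_power_inverse:
  assumes A: "A \<subseteq> arrows grp" and inv: "\<forall>g x. (g, x) \<in> A \<longrightarrow> (inv\<^bsub>semidirect \<Gamma> \<Lambda>\<^esub> g, act g x) \<in> A"
  shows "(k, x) \<in> gset_power grp A n \<Longrightarrow> (inv\<^bsub>semidirect \<Gamma> \<Lambda>\<^esub> k, act k x) \<in> gset_power grp A n"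
proof (induction n arbitrary: k x)
  case 0
  then show ?case using inv[rule_format, of k x] by simp
next
  case (Suc n)
  then obtain g h where g: "(g, act h x) \<in> A" and h: "(h, x) \<in> gset_power grp A n" and k: "k = g \<otimes>\<^bsub>semidirect \<Gamma> \<Lambda>\<^esub> h"
    unfolding gset_power.simps gset_mult_iff by (elim exE conjE)
  have mem: "g \<in> \<Gamma> \<times> \<Lambda>" "h \<in> \<Gamma> \<times> \<Lambda>"
    using subsetD[OF A g] gset_power_arrows[OF A h] unfolding arrows_iff by blast+
  have "(inv\<^bsub>semidirect \<Gamma> \<Lambda>\<^esub> g, act g (act h x)) \<in> gset_power grp A 0" using inv[rule_format, OF g] by simp
  moreover have "(inv\<^bsub>semidirect \<Gamma> \<Lambda>\<^esub> h, act (inv\<^bsub>semidirect \<Gamma> \<Lambda>\<^esub> g) (act g (act h x))) \<in> gset_power grp A n"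
    using Suc.IH[OF h] by (simp only: act_inv(1)[OF mem(1)])
  ultimately have "(inv\<^bsub>semidirect \<Gamma> \<Lambda>\<^esub> h \<otimes>\<^bsub>semidirect \<Gamma> \<Lambda>\<^esub> inv\<^bsub>semidirect \<Gamma> \<Lambda>\<^esub> g, act g (act h x)) \<in> gset_power grp A (Suc (n + 0))"
    by (rule gset_power_comp[OF A])
  moreover have "inv\<^bsub>semidirect \<Gamma> \<Lambda>\<^esub> k = inv\<^bsub>semidirect \<Gamma> \<Lambda>\<^esub> h \<otimes>\<^bsub>semidirect \<Gamma> \<Lambda>\<^esub> inv\<^bsub>semidirect \<Gamma> \<Lambda>\<^esub> g"
    unfolding k by (rule group.inv_mult_group[OF group_semidirect]; unfold semidirect_simps(1); rule mem)
  ultimately show ?case by (simp only: k act_mult[OF mem] add_0_right)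
qed

text \<open>Basic neighbourhoods in the split line, one-sided at the points t_+ and t_-. At a point
  of \<Gamma> they match the intervals that \<open>loc\<close> admits.\<close>

primrec near :: "real \<Rightarrow> split_real \<Rightarrow> real \<Rightarrow> real \<Rightarrow> bool" where
  "near \<delta> (Reg t) u v \<longleftrightarrow> t - \<delta> < u \<and> v < t + \<delta>"
| "near \<delta> (Plus t) u v \<longleftrightarrow> t \<le> u \<and> v < t + \<delta>"
| "near \<delta> (Minus t) u v \<longleftrightarrow> t - \<delta> < u \<and> v \<le> t"

lemma near_mono: "near \<delta> x u v \<Longrightarrow> \<delta> \<le> \<delta>' \<Longrightarrow> near \<delta>' x u v"
  by (cases x) auto

lemma split_open_near:
  assumes "openin (split_topology \<Gamma>) W" "x \<in> W"
  obtains \<delta> where "0 < \<delta>" "\<forall>u v. near \<delta> x u v \<longrightarrow> seg u v \<subseteq> W"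
proof -
  have "\<exists>\<delta>>0. \<forall>u v. near \<delta> x u v \<longrightarrow> seg u v \<subseteq> W"
    using assms unfolding split_topology_def openin_topology_generated_by_iff
  proof (induction rule: generate_topology_on.induct)
    case (Int a b)
    then obtain \<delta> \<delta>' where d: "0 < \<delta>" "\<forall>u v. near \<delta> x u v \<longrightarrow> seg u v \<subseteq> a" "0 < \<delta>'" "\<forall>u v. near \<delta>' x u v \<longrightarrow> seg u v \<subseteq> b"
      by blast
    show ?case
    proof (intro exI[of _ "min \<delta> \<delta>'"] conjI allI impI)
      fix u v assume "near (min \<delta> \<delta>') x u v"
      then have "near \<delta> x u v" "near \<delta>' x u v" by (auto elim: near_mono)
      then show "seg u v \<subseteq> a \<inter> b" using d by blast
    qed (use d in simp)
  next
    case (UN K)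
    then obtain k where "k \<in> K" "x \<in> k" by blast
    then obtain \<delta> where "0 < \<delta>" "\<forall>u v. near \<delta> x u v \<longrightarrow> seg u v \<subseteq> k" using UN.IH by blast
    then show ?case using \<open>k \<in> K\<close> by blast
  next
    case (Basis s)
    then consider "s = split_line \<Gamma>" | a where "s = {y \<in> split_line \<Gamma>. split_less a y}"
      | a where "s = {y \<in> split_line \<Gamma>. split_less y a}" by blast
    then show ?case
    proof cases
      case 1
      then show ?thesis using seg_split_line by (intro exI[of _ 1]) simp
    next
      case (2 a)
      then have "split_less a x" using Basis by simp
      then consider "proj a < proj x" | c where "a = Minus c" "x = Plus c" unfolding split_less_def by blast
      then show ?thesis
      proof cases
        case 1
        have "split_less a y" if "near (proj x - proj a) x u v" "y \<in> seg u v" for u v y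
          using that 1 unfolding split_less_def by (cases x; cases y) auto
        then have "seg u v \<subseteq> s" if "near (proj x - proj a) x u v" for u v using that seg_split_line 2 by blast
        then show ?thesis using 1 by (intro exI[of _ "proj x - proj a"] conjI allI impI) simp_all
      next
        \<comment> \<open>Here \<open>a\<close> and \<open>x\<close> are the two points over
          \<open>c\<close>. All points of an interval that begins at c_+ or later are above
          \<open>a\<close>, whatever its length.\<close>
        case c: (2 c)
        have "split_less a y" if "near 1 x u v" "y \<in> seg u v" for u v y
          using that unfolding c split_less_def by (cases y) auto
        then have "seg u v \<subseteq> s" if "near 1 x u v" for u v using that seg_split_line 2 by blast
        then show ?thesis by (intro exI[of _ 1] conjI allI impI) simp_all
      qed
    next
      case (3 a)
      then have "split_less x a" using Basis by simp
      then consider "proj x < proj a" | c where "x = Minus c" "a = Plus c" unfolding split_less_def by blast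
      then show ?thesis
      proof cases
        case 1
        have "split_less y a" if "near (proj a - proj x) x u v" "y \<in> seg u v" for u v y
          using that 1 unfolding split_less_def by (cases x; cases y) auto
        then have "seg u v \<subseteq> s" if "near (proj a - proj x) x u v" for u v using that seg_split_line 3 by blast
        then show ?thesis using 1 by (intro exI[of _ "proj a - proj x"] conjI allI impI) simp_all
      next
        case c: (2 c)
        have "split_less y a" if "near 1 x u v" "y \<in> seg u v" for u v y
          using that unfolding c split_less_def by (cases y) auto
        then have "seg u v \<subseteq> s" if "near 1 x u v" for u v using that seg_split_line 3 by blast
        then show ?thesis by (intro exI[of _ 1] conjI allI impI) simp_all
      qed
    qed
  qed simp
  then show thesis using that by blast
qed

text \<open>Having a finite subcover adds up along adjacent intervals, so \<open>loc_imp_all\<close>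
  reduces compactness to short intervals. At a point \<open>t\<close> of \<Gamma> two members of the
  cover are needed in general, one around t_- and one around t_+, and short intervals lie on one
  side of \<open>t\<close>.\<close>

lemma compactin_seg:
  assumes pq: "p \<in> \<Gamma>" "q \<in> \<Gamma>" "p < q"
  shows "compactin (split_topology \<Gamma>) (seg p q)"
  unfolding compactin_def
proof (intro conjI allI impI; (elim conjE)?)
  show "seg p q \<subseteq> topspace (split_topology \<Gamma>)"
    unfolding split_topology_def topology_generated_by_topspace using seg_split_line by blast
  fix U assume U: "\<forall>W\<in>U. openin (split_topology \<Gamma>) W" "seg p q \<subseteq> \<Union>U"
  have cover: "\<exists>W\<in>U. \<exists>\<delta>>0. \<forall>u v. near \<delta> x u v \<longrightarrow> seg u v \<subseteq> W" if x: "x \<in> seg p q" for x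
  proof -
    obtain W where W: "W \<in> U" "x \<in> W" using subsetD[OF U(2) x] by (rule UnionE)
    obtain \<delta> where "0 < \<delta>" "\<forall>u v. near \<delta> x u v \<longrightarrow> seg u v \<subseteq> W"
      by (rule split_open_near[OF bspec[OF U(1) W(1)] W(2)])
    then show ?thesis using W(1) by blast
  qed
  have single: "\<exists>F. finite F \<and> F \<subseteq> U \<and> seg u v \<subseteq> \<Union>F" if "W \<in> U" "seg u v \<subseteq> W" for W u v
    using that by (intro exI[of _ "{W}"]) simp
  show "\<exists>F. finite F \<and> F \<subseteq> U \<and> seg p q \<subseteq> \<Union>F"
  proof (rule loc_imp_all[OF pq, where P = "\<lambda>u v. \<exists>F. finite F \<and> F \<subseteq> U \<and> seg u v \<subseteq> \<Union>F"])
    fix u v w assume v: "v \<in> \<Gamma>" and "\<exists>F. finite F \<and> F \<subseteq> U \<and> seg u v \<subseteq> \<Union>F" "\<exists>F. finite F \<and> F \<subseteq> U \<and> seg v w \<subseteq> \<Union>F"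
    then obtain F F' where F: "finite F" "F \<subseteq> U" "seg u v \<subseteq> \<Union>F" "finite F'" "F' \<subseteq> U" "seg v w \<subseteq> \<Union>F'" by (elim exE conjE)
    have "seg u w \<subseteq> \<Union>(F \<union> F')" using order_trans[OF seg_split[OF v] Un_mono[OF F(3,6)]] by simp
    then show "\<exists>F. finite F \<and> F \<subseteq> U \<and> seg u w \<subseteq> \<Union>F" using F by (intro exI[of _ "F \<union> F'"]) simp
  next
    fix t assume t: "p \<le> t" "t \<le> q"
    show "loc t (\<lambda>u v. p \<le> u \<longrightarrow> v \<le> q \<longrightarrow> (\<exists>F. finite F \<and> F \<subseteq> U \<and> seg u v \<subseteq> \<Union>F))"
    proof (cases "t \<in> \<Gamma>")
      case False
      then have "Reg t \<in> seg p q" using t pq by (auto simp: less_le)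
      then obtain W \<delta> where W: "W \<in> U" "0 < \<delta>" "\<forall>u v. near \<delta> (Reg t) u v \<longrightarrow> seg u v \<subseteq> W" using cover by blast
      show ?thesis unfolding loc_def
        by (intro exI[of _ \<delta>] conjI ballI impI W(2) single[OF W(1)]) (use W(3) in simp)
    next
      case True
      have "\<exists>\<delta>>0. \<forall>u v. p \<le> u \<longrightarrow> v \<le> q \<longrightarrow> u < v \<longrightarrow> t \<le> u \<longrightarrow> v < t + \<delta> \<longrightarrow> (\<exists>F. finite F \<and> F \<subseteq> U \<and> seg u v \<subseteq> \<Union>F)"
      proof (cases "t < q")
        case lt: True
        then have "Plus t \<in> seg p q" using t True by simp
        then obtain W \<delta> where W: "W \<in> U" "0 < \<delta>" "\<forall>u v. near \<delta> (Plus t) u v \<longrightarrow> seg u v \<subseteq> W" using cover by blast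
        show ?thesis by (intro exI[of _ \<delta>] conjI allI impI W(2) single[OF W(1)]) (use W(3) in simp)
      next
        case False
        then show ?thesis by (intro exI[of _ 1]) auto
      qed
      then obtain d where d: "0 < d" "\<forall>u v. p \<le> u \<longrightarrow> v \<le> q \<longrightarrow> u < v \<longrightarrow> t \<le> u \<longrightarrow> v < t + d \<longrightarrow> (\<exists>F. finite F \<and> F \<subseteq> U \<and> seg u v \<subseteq> \<Union>F)"
        by (elim exE conjE)
      have "\<exists>\<delta>>0. \<forall>u v. p \<le> u \<longrightarrow> v \<le> q \<longrightarrow> u < v \<longrightarrow> t - \<delta> < u \<longrightarrow> v \<le> t \<longrightarrow> (\<exists>F. finite F \<and> F \<subseteq> U \<and> seg u v \<subseteq> \<Union>F)"
      proof (cases "p < t")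
        case lt: True
        then have "Minus t \<in> seg p q" using t True by simp
        then obtain W \<delta> where W: "W \<in> U" "0 < \<delta>" "\<forall>u v. near \<delta> (Minus t) u v \<longrightarrow> seg u v \<subseteq> W" using cover by blast
        show ?thesis by (intro exI[of _ \<delta>] conjI allI impI W(2) single[OF W(1)]) (use W(3) in simp)
      next
        case False
        then show ?thesis by (intro exI[of _ 1]) auto
      qed
      then obtain d' where d': "0 < d'" "\<forall>u v. p \<le> u \<longrightarrow> v \<le> q \<longrightarrow> u < v \<longrightarrow> t - d' < u \<longrightarrow> v \<le> t \<longrightarrow> (\<exists>F. finite F \<and> F \<subseteq> U \<and> seg u v \<subseteq> \<Union>F)"
        by (elim exE conjE)
      show ?thesis unfolding loc_def
      proof (intro exI[of _ "min d d'"] conjI ballI impI)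
        fix u v assume *: "t - min d d' < u" "u < v" "v < t + min d d'" "t \<in> \<Gamma> \<longrightarrow> \<not> (u < t \<and> t < v)" "p \<le> u" "v \<le> q"
        show "\<exists>F. finite F \<and> F \<subseteq> U \<and> seg u v \<subseteq> \<Union>F"
        proof (cases "t \<le> u")
          case True
          show ?thesis by (rule d(2)[rule_format]) (use * True in auto)
        next
          case False
          then have "v \<le> t" using * \<open>t \<in> \<Gamma>\<close> by auto
          show ?thesis by (rule d'(2)[rule_format]) (use * \<open>v \<le> t\<close> in auto)
        qed
      qed (use d d' in simp)
    qed
  qed
qed

lemma gtopology_grp: "gtopology grp = subtopology
    (prod_topology (discrete_topology (\<Gamma> \<times> \<Lambda>)) (split_topology \<Gamma>)) (arrows grp)"
  by (simp add: transf_groupoid_def)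

section \<open>Compact generation of the groupoid\<close>

lemma finitely_generated_of_compactly_generated:
  assumes "compactly_generated grp"
  shows "finitely_generated (semidirect \<Gamma> \<Lambda>)"
proof -
  obtain K where K: "K \<subseteq> arrows grp" "compactin (gtopology grp) K"
    "arrows grp = (\<Union>n. gset_power grp (K \<union> ginverse grp ` K) n)"
    using assms unfolding compactly_generated_def by (elim exE conjE)
  have "compactin (prod_topology (discrete_topology (\<Gamma> \<times> \<Lambda>)) (split_topology \<Gamma>)) K"
    using K(2) unfolding gtopology_grp compactin_subtopology by (rule conjunct1)
  then have "compactin (discrete_topology (\<Gamma> \<times> \<Lambda>)) (fst ` K)" by (rule image_compactin[OF _ continuous_map_fst])
  then have S: "finite (fst ` K)" "fst ` K \<subseteq> \<Gamma> \<times> \<Lambda>" unfolding compactin_discrete_topology by auto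
  define Gn where "Gn = generate (semidirect \<Gamma> \<Lambda>) (fst ` K)"
  have Gn: "subgroup Gn (semidirect \<Gamma> \<Lambda>)"
    unfolding Gn_def using S by (intro group.generate_is_subgroup[OF group_semidirect]) simp
  have A: "g \<in> Gn" if "(g, x) \<in> K \<union> ginverse grp ` K" for g x
    using that
  proof
    assume "(g, x) \<in> K"
    then show ?thesis unfolding Gn_def by (intro generate.incl) force
  next
    assume "(g, x) \<in> ginverse grp ` K"
    then obtain h y where "(h, y) \<in> K" "g = inv\<^bsub>semidirect \<Gamma> \<Lambda>\<^esub> h" by auto
    then show ?thesis unfolding Gn_def by (auto intro!: generate.inv) force
  qed
  have pow: "(k, x) \<in> gset_power grp (K \<union> ginverse grp ` K) n \<Longrightarrow> k \<in> Gn" for k x n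
  proof (induction n arbitrary: k)
    case 0
    then show ?case by (intro A[of k x]) simp
  next
    case (Suc n)
    then obtain g h where g: "(g, act h x) \<in> K \<union> ginverse grp ` K" and h: "(h, x) \<in> gset_power grp (K \<union> ginverse grp ` K) n"
      and k: "k = g \<otimes>\<^bsub>semidirect \<Gamma> \<Lambda>\<^esub> h"
      unfolding gset_power.simps gset_mult_iff by (elim exE conjE)
    show ?case unfolding k by (rule subgroup.m_closed[OF Gn A[OF g] Suc.IH[OF h]])
  qed
  have arrow: "g \<in> Gn" if gx: "(g, x) \<in> arrows grp" for g x
  proof -
    obtain n where "(g, x) \<in> gset_power grp (K \<union> ginverse grp ` K) n" using gx unfolding K(3) by (rule UN_E)
    then show ?thesis by (rule pow)
  qed
  have "Gn = \<Gamma> \<times> \<Lambda>"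
  proof (rule semidirect_subgroup_eq[OF Gn])
    \<comment> \<open>The unit 0_+ is fixed by every slope and stays in the interval under
      translations by positive \<open>c < l\<close>, so all elements required here occur in arrows
      from 0_+.\<close>
    show "(0, \<mu>) \<in> Gn" if "\<mu> \<in> \<Lambda>" "\<mu> < 1" for \<mu>
      by (rule arrow[of _ "Plus 0"]) (use that zero_mem l_pos in \<open>simp add: arrows_iff elt_def\<close>)
    show "(c, 1) \<in> Gn" if "c \<in> \<Gamma>" "0 < c" "c < l" for c
      by (rule arrow[of _ "Plus 0"]) (use that zero_mem one_slope l_pos in \<open>simp add: arrows_iff elt_def\<close>)
  qed
  then have "generate (semidirect \<Gamma> \<Lambda>) (fst ` K) = carrier (semidirect \<Gamma> \<Lambda>)" unfolding Gn_def by simp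
  then show ?thesis unfolding finitely_generated_def using S by (intro exI[of _ "fst ` K"]) simp
qed

text \<open>The largest such interval is the intersection of \<open>[0, l)\<close> with its preimage
  under the map.\<close>

lemma arrow_maps_into:
  assumes "(g, x) \<in> arrows grp"
  obtains u v where "maps_into l (elt g) u v" "x \<in> seg u v"
proof -
  have g: "g \<in> \<Gamma> \<times> \<Lambda>" "x \<in> seg 0 l" "act g x \<in> seg 0 l" using assms unfolding arrows_iff by blast+
  let ?e = "elt g"
  have e: "?e \<in> aff" by (rule elt_aff[OF g(1)])
  have "act (inv\<^bsub>semidirect \<Gamma> \<Lambda>\<^esub> g) (act g x) \<in> seg (iv ?e 0) (iv ?e l)"
    using act_seg[OF semidirect_inv_closed[OF g(1)] g(3)] unfolding elt_inv[OF g(1)] .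
  then have "x \<in> seg (iv ?e 0) (iv ?e l)" by (simp only: act_inv(1)[OF g(1)])
  then have x: "x \<in> seg (max 0 (iv ?e 0)) (min l (iv ?e l))" by (rule seg_max_min[OF g(2)])
  have "iv ?e 0 \<in> \<Gamma>" "iv ?e l \<in> \<Gamma>" using aff_mem[OF aff_iv[OF e]] zero_mem l_mem by auto
  moreover have "?e (iv ?e 0) \<le> ?e (max 0 (iv ?e 0))" "?e (min l (iv ?e l)) \<le> ?e (iv ?e l)"
    unfolding aff_le_iff[OF e] by auto
  ultimately have "maps_into l ?e (max 0 (iv ?e 0)) (min l (iv ?e l))"
    unfolding maps_into_def using e seg_less[OF x] zero_mem l_mem by (auto simp: max_def min_def)
  then show thesis using x by (rule that)
qed

lemma compactly_generated_grp:
  assumes gd0: "gen_data M C0"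
  shows "compactly_generated grp"
proof -
  define \<epsilon> where "\<epsilon> = Min (insert (l / 2) ((\<lambda>\<nu>. \<nu> * l / 4) ` M))"
  have M: "finite M" "M \<subseteq> \<Lambda>" "\<forall>\<nu>\<in>M. \<nu> < 1" "\<forall>\<mu>\<in>\<Lambda>. \<exists>\<nu>1\<in>mon M. \<exists>\<nu>2\<in>mon M. \<mu> = \<nu>2 / \<nu>1"
    using gd0[unfolded gen_data_def, THEN conjunct1]
      gd0[unfolded gen_data_def, THEN conjunct2, THEN conjunct1]
      gd0[unfolded gen_data_def, THEN conjunct2, THEN conjunct2, THEN conjunct1]
      gd0[unfolded gen_data_def, THEN conjunct2, THEN conjunct2, THEN conjunct2, THEN conjunct1] .
  have \<epsilon>: "0 < \<epsilon>" "\<epsilon> \<le> l / 2" "\<And>\<nu>. \<nu> \<in> M \<Longrightarrow> \<epsilon> \<le> \<nu> * l / 4"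
  proof -
    have fin: "finite (insert (l / 2) ((\<lambda>\<nu>. \<nu> * l / 4) ` M))" using M by simp
    show "0 < \<epsilon>" unfolding \<epsilon>_def using M l_pos slope_pos by (subst Min_gr_iff[OF fin]) auto
    show "\<epsilon> \<le> l / 2" unfolding \<epsilon>_def by (rule Min_le[OF fin]) simp
    show "\<epsilon> \<le> \<nu> * l / 4" if "\<nu> \<in> M" for \<nu> unfolding \<epsilon>_def by (rule Min_le[OF fin]) (intro insertI2 image_eqI[OF refl that])
  qed
  obtain C where gd: "gen_data M C" and Cs: "\<forall>c\<in>C. c < \<epsilon>" using gen_data_small[OF gd0 \<epsilon>(1)] .
  have C: "finite C" "C \<noteq> {}" "C \<subseteq> \<Gamma>" "\<forall>c\<in>C. 0 < c"
    and Cgen: "\<forall>S. 0 \<in> S \<longrightarrow> (\<forall>x\<in>S. \<forall>y\<in>S. x + y \<in> S) \<longrightarrow> (\<forall>x\<in>S. - x \<in> S) \<longrightarrow>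
      (\<forall>\<mu>\<in>\<Lambda>. \<forall>x\<in>S. \<mu> * x \<in> S) \<longrightarrow> C \<subseteq> S \<longrightarrow> \<Gamma> \<subseteq> S"
    using gd[unfolded gen_data_def, THEN conjunct2, THEN conjunct2, THEN conjunct2, THEN conjunct2, THEN conjunct1]
      gd[unfolded gen_data_def, THEN conjunct2, THEN conjunct2, THEN conjunct2, THEN conjunct2, THEN conjunct2, THEN conjunct1]
      gd[unfolded gen_data_def, THEN conjunct2, THEN conjunct2, THEN conjunct2, THEN conjunct2, THEN conjunct2, THEN conjunct2, THEN conjunct1]
      gd[unfolded gen_data_def, THEN conjunct2, THEN conjunct2, THEN conjunct2, THEN conjunct2, THEN conjunct2, THEN conjunct2, THEN conjunct2, THEN conjunct1]
      gd[unfolded gen_data_def, THEN conjunct2, THEN conjunct2, THEN conjunct2, THEN conjunct2, THEN conjunct2, THEN conjunct2, THEN conjunct2, THEN conjunct2] .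
  obtain \<gamma> where \<gamma>: "\<gamma> \<in> C" using C(2) by blast
  \<comment> \<open>Each generating germ is listed with the right end of its domain; all domains
    start at 0.\<close>
  define D where "D = insert (((0, 1), l) :: (real \<times> real) \<times> real) ((\<lambda>c. ((c, 1), l - c)) ` C \<union> (\<lambda>\<nu>. ((0, \<nu>), l)) ` M)"
  have D: "finite D" unfolding D_def using C M by simp
  have Dd: "fst d \<in> \<Gamma> \<times> \<Lambda> \<and> snd d \<in> \<Gamma> \<and> 0 < snd d \<and> snd d \<le> l \<and> 0 \<le> elt (fst d) 0 \<and> elt (fst d) (snd d) \<le> l" if "d \<in> D" for d
  proof -
    have "d = ((0, 1), l) \<or> (\<exists>c\<in>C. d = ((c, 1), l - c)) \<or> (\<exists>\<nu>\<in>M. d = ((0, \<nu>), l))"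
      using that unfolding D_def by (simp only: insert_iff Un_iff image_iff)
    then show ?thesis
    proof (elim disjE bexE)
      assume "d = ((0, 1), l)"
      then show ?thesis using l_mem l_pos zero_mem one_slope by (simp add: elt_def)
    next
      fix c assume "c \<in> C" and d: "d = ((c, 1), l - c)"
      then have "c \<in> \<Gamma>" "0 < c" "c < l" using C Cs \<epsilon> l_pos by force+
      then show ?thesis using d l_mem one_slope by (simp add: elt_def diff_mem)
    next
      fix \<nu> assume "\<nu> \<in> M" and d: "d = ((0, \<nu>), l)"
      then have "\<nu> \<in> \<Lambda>" "0 < \<nu>" "\<nu> < 1" using M slope_pos by auto
      then show ?thesis using d l_mem l_pos zero_mem by (simp add: elt_def)
    qed
  qed
  define K where "K = (\<Union>d\<in>D. {fst d} \<times> seg 0 (snd d))"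
  have K_arrows: "K \<subseteq> arrows grp"
  proof
    fix p assume "p \<in> K"
    then obtain d x where d: "d \<in> D" "p = (fst d, x)" "x \<in> seg 0 (snd d)" unfolding K_def by auto
    note dd = Dd[OF d(1)]
    have "x \<in> seg 0 l" using dd by (intro subsetD[OF seg_mono d(3)]) auto
    moreover have "act (fst d) x \<in> seg 0 l"
      using dd by (intro subsetD[OF seg_mono act_seg[OF _ d(3)]]) auto
    ultimately show "p \<in> arrows grp" unfolding d(2) arrows_iff using dd by blast
  qed
  have "compactin (prod_topology (discrete_topology (\<Gamma> \<times> \<Lambda>)) (split_topology \<Gamma>)) K"
    unfolding K_def
  proof (rule compactin_Union)
    show "finite ((\<lambda>d. {fst d} \<times> seg 0 (snd d)) ` D)" using D by simp
    fix S assume "S \<in> (\<lambda>d. {fst d} \<times> seg 0 (snd d)) ` D"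
    then obtain d where d: "d \<in> D" "S = {fst d} \<times> seg 0 (snd d)" by blast
    show "compactin (prod_topology (discrete_topology (\<Gamma> \<times> \<Lambda>)) (split_topology \<Gamma>)) S"
      unfolding d(2) compactin_Times using Dd[OF d(1)] zero_mem
      by (intro disjI2 conjI compactin_seg) (simp_all add: compactin_discrete_topology)
  qed
  then have K_compact: "compactin (gtopology grp) K" unfolding gtopology_grp compactin_subtopology using K_arrows by simp
  define A where "A = K \<union> ginverse grp ` K"
  have A: "A \<subseteq> arrows grp"
    unfolding A_def
  proof (rule Un_least[OF K_arrows], rule image_subsetI)
    fix p assume p: "p \<in> K"
    obtain g x where gx: "p = (g, x)" by (cases p)
    show "ginverse grp p \<in> arrows grp"
      using arrows_inverse subsetD[OF K_arrows p] unfolding gx by simp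
  qed
  have A_inv: "\<forall>g x. (g, x) \<in> A \<longrightarrow> (inv\<^bsub>semidirect \<Gamma> \<Lambda>\<^esub> g, act g x) \<in> A"
  proof (intro allI impI)
    fix g x assume "(g, x) \<in> A"
    then show "(inv\<^bsub>semidirect \<Gamma> \<Lambda>\<^esub> g, act g x) \<in> A"
      unfolding A_def
    proof
      assume "(g, x) \<in> K"
      then have "ginverse grp (g, x) \<in> ginverse grp ` K" by (rule imageI)
      then show "(inv\<^bsub>semidirect \<Gamma> \<Lambda>\<^esub> g, act g x) \<in> K \<union> ginverse grp ` K" by simp
    next
      assume "(g, x) \<in> ginverse grp ` K"
      then obtain h y where h: "(h, y) \<in> K" "g = inv\<^bsub>semidirect \<Gamma> \<Lambda>\<^esub> h" "x = act h y" by auto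
      then have hm: "h \<in> \<Gamma> \<times> \<Lambda>" using subsetD[OF K_arrows h(1)] unfolding arrows_iff by blast
      then have "inv\<^bsub>semidirect \<Gamma> \<Lambda>\<^esub> g = h" unfolding h(2)
        by (intro group.inv_inv[OF group_semidirect]) simp
      then show "(inv\<^bsub>semidirect \<Gamma> \<Lambda>\<^esub> g, act g x) \<in> K \<union> ginverse grp ` K"
        using h act_inv(1)[OF hm] by simp
    qed
  qed
  define Pow where "Pow = (\<Union>n. gset_power grp A n)"
  have Pow_comp: "(g \<otimes>\<^bsub>semidirect \<Gamma> \<Lambda>\<^esub> h, x) \<in> Pow" if "(g, act h x) \<in> Pow" "(h, x) \<in> Pow" for g h x
    using that gset_power_comp[OF A] unfolding Pow_def UN_iff by (metis UNIV_I)
  have Pow_inv: "(inv\<^bsub>semidirect \<Gamma> \<Lambda>\<^esub> g, act g x) \<in> Pow" if "(g, x) \<in> Pow" for g x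
    using that gset_power_inverse[OF A A_inv] unfolding Pow_def UN_iff by (metis UNIV_I)
  have Pow_D: "(fst d, x) \<in> Pow" if d: "d \<in> D" and x: "x \<in> seg 0 (snd d)" for d x
  proof -
    have "(fst d, x) \<in> K" unfolding K_def by (rule UN_I[OF d]) (simp add: x)
    then have "(fst d, x) \<in> gset_power grp A 0" by (simp add: A_def)
    then show ?thesis unfolding Pow_def by (rule UN_I[OF UNIV_I])
  qed
  have Pow_elt: "\<forall>k\<in>\<Gamma> \<times> \<Lambda>. elt k = e \<longrightarrow> (\<forall>x\<in>seg u v. (k, x) \<in> Pow)"
    if "g \<in> \<Gamma> \<times> \<Lambda>" "e = elt g" "\<forall>x\<in>seg u v. (g, x) \<in> Pow" for e g u v
    using that elt_inj[OF _ that(1)] by metis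
  have D_mem: "((0, 1), l) \<in> D" "\<And>c. c \<in> C \<Longrightarrow> ((c, 1), l - c) \<in> D" "\<And>\<nu>. \<nu> \<in> M \<Longrightarrow> ((0, \<nu>), l) \<in> D"
    unfolding D_def by simp_all
  \<comment> \<open>\<open>germs\<close> speaks of functions, arrows of group elements; by
    \<open>elt_inj\<close> the quantifier over \<open>k\<close> selects the one element that induces
    \<open>e\<close>.\<close>
  interpret germs \<Gamma> \<Lambda> l \<gamma> M C "\<lambda>e u v. \<forall>k\<in>\<Gamma> \<times> \<Lambda>. elt k = e \<longrightarrow> (\<forall>x\<in>seg u v. (k, x) \<in> Pow)"
  proof unfold_locales
    fix u v assume m: "maps_into l id u v"
    have "seg u v \<subseteq> seg 0 l" using m unfolding maps_into_def by (intro seg_mono) auto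
    then show "\<forall>k\<in>\<Gamma> \<times> \<Lambda>. elt k = id \<longrightarrow> (\<forall>x\<in>seg u v. (k, x) \<in> Pow)"
      using Dd[OF D_mem(1)] Pow_D[OF D_mem(1)]
      by (intro Pow_elt[of "(0, 1)"]) (auto simp: elt_def)
  next
    fix g u v u' v' assume g: "\<forall>k\<in>\<Gamma> \<times> \<Lambda>. elt k = g \<longrightarrow> (\<forall>x\<in>seg u v. (k, x) \<in> Pow)" "u \<le> u'" "v' \<le> v"
    have "seg u' v' \<subseteq> seg u v" by (rule seg_mono[OF g(2,3)])
    then show "\<forall>k\<in>\<Gamma> \<times> \<Lambda>. elt k = g \<longrightarrow> (\<forall>x\<in>seg u' v'. (k, x) \<in> Pow)" using g(1) by blast
  next
    fix g u w v assume v: "v \<in> \<Gamma>" and g: "\<forall>k\<in>\<Gamma> \<times> \<Lambda>. elt k = g \<longrightarrow> (\<forall>x\<in>seg u v. (k, x) \<in> Pow)"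
      "\<forall>k\<in>\<Gamma> \<times> \<Lambda>. elt k = g \<longrightarrow> (\<forall>x\<in>seg v w. (k, x) \<in> Pow)"
    show "\<forall>k\<in>\<Gamma> \<times> \<Lambda>. elt k = g \<longrightarrow> (\<forall>x\<in>seg u w. (k, x) \<in> Pow)" using g seg_split[OF v, of u w] by blast
  next
    fix g h u v assume m: "maps_into l g u v" "maps_into l h (g u) (g v)"
      and g: "\<forall>k\<in>\<Gamma> \<times> \<Lambda>. elt k = g \<longrightarrow> (\<forall>x\<in>seg u v. (k, x) \<in> Pow)"
      and h: "\<forall>k\<in>\<Gamma> \<times> \<Lambda>. elt k = h \<longrightarrow> (\<forall>x\<in>seg (g u) (g v). (k, x) \<in> Pow)"
    obtain a where a: "a \<in> \<Gamma> \<times> \<Lambda>" "g = elt a" using m(1) aff_elt unfolding maps_into_def by metis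
    obtain b where b: "b \<in> \<Gamma> \<times> \<Lambda>" "h = elt b" using m(2) aff_elt unfolding maps_into_def by metis
    show "\<forall>k\<in>\<Gamma> \<times> \<Lambda>. elt k = h \<circ> g \<longrightarrow> (\<forall>x\<in>seg u v. (k, x) \<in> Pow)"
    proof (rule Pow_elt[OF semidirect_closed[OF b(1) a(1)]], unfold a(2) b(2), rule elt_mult[OF b(1) a(1), symmetric], rule ballI)
      fix x assume x: "x \<in> seg u v"
      have "(a, x) \<in> Pow" using g a x by blast
      moreover have "(b, act a x) \<in> Pow" using h b act_seg[OF a(1) x] a(2) by blast
      ultimately show "(b \<otimes>\<^bsub>semidirect \<Gamma> \<Lambda>\<^esub> a, x) \<in> Pow" by (intro Pow_comp)
    qed
  next
    fix g u v assume m: "maps_into l g u v" and g: "\<forall>k\<in>\<Gamma> \<times> \<Lambda>. elt k = g \<longrightarrow> (\<forall>x\<in>seg u v. (k, x) \<in> Pow)"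
    obtain a where a: "a \<in> \<Gamma> \<times> \<Lambda>" "g = elt a" using m(1) aff_elt unfolding maps_into_def by metis
    have ea: "elt a \<in> aff" by (rule elt_aff[OF a(1)])
    show "\<forall>k\<in>\<Gamma> \<times> \<Lambda>. elt k = iv g \<longrightarrow> (\<forall>x\<in>seg (g u) (g v). (k, x) \<in> Pow)"
    proof (rule Pow_elt[OF semidirect_inv_closed[OF a(1)]], unfold a(2), rule elt_inv[OF a(1), symmetric], rule ballI)
      fix y assume y: "y \<in> seg (elt a u) (elt a v)"
      have "act (inv\<^bsub>semidirect \<Gamma> \<Lambda>\<^esub> a) y \<in> seg u v"
        using act_seg[OF semidirect_inv_closed[OF a(1)] y] unfolding elt_inv[OF a(1)] aff_iv_simps(2)[OF ea] .
      then have "(a, act (inv\<^bsub>semidirect \<Gamma> \<Lambda>\<^esub> a) y) \<in> Pow" using g a by blast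
      then show "(inv\<^bsub>semidirect \<Gamma> \<Lambda>\<^esub> a, y) \<in> Pow" using Pow_inv act_inv(2)[OF a(1), of y] by metis
    qed
  next
    fix \<nu> assume "\<nu> \<in> M"
    note d = D_mem(3)[OF this]
    show "\<forall>k\<in>\<Gamma> \<times> \<Lambda>. elt k = (\<lambda>t. \<nu> * t) \<longrightarrow> (\<forall>x\<in>seg 0 l. (k, x) \<in> Pow)"
      using Dd[OF d] Pow_D[OF d] by (intro Pow_elt[of "(0, \<nu>)"]) (auto simp: elt_def)
  next
    fix c assume "c \<in> C"
    note d = D_mem(2)[OF this]
    show "\<forall>k\<in>\<Gamma> \<times> \<Lambda>. elt k = (\<lambda>t. t + c) \<longrightarrow> (\<forall>x\<in>seg 0 (l - c). (k, x) \<in> Pow)"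
      using Dd[OF d] Pow_D[OF d] by (intro Pow_elt[of "(c, 1)"]) (auto simp: elt_def)
  next
    fix S assume S: "0 \<in> S" "\<And>x y. x \<in> S \<Longrightarrow> y \<in> S \<Longrightarrow> x + y \<in> S" "\<And>x. x \<in> S \<Longrightarrow> - x \<in> S"
      "\<And>\<mu> x. \<mu> \<in> \<Lambda> \<Longrightarrow> x \<in> S \<Longrightarrow> \<mu> * x \<in> S" "C \<subseteq> S"
    show "\<Gamma> \<subseteq> S" by (rule Cgen[rule_format]) (use S in simp_all)
  next
    show "2 * c \<le> l" if "c \<in> C" for c using bspec[OF Cs that] \<epsilon>(2) by simp
    show "4 * \<gamma> \<le> \<nu> * l" if "\<nu> \<in> M" for \<nu> using bspec[OF Cs \<gamma>] \<epsilon>(3)[OF that] by simp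
  qed (use l_mem l_pos M C \<gamma> in simp_all)
  have "Pow = arrows grp"
  proof
    show "Pow \<subseteq> arrows grp" unfolding Pow_def
    proof (rule UN_least, rule subrelI)
      fix n g x assume "(g, x) \<in> gset_power grp A n"
      then show "(g, x) \<in> arrows grp" by (rule gset_power_arrows[OF A])
    qed
    show "arrows grp \<subseteq> Pow"
    proof (rule subrelI)
      fix g x assume gx: "(g, x) \<in> arrows grp"
      obtain u v where uv: "maps_into l (elt g) u v" "x \<in> seg u v" by (rule arrow_maps_into[OF gx])
      have "g \<in> \<Gamma> \<times> \<Lambda>" using gx unfolding arrows_iff by blast
      then show "(g, x) \<in> Pow" using good_all[OF uv(1)] uv(2) by blast
    qed
  qed
  then have "arrows grp = (\<Union>n. gset_power grp (K \<union> ginverse grp ` K) n)" unfolding Pow_def A_def by simp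
  then show ?thesis unfolding compactly_generated_def using K_arrows K_compact
    by (intro exI[of _ K] conjI)
qed

end

section \<open>From subgroups of the reals to the four equivalent conditions\<close>

lemma group_real_add: "group real_add_group"
  by (rule groupI) (auto simp: real_add_group_def intro: exI[of _ "- x" for x])

lemma group_pos_real_mult: "group pos_real_mult_group"
proof (rule groupI)
  fix x assume "x \<in> carrier pos_real_mult_group"
  then show "\<exists>y\<in>carrier pos_real_mult_group. y \<otimes>\<^bsub>pos_real_mult_group\<^esub> x = \<one>\<^bsub>pos_real_mult_group\<^esub>"
    by (intro bexI[of _ "inverse x"]) (simp_all add: pos_real_mult_group_def)
qed (auto simp: pos_real_mult_group_def)

lemma gamma_lambda_of_subgroups:
  assumes \<Lambda>: "subgroup \<Lambda> pos_real_mult_group" "\<Lambda> \<noteq> {1}" and \<Gamma>: "Z_submodule \<Lambda> \<Gamma>" "\<Gamma> \<noteq> {0}"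
  shows "gamma_lambda \<Gamma> \<Lambda>"
proof
  have \<Gamma>_sub: "subgroup \<Gamma> real_add_group" and \<Gamma>_scale: "{\<mu> * \<gamma> | \<mu> \<gamma>. \<mu> \<in> \<Lambda> \<and> \<gamma> \<in> \<Gamma>} = \<Gamma>"
    using \<Gamma>(1) unfolding Z_submodule_def by blast+
  have inv_add: "inv\<^bsub>real_add_group\<^esub> x = - x" for x
    by (rule group.inv_equality[OF group_real_add]) (simp_all add: real_add_group_def)
  have pos: "0 < \<mu>" if "\<mu> \<in> \<Lambda>" for \<mu>
    using subsetD[OF subgroup.subset[OF \<Lambda>(1)] that] by (simp add: pos_real_mult_group_def)
  have inv_mult: "inv\<^bsub>pos_real_mult_group\<^esub> x = inverse x" if "0 < x" for x
    by (rule group.inv_equality[OF group_pos_real_mult]) (use that in \<open>simp_all add: pos_real_mult_group_def\<close>)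
  show zero: "0 \<in> \<Gamma>" using subgroup.one_closed[OF \<Gamma>_sub] by (simp add: real_add_group_def)
  show "x + y \<in> \<Gamma>" if "x \<in> \<Gamma>" "y \<in> \<Gamma>" for x y
    using subgroup.m_closed[OF \<Gamma>_sub that] by (simp add: real_add_group_def)
  show uminus: "- x \<in> \<Gamma>" if "x \<in> \<Gamma>" for x
    using subgroup.m_inv_closed[OF \<Gamma>_sub that] by (simp add: inv_add)
  show one: "1 \<in> \<Lambda>" using subgroup.one_closed[OF \<Lambda>(1)] by (simp add: pos_real_mult_group_def)
  show "\<mu> * \<nu> \<in> \<Lambda>" if "\<mu> \<in> \<Lambda>" "\<nu> \<in> \<Lambda>" for \<mu> \<nu>
    using subgroup.m_closed[OF \<Lambda>(1) that] by (simp add: pos_real_mult_group_def)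
  show inverse: "inverse \<mu> \<in> \<Lambda>" if "\<mu> \<in> \<Lambda>" for \<mu>
    using subgroup.m_inv_closed[OF \<Lambda>(1) that] pos[OF that] by (simp add: inv_mult)
  show "0 < \<mu>" if "\<mu> \<in> \<Lambda>" for \<mu> by (rule pos[OF that])
  show "\<mu> * x \<in> \<Gamma>" if "\<mu> \<in> \<Lambda>" "x \<in> \<Gamma>" for \<mu> x using that \<Gamma>_scale by blast
  show "\<exists>\<mu>\<in>\<Lambda>. \<mu> < 1"
  proof -
    obtain \<mu> where \<mu>: "\<mu> \<in> \<Lambda>" "\<mu> \<noteq> 1" using \<Lambda>(2) one by blast
    show ?thesis
    proof (cases "\<mu> < 1")
      case True
      then show ?thesis using \<mu>(1) by blast
    next
      case False
      then have "inverse \<mu> < 1" using \<mu>(2) by (simp add: inverse_less_1_iff)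
      then show ?thesis using inverse[OF \<mu>(1)] by blast
    qed
  qed
  show "\<exists>x\<in>\<Gamma>. 0 < x"
  proof -
    obtain x where "x \<in> \<Gamma>" "x \<noteq> 0" using \<Gamma>(2) zero by blast
    then have "0 < x \<or> 0 < - x" "x \<in> \<Gamma>" "- x \<in> \<Gamma>" using uminus by auto
    then show ?thesis by blast
  qed
qed

theorem theorem2:
  fixes \<Lambda> \<Gamma> :: "real set"
  assumes "subgroup \<Lambda> pos_real_mult_group" and "\<Lambda> \<noteq> {1}"
    and "Z_submodule \<Lambda> \<Gamma>" and "\<Gamma> \<subseteq> Z_span \<Lambda>" and "\<Gamma> \<noteq> {0}"
  shows "(\<forall>l \<in> \<Gamma>. l > 0 \<longrightarrow> is_simple (derived_group (V_group \<Gamma> \<Lambda> l))) \<and>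
    (finitely_generated (semidirect \<Gamma> \<Lambda>) \<longleftrightarrow>
       (\<forall>l \<in> \<Gamma>. l > 0 \<longrightarrow> compactly_generated (transf_groupoid \<Gamma> \<Lambda> l))) \<and>
    (finitely_generated (semidirect \<Gamma> \<Lambda>) \<longleftrightarrow>
       (\<forall>l \<in> \<Gamma>. l > 0 \<longrightarrow> finitely_generated (derived_group (V_group \<Gamma> \<Lambda> l)))) \<and>
    (finitely_generated (semidirect \<Gamma> \<Lambda>) \<longleftrightarrow>
       (\<forall>l \<in> \<Gamma>. l > 0 \<longrightarrow> two_generated (derived_group (V_group \<Gamma> \<Lambda> l))))"
proof -
  interpret gamma_lambda \<Gamma> \<Lambda>
    using assms(1-3,5) by (rule gamma_lambda_of_subgroups)
  have stein: "stein \<Gamma> \<Lambda> l" if "l \<in> \<Gamma>" "0 < l" for l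
    using that by unfold_locales
  obtain l\<^sub>0 where l0: "l\<^sub>0 \<in> \<Gamma>" "0 < l\<^sub>0" using ex_pos by blast
  have simple: "\<forall>l\<in>\<Gamma>. l > 0 \<longrightarrow> is_simple (derived_group (V_group \<Gamma> \<Lambda> l))"
    using stein.simple_V[OF stein] by blast
  have two: "two_generated (derived_group (V_group \<Gamma> \<Lambda> l))" "compactly_generated (transf_groupoid \<Gamma> \<Lambda> l)"
    if fg: "finitely_generated (semidirect \<Gamma> \<Lambda>)" and l: "l \<in> \<Gamma>" "0 < l" for l
  proof -
    interpret stein \<Gamma> \<Lambda> l using l by (rule stein)
    obtain M C where "gen_data M C" by (rule gen_data_of_finitely_generated[OF fg])
    then show "two_generated (derived_group (V_group \<Gamma> \<Lambda> l))" "compactly_generated (transf_groupoid \<Gamma> \<Lambda> l)"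
      by (rule two_generated_V, rule compactly_generated_grp)
  qed
  have fin: "finitely_generated (derived_group (V_group \<Gamma> \<Lambda> l))"
    if "two_generated (derived_group (V_group \<Gamma> \<Lambda> l))" for l
    using that by (rule two_generated_imp_finitely_generated)
  \<comment> \<open>A single length already forces finite generation of the semidirect product, so
    the conditions for all lengths are applied to one of them.\<close>
  have converse: "finitely_generated (semidirect \<Gamma> \<Lambda>)"
    if "finitely_generated (derived_group (V_group \<Gamma> \<Lambda> l\<^sub>0)) \<or> compactly_generated (transf_groupoid \<Gamma> \<Lambda> l\<^sub>0)"
    using that stein.finitely_generated_semidirect_of_V[OF stein[OF l0]]
      stein.finitely_generated_of_compactly_generated[OF stein[OF l0]] by blast
  show ?thesis using simple two fin converse l0 by blast
qed

end
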